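(* (Generalized Helmholtz--Hodge decomposition.) Let $1\le p\le\infty$ and $r>d/p$. For any vector-valued function $u_3\in(W_p^r(\mathbb{R}^d))^3$ define, via the inverse Fourier transform, $$\mathcal{P}^{\cdot}_{P_1(D)}u_3=\mathfrak{F}^{-1}\Big[I_{3\times3}\widehat{u_3}(\omega)-P_1(-i\omega)\big(P_1^*(-i\omega)P_1(-i\omega)\big)^{-1}P_1^*(-i\omega)\widehat{u_3}(\omega)\Big],$$ $$\mathcal{P}^{\times}_{P_1(D)}u_3=\mathfrak{F}^{-1}\Big[P_1(-i\omega)\big(P_1^*(-i\omega)P_1(-i\omega)\big)^{-1}P_1^*(-i\omega)\widehat{u_3}(\omega)\Big].$$ Then $u_3$ has the decomposition $$u_3=\mathcal{P}^{\cdot}_{P_1(D)}u_3+\mathcal{P}^{\times}_{P_1(D)}u_3$$ with $$\mathcal{P}^{\cdot}_{P_1(D)}u_3=\big[P_1^T(-D)P_1(D)I_{3\times3}-P_1(D)P_1^T(-D)\big](\Phi_1*u_3)$$ and $$\mathcal{P}^{\times}_{P_1(D)}u_3=P_1(D)P_1^T(-D)(\Phi_1*u_3).$$ Moreover, $P_1(-D)\cdot(\mathcal{P}^{\cdot}_{P_1(D)}u_3)=0$ and $P_1(D)\times(\mathcal{P}^{\times}_{P_1(D)}u_3)=0$. In particular, when $p=2$, the two components $\mathcal{P}^{\cdot}_{P_1(D)}u_3$ and $\mathcal{P}^{\times}_{P_1(D)}u_3$ are orthogonal to each other in $(L^2(\mathbb{R}^d))^3$.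
   Context: Here $m=3$, $n=1$. $P_1(D)=\sum_{|\alpha|\le r_1}\gamma_1^\alpha D^\alpha$ is a $3\times1$ column vector of linear differential operators on $\mathbb{R}^d$ of order $r_1$ with constant coefficients $\gamma_1^\alpha\in\mathbb{R}^3$; $P_1(-D)=\sum(-1)^{|\alpha|}\gamma_1^\alpha D^\alpha$; $P_1(\pm i\omega)=\sum\gamma_1^\alpha(\pm i\omega)^\alpha\in\mathbb{C}^3$; $P_1^*(-i\omega)=P_1(i\omega)^T$ is the Hermitian conjugate of $P_1(-i\omega)$. It is assumed that the scalar $P_1^*(-i\omega)P_1(-i\omega)$ is nonzero for every $\omega\ne0$. $\Phi_1$ is the fundamental solution of the scalar operator $P_1^T(-D)P_1(D)$, with $\widehat\Phi_1(\omega)=(P_1^*(-i\omega)P_1(-i\omega))^{-1}$. For a three-component field $v$, $P_1(-D)\cdot v=P_1(-D)^Tv$ and $P_1(D)\times v$ is the formal cross product in which the components of $P_1(D)$ act as differential operators on the components of $v$. The Fourier transform is $\mathfrak{F}(f)(\omega)=\widehat f(\omega)=\int_{\mathbb{R}^d}f(x)e^{i\omega\cdot x}\,dx$, extended to tempered distributions and applied componentwise, so that $D^\alpha$ has symbol $(-i\omega)^\alpha$ and $\widehat{f*g}=\widehat f\,\widehat g$. $W_p^r(\mathbb{R}^d)$ is the Sobolev space.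
   Formalization: For p>2 it is assumed that the products of symbol and transform of u_3 defining the projections exist (they fail e.g. for constant u_3, p=∞); the formulas with Φ_1*u_3 are claimed only when this convolution exists, and otherwise with the operators applied to Φ_1 before convolving. *)

theory Defs
  imports "HOL-Analysis.Analysis"
begin

type_synonym 'd mindex = "'d \<Rightarrow> nat"
type_synonym 'd tfun = "real^'d \<Rightarrow> complex"
type_synonym 'd tdist = "'d tfun \<Rightarrow> complex"
type_synonym 'd tdist3 = "'d tfun \<Rightarrow> complex^3"


section \<open>Partial derivatives, test functions, Schwartz functions\<close>

definition mdeg :: "'d::finite mindex \<Rightarrow> nat" where
  "mdeg \<alpha> = (\<Sum>k\<in>UNIV. \<alpha> k)"

definition pdiff :: "'d::finite \<Rightarrow> 'd tfun \<Rightarrow> 'd tfun" where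
  "pdiff k f x = vector_derivative (\<lambda>t. f (x + t *\<^sub>R axis k 1)) (at 0)"

primrec pdiffs :: "'d::finite list \<Rightarrow> 'd tfun \<Rightarrow> 'd tfun" where
  "pdiffs [] f = f"
| "pdiffs (k # ks) f = pdiff k (pdiffs ks f)"

text \<open>\<open>D\<^sup>\<alpha> f\<close>. The operator is only applied to smooth functions, whose partial derivatives
  commute, so the order in which the directions are listed is immaterial.\<close>

definition Dm :: "'d::finite mindex \<Rightarrow> 'd tfun \<Rightarrow> 'd tfun" where
  "Dm \<alpha> f = pdiffs (SOME ks. \<forall>k. count_list ks k = \<alpha> k) f"

definition smooth :: "'d::finite tfun \<Rightarrow> bool" where
  "smooth f \<longleftrightarrow> (\<forall>ks. pdiffs ks f differentiable_on UNIV)"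

definition test_functions :: "'d::finite tfun set" where
  "test_functions = {\<phi>. smooth \<phi> \<and> bounded {x. \<phi> x \<noteq> 0}}"

definition schwartz :: "'d::finite tfun set" where
  "schwartz = {\<phi>. smooth \<phi> \<and>
     (\<forall>ks N. bounded (range (\<lambda>x. (1 + norm x) ^ N *\<^sub>R pdiffs ks \<phi> x)))}"

definition schwartz_seminorm :: "nat \<Rightarrow> 'd::finite tfun \<Rightarrow> real" where
  "schwartz_seminorm N \<phi> =
     (SUP (ks, x) \<in> {ks. length ks \<le> N} \<times> UNIV. (1 + norm x) ^ N * norm (pdiffs ks \<phi> x))"


section \<open>Tempered distributions\<close>

text \<open>A tempered distribution is a functional on all functions of which only the values on Schwartz
  functions matter; equality of distributions is \<open>\<doteq>\<close>. A three-component distribution has values in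
  \<open>\<complex>\<^sup>3\<close> on scalar test functions.\<close>

definition tempered :: "'d::finite tdist \<Rightarrow> bool" where
  "tempered T \<longleftrightarrow>
     (\<forall>\<phi>\<in>schwartz. \<forall>\<psi>\<in>schwartz. T (\<lambda>x. \<phi> x + \<psi> x) = T \<phi> + T \<psi>) \<and>
     (\<forall>\<phi>\<in>schwartz. \<forall>c. T (\<lambda>x. c * \<phi> x) = c * T \<phi>) \<and>
     (\<exists>C N. \<forall>\<phi>\<in>schwartz. norm (T \<phi>) \<le> C * schwartz_seminorm N \<phi>)"

definition dist_eq :: "('d::finite tfun \<Rightarrow> 'b) \<Rightarrow> ('d tfun \<Rightarrow> 'b) \<Rightarrow> bool" (infix "\<doteq>" 50) where
  "S \<doteq> T \<longleftrightarrow> (\<forall>\<phi>\<in>schwartz. S \<phi> = T \<phi>)"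

definition cmp :: "'d tdist3 \<Rightarrow> 3 \<Rightarrow> 'd tdist" where
  "cmp V j = (\<lambda>\<phi>. V \<phi> $ j)"

definition fun_dist :: "'d::finite tfun \<Rightarrow> 'd tdist" where
  "fun_dist f = (\<lambda>\<phi>. LINT x|lborel. f x * \<phi> x)"

definition fun_dist3 :: "(real^'d::finite \<Rightarrow> complex^3) \<Rightarrow> 'd tdist3" where
  "fun_dist3 f = (\<lambda>\<phi>. \<chi> j. fun_dist (\<lambda>x. f x $ j) \<phi>)"

definition dirac :: "'d::finite tdist" where
  "dirac = (\<lambda>\<phi>. \<phi> 0)"

definition dist_deriv :: "'d::finite mindex \<Rightarrow> 'd tdist \<Rightarrow> 'd tdist" where
  "dist_deriv \<alpha> T = (\<lambda>\<phi>. (-1) ^ mdeg \<alpha> * T (Dm \<alpha> \<phi>))"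

definition fourier :: "'d::finite tfun \<Rightarrow> 'd tfun" where
  "fourier \<phi> \<omega> = (LINT x|lborel. \<phi> x * exp (\<i> * complex_of_real (\<omega> \<bullet> x)))"

definition inv_fourier :: "'d::finite tfun \<Rightarrow> 'd tfun" where
  "inv_fourier \<phi> x = complex_of_real (1 / (2 * pi) ^ CARD('d)) *
     (LINT \<omega>|lborel. \<phi> \<omega> * exp (- \<i> * complex_of_real (\<omega> \<bullet> x)))"

definition dist_fourier :: "('d::finite tfun \<Rightarrow> 'b) \<Rightarrow> 'd tfun \<Rightarrow> 'b" where
  "dist_fourier T = (\<lambda>\<phi>. T (fourier \<phi>))"

definition dist_inv_fourier :: "('d::finite tfun \<Rightarrow> 'b) \<Rightarrow> 'd tfun \<Rightarrow> 'b" where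
  "dist_inv_fourier T = (\<lambda>\<phi>. T (inv_fourier \<phi>))"


section \<open>Products and convolutions of tempered distributions\<close>

definition delta_seq :: "(nat \<Rightarrow> 'd::finite tfun) \<Rightarrow> bool" where
  "delta_seq \<rho> \<longleftrightarrow>
     (\<forall>n. \<rho> n \<in> test_functions) \<and>
     (\<forall>n. (LINT x|lborel. \<rho> n x) = 1) \<and>
     (\<exists>C. \<forall>n. (LINT x|lborel. norm (\<rho> n x)) \<le> C) \<and>
     (\<forall>e>0. \<forall>\<^sub>F n in sequentially. \<forall>x. \<rho> n x \<noteq> 0 \<longrightarrow> norm x < e)"

definition mollify :: "'d::finite tdist \<Rightarrow> 'd tfun \<Rightarrow> 'd tfun" where
  "mollify S \<rho> = (\<lambda>x. S (\<lambda>y. \<rho> (x - y)))"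

text \<open>The model product of distributions (Mikusinski, Kaminski): \<open>S \<cdot> T = lim (S * \<rho>\<^sub>n) T\<close>,
  where the limit has to exist for every delta sequence. It is partial, and includes the
  pointwise product \<open>f g\<close> of a locally integrable \<open>g\<close> and a bounded, almost everywhere continuous \<open>f\<close>,
  and the product of a smooth slowly increasing function and an arbitrary tempered distribution.
  The convolution is defined through the exchange formula, so it is partial as well.\<close>

definition is_product :: "'d::finite tdist \<Rightarrow> 'd tdist \<Rightarrow> 'd tdist \<Rightarrow> bool" where
  "is_product S T R \<longleftrightarrow> tempered R \<and>
     (\<forall>\<rho>. delta_seq \<rho> \<longrightarrow>
       (\<forall>\<phi>\<in>test_functions. (\<lambda>n. T (\<lambda>x. mollify S (\<rho> n) x * \<phi> x)) \<longlonglongrightarrow> R \<phi>))"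

definition product_defined :: "'d::finite tdist \<Rightarrow> 'd tdist \<Rightarrow> bool" where
  "product_defined S T \<longleftrightarrow> (\<exists>R. is_product S T R)"

definition dist_prod :: "'d::finite tdist \<Rightarrow> 'd tdist \<Rightarrow> 'd tdist" where
  "dist_prod S T = (SOME R. is_product S T R)"

definition conv_defined :: "'d::finite tdist \<Rightarrow> 'd tdist \<Rightarrow> bool" where
  "conv_defined S T \<longleftrightarrow> product_defined (dist_fourier S) (dist_fourier T)"

definition conv :: "'d::finite tdist \<Rightarrow> 'd tdist \<Rightarrow> 'd tdist" where
  "conv S T = dist_inv_fourier (dist_prod (dist_fourier S) (dist_fourier T))"

definition conv3 :: "'d::finite tdist \<Rightarrow> 'd tdist3 \<Rightarrow> 'd tdist3" where
  "conv3 S V = (\<lambda>\<phi>. \<chi> j. conv S (cmp V j) \<phi>)"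


section \<open>The Sobolev spaces\<close>

definition Lp :: "ereal \<Rightarrow> 'd::finite tfun \<Rightarrow> bool" where
  "Lp p f \<longleftrightarrow> f \<in> borel_measurable lborel \<and>
     (if p = \<infinity> then \<exists>C. AE x in lborel. norm (f x) \<le> C
      else integrable lborel (\<lambda>x. norm (f x) powr real_of_ereal p))"

definition weak_deriv :: "'d::finite mindex \<Rightarrow> 'd tfun \<Rightarrow> 'd tfun \<Rightarrow> bool" where
  "weak_deriv \<alpha> f g \<longleftrightarrow> (\<forall>\<phi>\<in>test_functions.
     (LINT x|lborel. f x * Dm \<alpha> \<phi> x) = (-1) ^ mdeg \<alpha> * (LINT x|lborel. g x * \<phi> x))"

text \<open>Finiteness of the Gagliardo (Sobolev-Slobodeckij) seminorm of order \<open>0 < s < 1\<close>,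
  resp. of the Hoelder seminorm if \<open>p = \<infinity>\<close>.\<close>

definition slobodeckij :: "ereal \<Rightarrow> real \<Rightarrow> 'd::finite tfun \<Rightarrow> bool" where
  "slobodeckij p s g \<longleftrightarrow>
     (if p = \<infinity> then \<exists>C. AE x in lborel. AE y in lborel. norm (g x - g y) \<le> C * norm (x - y) powr s
      else (\<integral>\<^sup>+x. \<integral>\<^sup>+y. ennreal (norm (g x - g y) powr real_of_ereal p /
              norm (x - y) powr (real CARD('d) + s * real_of_ereal p)) \<partial>lborel \<partial>lborel) < \<infinity>)"

text \<open>\<open>W\<^sup>r\<^sub>p\<close> for real \<open>r \<ge> 0\<close>; for integral \<open>r\<close> this is the classical Sobolev space.\<close>

definition sobolev :: "ereal \<Rightarrow> real \<Rightarrow> 'd::finite tfun \<Rightarrow> bool" where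
  "sobolev p r f \<longleftrightarrow> Lp p f \<and>
     (\<exists>g. \<forall>\<alpha>. mdeg \<alpha> \<le> nat \<lfloor>r\<rfloor> \<longrightarrow>
        Lp p (g \<alpha>) \<and> weak_deriv \<alpha> f (g \<alpha>) \<and>
        (frac r \<noteq> 0 \<and> mdeg \<alpha> = nat \<lfloor>r\<rfloor> \<longrightarrow> slobodeckij p (frac r) (g \<alpha>)))"


section \<open>The operator \<open>P\<^sub>1(D)\<close> and its symbol\<close>

text \<open>\<open>\<gamma>\<close> is the family of coefficients and \<open>m\<close> the order \<open>r\<^sub>1\<close>; coefficients of degree above
  \<open>m\<close> are ignored. \<open>op_cmp \<gamma> m j\<close> is the \<open>j\<close>-th component of \<open>P\<^sub>1(D)\<close>, and
  \<open>reflect \<gamma>\<close> are the coefficients of \<open>P\<^sub>1(-D)\<close>.\<close>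

definition op_cmp :: "('d::finite mindex \<Rightarrow> real^3) \<Rightarrow> nat \<Rightarrow> 3 \<Rightarrow> 'd tdist \<Rightarrow> 'd tdist" where
  "op_cmp \<gamma> m j T = (\<lambda>\<phi>. \<Sum>\<alpha> | mdeg \<alpha> \<le> m. complex_of_real (\<gamma> \<alpha> $ j) * dist_deriv \<alpha> T \<phi>)"

definition reflect :: "('d::finite mindex \<Rightarrow> real^3) \<Rightarrow> 'd mindex \<Rightarrow> real^3" where
  "reflect \<gamma> = (\<lambda>\<alpha>. (-1) ^ mdeg \<alpha> *\<^sub>R \<gamma> \<alpha>)"

definition op_grad :: "('d::finite mindex \<Rightarrow> real^3) \<Rightarrow> nat \<Rightarrow> 'd tdist \<Rightarrow> 'd tdist3" where
  "op_grad \<gamma> m T = (\<lambda>\<phi>. \<chi> j. op_cmp \<gamma> m j T \<phi>)"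

definition op_div :: "('d::finite mindex \<Rightarrow> real^3) \<Rightarrow> nat \<Rightarrow> 'd tdist3 \<Rightarrow> 'd tdist" where
  "op_div \<gamma> m V = (\<lambda>\<phi>. \<Sum>j\<in>UNIV. op_cmp \<gamma> m j (cmp V j) \<phi>)"

definition op_curl :: "('d::finite mindex \<Rightarrow> real^3) \<Rightarrow> nat \<Rightarrow> 'd tdist3 \<Rightarrow> 'd tdist3" where
  "op_curl \<gamma> m V = (\<lambda>\<phi>. vector
     [op_cmp \<gamma> m 2 (cmp V 3) \<phi> - op_cmp \<gamma> m 3 (cmp V 2) \<phi>,
      op_cmp \<gamma> m 3 (cmp V 1) \<phi> - op_cmp \<gamma> m 1 (cmp V 3) \<phi>,
      op_cmp \<gamma> m 1 (cmp V 2) \<phi> - op_cmp \<gamma> m 2 (cmp V 1) \<phi>])"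

text \<open>\<open>P\<^sub>1\<^sup>T(-D) P\<^sub>1(D)\<close>\<close>

definition op_scalar :: "('d::finite mindex \<Rightarrow> real^3) \<Rightarrow> nat \<Rightarrow> 'd tdist \<Rightarrow> 'd tdist" where
  "op_scalar \<gamma> m T = op_div (reflect \<gamma>) m (op_grad \<gamma> m T)"

text \<open>\<open>P\<^sub>1(D) P\<^sub>1\<^sup>T(-D)\<close>, as an operator on three-component fields and entrywise. The entries
  are applied to \<open>\<Phi>\<^sub>1\<close> itself where \<open>\<Phi>\<^sub>1 * u\<close> does not exist but
  \<open>(P\<^sub>1(D) P\<^sub>1\<^sup>T(-D) \<Phi>\<^sub>1) * u\<close> does.\<close>

definition op_matrix :: "('d::finite mindex \<Rightarrow> real^3) \<Rightarrow> nat \<Rightarrow> 'd tdist3 \<Rightarrow> 'd tdist3" where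
  "op_matrix \<gamma> m V = op_grad \<gamma> m (op_div (reflect \<gamma>) m V)"

definition op_entry :: "('d::finite mindex \<Rightarrow> real^3) \<Rightarrow> nat \<Rightarrow> 3 \<Rightarrow> 3 \<Rightarrow> 'd tdist \<Rightarrow> 'd tdist" where
  "op_entry \<gamma> m j k T = op_cmp \<gamma> m j (op_cmp (reflect \<gamma>) m k T)"

definition P_symbol :: "('d::finite mindex \<Rightarrow> real^3) \<Rightarrow> nat \<Rightarrow> complex^'d \<Rightarrow> complex^3" where
  "P_symbol \<gamma> m z = (\<chi> j. \<Sum>\<alpha> | mdeg \<alpha> \<le> m. complex_of_real (\<gamma> \<alpha> $ j) * (\<Prod>k\<in>UNIV. z $ k ^ \<alpha> k))"

text \<open>\<open>P\<^sub>1(-i\<omega>)\<close>, its Hermitian conjugate \<open>P\<^sub>1\<^sup>*(-i\<omega>)\<close>, and the scalar \<open>P\<^sub>1\<^sup>*(-i\<omega>) P\<^sub>1(-i\<omega>)\<close>\<close>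

definition P_minus :: "('d::finite mindex \<Rightarrow> real^3) \<Rightarrow> nat \<Rightarrow> real^'d \<Rightarrow> complex^3" where
  "P_minus \<gamma> m \<omega> = P_symbol \<gamma> m (\<chi> k. - \<i> * complex_of_real (\<omega> $ k))"

definition P_star :: "('d::finite mindex \<Rightarrow> real^3) \<Rightarrow> nat \<Rightarrow> real^'d \<Rightarrow> complex^3" where
  "P_star \<gamma> m \<omega> = (\<chi> j. cnj (P_minus \<gamma> m \<omega> $ j))"

definition PstarP :: "('d::finite mindex \<Rightarrow> real^3) \<Rightarrow> nat \<Rightarrow> real^'d \<Rightarrow> complex" where
  "PstarP \<gamma> m \<omega> = (\<Sum>j\<in>UNIV. P_star \<gamma> m \<omega> $ j * P_minus \<gamma> m \<omega> $ j)"

text \<open>The \<open>(j,k)\<close> entry of \<open>P\<^sub>1(-i\<omega>) (P\<^sub>1\<^sup>*(-i\<omega>) P\<^sub>1(-i\<omega>))\<^sup>-\<^sup>1 P\<^sub>1\<^sup>*(-i\<omega>)\<close>\<close>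

definition proj_symbol :: "('d::finite mindex \<Rightarrow> real^3) \<Rightarrow> nat \<Rightarrow> 3 \<Rightarrow> 3 \<Rightarrow> 'd tfun" where
  "proj_symbol \<gamma> m j k = (\<lambda>\<omega>. P_minus \<gamma> m \<omega> $ j * inverse (PstarP \<gamma> m \<omega>) * P_star \<gamma> m \<omega> $ k)"

text \<open>\<open>(P\<^sub>1\<^sup>* P\<^sub>1)\<^sup>-\<^sup>1\<close> need not be locally integrable at the origin (for \<open>P\<^sub>1 = \<nabla>\<close> it
  is \<open>1 / \<bar>\<omega>\<bar>\<^sup>2\<close>). The Fourier transform of \<open>\<Phi>\<^sub>1\<close> is therefore a generalized one: it equals this
  function on every Schwartz function on which the defining integral converges. If the function is
  locally integrable with tempered growth this means all Schwartz functions.\<close>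

definition given_by :: "'d::finite tdist \<Rightarrow> 'd tfun \<Rightarrow> bool" where
  "given_by T h \<longleftrightarrow> (\<forall>\<phi>\<in>schwartz. integrable lborel (\<lambda>\<omega>. h \<omega> * \<phi> \<omega>) \<longrightarrow> T \<phi> = fun_dist h \<phi>)"

definition fundamental_solution :: "('d::finite mindex \<Rightarrow> real^3) \<Rightarrow> nat \<Rightarrow> 'd tdist \<Rightarrow> bool" where
  "fundamental_solution \<gamma> m \<Phi> \<longleftrightarrow> tempered \<Phi> \<and>
     op_scalar \<gamma> m \<Phi> \<doteq> dirac \<and>
     given_by (dist_fourier \<Phi>) (\<lambda>\<omega>. inverse (PstarP \<gamma> m \<omega>))"


section \<open>The two projections\<close>

text \<open>The formulas defining the projections multiply the distributions \<open>F(V\<^sub>k)\<close> by a bounded symbol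
  that is in general discontinuous at \<open>0\<close>; \<open>projections_defined\<close> says that these products exist.\<close>

definition projections_defined :: "('d::finite mindex \<Rightarrow> real^3) \<Rightarrow> nat \<Rightarrow> 'd tdist3 \<Rightarrow> bool" where
  "projections_defined \<gamma> m V \<longleftrightarrow>
     (\<forall>j k. product_defined (fun_dist (proj_symbol \<gamma> m j k)) (dist_fourier (cmp V k)))"

definition symbol_times :: "('d::finite mindex \<Rightarrow> real^3) \<Rightarrow> nat \<Rightarrow> 'd tdist3 \<Rightarrow> 'd tdist3" where
  "symbol_times \<gamma> m W =
     (\<lambda>\<phi>. \<chi> j. \<Sum>k\<in>UNIV. dist_prod (fun_dist (proj_symbol \<gamma> m j k)) (cmp W k) \<phi>)"

definition proj_div :: "('d::finite mindex \<Rightarrow> real^3) \<Rightarrow> nat \<Rightarrow> 'd tdist3 \<Rightarrow> 'd tdist3" where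
  "proj_div \<gamma> m V =
     dist_inv_fourier (\<lambda>\<phi>. dist_fourier V \<phi> - symbol_times \<gamma> m (dist_fourier V) \<phi>)"

definition proj_curl :: "('d::finite mindex \<Rightarrow> real^3) \<Rightarrow> nat \<Rightarrow> 'd tdist3 \<Rightarrow> 'd tdist3" where
  "proj_curl \<gamma> m V = dist_inv_fourier (symbol_times \<gamma> m (dist_fourier V))"

definition orthogonal_L2 :: "'d::finite tdist3 \<Rightarrow> 'd tdist3 \<Rightarrow> bool" where
  "orthogonal_L2 V W \<longleftrightarrow> (\<exists>a b. (\<forall>j. Lp 2 (\<lambda>x. a x $ j)) \<and> (\<forall>j. Lp 2 (\<lambda>x. b x $ j)) \<and>
     V \<doteq> fun_dist3 a \<and> W \<doteq> fun_dist3 b \<and>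
     (LINT x|lborel. (\<Sum>j\<in>UNIV. a x $ j * cnj (b x $ j))) = 0)"

end

theory Submission
  imports Defs "HOL-Probability.Characteristic_Functions" "HOL-Probability.Sinc_Integral"
begin

text \<open>
On the Fourier side the statement is linear algebra at each frequency. Put \<open>P = P\<^sub>1(-i\<omega>)\<close>. The matrix
\<open>\<Pi> = P (P\<^sup>* P)\<^sup>-\<^sup>1 P\<^sup>*\<close> is the orthogonal projection of \<open>\<complex>\<^sup>3\<close> onto the line spanned by \<open>P\<close>. Hence
\<open>P\<^sup>* (1 - \<Pi>) = 0\<close>, \<open>P \<times> \<Pi> = 0\<close>, the trace of \<open>\<Pi>\<close> is \<open>1\<close>, and \<open>(1 - \<Pi>) v\<close> is orthogonal to \<open>\<Pi> v\<close>. Operators with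
constant coefficients act on the Fourier side as multiplication by polynomials (\<open>op_cmp_inv_fourier\<close>), so the
first two identities are the vanishing of the divergence and of the curl. The formulas with the fundamental
solution hold because the polynomial \<open>P\<^sub>j P\<^sub>k\<^sup>*\<close> times the transform of \<open>\<Phi>\<close> is the entry \<open>\<Pi>\<^sub>j\<^sub>k\<close>
(\<open>fundamental_solution_times\<close>): this factor compensates the singularity of \<open>(P\<^sup>* P)\<^sup>-\<^sup>1\<close>.

The difficulty is that \<open>\<Pi>\<close> is discontinuous at the origin, so that its product with the transform of the field
is a limit over delta sequences. Three facts make it possible to compute with such limits.

 \<^item> A product is unique up to equality of distributions (\<open>is_product_unique\<close>), since delta sequences exist and test
   functions are dense in the Schwartz space.
 \<^item> A polynomial may be moved from the first factor of a product to the result (\<open>is_product_polyn\<close>). For a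
   coordinate \<open>x\<^sub>k\<close> this amounts to the statement that \<open>S * (x\<^sub>k \<rho>\<^sub>n)\<close> contributes nothing in the limit, which holds because
   perturbing \<open>\<rho>\<^sub>n\<close> by \<open>x\<^sub>k \<rho>\<^sub>n\<close> gives another delta sequence and the limit does not depend on the sequence.
 \<^item> For \<open>p \<le> 2\<close> the products exist: \<open>L\<^sup>p\<close> is contained in \<open>L\<^sup>1 + L\<^sup>2\<close>, the transform of the field is a function
   (\<open>Lp_fourier_function\<close>), and the product with the bounded symbol \<open>\<Pi>\<close> is pointwise (\<open>is_product_fun\<close>).

Each claim about distributions then follows by exhibiting both sides as products with the same first factor. For \<open>p = 2\<close> orthogonality at each
frequency gives orthogonality of the fields by Parseval's formula (\<open>parseval_L2\<close>).

The Fourier analysis rests on Gaussian cutoffs. Inserting one proves the inversion formula on the Schwartz space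
(\<open>inv_fourier_fourier\<close>) and the Bessel inequality for functions in \<open>L\<^sup>1 \<inter> L\<^sup>2\<close> (\<open>fourier_L2_bound\<close>). The transform of a square
integrable function is the limit of the transforms of truncations. Inversion on Schwartz functions, together
with the fact that a square integrable function orthogonal to all test functions vanishes (\<open>L2_eq_0_AE\<close>), gives Parseval's
formula.
\<close>

section \<open>Smooth functions\<close>

lemma pdiff_eq:
  fixes f :: "'d::finite tfun"
  assumes "(f has_derivative f') (at x)"
  shows "pdiff k f x = f' (axis k 1)"
proof -
  have "((\<lambda>t. x + t *\<^sub>R axis k 1) has_derivative (\<lambda>t. t *\<^sub>R axis k 1)) (at (0::real))"
    by (auto intro!: derivative_eq_intros)
  moreover have "(f has_derivative f') (at (x + 0 *\<^sub>R axis k 1))"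
    using assms by simp
  ultimately have "((\<lambda>t. f (x + t *\<^sub>R axis k 1)) has_derivative (\<lambda>t. f' (t *\<^sub>R axis k 1))) (at 0)"
    by (rule has_derivative_compose)
  moreover have "f' (t *\<^sub>R axis k 1) = t *\<^sub>R f' (axis k 1)" for t
    using has_derivative_linear[OF assms] by (rule linear_scale)
  ultimately have "((\<lambda>t. f (x + t *\<^sub>R axis k 1)) has_vector_derivative f' (axis k 1)) (at 0)"
    by (simp add: has_vector_derivative_def)
  then show ?thesis
    unfolding pdiff_def by (rule vector_derivative_at)
qed

lemma sum_axis: "(\<Sum>k\<in>UNIV. axis l (1::real) $ k *\<^sub>R g k) = (g l :: complex)"
proof -
  have "(\<Sum>k\<in>UNIV. axis l (1::real) $ k *\<^sub>R g k) = (\<Sum>k\<in>UNIV. if k = l then g k else 0)"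
    by (rule sum.cong) (auto simp: axis_def)
  then show ?thesis by simp
qed

lemma linear_expand_axis:
  fixes f' :: "real^'d::finite \<Rightarrow> complex"
  assumes "linear f'"
  shows "f' h = (\<Sum>k\<in>UNIV. h $ k *\<^sub>R f' (axis k 1))"
proof -
  have "f' h = f' (\<Sum>k\<in>UNIV. h $ k *\<^sub>R axis k 1)"
    using basis_expansion[of h, symmetric] unfolding scalar_mult_eq_scaleR by (rule arg_cong)
  also have "\<dots> = (\<Sum>k\<in>UNIV. h $ k *\<^sub>R f' (axis k 1))"
    by (simp only: linear_sum[OF assms] linear_scale[OF assms])
  finally show ?thesis .
qed

lemma has_derivative_pdiff:
  fixes f :: "'d::finite tfun"
  assumes "f differentiable (at x)"
  shows "(f has_derivative (\<lambda>h. \<Sum>k\<in>UNIV. h $ k *\<^sub>R pdiff k f x)) (at x)"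
proof -
  obtain f' where f': "(f has_derivative f') (at x)"
    using assms by (auto simp: differentiable_def)
  moreover have "f' = (\<lambda>h. \<Sum>k\<in>UNIV. h $ k *\<^sub>R pdiff k f x)"
    unfolding pdiff_eq[OF f'] by (rule ext, rule linear_expand_axis[OF has_derivative_linear[OF f']])
  ultimately show ?thesis by simp
qed

lemma pdiffs_snoc: "pdiffs (ks @ [k]) f = pdiffs ks (pdiff k f)"
  by (induction ks) auto

text \<open>Closure properties of \<open>smooth\<close> are proved by induction on the order of differentiability;
  this finite-order notion makes the product rule inductive.\<close>

primrec smooth_upto :: "nat \<Rightarrow> 'd::finite tfun \<Rightarrow> bool" where
  "smooth_upto 0 f \<longleftrightarrow> f differentiable_on UNIV"
| "smooth_upto (Suc n) f \<longleftrightarrow> f differentiable_on UNIV \<and> (\<forall>k. smooth_upto n (pdiff k f))"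

lemma smooth_upto_differentiable: "smooth_upto n f \<Longrightarrow> f differentiable_on UNIV"
  by (cases n) auto

lemma smooth_upto_Suc: "smooth_upto (Suc n) f \<Longrightarrow> smooth_upto n f"
  by (induction n arbitrary: f) (auto simp: smooth_upto_differentiable)

lemma smooth_iff_smooth_upto: "smooth f \<longleftrightarrow> (\<forall>n. smooth_upto n f)"
proof
  assume f: "smooth f"
  have "smooth_upto n (pdiffs ks f)" for n ks
  proof (induction n arbitrary: ks)
    case 0 then show ?case using f by (simp add: smooth_def)
  next
    case (Suc n)
    then show ?case using f by (simp add: smooth_def flip: pdiffs.simps(2))
  qed
  from this[of _ "[]"] show "\<forall>n. smooth_upto n f" by simp
next
  assume f: "\<forall>n. smooth_upto n f"
  have "smooth_upto n (pdiffs ks f)" for n ks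
  proof (induction ks arbitrary: n)
    case (Cons k ks)
    from Cons[of "Suc n"] show ?case by simp
  qed (use f in simp)
  then show "smooth f" unfolding smooth_def by (auto intro: smooth_upto_differentiable)
qed

lemma smooth_differentiable: "smooth f \<Longrightarrow> f differentiable (at x)"
  unfolding smooth_def differentiable_on_def by (drule spec[of _ "[]"]) simp

lemma smooth_pdiff: "smooth f \<Longrightarrow> smooth (pdiff k f)"
  by (simp add: smooth_def flip: pdiffs_snoc)

lemma smooth_pdiffs: "smooth f \<Longrightarrow> smooth (pdiffs ks f)"
  by (induction ks) (auto simp: smooth_pdiff)

lemma smooth_continuous: "smooth f \<Longrightarrow> continuous_on S f"
  by (intro continuous_at_imp_continuous_on ballI differentiable_imp_continuous_within smooth_differentiable)

lemma smooth_measurable [measurable_dest]: "smooth f \<Longrightarrow> f \<in> borel_measurable borel"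
  by (intro borel_measurable_continuous_onI smooth_continuous)

lemma smooth_has_derivative:
  "smooth f \<Longrightarrow> (f has_derivative (\<lambda>h. \<Sum>k\<in>UNIV. h $ k *\<^sub>R pdiff k f x)) (at x)"
  by (intro has_derivative_pdiff smooth_differentiable)

lemma diff_on_UNIV: "f differentiable_on UNIV \<longleftrightarrow> (\<forall>x. f differentiable (at x))"
  by (simp add: differentiable_on_def)

lemma pdiff_add:
  assumes "f differentiable_on UNIV" "g differentiable_on UNIV"
  shows "pdiff k (\<lambda>x. f x + g x) = (\<lambda>x. pdiff k f x + pdiff k g x)"
proof
  fix x
  have "((\<lambda>x. f x + g x) has_derivative (\<lambda>h. (\<Sum>k\<in>UNIV. h $ k *\<^sub>R pdiff k f x) + (\<Sum>k\<in>UNIV. h $ k *\<^sub>R pdiff k g x))) (at x)"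
    using assms by (intro derivative_intros has_derivative_pdiff) (auto simp: diff_on_UNIV)
  from pdiff_eq[OF this] show "pdiff k (\<lambda>x. f x + g x) x = pdiff k f x + pdiff k g x"
    by (simp add: sum_axis)
qed

lemma pdiff_mult:
  assumes "f differentiable_on UNIV" "g differentiable_on UNIV"
  shows "pdiff k (\<lambda>x. f x * g x) = (\<lambda>x. pdiff k f x * g x + f x * pdiff k g x)"
proof
  fix x
  have "((\<lambda>x. f x * g x) has_derivative (\<lambda>h. f x * (\<Sum>k\<in>UNIV. h $ k *\<^sub>R pdiff k g x) + (\<Sum>k\<in>UNIV. h $ k *\<^sub>R pdiff k f x) * g x)) (at x)"
    using assms by (intro derivative_intros has_derivative_pdiff) (auto simp: diff_on_UNIV)
  from pdiff_eq[OF this] show "pdiff k (\<lambda>x. f x * g x) x = pdiff k f x * g x + f x * pdiff k g x"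
    by (simp add: sum_axis)
qed

lemma pdiff_const: "pdiff k (\<lambda>x. c) = (\<lambda>x. 0)"
  by (rule ext, subst pdiff_eq[of _ "\<lambda>_. 0"]) auto

lemma smooth_upto_const: "smooth_upto n (\<lambda>x. c)"
  by (induction n arbitrary: c) (auto simp: pdiff_const)

lemma smooth_upto_add: "smooth_upto n f \<Longrightarrow> smooth_upto n g \<Longrightarrow> smooth_upto n (\<lambda>x. f x + g x)"
  by (induction n arbitrary: f g) (auto simp: pdiff_add)

lemma smooth_upto_mult: "smooth_upto n f \<Longrightarrow> smooth_upto n g \<Longrightarrow> smooth_upto n (\<lambda>x. f x * g x)"
proof (induction n arbitrary: f g)
  case (Suc n)
  then have d: "f differentiable_on UNIV" "g differentiable_on UNIV"
    and s: "smooth_upto n f" "smooth_upto n g"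
    by (auto simp del: smooth_upto.simps intro: smooth_upto_differentiable smooth_upto_Suc)
  have "smooth_upto n (pdiff k (\<lambda>x. f x * g x))" for k
    unfolding pdiff_mult[OF d] using Suc s by (intro smooth_upto_add Suc.IH) auto
  then show ?case using d by (auto intro!: derivative_intros)
qed auto

lemma smooth_const [simp, intro]: "smooth (\<lambda>x. c)"
  by (simp add: smooth_iff_smooth_upto smooth_upto_const)

lemma smooth_add [intro]: "smooth f \<Longrightarrow> smooth g \<Longrightarrow> smooth (\<lambda>x. f x + g x)"
  by (simp add: smooth_iff_smooth_upto smooth_upto_add)

lemma smooth_mult [intro]: "smooth f \<Longrightarrow> smooth g \<Longrightarrow> smooth (\<lambda>x. f x * g x)"
  by (simp add: smooth_iff_smooth_upto smooth_upto_mult)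

lemma smooth_differentiable_on: "smooth f \<Longrightarrow> f differentiable_on UNIV"
  by (simp add: diff_on_UNIV smooth_differentiable)

lemma pdiffs_add:
  assumes "smooth f" "smooth g"
  shows "pdiffs ks (\<lambda>x. f x + g x) = (\<lambda>x. pdiffs ks f x + pdiffs ks g x)"
  by (induction ks) (use assms in \<open>auto simp: pdiff_add smooth_differentiable_on smooth_pdiffs\<close>)

lemma pdiff_cmult:
  "f differentiable_on UNIV \<Longrightarrow> pdiff k (\<lambda>x. c * f x) = (\<lambda>x. c * pdiff k f x)"
  by (subst pdiff_mult) (auto simp: pdiff_const)

lemma pdiffs_cmult:
  assumes "smooth f"
  shows "pdiffs ks (\<lambda>x. c * f x) = (\<lambda>x. c * pdiffs ks f x)"
  by (induction ks) (use assms in \<open>auto simp: pdiff_cmult smooth_differentiable_on smooth_pdiffs\<close>)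

lemma pdiff_affine:
  assumes "f differentiable_on UNIV"
  shows "pdiff k (\<lambda>x. f (a + c *\<^sub>R x)) = (\<lambda>x. of_real c * pdiff k f (a + c *\<^sub>R x))"
proof
  fix x
  have "((\<lambda>x. a + c *\<^sub>R x) has_derivative (\<lambda>h. c *\<^sub>R h)) (at x)"
    by (auto intro!: derivative_eq_intros)
  moreover have "(f has_derivative (\<lambda>h. \<Sum>k\<in>UNIV. h $ k *\<^sub>R pdiff k f (a + c *\<^sub>R x))) (at (a + c *\<^sub>R x))"
    using assms by (intro has_derivative_pdiff) (auto simp: diff_on_UNIV)
  ultimately have "((\<lambda>x. f (a + c *\<^sub>R x)) has_derivative
      (\<lambda>h. \<Sum>k\<in>UNIV. (c *\<^sub>R h) $ k *\<^sub>R pdiff k f (a + c *\<^sub>R x))) (at x)"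
    by (rule has_derivative_compose)
  from pdiff_eq[OF this] show "pdiff k (\<lambda>x. f (a + c *\<^sub>R x)) x = of_real c * pdiff k f (a + c *\<^sub>R x)"
    using sum_axis[of k "\<lambda>k. pdiff k f (a + c *\<^sub>R x)"]
    by (simp add: scaleR_conv_of_real[where 'a=complex] mult.assoc flip: sum_distrib_left)
qed

lemma differentiable_affine:
  fixes f :: "'d::finite tfun"
  assumes "f differentiable_on UNIV"
  shows "(\<lambda>x. f (a + c *\<^sub>R x)) differentiable_on UNIV"
  unfolding diff_on_UNIV
proof
  fix x
  have "(\<lambda>x. a + c *\<^sub>R x) differentiable at x" by (auto intro!: derivative_intros)
  moreover have "f differentiable at (a + c *\<^sub>R x)" using assms by (simp add: diff_on_UNIV)
  ultimately show "(\<lambda>x. f (a + c *\<^sub>R x)) differentiable at x"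
    using differentiable_chain_at[of "\<lambda>x. a + c *\<^sub>R x" x f] by (simp add: o_def)
qed

lemma smooth_upto_affine: "smooth_upto n f \<Longrightarrow> smooth_upto n (\<lambda>x. f (a + c *\<^sub>R x))"
proof (induction n arbitrary: f)
  case (Suc n)
  then show ?case
    by (auto simp: pdiff_affine differentiable_affine intro!: smooth_upto_mult smooth_upto_const)
qed (auto simp: differentiable_affine)

lemma smooth_affine: "smooth f \<Longrightarrow> smooth (\<lambda>x. f (a + c *\<^sub>R x))"
  by (simp add: smooth_iff_smooth_upto smooth_upto_affine)

lemma pdiffs_affine:
  assumes "smooth f"
  shows "pdiffs ks (\<lambda>x. f (a + c *\<^sub>R x)) = (\<lambda>x. of_real c ^ length ks * pdiffs ks f (a + c *\<^sub>R x))"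
proof (induction ks)
  case (Cons k ks)
  have "(\<lambda>x. pdiffs ks f (a + c *\<^sub>R x)) differentiable_on UNIV"
    using assms by (intro smooth_differentiable_on smooth_affine smooth_pdiffs)
  with Cons assms show ?case
    by (simp add: pdiff_cmult pdiff_affine smooth_pdiffs smooth_differentiable_on mult_ac)
qed auto

lemma coord_has_derivative:
  "((\<lambda>x. complex_of_real (x $ k)) has_derivative (\<lambda>h. of_real (h $ k))) (at (x::real^'d::finite))"
  by (intro has_derivative_of_real bounded_linear_imp_has_derivative bounded_linear_vec_nth)

lemma pdiff_coord: "pdiff l (\<lambda>x::real^'d::finite. complex_of_real (x $ k)) = (\<lambda>x. if l = k then 1 else 0)"
  by (rule ext, subst pdiff_eq[OF coord_has_derivative]) (auto simp: axis_def)

lemma smooth_coord [intro]: "smooth (\<lambda>x::real^'d::finite. complex_of_real (x $ k))"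
proof -
  have d: "(\<lambda>x::real^'d::finite. complex_of_real (x $ k)) differentiable_on UNIV"
    using coord_has_derivative by (auto simp: diff_on_UNIV differentiable_def)
  have "smooth_upto n (\<lambda>x::real^'d::finite. complex_of_real (x $ k))" for n
  proof (cases n)
    case 0
    with d show ?thesis by simp
  next
    case (Suc m)
    have "smooth_upto m (\<lambda>x::real^'d. if l = k then 1 else 0)" for l
      using smooth_upto_const[of m "if l = k then 1 else 0"] by simp
    with d Suc show ?thesis by (simp add: pdiff_coord del: if_split)
  qed
  then show ?thesis by (simp add: smooth_iff_smooth_upto)
qed

lemma smooth_sum [intro]: "(\<And>i. i \<in> I \<Longrightarrow> smooth (f i)) \<Longrightarrow> smooth (\<lambda>x. \<Sum>i\<in>I. f i x)"
  by (induction I rule: infinite_finite_induct) auto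

lemma smooth_prod [intro]: "(\<And>i. i \<in> I \<Longrightarrow> smooth (f i)) \<Longrightarrow> smooth (\<lambda>x. \<Prod>i\<in>I. f i x)"
  by (induction I rule: infinite_finite_induct) auto

text \<open>A quadratic remainder estimate is the convenient certificate of differentiability for
  integrals and for functionals depending on a parameter.\<close>

lemma has_derivative_quadratic_remainder:
  fixes f :: "'d::finite tfun"
  assumes C: "\<And>h. norm h \<le> 1 \<Longrightarrow> norm (f (x + h) - f x - (\<Sum>k\<in>UNIV. h $ k *\<^sub>R g k)) \<le> C * (norm h)\<^sup>2"
  shows "(f has_derivative (\<lambda>h. \<Sum>k\<in>UNIV. h $ k *\<^sub>R g k)) (at x)"
  unfolding has_derivative_at
proof
  have lin: "linear (\<lambda>h::real^'d. \<Sum>k\<in>UNIV. h $ k *\<^sub>R g k)"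
    by (rule linearI) (auto simp: scaleR_left_distrib sum.distrib scaleR_sum_right)
  then show "bounded_linear (\<lambda>h::real^'d. \<Sum>k\<in>UNIV. h $ k *\<^sub>R g k)"
    by (rule linear_conv_bounded_linear[THEN iffD1])
  show "(\<lambda>h. norm (f (x + h) - f x - (\<Sum>k\<in>UNIV. h $ k *\<^sub>R g k)) / norm h) \<midarrow>0\<rightarrow> 0"
  proof (rule Lim_null_comparison)
    have "\<forall>\<^sub>F h in at (0::real^'d). norm h \<le> 1"
      unfolding eventually_at by (intro exI[of _ 1]) (auto simp: dist_norm)
    then show "\<forall>\<^sub>F h in at 0. norm (norm (f (x + h) - f x - (\<Sum>k\<in>UNIV. h $ k *\<^sub>R g k)) / norm h) \<le> C * norm h"
    proof eventually_elim
      case (elim h)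
      show ?case using C[OF elim] by (cases "h = 0") (auto simp: divide_simps power2_eq_square)
    qed
    have "((\<lambda>h::real^'d. C * norm h) \<longlongrightarrow> C * norm (0::real^'d)) (at 0)"
      by (intro tendsto_intros)
    then show "((\<lambda>h::real^'d. C * norm h) \<longlongrightarrow> 0) (at 0)" by simp
  qed
qed

lemma pdiff_quadratic_remainder:
  fixes f :: "'d::finite tfun"
  assumes "\<And>h. norm h \<le> 1 \<Longrightarrow> norm (f (x + h) - f x - (\<Sum>k\<in>UNIV. h $ k *\<^sub>R g k)) \<le> C * (norm h)\<^sup>2"
  shows "pdiff k f x = g k" "f differentiable (at x)"
proof -
  have d: "(f has_derivative (\<lambda>h. \<Sum>k\<in>UNIV. h $ k *\<^sub>R g k)) (at x)"
    by (rule has_derivative_quadratic_remainder[of f x g C]) (rule assms)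
  show "pdiff k f x = g k"
    unfolding pdiff_eq[OF d] by (rule sum_axis)
  show "f differentiable (at x)" using d by (auto simp: differentiable_def)
qed

lemma smooth_coinduct:
  assumes "P f" "\<And>f. P f \<Longrightarrow> f differentiable_on UNIV" "\<And>f k. P f \<Longrightarrow> P (pdiff k f)"
  shows "smooth f"
proof -
  have "smooth_upto n f" if "P f" for n f
    using that by (induction n arbitrary: f) (use assms in auto)
  with assms(1) show ?thesis by (simp add: smooth_iff_smooth_upto)
qed

section \<open>The Schwartz space\<close>

lemma schwartz_smooth: "f \<in> schwartz \<Longrightarrow> smooth f"
  by (simp add: schwartz_def)

lemma schwartz_iff:
  "f \<in> schwartz \<longleftrightarrow> smooth f \<and> (\<forall>ks N. \<exists>C. \<forall>x. (1 + norm x) ^ N * norm (pdiffs ks f x) \<le> C)"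
  by (auto simp: schwartz_def bounded_iff)

lemma schwartz_pdiff: "f \<in> schwartz \<Longrightarrow> pdiff k f \<in> schwartz"
  by (auto simp: schwartz_iff smooth_pdiff simp flip: pdiffs_snoc)

lemma schwartz_pdiffs: "f \<in> schwartz \<Longrightarrow> pdiffs ks f \<in> schwartz"
  by (induction ks) (auto simp: schwartz_pdiff)

lemma finite_lists_le: "finite {ks :: 'd::finite list. length ks \<le> N}"
  using finite_lists_length_le[of "UNIV :: 'd set" N] by simp

lemma schwartz_seminorm_upper:
  fixes f :: "'d::finite tfun"
  assumes f: "f \<in> schwartz" and ks: "length ks \<le> N"
  shows "(1 + norm x) ^ N * norm (pdiffs ks f x) \<le> schwartz_seminorm N f"
proof -
  have "\<forall>ks. \<exists>C. \<forall>x. (1 + norm x) ^ N * norm (pdiffs ks f x) \<le> C"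
    using f by (auto simp: schwartz_iff)
  then obtain C where C: "\<And>ks x. (1 + norm x) ^ N * norm (pdiffs ks f x) \<le> C ks"
    by metis
  have "bdd_above ((\<lambda>(ks, x). (1 + norm x) ^ N * norm (pdiffs ks f x)) `
      ({ks. length ks \<le> N} \<times> UNIV))"
  proof (rule bdd_aboveI2)
    fix p assume p: "p \<in> {ks :: 'd list. length ks \<le> N} \<times> (UNIV :: (real^'d) set)"
    obtain ks y where [simp]: "p = (ks, y)" by (cases p)
    have "(1 + norm y) ^ N * norm (pdiffs ks f y) \<le> \<bar>C ks\<bar>"
      using C[of y ks] by simp
    also have "\<dots> \<le> (\<Sum>ks | length ks \<le> N. \<bar>C ks\<bar>)"
      using p by (intro member_le_sum finite_lists_le) auto
    finally show "(case p of (ks, x) \<Rightarrow> (1 + norm x) ^ N * norm (pdiffs ks f x))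
      \<le> (\<Sum>ks | length ks \<le> N. \<bar>C ks\<bar>)" by simp
  qed
  from cSUP_upper[OF _ this, of "(ks, x)"] ks show ?thesis
    by (simp add: schwartz_seminorm_def)
qed

lemma schwartz_seminorm_least:
  fixes f :: "'d::finite tfun"
  assumes "\<And>ks x. length ks \<le> N \<Longrightarrow> (1 + norm x) ^ N * norm (pdiffs ks f x) \<le> C"
  shows "schwartz_seminorm N f \<le> C"
  unfolding schwartz_seminorm_def
  by (rule cSUP_least) (use assms in \<open>auto intro: exI[of _ "[]"]\<close>)

lemma schwartz_seminorm_nonneg: "f \<in> schwartz \<Longrightarrow> 0 \<le> schwartz_seminorm N f"
  by (rule order_trans[OF _ schwartz_seminorm_upper[of f "[]" N 0]]) auto

lemma schwartz_seminorm_mono: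
  fixes f :: "'d::finite tfun"
  assumes "f \<in> schwartz" "N \<le> M"
  shows "schwartz_seminorm N f \<le> schwartz_seminorm M f"
proof (rule schwartz_seminorm_least)
  fix ks :: "'d list" and x assume "length ks \<le> N"
  then have "(1 + norm x) ^ M * norm (pdiffs ks f x) \<le> schwartz_seminorm M f"
    using assms by (intro schwartz_seminorm_upper) auto
  moreover have "(1 + norm x) ^ N * norm (pdiffs ks f x) \<le> (1 + norm x) ^ M * norm (pdiffs ks f x)"
    using assms by (intro mult_right_mono power_increasing) auto
  ultimately show "(1 + norm x) ^ N * norm (pdiffs ks f x) \<le> schwartz_seminorm M f" by simp
qed

lemma schwartz_bound:
  assumes "f \<in> schwartz" "N \<le> M" "length ks \<le> M"
  shows "(1 + norm x) ^ N * norm (pdiffs ks f x) \<le> schwartz_seminorm M f"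
proof -
  have "(1 + norm x) ^ N * norm (pdiffs ks f x) \<le> (1 + norm x) ^ M * norm (pdiffs ks f x)"
    using assms by (intro mult_right_mono power_increasing) auto
  with schwartz_seminorm_upper[OF assms(1,3), of x] show ?thesis by simp
qed

lemma schwartz_bound0:
  assumes "f \<in> schwartz" "N \<le> M"
  shows "(1 + norm x) ^ N * norm (f x) \<le> schwartz_seminorm M f"
  using schwartz_bound[OF assms, of "[]" x] by simp

lemma schwartz_seminorm_pdiff:
  fixes f :: "'d::finite tfun"
  assumes "f \<in> schwartz"
  shows "schwartz_seminorm N (pdiff k f) \<le> schwartz_seminorm (Suc N) f"
proof (rule schwartz_seminorm_least)
  fix ks :: "'d list" and x assume "length ks \<le> N"
  then show "(1 + norm x) ^ N * norm (pdiffs ks (pdiff k f) x) \<le> schwartz_seminorm (Suc N) f"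
    using schwartz_bound[OF assms, of N "Suc N" "ks @ [k]" x] by (simp add: pdiffs_snoc)
qed

text \<open>Bounds for each single derivative combine to a seminorm bound because only finitely many lists have
  length at most \<open>N\<close>. The index \<open>j\<close> lets one constant serve a whole family of functions.\<close>

lemma seminorm_bound_uniform:
  fixes A :: "'j \<Rightarrow> 'd::finite tfun"
  assumes B: "\<And>j. j \<in> J \<Longrightarrow> B j \<in> schwartz"
    and *: "\<And>ks. \<exists>C M. \<forall>j\<in>J. \<forall>x. (1 + norm x) ^ N * norm (pdiffs ks (A j) x) \<le> C * schwartz_seminorm M (B j)"
  obtains C M where "C \<ge> 0" "\<And>j. j \<in> J \<Longrightarrow> schwartz_seminorm N (A j) \<le> C * schwartz_seminorm M (B j)"
proof -
  obtain C M where C: "\<And>ks j x. j \<in> J \<Longrightarrow>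
      (1 + norm x) ^ N * norm (pdiffs ks (A j) x) \<le> C ks * schwartz_seminorm (M ks) (B j)"
    using * by metis
  define L where "L = {ks :: 'd list. length ks \<le> N}"
  have [simp]: "finite L" unfolding L_def by (rule finite_lists_le)
  define C' where "C' = (\<Sum>ks\<in>L. \<bar>C ks\<bar>)"
  define M' where "M' = (\<Sum>ks\<in>L. M ks)"
  have "schwartz_seminorm N (A j) \<le> C' * schwartz_seminorm M' (B j)" if j: "j \<in> J" for j
  proof (rule schwartz_seminorm_least)
    fix ks :: "'d list" and x assume "length ks \<le> N"
    then have ks: "ks \<in> L" by (simp add: L_def)
    have "(1 + norm x) ^ N * norm (pdiffs ks (A j) x) \<le> C ks * schwartz_seminorm (M ks) (B j)"
      by (rule C[OF j])
    also have "\<dots> \<le> C' * schwartz_seminorm M' (B j)"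
    proof (rule mult_mono)
      show "C ks \<le> C'"
        unfolding C'_def using ks member_le_sum[of ks L "\<lambda>ks. \<bar>C ks\<bar>"] by force
      show "schwartz_seminorm (M ks) (B j) \<le> schwartz_seminorm M' (B j)"
        using ks member_le_sum[of ks L M] by (intro schwartz_seminorm_mono B j) (simp add: M'_def)
    qed (auto simp: C'_def intro!: sum_nonneg schwartz_seminorm_nonneg B j)
    finally show "(1 + norm x) ^ N * norm (pdiffs ks (A j) x) \<le> C' * schwartz_seminorm M' (B j)" .
  qed
  moreover have "C' \<ge> 0" by (simp add: C'_def sum_nonneg)
  ultimately show thesis by (rule that[rotated])
qed

lemma schwartz_add:
  fixes f :: "'d::finite tfun"
  assumes "f \<in> schwartz" "g \<in> schwartz"
  shows "(\<lambda>x. f x + g x) \<in> schwartz"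
  unfolding schwartz_iff
proof safe
  show "smooth (\<lambda>x. f x + g x)" using assms by (intro smooth_add schwartz_smooth)
  fix ks :: "'d list" and N
  define M where "M = N + length ks"
  have "(1 + norm x) ^ N * norm (pdiffs ks (\<lambda>x. f x + g x) x) \<le> schwartz_seminorm M f + schwartz_seminorm M g" for x
  proof -
    have "(1 + norm x) ^ N * norm (pdiffs ks (\<lambda>x. f x + g x) x)
      \<le> (1 + norm x) ^ N * norm (pdiffs ks f x) + (1 + norm x) ^ N * norm (pdiffs ks g x)"
      unfolding distrib_left[symmetric] using assms
      by (intro mult_left_mono) (auto simp: pdiffs_add schwartz_smooth norm_triangle_ineq)
    with schwartz_bound[OF assms(1), of N M ks x] schwartz_bound[OF assms(2), of N M ks x]
    show ?thesis by (simp add: M_def)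
  qed
  then show "\<exists>C. \<forall>x. (1 + norm x) ^ N * norm (pdiffs ks (\<lambda>x. f x + g x) x) \<le> C" by blast
qed

subsection \<open>Slowly increasing multipliers\<close>

text \<open>A family of smooth functions whose derivatives of each order grow at most polynomially,
  uniformly over the family. Uniformity is needed for cutoffs, where the family is indexed by
  the scale; a single function is the family over \<open>unit\<close>.\<close>

definition slow_family :: "('i \<Rightarrow> 'd::finite tfun) \<Rightarrow> bool" where
  "slow_family W \<longleftrightarrow> (\<forall>i. smooth (W i)) \<and>
     (\<forall>ks. \<exists>C M. \<forall>i x. norm (pdiffs ks (W i) x) \<le> C * (1 + norm x) ^ M)"

abbreviation slow :: "'d::finite tfun \<Rightarrow> bool" where
  "slow w \<equiv> slow_family (\<lambda>_::unit. w)"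

lemma slow_family_pdiff: "slow_family W \<Longrightarrow> slow_family (\<lambda>i. pdiff k (W i))"
  unfolding slow_family_def by (auto simp: smooth_pdiff simp flip: pdiffs_snoc)

lemma slow_familyE:
  assumes "slow_family W"
  obtains C M where "C \<ge> 0" "\<And>i x. norm (pdiffs ks (W i) x) \<le> C * (1 + norm x) ^ M"
proof -
  obtain C M where C: "\<And>i x. norm (pdiffs ks (W i) x) \<le> C * (1 + norm x) ^ M"
    using assms by (metis slow_family_def)
  from C[of undefined 0] have "C \<ge> 0" by (simp add: order_trans[OF norm_ge_zero])
  with C that show thesis by blast
qed

text \<open>The innermost derivative is peeled off, since it is the one to which the product rule applies
  directly: both summands are again products of a slow family and a Schwartz function, with one
  derivative less to come.\<close>

lemma slow_family_mult_bound:
  fixes W :: "'i \<Rightarrow> 'd::finite tfun"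
  assumes "slow_family W"
  shows "\<exists>C M. \<forall>i. \<forall>f\<in>schwartz. \<forall>x.
    (1 + norm x) ^ N * norm (pdiffs ks (\<lambda>x. W i x * f x) x) \<le> C * schwartz_seminorm M f"
  using assms
proof (induction ks arbitrary: W rule: rev_induct)
  case Nil
  obtain C M where C: "C \<ge> 0" "\<And>i x. norm (pdiffs [] (W i) x) \<le> C * (1 + norm x) ^ M"
    using slow_familyE[OF Nil, of "[]"] by blast
  have "(1 + norm x) ^ N * norm (W i x * f x) \<le> C * schwartz_seminorm (N + M) f"
    if f: "f \<in> schwartz" for i x f
  proof -
    have "(1 + norm x) ^ N * norm (W i x * f x) \<le> (1 + norm x) ^ N * ((C * (1 + norm x) ^ M) * norm (f x))"
      unfolding norm_mult using C(2)[of i x] by (intro mult_left_mono mult_right_mono) auto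
    also have "\<dots> = C * ((1 + norm x) ^ (N + M) * norm (f x))"
      by (simp add: power_add)
    also have "\<dots> \<le> C * schwartz_seminorm (N + M) f"
      using f C by (intro mult_left_mono schwartz_bound0) auto
    finally show ?thesis .
  qed
  then show ?case by (intro exI[of _ C] exI[of _ "N + M"]) simp
next
  case (snoc k ks)
  obtain C1 M1 where 1: "\<And>i f x. f \<in> schwartz \<Longrightarrow>
    (1 + norm x) ^ N * norm (pdiffs ks (\<lambda>x. pdiff k (W i) x * f x) x) \<le> C1 * schwartz_seminorm M1 f"
    using snoc.IH[OF slow_family_pdiff[OF snoc.prems]] by blast
  obtain C2 M2 where 2: "\<And>i f x. f \<in> schwartz \<Longrightarrow>
    (1 + norm x) ^ N * norm (pdiffs ks (\<lambda>x. W i x * f x) x) \<le> C2 * schwartz_seminorm M2 f"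
    using snoc.IH[OF snoc.prems] by blast
  have "(1 + norm x) ^ N * norm (pdiffs (ks @ [k]) (\<lambda>x. W i x * f x) x)
      \<le> (\<bar>C1\<bar> + \<bar>C2\<bar>) * schwartz_seminorm (max M1 (Suc M2)) f"
    if f: "f \<in> schwartz" for i x f
  proof -
    have W: "smooth (W i)" using snoc.prems by (simp add: slow_family_def)
    have "pdiffs (ks @ [k]) (\<lambda>x. W i x * f x) x =
       pdiffs ks (\<lambda>x. pdiff k (W i) x * f x) x + pdiffs ks (\<lambda>x. W i x * pdiff k f x) x"
      unfolding pdiffs_snoc using W f
      by (simp add: pdiff_mult smooth_differentiable_on pdiffs_add smooth_mult smooth_pdiff schwartz_smooth)
    then have "(1 + norm x) ^ N * norm (pdiffs (ks @ [k]) (\<lambda>x. W i x * f x) x) \<le>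
       (1 + norm x) ^ N * norm (pdiffs ks (\<lambda>x. pdiff k (W i) x * f x) x)
        + (1 + norm x) ^ N * norm (pdiffs ks (\<lambda>x. W i x * pdiff k f x) x)"
      unfolding distrib_left[symmetric] by (intro mult_left_mono) (auto simp: norm_triangle_ineq)
    also have "\<dots> \<le> C1 * schwartz_seminorm M1 f + C2 * schwartz_seminorm M2 (pdiff k f)"
      using f by (intro add_mono 1 2 schwartz_pdiff)
    also have "\<dots> \<le> \<bar>C1\<bar> * schwartz_seminorm (max M1 (Suc M2)) f + \<bar>C2\<bar> * schwartz_seminorm (max M1 (Suc M2)) f"
    proof (intro add_mono mult_mono)
      show "schwartz_seminorm M2 (pdiff k f) \<le> schwartz_seminorm (max M1 (Suc M2)) f"
        by (rule order_trans[OF schwartz_seminorm_pdiff[OF f]]) (simp add: schwartz_seminorm_mono f)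
    qed (auto simp: f schwartz_seminorm_mono schwartz_seminorm_nonneg schwartz_pdiff)
    finally show ?thesis by (simp add: distrib_right)
  qed
  then show ?case by blast
qed

lemma slow_family_mult_schwartz:
  fixes W :: "'i \<Rightarrow> 'd::finite tfun"
  assumes W: "slow_family W" and f: "f \<in> schwartz"
  shows "(\<lambda>x. W i x * f x) \<in> schwartz"
  unfolding schwartz_iff
proof safe
  show "smooth (\<lambda>x. W i x * f x)"
    using W schwartz_smooth[OF f] by (auto simp: slow_family_def)
  fix ks :: "'d list" and N
  show "\<exists>C. \<forall>x. (1 + norm x) ^ N * norm (pdiffs ks (\<lambda>x. W i x * f x) x) \<le> C"
    using slow_family_mult_bound[OF W, of N ks] f by blast
qed

lemma slow_family_mult_seminorm:
  fixes W :: "'i \<Rightarrow> 'd::finite tfun"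
  assumes W: "slow_family W"
  obtains C M where "C \<ge> 0" "\<And>i f. f \<in> schwartz \<Longrightarrow>
    schwartz_seminorm N (\<lambda>x. W i x * f x) \<le> C * schwartz_seminorm M f"
proof -
  obtain C M where "C \<ge> 0" and CM: "\<And>j. j \<in> UNIV \<times> schwartz \<Longrightarrow>
    schwartz_seminorm N (case j of (i, f) \<Rightarrow> \<lambda>x. W i x * f x) \<le> C * schwartz_seminorm M (snd j)"
  proof (rule seminorm_bound_uniform)
    fix ks :: "'d list"
    show "\<exists>C M. \<forall>j\<in>UNIV \<times> schwartz. \<forall>x. (1 + norm x) ^ N *
        norm (pdiffs ks (case j of (i, f) \<Rightarrow> \<lambda>x. W i x * f x) x) \<le> C * schwartz_seminorm M (snd j)"
      using slow_family_mult_bound[OF W, of N ks] by force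
  qed auto
  have "schwartz_seminorm N (\<lambda>x. W i x * f x) \<le> C * schwartz_seminorm M f" if "f \<in> schwartz" for i f
    using CM[of "(i, f)"] that by simp
  with \<open>C \<ge> 0\<close> show thesis by (rule that)
qed

lemma slow_const: "slow (\<lambda>x. c)"
proof -
  have "\<exists>C M. \<forall>x. norm (pdiffs ks (\<lambda>x::real^'d::finite. c) x) \<le> C * (1 + norm x) ^ M" for ks
  proof -
    have "\<exists>d. pdiffs ks (\<lambda>x::real^'d::finite. c) = (\<lambda>x. d)"
      by (induction ks) (auto simp: pdiff_const)
    then obtain d where "pdiffs ks (\<lambda>x::real^'d::finite. c) = (\<lambda>x. d)" by blast
    then have "\<forall>x. norm (pdiffs ks (\<lambda>x::real^'d::finite. c) x) \<le> norm d * (1 + norm x) ^ 0"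
      by simp
    then show ?thesis by blast
  qed
  then show ?thesis by (auto simp: slow_family_def)
qed

lemma slow_coord: "slow (\<lambda>x::real^'d::finite. complex_of_real (x $ k))"
  unfolding slow_family_def
proof safe
  fix ks :: "'d list"
  show "\<exists>C M. \<forall>i x. norm (pdiffs ks (\<lambda>x::real^'d. complex_of_real (x $ k)) x) \<le> C * (1 + norm x) ^ M"
  proof (cases ks rule: rev_cases)
    case Nil
    have "norm (pdiffs ks (\<lambda>x::real^'d. complex_of_real (x $ k)) x) \<le> 1 * (1 + norm x) ^ 1" for x
      using component_le_norm_cart[of x k] Nil by simp
    then show ?thesis by blast
  next
    case (snoc ls l)
    then have "pdiffs ks (\<lambda>x::real^'d. complex_of_real (x $ k)) = pdiffs ls (\<lambda>x. if l = k then 1 else 0)"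
      by (simp add: pdiffs_snoc pdiff_coord)
    moreover have "(\<lambda>x::real^'d. if l = k then 1 else 0 :: complex) = (\<lambda>x. of_bool (l = k))" by auto
    moreover have "slow (\<lambda>x::real^'d. of_bool (l = k))" by (rule slow_const)
    ultimately show ?thesis by (simp add: slow_family_def)
  qed
qed auto

lemma slow_family_add:
  fixes W :: "'i \<Rightarrow> 'd::finite tfun"
  assumes V: "slow_family V" and W: "slow_family W"
  shows "slow_family (\<lambda>i x. V i x + W i x)"
  unfolding slow_family_def
proof safe
  have s: "smooth (V i)" "smooth (W i)" for i using V W by (auto simp: slow_family_def)
  then show "smooth (\<lambda>x. V i x + W i x)" for i by auto
  fix ks :: "'d list"
  obtain C M where C: "C \<ge> 0" "\<And>i x. norm (pdiffs ks (V i) x) \<le> C * (1 + norm x) ^ M"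
    using slow_familyE[OF V, of ks] by blast
  obtain D L where D: "D \<ge> 0" "\<And>i x. norm (pdiffs ks (W i) x) \<le> D * (1 + norm x) ^ L"
    using slow_familyE[OF W, of ks] by blast
  have "norm (pdiffs ks (\<lambda>x. V i x + W i x) x) \<le> (C + D) * (1 + norm x) ^ (M + L)" for i x
  proof -
    have "norm (pdiffs ks (\<lambda>x. V i x + W i x) x) \<le> C * (1 + norm x) ^ M + D * (1 + norm x) ^ L"
      using s C(2)[of i x] D(2)[of i x] by (simp add: pdiffs_add norm_triangle_le)
    also have "\<dots> \<le> C * (1 + norm x) ^ (M + L) + D * (1 + norm x) ^ (M + L)"
      using C D by (intro add_mono mult_left_mono power_increasing) auto
    finally show ?thesis by (simp add: distrib_right)
  qed
  then show "\<exists>C M. \<forall>i x. norm (pdiffs ks (\<lambda>x. V i x + W i x) x) \<le> C * (1 + norm x) ^ M" by blast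
qed

lemma slow_family_mult:
  fixes W :: "'i \<Rightarrow> 'd::finite tfun"
  assumes V: "slow_family V" and W: "slow_family W"
  shows "slow_family (\<lambda>i x. V i x * W i x)"
  unfolding slow_family_def
proof safe
  show "smooth (\<lambda>x. V i x * W i x)" for i using V W by (auto simp: slow_family_def)
  fix ks :: "'d list"
  show "\<exists>C M. \<forall>i x. norm (pdiffs ks (\<lambda>x. V i x * W i x) x) \<le> C * (1 + norm x) ^ M"
    using V W
  proof (induction ks arbitrary: V W rule: rev_induct)
    case Nil
    obtain C M where C: "C \<ge> 0" "\<And>i x. norm (pdiffs [] (V i) x) \<le> C * (1 + norm x) ^ M"
      using slow_familyE[OF Nil(1), of "[]"] by blast
    obtain D L where D: "D \<ge> 0" "\<And>i x. norm (pdiffs [] (W i) x) \<le> D * (1 + norm x) ^ L"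
      using slow_familyE[OF Nil(2), of "[]"] by blast
    have "norm (V i x * W i x) \<le> (C * D) * (1 + norm x) ^ (M + L)" for i x
    proof -
      have "norm (V i x * W i x) \<le> (C * (1 + norm x) ^ M) * (D * (1 + norm x) ^ L)"
        unfolding norm_mult using C(1) C(2)[of i x] D(2)[of i x] by (intro mult_mono) auto
      then show ?thesis by (simp add: power_add mult_ac)
    qed
    then show ?case by auto
  next
    case (snoc k ks)
    have s: "smooth (V i)" "smooth (W i)" for i using snoc.prems by (auto simp: slow_family_def)
    obtain C M where C: "\<And>i x. norm (pdiffs ks (\<lambda>x. pdiff k (V i) x * W i x) x) \<le> C * (1 + norm x) ^ M"
      using snoc.IH[OF slow_family_pdiff snoc.prems(2), OF snoc.prems(1)] by blast
    obtain D L where D: "\<And>i x. norm (pdiffs ks (\<lambda>x. V i x * pdiff k (W i) x) x) \<le> D * (1 + norm x) ^ L"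
      using snoc.IH[OF snoc.prems(1) slow_family_pdiff, OF snoc.prems(2)] by blast
    have "norm (pdiffs (ks @ [k]) (\<lambda>x. V i x * W i x) x) \<le> (\<bar>C\<bar> + \<bar>D\<bar>) * (1 + norm x) ^ (M + L)" for i x
    proof -
      have "pdiffs (ks @ [k]) (\<lambda>x. V i x * W i x) x =
         pdiffs ks (\<lambda>x. pdiff k (V i) x * W i x) x + pdiffs ks (\<lambda>x. V i x * pdiff k (W i) x) x"
        unfolding pdiffs_snoc using s
        by (simp add: pdiff_mult smooth_differentiable_on pdiffs_add smooth_mult smooth_pdiff)
      then have "norm (pdiffs (ks @ [k]) (\<lambda>x. V i x * W i x) x) \<le> C * (1 + norm x) ^ M + D * (1 + norm x) ^ L"
        using C[of i x] D[of i x] by (simp add: norm_triangle_le)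
      also have "\<dots> \<le> \<bar>C\<bar> * (1 + norm x) ^ (M + L) + \<bar>D\<bar> * (1 + norm x) ^ (M + L)"
        by (intro add_mono mult_mono power_increasing) auto
      finally show ?thesis by (simp add: distrib_right)
    qed
    then show ?case by blast
  qed
qed

lemma schwartz_cmult: "f \<in> schwartz \<Longrightarrow> (\<lambda>x. c * f x) \<in> schwartz"
  by (rule slow_family_mult_schwartz[OF slow_const])

lemma schwartz_zero [simp]: "(\<lambda>x::real^'d::finite. 0) \<in> schwartz"
proof -
  have "pdiffs ks (\<lambda>x::real^'d. 0) = (\<lambda>x. 0)" for ks
    by (induction ks) (auto simp: pdiff_const)
  then show ?thesis by (auto simp: schwartz_iff intro: exI[of _ 0])
qed

lemma schwartz_diff: "f \<in> schwartz \<Longrightarrow> g \<in> schwartz \<Longrightarrow> (\<lambda>x. f x - g x) \<in> schwartz"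
  using schwartz_add[of f "\<lambda>x. (-1) * g x"] schwartz_cmult[of g "-1"] by simp

lemma schwartz_sum: "(\<And>i. i \<in> I \<Longrightarrow> f i \<in> schwartz) \<Longrightarrow> (\<lambda>x. \<Sum>i\<in>I. f i x) \<in> schwartz"
  by (induction I rule: infinite_finite_induct) (auto intro!: schwartz_add)

lemma schwartz_coord: "f \<in> schwartz \<Longrightarrow> (\<lambda>x. complex_of_real (x $ k) * f x) \<in> schwartz"
  by (rule slow_family_mult_schwartz[OF slow_coord])

subsection \<open>Taylor expansion, reflections and translations\<close>

lemma one_plus_norm_segment:
  fixes x z :: "'a::real_normed_vector"
  assumes "norm (z - x) \<le> 1"
  shows "1 + norm x \<le> 2 * (1 + norm z)"
proof -
  have "norm x \<le> norm z + norm (z - x)"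
    using norm_triangle_ineq4[of z "z - x"] by simp
  also have "\<dots> \<le> norm z + 1" using assms by simp
  finally have "norm x \<le> norm z + 1" .
  then have "1 + norm x \<le> 2 + norm z" by simp
  also have "\<dots> \<le> 2 * (1 + norm z)" by simp
  finally show ?thesis .
qed

text \<open>The mean value inequality on the unit ball around \<open>x\<close>, on which the weight varies at most by a factor
  \<open>2\<^sup>N\<close>.\<close>

lemma pdiff_lipschitz_weighted:
  fixes f :: "'d::finite tfun"
  assumes f: "f \<in> schwartz" and h: "norm (y - x) \<le> 1"
  shows "(1 + norm x) ^ N * norm (f y - f x) \<le> real CARD('d) * 2 ^ N * schwartz_seminorm (Suc N) f * norm (y - x)"
proof -
  let ?B = "schwartz_seminorm (Suc N) f"
  have B0: "?B \<ge> 0" by (rule schwartz_seminorm_nonneg[OF f])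
  have b: "norm (pdiff k f z) \<le> 2 ^ N * ?B / (1 + norm x) ^ N" if z: "norm (z - x) \<le> 1" for k z
  proof -
    have "(1 + norm x) ^ N * norm (pdiff k f z) \<le> (2 * (1 + norm z)) ^ N * norm (pdiff k f z)"
      using one_plus_norm_segment[OF z] by (intro mult_right_mono power_mono) auto
    also have "\<dots> = 2 ^ N * ((1 + norm z) ^ N * norm (pdiffs [k] f z))"
      by (simp only: power_mult_distrib pdiffs.simps mult.assoc)
    also have "\<dots> \<le> 2 ^ N * ?B"
      using f by (intro mult_left_mono schwartz_bound) auto
    finally show ?thesis
      by (simp add: pos_le_divide_eq mult.commute add_pos_nonneg)
  qed
  have "norm (f y - f x) \<le> (real CARD('d) * (2 ^ N * ?B / (1 + norm x) ^ N)) * norm (y - x)"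
  proof (rule differentiable_bound[where S = "cball x (norm (y - x))"
        and f' = "\<lambda>z h. \<Sum>k\<in>UNIV. h $ k *\<^sub>R pdiff k f z"])
    show "convex (cball x (norm (y - x)))" by simp
    fix z assume z: "z \<in> cball x (norm (y - x))"
    show "(f has_derivative (\<lambda>h. \<Sum>k\<in>UNIV. h $ k *\<^sub>R pdiff k f z)) (at z within cball x (norm (y - x)))"
      by (rule has_derivative_at_withinI[OF smooth_has_derivative[OF schwartz_smooth[OF f]]])
    show "onorm (\<lambda>h. \<Sum>k\<in>UNIV. h $ k *\<^sub>R pdiff k f z) \<le> real CARD('d) * (2 ^ N * ?B / (1 + norm x) ^ N)"
    proof (rule onorm_bound)
      fix v :: "real^'d"
      have "norm (\<Sum>k\<in>UNIV. v $ k *\<^sub>R pdiff k f z) \<le> (\<Sum>k\<in>(UNIV::'d set). norm v * (2 ^ N * ?B / (1 + norm x) ^ N))"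
      proof (rule sum_norm_le)
        fix k
        show "norm (v $ k *\<^sub>R pdiff k f z) \<le> norm v * (2 ^ N * ?B / (1 + norm x) ^ N)"
          unfolding norm_scaleR using z h component_le_norm_cart[of v k]
          by (intro mult_mono b) (auto simp: dist_norm norm_minus_commute)
      qed
      then show "norm (\<Sum>k\<in>UNIV. v $ k *\<^sub>R pdiff k f z) \<le> real CARD('d) * (2 ^ N * ?B / (1 + norm x) ^ N) * norm v"
        by (simp add: mult_ac)
    qed (use B0 in simp)
  qed (auto simp: dist_norm norm_minus_commute)
  then have "norm (f y - f x) \<le> (real CARD('d) * (2 ^ N * ?B) * norm (y - x)) / (1 + norm x) ^ N"
    by (simp add: mult_ac)
  then show ?thesis
    by (simp add: pos_le_divide_eq mult_ac add_pos_nonneg)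
qed

text \<open>The error of the linear approximation is quadratic in \<open>h\<close> and still decays rapidly in \<open>x\<close>. The decay
  makes the error small in mean, which yields the rule for the transform of a derivative, and small in
  every seminorm, which yields the smoothness of regularizations.\<close>

lemma taylor_weighted:
  fixes f :: "'d::finite tfun"
  assumes f: "f \<in> schwartz"
  obtains C where "C \<ge> 0" "\<And>x h. norm h \<le> 1 \<Longrightarrow>
    (1 + norm x) ^ N * norm (f (x + h) - f x - (\<Sum>k\<in>UNIV. h $ k *\<^sub>R pdiff k f x)) \<le> C * (norm h)\<^sup>2"
proof -
  define B where "B = (\<Sum>k\<in>UNIV. real CARD('d) * 2 ^ N * schwartz_seminorm (Suc N) (pdiff k f))"
  have B0: "B \<ge> 0" unfolding B_def by (intro sum_nonneg mult_nonneg_nonneg schwartz_seminorm_nonneg schwartz_pdiff f) auto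
  have "(1 + norm x) ^ N * norm (f (x + h) - f x - (\<Sum>k\<in>UNIV. h $ k *\<^sub>R pdiff k f x)) \<le> B * (norm h)\<^sup>2"
    if h: "norm h \<le> 1" for x h
  proof -
    define D where "D = (\<lambda>z (v :: real^'d). \<Sum>k\<in>UNIV. v $ k *\<^sub>R pdiff k f z)"
    let ?S = "cball x (norm h)"
    have "norm (f (x + h) - f x - D x ((x + h) - x)) \<le> norm ((x + h) - x) * (B * norm h / (1 + norm x) ^ N)"
    proof (rule differentiable_bound_linearization[where S = ?S and f' = D and ?x0.0 = x])
      fix t :: real assume t: "t \<in> {0..1}"
      then have "t * norm h \<le> 1 * norm h" by (intro mult_right_mono) auto
      with t show "x + t *\<^sub>R (x + h - x) \<in> ?S" by (simp add: dist_norm)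
    next
      fix z assume z: "z \<in> ?S"
      show "(f has_derivative D z) (at z within ?S)"
        unfolding D_def by (rule has_derivative_at_withinI[OF smooth_has_derivative[OF schwartz_smooth[OF f]]])
      have zx: "norm (z - x) \<le> norm h" using z by (simp add: dist_norm norm_minus_commute)
      have "norm (pdiff k f z - pdiff k f x) \<le> real CARD('d) * 2 ^ N * schwartz_seminorm (Suc N) (pdiff k f) * norm h / (1 + norm x) ^ N" for k
      proof -
        have "(1 + norm x) ^ N * norm (pdiff k f z - pdiff k f x)
          \<le> real CARD('d) * 2 ^ N * schwartz_seminorm (Suc N) (pdiff k f) * norm (z - x)"
          using zx h by (intro pdiff_lipschitz_weighted schwartz_pdiff f) auto
        also have "\<dots> \<le> real CARD('d) * 2 ^ N * schwartz_seminorm (Suc N) (pdiff k f) * norm h"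
          using zx by (intro mult_left_mono mult_nonneg_nonneg schwartz_seminorm_nonneg schwartz_pdiff f) auto
        finally show ?thesis by (simp add: pos_le_divide_eq mult_ac add_pos_nonneg)
      qed
      then have sb: "(\<Sum>k\<in>UNIV. norm (pdiff k f z - pdiff k f x)) \<le> B * norm h / (1 + norm x) ^ N"
        unfolding B_def sum_distrib_right sum_divide_distrib by (intro sum_mono)
      have "onorm (\<lambda>v. D z v - D x v) \<le> B * norm h / (1 + norm x) ^ N"
      proof (rule onorm_bound)
        fix v :: "real^'d"
        have "norm (D z v - D x v) = norm (\<Sum>k\<in>UNIV. v $ k *\<^sub>R (pdiff k f z - pdiff k f x))"
          by (simp add: D_def scaleR_diff_right sum_subtractf)
        also have "\<dots> \<le> (\<Sum>k\<in>UNIV. norm v * norm (pdiff k f z - pdiff k f x))"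
          using component_le_norm_cart[of v] by (intro sum_norm_le) (simp add: mult_right_mono)
        also have "\<dots> = norm v * (\<Sum>k\<in>UNIV. norm (pdiff k f z - pdiff k f x))"
          by (simp add: sum_distrib_left)
        also have "\<dots> \<le> norm v * (B * norm h / (1 + norm x) ^ N)"
          using sb by (intro mult_left_mono) auto
        finally show "norm (D z v - D x v) \<le> B * norm h / (1 + norm x) ^ N * norm v" by (simp add: mult.commute)
      qed (use B0 in simp)
      then show "onorm (D z - D x) \<le> B * norm h / (1 + norm x) ^ N"
        by (simp add: fun_diff_def)
    qed auto
    then have "norm (f (x + h) - f x - D x h) \<le> B * (norm h)\<^sup>2 / (1 + norm x) ^ N"
      by (simp add: power2_eq_square mult_ac)
    then show ?thesis unfolding D_def by (simp add: pos_le_divide_eq mult_ac add_pos_nonneg)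
  qed
  with B0 show thesis by (rule that)
qed

lemma one_plus_norm_affine:
  fixes x a :: "'a::real_normed_vector"
  assumes "\<bar>c\<bar> = 1"
  shows "1 + norm x \<le> (1 + norm a) * (1 + norm (a + c *\<^sub>R x))"
proof -
  have "norm x = norm ((a + c *\<^sub>R x) - a)" using assms by simp
  also have "\<dots> \<le> norm (a + c *\<^sub>R x) + norm a" by (rule norm_triangle_ineq4)
  finally have "norm x \<le> norm (a + c *\<^sub>R x) + norm a" .
  then have "1 + norm x \<le> 1 + norm a + norm (a + c *\<^sub>R x)" by simp
  also have "\<dots> \<le> 1 + norm a + norm (a + c *\<^sub>R x) + norm a * norm (a + c *\<^sub>R x)" by simp
  also have "\<dots> = (1 + norm a) * (1 + norm (a + c *\<^sub>R x))" by (simp add: algebra_simps)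
  finally show ?thesis .
qed

text \<open>For \<open>\<bar>c\<bar> = 1\<close> the weight at \<open>x\<close> is at most \<open>1 + \<bar>a\<bar>\<close> times the weight at \<open>a + c x\<close>.\<close>

lemma schwartz_affine:
  fixes f :: "'d::finite tfun"
  assumes f: "f \<in> schwartz" and c: "\<bar>c\<bar> = 1"
  shows "(\<lambda>x. f (a + c *\<^sub>R x)) \<in> schwartz"
    and "schwartz_seminorm N (\<lambda>x. f (a + c *\<^sub>R x)) \<le> (1 + norm a) ^ N * schwartz_seminorm N f"
proof -
  have *: "(1 + norm x) ^ N * norm (pdiffs ks (\<lambda>x. f (a + c *\<^sub>R x)) x) \<le> (1 + norm a) ^ N * ((1 + norm (a + c *\<^sub>R x)) ^ N * norm (pdiffs ks f (a + c *\<^sub>R x)))"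
    for N ks x
  proof -
    have "norm (pdiffs ks (\<lambda>x. f (a + c *\<^sub>R x)) x) = norm (pdiffs ks f (a + c *\<^sub>R x))"
      using f c by (simp add: pdiffs_affine schwartz_smooth norm_mult norm_power)
    moreover have "(1 + norm x) ^ N \<le> ((1 + norm a) * (1 + norm (a + c *\<^sub>R x))) ^ N"
      using one_plus_norm_affine[OF c, of x a] by (intro power_mono) auto
    ultimately show ?thesis
      using mult_right_mono[of "(1 + norm x) ^ N" "((1 + norm a) * (1 + norm (a + c *\<^sub>R x))) ^ N" "norm (pdiffs ks f (a + c *\<^sub>R x))"]
      by (simp add: power_mult_distrib mult.assoc)
  qed
  show "(\<lambda>x. f (a + c *\<^sub>R x)) \<in> schwartz"
    unfolding schwartz_iff
  proof safe
    show "smooth (\<lambda>x. f (a + c *\<^sub>R x))" by (intro smooth_affine schwartz_smooth f)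
    fix ks :: "'d list" and N
    have "(1 + norm x) ^ N * norm (pdiffs ks (\<lambda>x. f (a + c *\<^sub>R x)) x) \<le> (1 + norm a) ^ N * schwartz_seminorm (N + length ks) f" for x
      using f by (intro order_trans[OF *[of x N ks]] mult_left_mono schwartz_bound) auto
    then show "\<exists>C. \<forall>x. (1 + norm x) ^ N * norm (pdiffs ks (\<lambda>x. f (a + c *\<^sub>R x)) x) \<le> C" by blast
  qed
  show "schwartz_seminorm N (\<lambda>x. f (a + c *\<^sub>R x)) \<le> (1 + norm a) ^ N * schwartz_seminorm N f"
  proof (rule schwartz_seminorm_least)
    fix ks :: "'d list" and x assume "length ks \<le> N"
    with f show "(1 + norm x) ^ N * norm (pdiffs ks (\<lambda>x. f (a + c *\<^sub>R x)) x) \<le> (1 + norm a) ^ N * schwartz_seminorm N f"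
      by (intro order_trans[OF *[of x N ks]] mult_left_mono schwartz_bound) auto
  qed
qed

lemma schwartz_reflect_translate: "f \<in> schwartz \<Longrightarrow> (\<lambda>y. f (x - y)) \<in> schwartz"
  using schwartz_affine(1)[of f "-1" x] by simp

subsection \<open>Test functions\<close>

text \<open>Derivatives of a test function do not leave the closure of its support; outside they vanish together with
  the function.\<close>

lemma pdiffs_eq_0_open:
  assumes "open U" "\<And>x. x \<in> U \<Longrightarrow> f x = 0" "x \<in> U"
  shows "pdiffs ks f x = 0"
  using assms(3)
proof (induction ks arbitrary: x)
  case (Cons k ks)
  have "(pdiffs ks f has_derivative (\<lambda>_. 0)) (at x)"
    by (rule has_derivative_transform_within_open[of "\<lambda>_. 0" _ _ UNIV U])
      (use Cons assms in auto)
  from pdiff_eq[OF this] show ?case by simp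
qed (use assms in auto)

lemma test_functions_schwartz: 
  fixes f :: "'d::finite tfun"
  assumes "f \<in> test_functions" shows "f \<in> schwartz"
  unfolding schwartz_iff
proof safe
  show s: "smooth f" using assms by (simp add: test_functions_def)
  fix ks :: "'d list" and N
  let ?K = "closure {x. f x \<noteq> 0}"
  have "compact ?K" using assms by (simp add: test_functions_def compact_closure)
  moreover have "continuous_on ?K (\<lambda>x. (1 + norm x) ^ N * norm (pdiffs ks f x))"
    by (intro continuous_intros smooth_continuous smooth_pdiffs s)
  ultimately have "bounded ((\<lambda>x. (1 + norm x) ^ N * norm (pdiffs ks f x)) ` ?K)"
    by (intro compact_imp_bounded compact_continuous_image)
  then obtain C where C': "\<forall>y\<in>(\<lambda>x. (1 + norm x) ^ N * norm (pdiffs ks f x)) ` ?K. norm y \<le> C"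
    unfolding bounded_iff by blast
  have C: "(1 + norm x) ^ N * norm (pdiffs ks f x) \<le> C" if "x \<in> ?K" for x
  proof -
    have "norm ((1 + norm x) ^ N * norm (pdiffs ks f x)) \<le> C" using C' that by blast
    then show ?thesis by simp
  qed
  have "(1 + norm x) ^ N * norm (pdiffs ks f x) \<le> \<bar>C\<bar>" for x
  proof (cases "x \<in> ?K")
    case False
    have "pdiffs ks f x = 0"
      by (rule pdiffs_eq_0_open[of "- ?K"]) (use False closure_subset[of "{x. f x \<noteq> 0}"] in auto)
    then show ?thesis by simp
  qed (use C[of x] in simp)
  then show "\<exists>C. \<forall>x. (1 + norm x) ^ N * norm (pdiffs ks f x) \<le> C" by blast
qed

lemma test_functions_mult: "smooth g \<Longrightarrow> f \<in> test_functions \<Longrightarrow> (\<lambda>x. g x * f x) \<in> test_functions"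
  by (auto simp: test_functions_def intro: bounded_subset)

lemma test_functions_add: "f \<in> test_functions \<Longrightarrow> g \<in> test_functions \<Longrightarrow> (\<lambda>x. f x + g x) \<in> test_functions"
  unfolding test_functions_def
  by (auto intro: bounded_subset[of "{x. f x \<noteq> 0} \<union> {x. g x \<noteq> 0}"])

subsection \<open>Integrability\<close>

text \<open>Fubini's theorem in the form needed for functions that are products over the coordinates:
  Lebesgue measure on \<open>\<real>\<^sup>d\<close> is the image of the product measure indexed by the basis vectors.\<close>

lemma lborel_vec_prod:
  fixes f :: "'d::finite \<Rightarrow> real \<Rightarrow> complex"
  assumes f: "\<And>k. integrable lborel (f k)"
  shows "integrable lborel (\<lambda>x::real^'d. \<Prod>k\<in>UNIV. f k (x $ k))"
    and "(LINT x|lborel. (\<Prod>k\<in>UNIV. f k ((x::real^'d) $ k))) = (\<Prod>k\<in>UNIV. LINT t|lborel. f k t)"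
proof -
  interpret product_sigma_finite "\<lambda>_. lborel :: real measure" by standard
  let ?B = "Basis :: (real^'d) set"
  define ax where "ax = (\<lambda>k::'d. axis k (1::real))"
  have bij: "bij_betw ax UNIV ?B"
    by (auto simp: bij_betw_def inj_on_def Basis_vec_def ax_def axis_eq_axis)
  define g where "g b = f (inv_into UNIV ax b)" for b
  have g: "g (ax k) = f k" for k
    using bij by (simp add: g_def bij_betw_def)
  have gi: "integrable lborel (g b)" for b by (simp add: g_def f)
  have re: "(\<Prod>b\<in>?B. h b) = (\<Prod>k\<in>UNIV. h (ax k))" for h :: "real^'d \<Rightarrow> complex"
    by (rule prod.reindex_bij_betw[OF bij, symmetric])
  have comp: "(\<Sum>b\<in>?B. y b *\<^sub>R b) $ k = y (ax k)" for y k
  proof -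
    have "(\<Sum>b\<in>?B. y b *\<^sub>R b) = (\<Sum>l\<in>UNIV. y (ax l) *\<^sub>R ax l)"
      by (rule sum.reindex_bij_betw[OF bij, symmetric])
    then show ?thesis
      by (simp add: ax_def axis_def if_distrib[of "\<lambda>c. _ * c"] cong: if_cong)
  qed
  have m [measurable]: "f k \<in> borel_measurable borel" for k
    using f[of k] by simp
  have i: "integrable (Pi\<^sub>M ?B (\<lambda>_. lborel)) (\<lambda>y. \<Prod>b\<in>?B. g b (y b))"
    by (intro product_integrable_prod gi) auto
  have eq: "(\<Prod>b\<in>?B. g b (y b)) = (\<Prod>k\<in>UNIV. f k ((\<Sum>b\<in>?B. y b *\<^sub>R b) $ k))" for y
    unfolding re comp g ..
  show "integrable lborel (\<lambda>x::real^'d. \<Prod>k\<in>UNIV. f k (x $ k))"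
    using i unfolding eq by (subst lborel_eq, subst integrable_distr_eq) auto
  have "(LINT x|lborel. (\<Prod>k\<in>UNIV. f k ((x::real^'d) $ k))) = (LINT y|Pi\<^sub>M ?B (\<lambda>_. lborel). (\<Prod>b\<in>?B. g b (y b)))"
    unfolding eq by (subst lborel_eq, subst integral_distr) auto
  also have "\<dots> = (\<Prod>b\<in>?B. LINT t|lborel. g b t)"
    by (intro product_integral_prod gi) auto
  finally show "(LINT x|lborel. (\<Prod>k\<in>UNIV. f k ((x::real^'d) $ k))) = (\<Prod>k\<in>UNIV. LINT t|lborel. f k t)"
    unfolding re g .
qed

text \<open>Comparison with the product of the functions \<open>1 / (1 + x\<^sub>k\<^sup>2)\<close>.\<close>

lemma integrable_weight:
  assumes "2 * CARD('d::finite) \<le> N"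
  shows "integrable lborel (\<lambda>x::real^'d. 1 / (1 + norm x) ^ N)"
proof -
  have "integrable lborel (\<lambda>t::real. inverse (1 + t^2))"
    using integrable_inverse_1_plus_square by (simp add: set_integrable_def)
  then have "integrable lborel (\<lambda>t::real. complex_of_real (inverse (1 + t^2)))"
    by (rule integrable_of_real)
  then have *: "integrable lborel (\<lambda>x::real^'d. \<Prod>k\<in>UNIV. complex_of_real (inverse (1 + (x $ k)^2)))"
    by (rule lborel_vec_prod(1))
  show ?thesis
  proof (rule Bochner_Integration.integrable_bound[OF *])
    show "(\<lambda>x::real^'d. 1 / (1 + norm x) ^ N) \<in> borel_measurable lborel" by measurable
    have "1 / (1 + norm x) ^ N \<le> (\<Prod>k\<in>UNIV. inverse (1 + (x $ k)^2))" for x :: "real^'d"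
    proof -
      have "(\<Prod>k\<in>UNIV. 1 + (x $ k)^2) \<le> (\<Prod>k\<in>(UNIV::'d set). (1 + norm x)^2)"
      proof (rule prod_mono, safe)
        fix k
        have "(x $ k)^2 \<le> (norm x)^2"
          using component_le_norm_cart[of x k] by (simp add: abs_le_square_iff[symmetric])
        then show "1 + (x $ k)^2 \<le> (1 + norm x)^2"
          by (simp add: power2_sum add_increasing2)
      qed simp
      also have "\<dots> = (1 + norm x) ^ (2 * CARD('d))"
        by (simp add: power_mult)
      also have "\<dots> \<le> (1 + norm x) ^ N"
        using assms by (intro power_increasing) auto
      finally have "(\<Prod>k\<in>UNIV. 1 + (x $ k)^2) \<le> (1 + norm x) ^ N" .
      moreover have "(\<Prod>k\<in>UNIV. 1 + (x $ k)^2) > 0" by (intro prod_pos) (auto intro: add_pos_nonneg)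
      moreover have "(\<Prod>k\<in>UNIV. inverse (1 + (x $ k)^2)) = inverse (\<Prod>k\<in>UNIV. 1 + (x $ k)^2)"
        using prod_inversef[of "\<lambda>k. 1 + (x $ k)^2" UNIV] by (simp add: o_def)
      ultimately show ?thesis
        by (simp add: divide_inverse le_imp_inverse_le)
    qed
    then show "AE x in lborel. norm (1 / (1 + norm (x::real^'d)) ^ N) \<le> norm (\<Prod>k\<in>UNIV. complex_of_real (inverse (1 + (x $ k)^2)))"
      by (auto simp: prod_norm[symmetric] norm_inverse simp flip: of_real_inverse intro!: order_trans[OF _ prod_mono] )
  qed
qed

text \<open>The condition makes \<open>w f\<close> integrable for all Schwartz functions \<open>f\<close>, with a bound by a seminorm
  of \<open>f\<close>; it covers bounded functions, polynomials and all Lebesgue classes.\<close>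

definition tempered_fun :: "'d::finite tfun \<Rightarrow> bool" where
  "tempered_fun w \<longleftrightarrow> w \<in> borel_measurable borel \<and>
     (\<exists>N. integrable lborel (\<lambda>x. w x / of_real ((1 + norm x) ^ N)))"

lemma tempered_fun_schwartz_bound:
  assumes "tempered_fun w"
  obtains C M where "C \<ge> 0" "\<And>f. f \<in> schwartz \<Longrightarrow> integrable lborel (\<lambda>x. w x * f x)"
    "\<And>f. f \<in> schwartz \<Longrightarrow> (LINT x|lborel. norm (w x * f x)) \<le> C * schwartz_seminorm M f"
proof -
  obtain M where M: "integrable lborel (\<lambda>x. w x / of_real ((1 + norm x) ^ M))" and [measurable]: "w \<in> borel_measurable borel"
    using assms by (auto simp: tempered_fun_def)
  define C where "C = (LINT x|lborel. norm (w x / of_real ((1 + norm x) ^ M)))"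
  have b: "norm (w x * f x) \<le> schwartz_seminorm M f * norm (w x / of_real ((1 + norm x) ^ M))"
    if "f \<in> schwartz" for f x
  proof -
    have p: "1 + norm x > 0" by (simp add: add_pos_nonneg)
    have "norm (w x * f x) = norm (w x / of_real ((1 + norm x) ^ M)) * ((1 + norm x) ^ M * norm (f x))"
      using p by (simp add: norm_mult norm_divide norm_power del: of_real_power of_real_add)
    also have "\<dots> \<le> norm (w x / of_real ((1 + norm x) ^ M)) * schwartz_seminorm M f"
      using that by (intro mult_left_mono schwartz_bound0) auto
    finally show ?thesis by (simp add: mult.commute)
  qed
  have i: "integrable lborel (\<lambda>x. w x * f x)" if f: "f \<in> schwartz" for f
  proof (rule Bochner_Integration.integrable_bound)
    show "integrable lborel (\<lambda>x. schwartz_seminorm M f * norm (w x / of_real ((1 + norm x) ^ M)))"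
      using M by (intro integrable_mult_right integrable_norm)
    show "(\<lambda>x. w x * f x) \<in> borel_measurable lborel"
      using smooth_measurable[OF schwartz_smooth[OF f]] by measurable
    show "AE x in lborel. norm (w x * f x) \<le> norm (schwartz_seminorm M f * norm (w x / of_real ((1 + norm x) ^ M)))"
      using b[OF f] by (auto intro: order_trans[OF _ abs_ge_self])
  qed
  have "(LINT x|lborel. norm (w x * f x)) \<le> C * schwartz_seminorm M f" if f: "f \<in> schwartz" for f
  proof -
    have "(LINT x|lborel. norm (w x * f x)) \<le> (LINT x|lborel. schwartz_seminorm M f * norm (w x / of_real ((1 + norm x) ^ M)))"
      using M by (intro integral_mono b f integrable_norm i integrable_mult_right)
    then show ?thesis by (simp add: C_def mult.commute)
  qed
  with i show thesis by (intro that[of C M]) (auto simp: C_def)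
qed

lemma tempered_fun_integrable:
  assumes "tempered_fun w" and f: "f \<in> schwartz"
  shows "integrable lborel (\<lambda>x. w x * f x)"
proof -
  obtain C M where "\<And>f. f \<in> schwartz \<Longrightarrow> integrable lborel (\<lambda>x. w x * f x)"
    using tempered_fun_schwartz_bound[OF assms(1)] by blast
  then show ?thesis using f by blast
qed

lemma tempered_fun_mono:
  fixes v w :: "'d::finite tfun"
  assumes v: "tempered_fun v" and [measurable]: "w \<in> borel_measurable borel"
    and "\<And>x. norm (w x) \<le> C * (1 + norm x) ^ M * norm (v x)"
  shows "tempered_fun w"
proof -
  obtain N where N: "integrable lborel (\<lambda>x. v x / of_real ((1 + norm x) ^ N))"
    using v by (auto simp: tempered_fun_def)
  have "integrable lborel (\<lambda>x. w x / of_real ((1 + norm x) ^ (M + N)))"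
  proof (rule Bochner_Integration.integrable_bound)
    show "integrable lborel (\<lambda>x. C *\<^sub>R (v x / of_real ((1 + norm x) ^ N)))"
      using N by (rule integrable_scaleR_right)
    show "AE x in lborel. norm (w x / of_real ((1 + norm x) ^ (M + N))) \<le> norm (C *\<^sub>R (v x / of_real ((1 + norm x) ^ N)))"
    proof (rule AE_I2)
      fix x :: "real^'d"
      have p: "1 + norm x > 0" by (simp add: add_pos_nonneg)
      have "norm (w x) \<le> \<bar>C\<bar> * (1 + norm x) ^ M * norm (v x)"
        by (intro order_trans[OF assms(3)] mult_right_mono) auto
      then have "norm (w x) / ((1 + norm x) ^ M * (1 + norm x) ^ N) \<le> (\<bar>C\<bar> * (1 + norm x) ^ M * norm (v x)) / ((1 + norm x) ^ M * (1 + norm x) ^ N)"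
        by (intro divide_right_mono) auto
      then show "norm (w x / of_real ((1 + norm x) ^ (M + N))) \<le> norm (C *\<^sub>R (v x / of_real ((1 + norm x) ^ N)))"
        using p by (simp add: norm_divide power_add norm_mult norm_power del: of_real_power of_real_add)
    qed
  qed measurable
  then show ?thesis by (auto simp: tempered_fun_def)
qed

lemma tempered_fun_const: "tempered_fun (\<lambda>x. c)"
proof -
  have "integrable lborel (\<lambda>x::real^'d::finite. c * of_real (1 / (1 + norm x) ^ (2 * CARD('d))))"
    by (intro integrable_mult_right integrable_of_real integrable_weight order_refl)
  then show ?thesis by (auto simp: tempered_fun_def)
qed

lemma tempered_fun_integrableI: "integrable lborel w \<Longrightarrow> tempered_fun w"
  unfolding tempered_fun_def by (auto intro!: exI[of _ 0] dest: borel_measurable_integrable)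

lemma tempered_fun_bounded:
  assumes [measurable]: "w \<in> borel_measurable borel" and "\<And>x. norm (w x) \<le> C"
  shows "tempered_fun w"
  by (rule tempered_fun_mono[OF tempered_fun_const[of 1], of w C 0]) (use assms in auto)

lemma tempered_fun_add:
  assumes v: "tempered_fun v" and w: "tempered_fun w"
  shows "tempered_fun (\<lambda>x. v x + w x)"
proof -
  have [measurable]: "v \<in> borel_measurable borel" "w \<in> borel_measurable borel"
    using v w by (auto simp: tempered_fun_def)
  obtain N where N: "integrable lborel (\<lambda>x. v x / of_real ((1 + norm x) ^ N))"
    using v by (auto simp: tempered_fun_def)
  obtain M where M: "integrable lborel (\<lambda>x. w x / of_real ((1 + norm x) ^ M))"
    using w by (auto simp: tempered_fun_def)
  have up: "integrable lborel (\<lambda>x. f x / of_real ((1 + norm x) ^ (A + B)))"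
    if i: "integrable lborel (\<lambda>x. f x / of_real ((1 + norm x) ^ A))" and [measurable]: "f \<in> borel_measurable borel" for f :: "'a tfun" and A B
  proof (rule Bochner_Integration.integrable_bound[OF i])
    show "AE x in lborel. norm (f x / of_real ((1 + norm x) ^ (A + B))) \<le> norm (f x / of_real ((1 + norm x) ^ A))"
      by (auto simp: norm_divide norm_power simp del: of_real_power of_real_add
          intro!: divide_left_mono power_increasing mult_pos_pos zero_less_power add_pos_nonneg)
  qed measurable
  have "integrable lborel (\<lambda>x. v x / of_real ((1 + norm x) ^ (N + M)) + w x / of_real ((1 + norm x) ^ (M + N)))"
    by (intro Bochner_Integration.integrable_add up N M) auto
  then show ?thesis by (auto simp: tempered_fun_def add_divide_distrib add.commute intro!: exI[of _ "N + M"])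
qed

lemma schwartz_integrable: "f \<in> schwartz \<Longrightarrow> integrable lborel f"
  using tempered_fun_integrable[OF tempered_fun_const[of 1], of f] by simp

section \<open>The Fourier transform\<close>

lemma cis_measurable [measurable]:
  "(\<lambda>x. exp (\<i> * complex_of_real (\<omega> \<bullet> x))) \<in> borel_measurable (borel :: (real^'d::finite) measure)"
  by (intro borel_measurable_continuous_onI continuous_intros)

lemma fourier_integrable:
  fixes f :: "'d::finite tfun"
  assumes "integrable lborel f"
  shows "integrable lborel (\<lambda>x. f x * exp (\<i> * complex_of_real (\<omega> \<bullet> x)))"
proof (rule Bochner_Integration.integrable_bound[OF assms])
  show "(\<lambda>x. f x * exp (\<i> * complex_of_real (\<omega> \<bullet> x))) \<in> borel_measurable lborel"
    using borel_measurable_integrable[OF assms] by measurable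
qed (simp add: norm_mult)

lemma fourier_add:
  assumes "integrable lborel f" "integrable lborel g"
  shows "fourier (\<lambda>x. f x + g x) \<omega> = fourier f \<omega> + fourier g \<omega>"
  unfolding fourier_def distrib_right
  by (intro Bochner_Integration.integral_add fourier_integrable assms)

lemma fourier_cmult: "fourier (\<lambda>x. c * f x) \<omega> = c * fourier f \<omega>"
  by (simp add: fourier_def mult.assoc)

lemma fourier_diff:
  assumes "integrable lborel f" "integrable lborel g"
  shows "fourier (\<lambda>x. f x - g x) \<omega> = fourier f \<omega> - fourier g \<omega>"
  unfolding fourier_def left_diff_distrib
  by (intro Bochner_Integration.integral_diff fourier_integrable assms)

lemma norm_fourier_le:
  fixes f :: "'d::finite tfun"
  shows "norm (fourier f \<omega>) \<le> (LINT x|lborel. norm (f x))"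
proof -
  have "norm (fourier f \<omega>) \<le> (LINT x|lborel. norm (f x * exp (\<i> * complex_of_real (\<omega> \<bullet> x))))"
    unfolding fourier_def by (rule integral_norm_bound)
  then show ?thesis by (simp add: norm_mult)
qed

lemma fourier_measurable [measurable]:
  fixes f :: "'d::finite tfun"
  assumes [measurable]: "f \<in> borel_measurable borel"
  shows "fourier f \<in> borel_measurable borel"
proof -
  have m: "(\<lambda>p::(real^'d) \<times> (real^'d). exp (\<i> * complex_of_real (fst p \<bullet> snd p))) \<in> borel_measurable borel"
    by (intro borel_measurable_continuous_onI continuous_intros)
  have [measurable]: "(\<lambda>p::(real^'d) \<times> (real^'d). exp (\<i> * complex_of_real (fst p \<bullet> snd p))) \<in> borel_measurable (borel \<Otimes>\<^sub>M lborel)"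
    using m by (simp add: borel_prod)
  have "(\<lambda>\<omega>::real^'d. LINT x|lborel. f x * exp (\<i> * complex_of_real (\<omega> \<bullet> x))) \<in> borel_measurable borel"
  proof (rule lborel.borel_measurable_lebesgue_integral)
    have "(\<lambda>p. f (snd p) * exp (\<i> * complex_of_real (fst p \<bullet> snd p))) \<in> borel_measurable (borel \<Otimes>\<^sub>M lborel)"
      by measurable
    then show "(\<lambda>(\<omega>, x). f x * exp (\<i> * complex_of_real (\<omega> \<bullet> x))) \<in> borel_measurable (borel \<Otimes>\<^sub>M lborel)"
      by (simp add: case_prod_beta)
  qed
  then show ?thesis by (simp add: fourier_def[abs_def])
qed

lemma iexp_remainder: "norm (exp (\<i> * complex_of_real t) - 1 - \<i> * of_real t) \<le> t\<^sup>2"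
proof -
  have "norm (exp (\<i> * complex_of_real t) - (\<Sum>k\<le>1. (\<i> * of_real t) ^ k / fact k)) \<le> \<bar>t\<bar> ^ Suc 1 / fact (Suc 1)"
    by (rule iexp_approx1)
  moreover have "(\<Sum>k\<le>1. (\<i> * complex_of_real t) ^ k / fact k) = 1 + \<i> * of_real t" by simp
  ultimately have "norm (exp (\<i> * complex_of_real t) - 1 - \<i> * of_real t) \<le> t\<^sup>2 / 2"
    by (simp add: diff_diff_eq power2_eq_square)
  also have "\<dots> \<le> t\<^sup>2" by simp
  finally show ?thesis .
qed

text \<open>The counterpart of differentiation on the other side of the transform.\<close>

definition coord_mul :: "'d::finite \<Rightarrow> 'd tfun \<Rightarrow> 'd tfun" where
  "coord_mul k f = (\<lambda>x. \<i> * complex_of_real (x $ k) * f x)"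

lemma slow_coord_mul: "slow (\<lambda>x::real^'d::finite. \<i> * complex_of_real (x $ k))"
  using slow_family_mult[OF slow_const slow_coord, of "\<i>" k] .

lemma schwartz_coord_mul: "f \<in> schwartz \<Longrightarrow> coord_mul k f \<in> schwartz"
  unfolding coord_mul_def by (rule slow_family_mult_schwartz[OF slow_coord_mul])

lemma schwartz_foldr_coord_mul: "f \<in> schwartz \<Longrightarrow> foldr coord_mul ks f \<in> schwartz"
  by (induction ks) (auto simp: schwartz_coord_mul)

lemma schwartz_norm2_integrable:
  fixes f :: "'d::finite tfun"
  assumes f: "f \<in> schwartz"
  shows "integrable lborel (\<lambda>x. (norm x)\<^sup>2 * norm (f x))"
proof -
  have "tempered_fun (\<lambda>x::real^'d. complex_of_real ((norm x)\<^sup>2))"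
  proof (rule tempered_fun_mono[OF tempered_fun_const[of 1]])
    show "norm (complex_of_real ((norm x)\<^sup>2)) \<le> 1 * (1 + norm x) ^ 2 * norm (1::complex)" for x :: "real^'d"
      by (simp add: norm_power power_mono)
  qed measurable
  from integrable_norm[OF tempered_fun_integrable[OF this f]]
  show ?thesis by (simp add: norm_mult norm_power)
qed

text \<open>The remainder \<open>e\<^sup>i\<^sup>t - 1 - i t\<close> is at most \<open>t\<^sup>2\<close>, so the transform differs from its linear approximation by
  at most \<open>\<bar>h\<bar>\<^sup>2\<close> times the second moment of \<open>f\<close>.\<close>

lemma fourier_has_pdiff:
  fixes f :: "'d::finite tfun"
  assumes f: "f \<in> schwartz"
  shows "pdiff k (fourier f) = fourier (coord_mul k f)" "fourier f differentiable (at \<omega>)"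
proof -
  have *: "norm (fourier f (\<omega> + h) - fourier f \<omega> - (\<Sum>k\<in>UNIV. h $ k *\<^sub>R fourier (coord_mul k f) \<omega>))
    \<le> (LINT x|lborel. (norm x)\<^sup>2 * norm (f x)) * (norm h)\<^sup>2" for \<omega> h
  proof -
    let ?e = "\<lambda>\<omega> x. exp (\<i> * complex_of_real (\<omega> \<bullet> x))"
    have ii: "integrable lborel (\<lambda>x. coord_mul k f x * ?e \<omega> x)" for k
      by (intro fourier_integrable schwartz_integrable schwartz_coord_mul f)
    have fi: "integrable lborel (\<lambda>x. f x * ?e \<omega> x)" for \<omega>
      by (intro fourier_integrable schwartz_integrable f)
    have eq: "f x * ?e (\<omega> + h) x - f x * ?e \<omega> x - (\<Sum>k\<in>UNIV. h $ k *\<^sub>R (coord_mul k f x * ?e \<omega> x))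
      = f x * ?e \<omega> x * (?e h x - 1 - \<i> * of_real (h \<bullet> x))" for x
    proof -
      have "(\<Sum>k\<in>UNIV. h $ k *\<^sub>R (coord_mul k f x * ?e \<omega> x)) = f x * ?e \<omega> x * (\<i> * of_real (h \<bullet> x))"
        by (simp add: coord_mul_def inner_vec_def sum_distrib_left sum_distrib_right scaleR_conv_of_real mult_ac)
      then show ?thesis
        by (simp add: inner_add_left distrib_left exp_add algebra_simps)
    qed
    have "fourier f (\<omega> + h) - fourier f \<omega> - (\<Sum>k\<in>UNIV. h $ k *\<^sub>R fourier (coord_mul k f) \<omega>) =
      (LINT x|lborel. f x * ?e (\<omega> + h) x - f x * ?e \<omega> x - (\<Sum>k\<in>UNIV. h $ k *\<^sub>R (coord_mul k f x * ?e \<omega> x)))"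
      unfolding fourier_def
      by (simp add: Bochner_Integration.integral_diff Bochner_Integration.integral_sum fi ii integrable_scaleR_right)
    also have "norm \<dots> \<le> (LINT x|lborel. (norm x)\<^sup>2 * norm (f x) * (norm h)\<^sup>2)"
    proof (rule order_trans[OF integral_norm_bound integral_mono], rule integrable_norm)
      show "integrable lborel (\<lambda>x. f x * ?e (\<omega> + h) x - f x * ?e \<omega> x - (\<Sum>k\<in>UNIV. h $ k *\<^sub>R (coord_mul k f x * ?e \<omega> x)))"
        by (intro Bochner_Integration.integrable_diff Bochner_Integration.integrable_sum integrable_scaleR_right fi ii)
      show "integrable lborel (\<lambda>x. (norm x)\<^sup>2 * norm (f x) * (norm h)\<^sup>2)"
        by (intro integrable_mult_left schwartz_norm2_integrable f)
      fix x
      have "norm (?e h x - 1 - \<i> * of_real (h \<bullet> x)) \<le> (h \<bullet> x)\<^sup>2" by (rule iexp_remainder)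
      also have "\<dots> \<le> (norm h * norm x)\<^sup>2"
        using Cauchy_Schwarz_ineq2[of h x] by (simp add: abs_le_square_iff[symmetric] abs_mult)
      finally have "norm (f x) * norm (?e h x - 1 - \<i> * of_real (h \<bullet> x)) \<le> norm (f x) * (norm h * norm x)\<^sup>2"
        by (intro mult_left_mono) auto
      then show "norm (f x * ?e (\<omega> + h) x - f x * ?e \<omega> x - (\<Sum>k\<in>UNIV. h $ k *\<^sub>R (coord_mul k f x * ?e \<omega> x)))
        \<le> (norm x)\<^sup>2 * norm (f x) * (norm h)\<^sup>2"
        unfolding eq by (simp add: norm_mult power_mult_distrib mult_ac)
    qed
    finally show ?thesis by simp
  qed
  show "pdiff k (fourier f) = fourier (coord_mul k f)"
    by (rule ext, rule pdiff_quadratic_remainder(1)[where g = "\<lambda>k. fourier (coord_mul k f) _", OF *])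
  show "fourier f differentiable (at \<omega>)"
    by (rule pdiff_quadratic_remainder(2)[where g = "\<lambda>k. fourier (coord_mul k f) _", OF *])
qed

lemma smooth_fourier:
  assumes "f \<in> schwartz"
  shows "smooth (fourier f)"
proof -
  have "\<exists>g\<in>schwartz. fourier f = fourier g" using assms by blast
  then show ?thesis
    by (rule smooth_coinduct[where P = "\<lambda>f. \<exists>g\<in>schwartz. f = fourier g"])
      (auto simp: diff_on_UNIV fourier_has_pdiff intro: schwartz_coord_mul)
qed

lemma pdiffs_fourier: "f \<in> schwartz \<Longrightarrow> pdiffs ks (fourier f) = fourier (foldr coord_mul ks f)"
  by (induction ks) (auto simp: fourier_has_pdiff schwartz_foldr_coord_mul)

lemma lborel_integral_affine:
  fixes f :: "'a::euclidean_space \<Rightarrow> 'b::{banach, second_countable_topology}"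
  assumes [measurable]: "f \<in> borel_measurable borel" and c: "c \<noteq> 0"
  shows "(LINT x|lborel. f x) = \<bar>c\<bar> ^ DIM('a) *\<^sub>R (LINT x|lborel. f (t + c *\<^sub>R x))"
  by (subst lborel_affine[OF c, of t]) (simp add: integral_density integral_distr)

lemma lborel_integrable_affine:
  fixes f :: "'a::euclidean_space \<Rightarrow> 'b::{banach, second_countable_topology}"
  assumes f: "integrable lborel f" and c: "c \<noteq> 0"
  shows "integrable lborel (\<lambda>x. f (t + c *\<^sub>R x))"
proof -
  have [measurable]: "f \<in> borel_measurable borel" using f by auto
  have "integrable (density (distr lborel borel (\<lambda>x. t + c *\<^sub>R x)) (\<lambda>_. ennreal (\<bar>c\<bar> ^ DIM('a)))) f"
    using f by (subst (asm) lborel_affine[OF c, of t]) (simp add: ennreal_power)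
  then have "integrable lborel (\<lambda>x. \<bar>c\<bar> ^ DIM('a) *\<^sub>R f (t + c *\<^sub>R x))"
    by (simp add: integrable_density integrable_distr_eq)
  from integrable_scaleR_right[OF this, of "inverse (\<bar>c\<bar> ^ DIM('a))"]
  show ?thesis using c by simp
qed

lemma fourier_translate:
  fixes f :: "'d::finite tfun"
  assumes [measurable]: "f \<in> borel_measurable borel"
  shows "fourier (\<lambda>x. f (a + x)) \<omega> = exp (- (\<i> * complex_of_real (\<omega> \<bullet> a))) * fourier f \<omega>"
proof -
  have "fourier f \<omega> = (LINT x|lborel. f (a + x) * exp (\<i> * complex_of_real (\<omega> \<bullet> (a + x))))"
    unfolding fourier_def by (subst lborel_integral_affine[of _ 1 a]) auto
  also have "\<dots> = (LINT x|lborel. exp (\<i> * complex_of_real (\<omega> \<bullet> a)) * (f (a + x) * exp (\<i> * complex_of_real (\<omega> \<bullet> x))))"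
    by (simp add: inner_add_right distrib_left exp_add mult_ac)
  also have "\<dots> = exp (\<i> * complex_of_real (\<omega> \<bullet> a)) * fourier (\<lambda>x. f (a + x)) \<omega>"
    by (simp add: fourier_def)
  finally show ?thesis by (simp add: exp_minus field_simps)
qed

text \<open>Differentiation becomes multiplication: the transform of a translate is known, and
  translates differ from \<open>f\<close> by the derivative up to an integrable quadratic error.\<close>

lemma fourier_pdiff:
  fixes f :: "'d::finite tfun"
  assumes f: "f \<in> schwartz"
  shows "fourier (pdiff k f) \<omega> = - \<i> * complex_of_real (\<omega> $ k) * fourier f \<omega>"
proof -
  obtain C where C: "C \<ge> 0" "\<And>x h. norm h \<le> 1 \<Longrightarrow>
    (1 + norm x) ^ (2 * CARD('d)) * norm (f (x + h) - f x - (\<Sum>k\<in>UNIV. h $ k *\<^sub>R pdiff k f x)) \<le> C * (norm h)\<^sup>2"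
    using taylor_weighted[OF f] by blast
  define A where "A = C * (LINT x::real^'d|lborel. 1 / (1 + norm x) ^ (2 * CARD('d)))"
  define e where "e = fourier (pdiff k f) \<omega> + \<i> * complex_of_real (\<omega> $ k) * fourier f \<omega>"
  have [measurable]: "f \<in> borel_measurable borel" by (rule smooth_measurable[OF schwartz_smooth[OF f]])
  \<comment> \<open>The transform of a difference quotient in direction \<open>k\<close>, expanded to second order in \<open>t\<close>.\<close>
  have bound: "t * norm e \<le> (A + (\<omega> $ k)\<^sup>2 * norm (fourier f \<omega>)) * t\<^sup>2" if t: "0 < t" "t \<le> 1" for t
  proof -
    let ?a = "t *\<^sub>R axis k 1 :: real^'d"
    have tr: "(\<lambda>x. f (?a + x)) \<in> schwartz" using schwartz_affine(1)[OF f, of 1 ?a] by simp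
    have "norm (fourier (\<lambda>x. f (?a + x) - f x - of_real t * pdiff k f x) \<omega>) \<le> A * t\<^sup>2"
    proof -
      have "norm (fourier (\<lambda>x. f (?a + x) - f x - of_real t * pdiff k f x) \<omega>)
        \<le> (LINT x|lborel. norm (f (?a + x) - f x - of_real t * pdiff k f x))"
        by (rule norm_fourier_le)
      also have "\<dots> \<le> (LINT x::real^'d|lborel. C * t\<^sup>2 * (1 / (1 + norm x) ^ (2 * CARD('d))))"
      proof (rule integral_mono)
        show "integrable lborel (\<lambda>x. norm (f (?a + x) - f x - of_real t * pdiff k f x))"
          by (intro integrable_norm schwartz_integrable schwartz_diff schwartz_cmult schwartz_pdiff f tr)
        show "integrable lborel (\<lambda>x::real^'d. C * t\<^sup>2 * (1 / (1 + norm x) ^ (2 * CARD('d))))"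
          by (intro integrable_mult_right integrable_weight order_refl)
        fix x :: "real^'d"
        have "norm ?a \<le> 1" using t by simp
        from C(2)[OF this, of x]
        have "(1 + norm x) ^ (2 * CARD('d)) * norm (f (x + ?a) - f x - (\<Sum>l\<in>UNIV. ?a $ l *\<^sub>R pdiff l f x)) \<le> C * t\<^sup>2"
          using t by simp
        moreover have "(\<Sum>l\<in>UNIV. ?a $ l *\<^sub>R pdiff l f x) = of_real t * pdiff k f x"
          using sum_axis[of k "\<lambda>l. pdiff l f x"]
          by (simp add: scaleR_conv_of_real[where 'a=complex] mult.assoc flip: sum_distrib_left)
        ultimately show "norm (f (?a + x) - f x - of_real t * pdiff k f x) \<le> C * t\<^sup>2 * (1 / (1 + norm x) ^ (2 * CARD('d)))"
          by (simp add: pos_le_divide_eq add_pos_nonneg mult_ac add.commute)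
      qed
      also have "\<dots> = C * t\<^sup>2 * (LINT x::real^'d|lborel. 1 / (1 + norm x) ^ (2 * CARD('d)))"
        by (rule integral_mult_right_zero)
      finally show ?thesis by (simp add: A_def mult.assoc mult.commute[of "t\<^sup>2"])
    qed
    moreover have "fourier (\<lambda>x. f (?a + x) - f x - of_real t * pdiff k f x) \<omega>
      = fourier (\<lambda>x. f (?a + x)) \<omega> - fourier f \<omega> - of_real t * fourier (pdiff k f) \<omega>"
      by (subst fourier_diff, (intro schwartz_integrable schwartz_diff schwartz_cmult schwartz_pdiff f tr)+,
          subst fourier_diff, (intro schwartz_integrable f tr)+) (simp add: fourier_cmult)
    moreover have "fourier (\<lambda>x. f (?a + x)) \<omega> = exp (\<i> * complex_of_real (- t * \<omega> $ k)) * fourier f \<omega>"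
      by (subst fourier_translate) (auto simp: inner_axis mult_ac)
    ultimately have 1: "norm ((exp (\<i> * complex_of_real (- t * \<omega> $ k)) - 1) * fourier f \<omega> - of_real t * fourier (pdiff k f) \<omega>) \<le> A * t\<^sup>2"
      by (simp only: left_diff_distrib mult_1)
    have 2: "norm ((exp (\<i> * complex_of_real (- t * \<omega> $ k)) - 1 - \<i> * of_real (- t * \<omega> $ k)) * fourier f \<omega>) \<le> (t * \<omega> $ k)\<^sup>2 * norm (fourier f \<omega>)"
      unfolding norm_mult using iexp_remainder[of "- t * \<omega> $ k"] by (intro mult_right_mono) (auto simp: power_mult_distrib)
    have "of_real t * e = ((exp (\<i> * complex_of_real (- t * \<omega> $ k)) - 1 - \<i> * of_real (- t * \<omega> $ k)) * fourier f \<omega>)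
       - ((exp (\<i> * complex_of_real (- t * \<omega> $ k)) - 1) * fourier f \<omega> - of_real t * fourier (pdiff k f) \<omega>)"
      by (simp add: e_def algebra_simps)
    then have "norm (of_real t * e) \<le> (t * \<omega> $ k)\<^sup>2 * norm (fourier f \<omega>) + A * t\<^sup>2"
      using norm_triangle_le_diff[OF add_mono[OF 2 1]] by simp
    then show ?thesis using t by (simp add: norm_mult power_mult_distrib algebra_simps)
  qed
  define B where "B = A + (\<omega> $ k)\<^sup>2 * norm (fourier f \<omega>)"
  have "norm e \<le> B * t" if t: "0 < t" "t \<le> 1" for t
    using bound[OF t] t by (simp add: B_def power2_eq_square)
  then have "\<forall>\<^sub>F t in at_right 0. norm e \<le> B * t"
    unfolding eventually_at_right_field by (intro exI[of _ 1]) auto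
  moreover have "((\<lambda>t. B * t) \<longlongrightarrow> B * 0) (at_right 0)"
    by (intro tendsto_intros)
  ultimately have "norm e \<le> B * 0"
    using tendsto_lowerbound[of "\<lambda>t. B * t" "B * 0" "at_right 0" "norm e"] trivial_limit_at_right_real by blast
  then have "e = 0" by simp
  then show ?thesis by (simp add: e_def eq_neg_iff_add_eq_0)
qed

lemma schwartz_L1_bound:
  obtains C M where "C \<ge> 0" "\<And>f::'d::finite tfun. f \<in> schwartz \<Longrightarrow> (LINT x|lborel. norm (f x)) \<le> C * schwartz_seminorm M f"
  using tempered_fun_schwartz_bound[OF tempered_fun_const[of 1, where 'a='d]]
  by (metis (no_types, lifting) Bochner_Integration.integral_cong mult_1)

text \<open>Each power of \<open>1 + \<bar>\<omega>\<bar>\<close> is paid for by one derivative of \<open>f\<close>, as \<open>\<omega>\<^sub>k\<close> times the transform is the transform of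
  a derivative.\<close>

lemma fourier_decay:
  obtains C M where "C \<ge> 0" "\<And>(f::'d::finite tfun) \<omega>. f \<in> schwartz \<Longrightarrow>
    (1 + norm \<omega>) ^ N * norm (fourier f \<omega>) \<le> C * schwartz_seminorm M f"
proof -
  have "\<exists>C M. C \<ge> 0 \<and> (\<forall>f::'d tfun. \<forall>\<omega>. f \<in> schwartz \<longrightarrow> (1 + norm \<omega>) ^ N * norm (fourier f \<omega>) \<le> C * schwartz_seminorm M f)"
  proof (induction N)
    case 0
    obtain C M where C: "C \<ge> 0" "\<And>f::'d tfun. f \<in> schwartz \<Longrightarrow> (LINT x|lborel. norm (f x)) \<le> C * schwartz_seminorm M f"
      by (rule schwartz_L1_bound) blast
    then show ?case
      by (intro exI[of _ C] exI[of _ M]) (auto intro: order_trans[OF norm_fourier_le])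
  next
    case (Suc N)
    then obtain C M where C: "C \<ge> 0" and CM: "\<And>(f::'d tfun) \<omega>. f \<in> schwartz \<Longrightarrow> (1 + norm \<omega>) ^ N * norm (fourier f \<omega>) \<le> C * schwartz_seminorm M f"
      by blast
    have "(1 + norm \<omega>) ^ Suc N * norm (fourier f \<omega>) \<le> (C * (1 + real CARD('d))) * schwartz_seminorm (Suc M) f"
      if f: "f \<in> schwartz" for f :: "'d tfun" and \<omega>
    proof -
      have "(1 + norm \<omega>) * norm (fourier f \<omega>) \<le> (1 + (\<Sum>k\<in>UNIV. \<bar>\<omega> $ k\<bar>)) * norm (fourier f \<omega>)"
        using norm_le_l1_cart[of \<omega>] by (intro mult_right_mono) auto
      also have "\<dots> = norm (fourier f \<omega>) + (\<Sum>k\<in>UNIV. norm (fourier (pdiff k f) \<omega>))"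
        by (simp add: fourier_pdiff[OF f] norm_mult distrib_right sum_distrib_right)
      finally have a: "(1 + norm \<omega>) * norm (fourier f \<omega>) \<le> norm (fourier f \<omega>) + (\<Sum>k\<in>UNIV. norm (fourier (pdiff k f) \<omega>))" .
      have "(1 + norm \<omega>) ^ Suc N * norm (fourier f \<omega>) = (1 + norm \<omega>) ^ N * ((1 + norm \<omega>) * norm (fourier f \<omega>))"
        by simp
      also have "\<dots> \<le> (1 + norm \<omega>) ^ N * (norm (fourier f \<omega>) + (\<Sum>k\<in>UNIV. norm (fourier (pdiff k f) \<omega>)))"
        by (rule mult_left_mono[OF a]) simp
      also have "\<dots> = (1 + norm \<omega>) ^ N * norm (fourier f \<omega>) + (\<Sum>k\<in>UNIV. (1 + norm \<omega>) ^ N * norm (fourier (pdiff k f) \<omega>))"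
        by (simp add: distrib_left sum_distrib_left)
      also have "\<dots> \<le> C * schwartz_seminorm (Suc M) f + (\<Sum>k\<in>(UNIV::'d set). C * schwartz_seminorm (Suc M) f)"
      proof (intro add_mono sum_mono)
        show "(1 + norm \<omega>) ^ N * norm (fourier f \<omega>) \<le> C * schwartz_seminorm (Suc M) f"
          using C f by (intro order_trans[OF CM] mult_left_mono schwartz_seminorm_mono) auto
        show "(1 + norm \<omega>) ^ N * norm (fourier (pdiff k f) \<omega>) \<le> C * schwartz_seminorm (Suc M) f" for k
          using C f by (intro order_trans[OF CM] mult_left_mono schwartz_seminorm_pdiff schwartz_pdiff) auto
      qed
      finally show ?thesis by (simp add: algebra_simps)
    qed
    then show ?case using C by (intro exI[of _ "C * (1 + real CARD('d))"] exI[of _ "Suc M"]) auto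
  qed
  then show thesis using that by blast
qed

lemma foldr_coord_mul_seminorm:
  shows "\<exists>C M. C \<ge> 0 \<and> (\<forall>f::'d::finite tfun. f \<in> schwartz \<longrightarrow> schwartz_seminorm N (foldr coord_mul ks f) \<le> C * schwartz_seminorm M f)"
proof (induction ks arbitrary: N)
  case Nil
  show ?case by (intro exI[of _ 1] exI[of _ N]) auto
next
  case (Cons k ks)
  obtain C M where C: "C \<ge> 0" "\<And>(i::unit) f. f \<in> schwartz \<Longrightarrow>
    schwartz_seminorm N (\<lambda>x::real^'d. \<i> * complex_of_real (x $ k) * f x) \<le> C * schwartz_seminorm M f"
    using slow_family_mult_seminorm[OF slow_coord_mul] by blast
  obtain D L where D: "D \<ge> 0" "\<And>f::'d tfun. f \<in> schwartz \<Longrightarrow> schwartz_seminorm M (foldr coord_mul ks f) \<le> D * schwartz_seminorm L f"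
    using Cons[of M] by blast
  have "schwartz_seminorm N (foldr coord_mul (k # ks) f) \<le> (C * D) * schwartz_seminorm L f" if f: "f \<in> schwartz" for f :: "'d tfun"
  proof -
    have "schwartz_seminorm N (foldr coord_mul (k # ks) f) \<le> C * schwartz_seminorm M (foldr coord_mul ks f)"
      using C(2)[OF schwartz_foldr_coord_mul[OF f, of ks]] by (simp add: coord_mul_def)
    also have "\<dots> \<le> C * (D * schwartz_seminorm L f)" using C D f by (intro mult_left_mono) auto
    finally show ?thesis by simp
  qed
  then show ?case using C D by (intro exI[of _ "C * D"] exI[of _ L]) auto
qed

lemma fourier_pdiffs_bound:
  "\<exists>C M. \<forall>f\<in>schwartz. \<forall>\<omega>. (1 + norm \<omega>) ^ N * norm (pdiffs ks (fourier (f::'d::finite tfun)) \<omega>) \<le> C * schwartz_seminorm M f"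
proof -
  obtain C M where C: "C \<ge> 0" "\<And>(f::'d tfun) \<omega>. f \<in> schwartz \<Longrightarrow>
    (1 + norm \<omega>) ^ N * norm (fourier f \<omega>) \<le> C * schwartz_seminorm M f"
    using fourier_decay by blast
  obtain D L where D: "D \<ge> 0" "\<And>f::'d tfun. f \<in> schwartz \<Longrightarrow> schwartz_seminorm M (foldr coord_mul ks f) \<le> D * schwartz_seminorm L f"
    using foldr_coord_mul_seminorm[of M ks] by blast
  have "(1 + norm \<omega>) ^ N * norm (pdiffs ks (fourier f) \<omega>) \<le> (C * D) * schwartz_seminorm L f" if f: "f \<in> schwartz" for f :: "'d tfun" and \<omega>
  proof -
    have "(1 + norm \<omega>) ^ N * norm (pdiffs ks (fourier f) \<omega>) \<le> C * schwartz_seminorm M (foldr coord_mul ks f)"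
      using C(2)[OF schwartz_foldr_coord_mul[OF f, of ks], of \<omega>] by (simp add: pdiffs_fourier f)
    also have "\<dots> \<le> C * (D * schwartz_seminorm L f)" using C D f by (intro mult_left_mono) auto
    finally show ?thesis by simp
  qed
  then show ?thesis by blast
qed

lemma schwartz_fourier: "(f::'d::finite tfun) \<in> schwartz \<Longrightarrow> fourier f \<in> schwartz"
  unfolding schwartz_iff[of "fourier f"] using smooth_fourier fourier_pdiffs_bound by blast

lemma fourier_seminorm:
  obtains C M where "C \<ge> 0" "\<And>f::'d::finite tfun. f \<in> schwartz \<Longrightarrow> schwartz_seminorm N (fourier f) \<le> C * schwartz_seminorm M f"
  using seminorm_bound_uniform[of schwartz "\<lambda>f. f" N fourier] fourier_pdiffs_bound[of N] by auto

lemma inv_fourier_eq: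
  fixes f :: "'d::finite tfun"
  shows "inv_fourier f = (\<lambda>x. complex_of_real (1 / (2 * pi) ^ CARD('d)) * fourier f (0 + (-1) *\<^sub>R x))"
  by (rule ext) (simp add: inv_fourier_def fourier_def inner_commute)

lemma schwartz_inv_fourier: 
  assumes "(f::'d::finite tfun) \<in> schwartz" shows "inv_fourier f \<in> schwartz"
  unfolding inv_fourier_eq
  by (rule schwartz_cmult[OF schwartz_affine(1)[OF schwartz_fourier[OF assms]]]) simp

lemma inv_fourier_seminorm:
  obtains C M where "C \<ge> 0" "\<And>f::'d::finite tfun. f \<in> schwartz \<Longrightarrow> schwartz_seminorm N (inv_fourier f) \<le> C * schwartz_seminorm M f"
proof -
  obtain A L where A: "A \<ge> 0" "\<And>(i::unit) f. f \<in> schwartz \<Longrightarrow>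
      schwartz_seminorm N (\<lambda>x::real^'d. complex_of_real (1 / (2 * pi) ^ CARD('d)) * f x) \<le> A * schwartz_seminorm L f"
    using slow_family_mult_seminorm[OF slow_const] by blast
  obtain C M where C: "C \<ge> 0" "\<And>f::'d tfun. f \<in> schwartz \<Longrightarrow> schwartz_seminorm L (fourier f) \<le> C * schwartz_seminorm M f"
    using fourier_seminorm by blast
  have "schwartz_seminorm N (inv_fourier f) \<le> (A * C) * schwartz_seminorm M f" if f: "f \<in> schwartz" for f :: "'d tfun"
  proof -
    let ?g = "\<lambda>x. fourier f (0 + (-1) *\<^sub>R x)"
    have g: "?g \<in> schwartz" "schwartz_seminorm L ?g \<le> schwartz_seminorm L (fourier f)"
      using schwartz_affine(1)[OF schwartz_fourier[OF f], of "-1" 0]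
        schwartz_affine(2)[OF schwartz_fourier[OF f], of "-1" L 0] by simp_all
    have "schwartz_seminorm N (inv_fourier f) \<le> A * schwartz_seminorm L ?g"
      unfolding inv_fourier_eq using A(2)[OF g(1)] .
    also have "\<dots> \<le> A * (C * schwartz_seminorm M f)"
      using A(1) C(2)[OF f] g(2) by (intro mult_left_mono) auto
    finally show ?thesis by simp
  qed
  then show thesis using A C that[of "A * C" M] by simp
qed

lemma inv_fourier_pdiff:
  "f \<in> schwartz \<Longrightarrow> inv_fourier (pdiff k f) \<omega> = \<i> * complex_of_real (\<omega> $ k) * inv_fourier f \<omega>"
  by (simp add: inv_fourier_eq fourier_pdiff)

subsection \<open>Fubini and the inversion formula\<close>

lemma fourier_swap:
  fixes f g :: "'d::finite tfun"
  assumes f: "integrable lborel f" and g: "integrable lborel g"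
  shows "(LINT \<omega>|lborel. fourier f \<omega> * g \<omega>) = (LINT x|lborel. f x * fourier g x)"
proof -
  let ?k = "\<lambda>x \<omega>. f x * g \<omega> * exp (\<i> * complex_of_real (\<omega> \<bullet> x))"
  have [measurable]: "f \<in> borel_measurable borel" "g \<in> borel_measurable borel" using f g by auto
  have m: "(\<lambda>p::(real^'d) \<times> (real^'d). exp (\<i> * complex_of_real (snd p \<bullet> fst p))) \<in> borel_measurable borel"
    by (intro borel_measurable_continuous_onI continuous_intros)
  have [measurable]: "(\<lambda>p::(real^'d) \<times> (real^'d). exp (\<i> * complex_of_real (snd p \<bullet> fst p))) \<in> borel_measurable (lborel \<Otimes>\<^sub>M lborel)"
    using m by (simp add: lborel_prod)
  have i: "integrable (lborel \<Otimes>\<^sub>M lborel) (case_prod ?k)"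
  proof (rule Bochner_Integration.integrable_bound)
    show "integrable (lborel \<Otimes>\<^sub>M lborel) (\<lambda>(x, y). f x * g y)"
      by (rule lborel_pair.Fubini_integrable) (use f g in \<open>auto simp: norm_mult\<close>)
    have "(\<lambda>p. f (fst p) * g (snd p) * exp (\<i> * complex_of_real (snd p \<bullet> fst p))) \<in> borel_measurable (lborel \<Otimes>\<^sub>M lborel)"
      by measurable
    then show "case_prod ?k \<in> borel_measurable (lborel \<Otimes>\<^sub>M lborel)"
      by (simp add: case_prod_beta')
  qed (auto simp: norm_mult)
  have "(LINT \<omega>|lborel. fourier f \<omega> * g \<omega>) = (LINT \<omega>|lborel. LINT x|lborel. ?k x \<omega>)"
    unfolding fourier_def by (subst integral_mult_left_zero[symmetric]) (simp add: mult_ac)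
  also have "\<dots> = (LINT x|lborel. LINT \<omega>|lborel. ?k x \<omega>)"
    by (rule lborel_pair.Fubini_integral[OF i])
  also have "\<dots> = (LINT x|lborel. f x * fourier g x)"
    unfolding fourier_def by (subst integral_mult_right_zero[symmetric]) (simp add: mult_ac inner_commute)
  finally show ?thesis .
qed

text \<open>\<open>gauss \<epsilon>\<close> is the density of independent centred normal variables with deviation \<open>\<epsilon>\<close>, and
  \<open>gcut \<epsilon>\<close> its transform; as \<open>\<epsilon>\<close> tends to \<open>0\<close> the former is an approximate identity and the latter
  a cutoff increasing to \<open>1\<close>.\<close>

definition gauss :: "real \<Rightarrow> real^'d::finite \<Rightarrow> real" where
  "gauss \<epsilon> x = (\<Prod>k\<in>UNIV. normal_density 0 \<epsilon> (x $ k))"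

definition gcut :: "real \<Rightarrow> real^'d::finite \<Rightarrow> real" where
  "gcut \<epsilon> \<omega> = (\<Prod>k\<in>UNIV. exp (- (\<epsilon> * \<omega> $ k)\<^sup>2 / 2))"

lemma normal_density_scaled: "\<sigma> > 0 \<Longrightarrow> \<sigma> * normal_density 0 \<sigma> (\<sigma> * s) = std_normal_density s"
  by (simp add: normal_density_def power_mult_distrib real_sqrt_mult)

lemma normal_fourier_1d:
  assumes "\<sigma> > 0"
  shows "(LINT t|lborel. complex_of_real (normal_density 0 \<sigma> t) * exp (\<i> * complex_of_real (x * t)))
    = complex_of_real (exp (- (\<sigma> * x)\<^sup>2 / 2))"
proof -
  have "complex_of_real (exp (- (\<sigma> * x)\<^sup>2 / 2)) = char std_normal_distribution (\<sigma> * x)"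
    by (simp add: char_std_normal_distribution)
  also have "\<dots> = (LINT s|lborel. std_normal_density s *\<^sub>R exp (\<i> * complex_of_real (\<sigma> * x * s)))"
    unfolding char_def by (subst integral_density) (auto simp: normal_density_nonneg)
  also have "\<dots> = (LINT s|lborel. \<sigma> *\<^sub>R (complex_of_real (normal_density 0 \<sigma> (0 + \<sigma> * s)) * exp (\<i> * complex_of_real (x * (0 + \<sigma> * s)))))"
    by (intro Bochner_Integration.integral_cong refl)
      (simp add: scaleR_conv_of_real mult_ac flip: normal_density_scaled[OF assms])
  also have "\<dots> = (LINT t|lborel. complex_of_real (normal_density 0 \<sigma> t) * exp (\<i> * complex_of_real (x * t)))"
    using assms by (subst lborel_integral_real_affine[of \<sigma> _ 0]) auto
  finally show ?thesis ..
qed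

text \<open>\<open>exp (- (\<epsilon> t)\<^sup>2 / 2)\<close> is a multiple of the normal density of deviation \<open>1 / \<epsilon>\<close>, whose characteristic
  function is known.\<close>

lemma gcut_fourier_1d:
  assumes "\<epsilon> > 0"
  shows "(LINT t|lborel. complex_of_real (exp (- (\<epsilon> * t)\<^sup>2 / 2)) * exp (\<i> * complex_of_real (x * t)))
    = complex_of_real (2 * pi * normal_density 0 \<epsilon> x)"
    and "integrable lborel (\<lambda>t. exp (- (\<epsilon> * t)\<^sup>2 / 2))"
proof -
  have eq: "exp (- (\<epsilon> * t)\<^sup>2 / 2) = (sqrt (2 * pi) / \<epsilon>) * normal_density 0 (1 / \<epsilon>) t" for t
    using assms by (simp add: normal_density_def power_mult_distrib power_divide real_sqrt_divide field_simps)
  have "(LINT t|lborel. complex_of_real (exp (- (\<epsilon> * t)\<^sup>2 / 2)) * exp (\<i> * complex_of_real (x * t)))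
    = complex_of_real (sqrt (2 * pi) / \<epsilon>) * (LINT t|lborel. complex_of_real (normal_density 0 (1 / \<epsilon>) t) * exp (\<i> * complex_of_real (x * t)))"
    unfolding eq of_real_mult mult.assoc by (rule integral_mult_right_zero)
  also have "\<dots> = complex_of_real ((sqrt (2 * pi) / \<epsilon>) * exp (- (x / \<epsilon>)\<^sup>2 / 2))"
    using normal_fourier_1d[of "1 / \<epsilon>" x] assms by simp
  also have "(sqrt (2 * pi) / \<epsilon>) * exp (- (x / \<epsilon>)\<^sup>2 / 2) = 2 * pi * normal_density 0 \<epsilon> x"
  proof -
    have "2 * pi = sqrt (2 * pi) * sqrt (2 * pi)" by simp
    then show ?thesis
      using assms by (simp add: normal_density_def real_sqrt_mult power_divide field_simps)
  qed
  finally show "(LINT t|lborel. complex_of_real (exp (- (\<epsilon> * t)\<^sup>2 / 2)) * exp (\<i> * complex_of_real (x * t)))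
    = complex_of_real (2 * pi * normal_density 0 \<epsilon> x)" .
  show "integrable lborel (\<lambda>t. exp (- (\<epsilon> * t)\<^sup>2 / 2))"
    unfolding eq by (intro integrable_mult_right integrable_normal_density) (use assms in simp)
qed

lemma gcut_measurable [measurable]: "gcut \<epsilon> \<in> borel_measurable borel"
  unfolding gcut_def[abs_def] by (intro borel_measurable_continuous_onI continuous_intros) auto

lemma gauss_measurable [measurable]: "gauss \<epsilon> \<in> borel_measurable (borel :: (real^'d::finite) measure)"
proof -
  have [measurable]: "(\<lambda>x::real^'d. x $ k) \<in> borel_measurable borel" for k
    by (intro borel_measurable_continuous_onI continuous_intros)
  show ?thesis unfolding gauss_def[abs_def] by measurable
qed

lemma gcut_integrable: "\<epsilon> > 0 \<Longrightarrow> integrable lborel (\<lambda>\<omega>. complex_of_real (gcut \<epsilon> \<omega>))"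
  unfolding gcut_def of_real_prod by (intro lborel_vec_prod integrable_of_real gcut_fourier_1d)

lemma gauss_integrable: "\<epsilon> > 0 \<Longrightarrow> integrable lborel (\<lambda>x. complex_of_real (gauss \<epsilon> x))"
  unfolding gauss_def of_real_prod by (intro lborel_vec_prod integrable_of_real integrable_normal_density)

lemma gauss_nonneg: "gauss \<epsilon> x \<ge> 0"
  unfolding gauss_def by (intro prod_nonneg) (auto simp: normal_density_nonneg)

lemma gcut_pos: "gcut \<epsilon> x > 0"
  unfolding gcut_def by (intro prod_pos) auto

lemma gcut_le_1: "gcut \<epsilon> x \<le> 1"
  unfolding gcut_def by (intro prod_le_1) auto

lemma gauss_integral: "(LINT x|lborel. gauss \<epsilon> x) = 1" if "\<epsilon> > 0"
proof -
  have "(LINT x|lborel. complex_of_real (gauss \<epsilon> x)) = 1"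
    unfolding gauss_def of_real_prod using that
    by (subst lborel_vec_prod(2)) (auto intro!: integrable_of_real)
  then show ?thesis using of_real_eq_1_iff[where 'a=complex] by simp
qed

lemma gcut_tendsto: "(\<lambda>n. gcut (1 / real (Suc n)) \<omega>) \<longlonglongrightarrow> 1"
proof -
  have "(\<lambda>n. gcut (1 / real (Suc n)) \<omega>) \<longlonglongrightarrow> (\<Prod>k\<in>UNIV. exp (- (0 * \<omega> $ k)\<^sup>2 / 2))"
    unfolding gcut_def by (intro tendsto_intros LIMSEQ_Suc lim_1_over_n) auto
  then show ?thesis by simp
qed

lemma exp_inner_prod: "exp (\<i> * complex_of_real ((x::real^'d::finite) \<bullet> y)) = (\<Prod>k\<in>UNIV. exp (\<i> * complex_of_real (x $ k * y $ k)))"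
  by (simp add: inner_vec_def sum_distrib_left exp_sum)

lemma fourier_gcut:
  fixes x :: "real^'d::finite"
  assumes e: "\<epsilon> > 0"
  shows "fourier (\<lambda>\<omega>. complex_of_real (gcut \<epsilon> \<omega>)) x = complex_of_real ((2 * pi) ^ CARD('d) * gauss \<epsilon> x)"
proof -
  have "fourier (\<lambda>\<omega>. complex_of_real (gcut \<epsilon> \<omega>)) x =
    (LINT \<omega>|lborel. (\<Prod>k\<in>UNIV. complex_of_real (exp (- (\<epsilon> * (\<omega>::real^'d) $ k)\<^sup>2 / 2)) * exp (\<i> * complex_of_real (x $ k * \<omega> $ k))))"
    unfolding fourier_def gcut_def exp_inner_prod of_real_prod prod.distrib ..
  also have "\<dots> = (\<Prod>k\<in>UNIV. LINT t|lborel. complex_of_real (exp (- (\<epsilon> * t)\<^sup>2 / 2)) * exp (\<i> * complex_of_real (x $ k * t)))"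
  proof (rule lborel_vec_prod(2))
    fix k
    show "integrable lborel (\<lambda>t. complex_of_real (exp (- (\<epsilon> * t)\<^sup>2 / 2)) * exp (\<i> * complex_of_real (x $ k * t)))"
      by (rule Bochner_Integration.integrable_bound[OF gcut_fourier_1d(2)[OF e]])
        (auto simp: norm_mult intro!: borel_measurable_continuous_onI continuous_intros)
  qed
  also have "\<dots> = (\<Prod>k\<in>UNIV. complex_of_real (2 * pi * normal_density 0 \<epsilon> (x $ k)))"
    by (simp only: gcut_fourier_1d(1)[OF e])
  also have "\<dots> = complex_of_real ((2 * pi) ^ CARD('d) * gauss \<epsilon> x)"
    by (simp add: gauss_def prod.distrib)
  finally show ?thesis .
qed

lemma gauss_scaled: "\<epsilon> > 0 \<Longrightarrow> \<epsilon> ^ CARD('d) * gauss \<epsilon> (\<epsilon> *\<^sub>R (s::real^'d::finite)) = gauss 1 s"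
  by (simp add: gauss_def flip: normal_density_scaled[of \<epsilon>]) (simp add: prod.distrib)

text \<open>After rescaling, the kernel is the fixed density \<open>gauss 1\<close> and the limit passes inside \<open>f\<close>.\<close>

lemma gauss_approx_identity:
  fixes f :: "'d::finite tfun"
  assumes cont: "continuous_on UNIV f" and b: "\<And>x. norm (f x) \<le> B"
  shows "(\<lambda>n. LINT y|lborel. f y * complex_of_real (gauss (1 / real (Suc n)) (y - x))) \<longlonglongrightarrow> f x"
proof -
  have [measurable]: "f \<in> borel_measurable borel" by (rule borel_measurable_continuous_onI[OF cont])
  have eq: "(LINT y|lborel. f y * complex_of_real (gauss (1 / real (Suc n)) (y - x)))
    = (LINT s|lborel. f (x + (1 / real (Suc n)) *\<^sub>R s) * complex_of_real (gauss 1 s))" for n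
  proof -
    let ?e = "1 / real (Suc n)"
    have "(LINT y|lborel. f y * complex_of_real (gauss ?e (y - x)))
      = \<bar>?e\<bar> ^ CARD('d) *\<^sub>R (LINT s|lborel. f (x + ?e *\<^sub>R s) * complex_of_real (gauss ?e ((x + ?e *\<^sub>R s) - x)))"
      by (subst lborel_integral_affine[of _ ?e x]) (auto simp: DIM_cart)
    also have "\<dots> = (LINT s|lborel. ?e ^ CARD('d) *\<^sub>R (f (x + ?e *\<^sub>R s) * complex_of_real (gauss ?e (?e *\<^sub>R s))))"
      by simp
    also have "\<dots> = (LINT s|lborel. f (x + ?e *\<^sub>R s) * complex_of_real (gauss 1 s))"
      by (intro Bochner_Integration.integral_cong refl)
        (simp only: scaleR_conv_of_real gauss_scaled[of ?e, symmetric] zero_less_divide_1_iff of_nat_0_less_iff zero_less_Suc of_real_mult of_real_power mult_ac)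
    finally show ?thesis .
  qed
  have "(\<lambda>n. LINT s|lborel. f (x + (1 / real (Suc n)) *\<^sub>R s) * complex_of_real (gauss 1 s)) \<longlonglongrightarrow>
    (LINT s|lborel. f x * complex_of_real (gauss 1 (s::real^'d)))"
  proof (rule integral_dominated_convergence)
    show "integrable lborel (\<lambda>s::real^'d. B * gauss 1 s)"
      using integrable_norm[OF gauss_integrable[of 1, where 'a='d]] by (simp add: gauss_nonneg)
    show "AE s in lborel. (\<lambda>n. f (x + (1 / real (Suc n)) *\<^sub>R s) * complex_of_real (gauss 1 s)) \<longlonglongrightarrow> f x * complex_of_real (gauss 1 s)"
    proof (rule AE_I2)
      fix s :: "real^'d"
      have "(\<lambda>n. x + (1 / real (Suc n)) *\<^sub>R s) \<longlonglongrightarrow> x + 0 *\<^sub>R s"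
        by (intro tendsto_intros LIMSEQ_Suc lim_1_over_n)
      then have "(\<lambda>n. f (x + (1 / real (Suc n)) *\<^sub>R s)) \<longlonglongrightarrow> f x"
        using continuous_on_tendsto_compose[OF cont, of "\<lambda>n. x + (1 / real (Suc n)) *\<^sub>R s" x sequentially] by simp
      then show "(\<lambda>n. f (x + (1 / real (Suc n)) *\<^sub>R s) * complex_of_real (gauss 1 s)) \<longlonglongrightarrow> f x * complex_of_real (gauss 1 s)"
        by (intro tendsto_intros)
    qed
    show "AE s in lborel. norm (f (x + (1 / real (Suc n)) *\<^sub>R s) * complex_of_real (gauss 1 s)) \<le> B * gauss 1 s" for n
      using b by (auto simp: norm_mult gauss_nonneg intro!: mult_right_mono)
  qed auto
  moreover have "(LINT s|lborel. f x * complex_of_real (gauss 1 (s::real^'d))) = f x"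
    using gauss_integral[of 1, where 'a='d] by simp
  ultimately show ?thesis unfolding eq by (simp only:)
qed

lemma fourier_modulated_gcut:
  fixes x y :: "real^'d::finite"
  assumes "\<epsilon> > 0"
  shows "fourier (\<lambda>\<omega>. exp (- \<i> * complex_of_real (\<omega> \<bullet> x)) * complex_of_real (gcut \<epsilon> \<omega>)) y
    = complex_of_real ((2 * pi) ^ CARD('d) * gauss \<epsilon> (y - x))"
proof -
  have "fourier (\<lambda>\<omega>. exp (- \<i> * complex_of_real (\<omega> \<bullet> x)) * complex_of_real (gcut \<epsilon> \<omega>)) y
     = fourier (\<lambda>\<omega>. complex_of_real (gcut \<epsilon> \<omega>)) (y - x)"
  proof -
    have "exp (- \<i> * complex_of_real (\<omega> \<bullet> x)) * exp (\<i> * complex_of_real (y \<bullet> \<omega>)) = exp (\<i> * complex_of_real ((y - x) \<bullet> \<omega>))" for \<omega>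
      by (simp add: mult_exp_exp inner_diff_left inner_commute[of \<omega> x] algebra_simps)
    then show ?thesis
      unfolding fourier_def by (intro Bochner_Integration.integral_cong refl) (simp add: mult_ac)
  qed
  then show ?thesis using fourier_gcut[OF assms] by simp
qed

lemma modulated_gcut_integrable:
  assumes "\<epsilon> > 0"
  shows "integrable lborel (\<lambda>\<omega>::real^'d::finite. exp (- \<i> * complex_of_real (\<omega> \<bullet> x)) * complex_of_real (gcut \<epsilon> \<omega>))"
  using fourier_integrable[OF gcut_integrable[OF assms], of "- x"]
  by (simp add: mult.commute inner_commute)

text \<open>Gaussian summation: with the cutoff inserted, the inner and outer integrals may be exchanged, and
  the transform of the modulated cutoff is \<open>(2 \<pi>)\<^sup>d\<close> times a Gaussian kernel centred at \<open>x\<close>.\<close>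

theorem inv_fourier_fourier:
  fixes f :: "'d::finite tfun"
  assumes f: "f \<in> schwartz"
  shows "inv_fourier (fourier f) = f"
proof
  fix x
  let ?c = "complex_of_real ((2 * pi) ^ CARD('d))"
  let ?e = "\<lambda>n. 1 / real (Suc n)"
  have F: "fourier f \<in> schwartz" by (rule schwartz_fourier[OF f])
  have [measurable]: "fourier f \<in> borel_measurable borel" by (rule smooth_measurable[OF schwartz_smooth[OF F]])
  have eq: "(LINT \<omega>|lborel. fourier f \<omega> * (exp (- \<i> * complex_of_real (\<omega> \<bullet> x)) * complex_of_real (gcut (?e n) \<omega>)))
    = ?c * (LINT y|lborel. f y * complex_of_real (gauss (?e n) (y - x)))" for n
  proof -
    have e: "?e n > 0" by simp
    show ?thesis
      unfolding fourier_swap[OF schwartz_integrable[OF f] modulated_gcut_integrable[OF e]] fourier_modulated_gcut[OF e]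
        integral_mult_right_zero[symmetric]
      by (intro Bochner_Integration.integral_cong refl) (simp only: of_real_mult mult_ac)
  qed
  have "(\<lambda>n. LINT \<omega>|lborel. fourier f \<omega> * (exp (- \<i> * complex_of_real (\<omega> \<bullet> x)) * complex_of_real (gcut (?e n) \<omega>)))
    \<longlonglongrightarrow> (LINT \<omega>|lborel. fourier f \<omega> * exp (- \<i> * complex_of_real (\<omega> \<bullet> x)))"
  proof (rule integral_dominated_convergence)
    have [measurable]: "(\<lambda>\<omega>. exp (- \<i> * complex_of_real (\<omega> \<bullet> x))) \<in> borel_measurable borel"
      by (intro borel_measurable_continuous_onI continuous_intros)
    show "(\<lambda>\<omega>. fourier f \<omega> * exp (- \<i> * complex_of_real (\<omega> \<bullet> x))) \<in> borel_measurable lborel"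
      "(\<lambda>\<omega>. fourier f \<omega> * (exp (- \<i> * complex_of_real (\<omega> \<bullet> x)) * complex_of_real (gcut (?e n) \<omega>))) \<in> borel_measurable lborel" for n
      by measurable
    show "integrable lborel (\<lambda>\<omega>. norm (fourier f \<omega>))"
      by (intro integrable_norm schwartz_integrable F)
    show "AE \<omega> in lborel. (\<lambda>n. fourier f \<omega> * (exp (- \<i> * complex_of_real (\<omega> \<bullet> x)) * complex_of_real (gcut (?e n) \<omega>)))
      \<longlonglongrightarrow> fourier f \<omega> * exp (- \<i> * complex_of_real (\<omega> \<bullet> x))"
    proof (rule AE_I2)
      fix \<omega>
      have "(\<lambda>n. fourier f \<omega> * (exp (- \<i> * complex_of_real (\<omega> \<bullet> x)) * complex_of_real (gcut (?e n) \<omega>)))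
        \<longlonglongrightarrow> fourier f \<omega> * (exp (- \<i> * complex_of_real (\<omega> \<bullet> x)) * complex_of_real 1)"
        by (intro tendsto_intros gcut_tendsto)
      then show "(\<lambda>n. fourier f \<omega> * (exp (- \<i> * complex_of_real (\<omega> \<bullet> x)) * complex_of_real (gcut (?e n) \<omega>)))
        \<longlonglongrightarrow> fourier f \<omega> * exp (- \<i> * complex_of_real (\<omega> \<bullet> x))" by simp
    qed
    show "AE \<omega> in lborel. norm (fourier f \<omega> * (exp (- \<i> * complex_of_real (\<omega> \<bullet> x)) * complex_of_real (gcut (?e n) \<omega>))) \<le> norm (fourier f \<omega>)" for n
    proof (rule AE_I2)
      fix \<omega>
      have "norm (exp (- \<i> * complex_of_real (\<omega> \<bullet> x))) = 1"
        using norm_exp_i_times[of "- (\<omega> \<bullet> x)"] by simp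
      moreover have "norm (fourier f \<omega>) * gcut (?e n) \<omega> \<le> norm (fourier f \<omega>) * 1"
        by (intro mult_left_mono gcut_le_1) auto
      ultimately show "norm (fourier f \<omega> * (exp (- \<i> * complex_of_real (\<omega> \<bullet> x)) * complex_of_real (gcut (?e n) \<omega>))) \<le> norm (fourier f \<omega>)"
        using gcut_pos[of "?e n" \<omega>] by (simp add: norm_mult)
    qed
  qed
  moreover have "(\<lambda>n. LINT \<omega>|lborel. fourier f \<omega> * (exp (- \<i> * complex_of_real (\<omega> \<bullet> x)) * complex_of_real (gcut (?e n) \<omega>)))
    \<longlonglongrightarrow> ?c * f x"
    unfolding eq
  proof (intro tendsto_intros gauss_approx_identity)
    show "continuous_on UNIV f" by (intro smooth_continuous schwartz_smooth f)
    show "norm (f x) \<le> schwartz_seminorm 0 f" for x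
      using schwartz_bound0[OF f, of 0 0 x] by simp
  qed
  ultimately have "(LINT \<omega>|lborel. fourier f \<omega> * exp (- \<i> * complex_of_real (\<omega> \<bullet> x))) = ?c * f x"
    by (rule LIMSEQ_unique)
  then show "inv_fourier (fourier f) x = f x"
    by (simp add: inv_fourier_def)
qed

text \<open>The two transforms differ by a factor and a reflection, which commutes with both.\<close>

theorem fourier_inv_fourier:
  fixes f :: "'d::finite tfun"
  assumes f: "f \<in> schwartz"
  shows "fourier (inv_fourier f) = f"
proof
  fix x
  have F: "fourier f \<in> schwartz" by (rule schwartz_fourier[OF f])
  have [measurable]: "fourier f \<in> borel_measurable borel" by (rule smooth_measurable[OF schwartz_smooth[OF F]])
  let ?c = "complex_of_real (1 / (2 * pi) ^ CARD('d))"
  have "inv_fourier (fourier f) x = ?c * (LINT \<omega>|lborel. fourier f \<omega> * exp (- \<i> * complex_of_real (\<omega> \<bullet> x)))"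
    by (simp add: inv_fourier_def)
  also have "(LINT \<omega>|lborel. fourier f \<omega> * exp (- \<i> * complex_of_real (\<omega> \<bullet> x)))
    = (LINT \<omega>|lborel. fourier f (0 + (-1) *\<^sub>R \<omega>) * exp (- \<i> * complex_of_real ((0 + (-1) *\<^sub>R \<omega>) \<bullet> x)))"
  proof (subst lborel_integral_affine[of _ "-1" 0])
    have [measurable]: "(\<lambda>\<omega>. exp (- \<i> * complex_of_real (\<omega> \<bullet> x))) \<in> borel_measurable borel"
      by (intro borel_measurable_continuous_onI continuous_intros)
    show "(\<lambda>\<omega>. fourier f \<omega> * exp (- \<i> * complex_of_real (\<omega> \<bullet> x))) \<in> borel_measurable borel" by measurable
  qed auto
  also have "?c * \<dots> = fourier (inv_fourier f) x"
    by (simp add: inv_fourier_eq fourier_def inner_commute mult.assoc)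
  finally show "fourier (inv_fourier f) x = f x" using inv_fourier_fourier[OF f] by simp
qed

section \<open>Tempered distributions\<close>

lemma tempered_add_eq:
  assumes "tempered T" "f \<in> schwartz" "g \<in> schwartz"
  shows "T (\<lambda>x. f x + g x) = T f + T g"
  using bspec[OF bspec[OF assms(1)[unfolded tempered_def, THEN conjunct1] assms(2)] assms(3)] .

lemma tempered_cmult_eq:
  assumes "tempered T" "f \<in> schwartz"
  shows "T (\<lambda>x. c * f x) = c * T f"
  using spec[OF bspec[OF assms(1)[unfolded tempered_def, THEN conjunct2, THEN conjunct1] assms(2)], of c] .

lemma tempered_diff_eq:
  assumes "tempered T" "f \<in> schwartz" "g \<in> schwartz"
  shows "T (\<lambda>x. f x - g x) = T f - T g"
proof -
  have "(\<lambda>x. f x - g x) = (\<lambda>x. f x + (- 1) * g x)" by simp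
  then have "T (\<lambda>x. f x - g x) = T f + (- 1) * T g"
    by (simp only: tempered_add_eq[OF assms(1,2) schwartz_cmult[OF assms(3)]] tempered_cmult_eq[OF assms(1,3)])
  then show ?thesis by simp
qed

lemma tempered_zero_eq: "tempered T \<Longrightarrow> T (\<lambda>x. 0) = 0"
  using tempered_cmult_eq[of T "\<lambda>x. 0" 0] by simp

lemma tempered_sum_eq:
  assumes "tempered T" "\<And>i. i \<in> I \<Longrightarrow> f i \<in> schwartz"
  shows "T (\<lambda>x. \<Sum>i\<in>I. f i x) = (\<Sum>i\<in>I. T (f i))"
  using assms(2) by (induction I rule: infinite_finite_induct)
    (simp_all add: tempered_zero_eq[OF assms(1)] tempered_add_eq[OF assms(1)] schwartz_sum)

lemma tempered_bound:
  assumes "tempered (T :: 'd::finite tdist)"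
  obtains C N where "C \<ge> 0" "\<And>f. f \<in> schwartz \<Longrightarrow> norm (T f) \<le> C * schwartz_seminorm N f"
proof -
  obtain C N where C: "\<And>f. f \<in> schwartz \<Longrightarrow> norm (T f) \<le> C * schwartz_seminorm N f"
    using assms unfolding tempered_def by blast
  have "norm (T f) \<le> \<bar>C\<bar> * schwartz_seminorm N f" if "f \<in> schwartz" for f
    using C[OF that] by (rule order_trans) (intro mult_right_mono schwartz_seminorm_nonneg that abs_ge_self)
  then show thesis by (intro that[of "\<bar>C\<bar>" N]) auto
qed

text \<open>All operations on distributions below are adjoints of operations on Schwartz functions; this is the
  common proof that they preserve temperedness.\<close>

lemma tempered_compose:
  fixes T :: "'d::finite tdist"
  assumes T: "tempered T" and A: "\<And>f. f \<in> schwartz \<Longrightarrow> A f \<in> schwartz"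
    and add: "\<And>f g. f \<in> schwartz \<Longrightarrow> g \<in> schwartz \<Longrightarrow> A (\<lambda>x. f x + g x) = (\<lambda>x. A f x + A g x)"
    and mult: "\<And>f c. f \<in> schwartz \<Longrightarrow> A (\<lambda>x. c * f x) = (\<lambda>x. c * A f x)"
    and bound: "\<And>N. \<exists>C M. C \<ge> 0 \<and> (\<forall>f\<in>schwartz. schwartz_seminorm N (A f) \<le> C * schwartz_seminorm M f)"
  shows "tempered (\<lambda>\<phi>. T (A \<phi>))"
proof -
  obtain D N where D: "D \<ge> 0" "\<And>f. f \<in> schwartz \<Longrightarrow> norm (T f) \<le> D * schwartz_seminorm N f"
    using tempered_bound[OF T] by blast
  obtain C M where C: "C \<ge> 0" "\<And>f. f \<in> schwartz \<Longrightarrow> schwartz_seminorm N (A f) \<le> C * schwartz_seminorm M f"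
    using bound[of N] by blast
  have "norm (T (A f)) \<le> (D * C) * schwartz_seminorm M f" if f: "f \<in> schwartz" for f
  proof -
    have "norm (T (A f)) \<le> D * schwartz_seminorm N (A f)" by (rule D(2)[OF A[OF f]])
    also have "\<dots> \<le> D * (C * schwartz_seminorm M f)" by (intro mult_left_mono C D f)
    finally show ?thesis by simp
  qed
  then show ?thesis
    unfolding tempered_def using T A by (auto simp: add mult tempered_add_eq tempered_cmult_eq)
qed

lemma tempered_dist_fourier: "tempered (T :: 'd::finite tdist) \<Longrightarrow> tempered (dist_fourier T)"
  unfolding dist_fourier_def
proof (rule tempered_compose[where A = fourier])
  show "\<exists>C M. C \<ge> 0 \<and> (\<forall>f\<in>schwartz. schwartz_seminorm N (fourier (f::'d tfun)) \<le> C * schwartz_seminorm M f)" for N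
    by (rule fourier_seminorm[of N]) blast
qed (auto simp: schwartz_fourier fourier_add fourier_cmult schwartz_integrable)

lemma inv_fourier_add:
  assumes "(f :: 'd::finite tfun) \<in> schwartz" "g \<in> schwartz"
  shows "inv_fourier (\<lambda>x. f x + g x) = (\<lambda>x. inv_fourier f x + inv_fourier g x)"
  using assms by (simp add: inv_fourier_eq fourier_add schwartz_integrable distrib_left)

lemma inv_fourier_cmult:
  "inv_fourier (\<lambda>x. c * f x) = (\<lambda>x. c * inv_fourier (f :: 'd::finite tfun) x)"
  by (simp add: inv_fourier_eq fourier_cmult mult.left_commute)

lemma tempered_dist_inv_fourier: "tempered (T :: 'd::finite tdist) \<Longrightarrow> tempered (dist_inv_fourier T)"
  unfolding dist_inv_fourier_def
proof (rule tempered_compose[where A = inv_fourier])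
  show "\<exists>C M. C \<ge> 0 \<and> (\<forall>f\<in>schwartz. schwartz_seminorm N (inv_fourier (f::'d tfun)) \<le> C * schwartz_seminorm M f)" for N
    by (rule inv_fourier_seminorm[of N]) blast
qed (auto simp: schwartz_inv_fourier inv_fourier_add inv_fourier_cmult)

definition fun_times :: "'d tfun \<Rightarrow> 'd tdist \<Rightarrow> 'd tdist" where
  "fun_times w T = (\<lambda>\<phi>. T (\<lambda>x. w x * \<phi> x))"

lemma slow_mult_schwartz: "slow w \<Longrightarrow> f \<in> schwartz \<Longrightarrow> (\<lambda>x. w x * f x) \<in> schwartz"
  using slow_family_mult_schwartz[of "\<lambda>_::unit. w"] .

lemma tempered_fun_times:
  assumes "slow (w :: 'd::finite tfun)" "tempered T"
  shows "tempered (fun_times w T)"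
  unfolding fun_times_def
proof (rule tempered_compose[OF assms(2)])
  show "\<exists>C M. C \<ge> 0 \<and> (\<forall>f\<in>schwartz. schwartz_seminorm N (\<lambda>x. w x * f x) \<le> C * schwartz_seminorm M f)" for N
    by (rule slow_family_mult_seminorm[OF assms(1), of N]) blast
qed (auto simp: slow_mult_schwartz assms distrib_left mult.left_commute)

lemma tempered_add:
  fixes S T :: "'d::finite tdist"
  assumes S: "tempered S" and T: "tempered T"
  shows "tempered (\<lambda>\<phi>. S \<phi> + T \<phi>)"
proof -
  obtain C N where C: "C \<ge> 0" "\<And>f. f \<in> schwartz \<Longrightarrow> norm (S f) \<le> C * schwartz_seminorm N f"
    using tempered_bound[OF S] by blast
  obtain D M where D: "D \<ge> 0" "\<And>f. f \<in> schwartz \<Longrightarrow> norm (T f) \<le> D * schwartz_seminorm M f"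
    using tempered_bound[OF T] by blast
  have "norm (S f + T f) \<le> (C + D) * schwartz_seminorm (max N M) f" if f: "f \<in> schwartz" for f
  proof -
    have "norm (S f + T f) \<le> C * schwartz_seminorm N f + D * schwartz_seminorm M f"
      by (intro norm_triangle_le add_mono C D f)
    also have "\<dots> \<le> C * schwartz_seminorm (max N M) f + D * schwartz_seminorm (max N M) f"
      by (intro add_mono mult_left_mono schwartz_seminorm_mono C D f) auto
    finally show ?thesis by (simp add: distrib_right)
  qed
  then have "\<exists>C N. \<forall>f\<in>schwartz. norm (S f + T f) \<le> C * schwartz_seminorm N f" by blast
  then show ?thesis
    unfolding tempered_def
    by (simp add: tempered_add_eq[OF S] tempered_add_eq[OF T] tempered_cmult_eq[OF S] tempered_cmult_eq[OF T] distrib_left)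
qed

lemma tempered_zero: "tempered (\<lambda>\<phi>. 0)"
  unfolding tempered_def by (auto intro: exI[of _ 0])

lemma tempered_cmult:
  fixes T :: "'d::finite tdist"
  assumes T: "tempered T" shows "tempered (\<lambda>\<phi>. c * T \<phi>)"
proof -
  have "tempered (fun_times (\<lambda>x. c) T)" by (rule tempered_fun_times[OF slow_const T])
  moreover have "tempered (\<lambda>\<phi>. c * T \<phi>) \<longleftrightarrow> tempered (fun_times (\<lambda>x. c) T)"
    unfolding tempered_def fun_times_def
    by (intro arg_cong2[of _ _ _ _ "(\<and>)"] ball_cong refl arg_cong[of _ _ All] ext arg_cong[of _ _ Ex])
      (auto simp: tempered_cmult_eq[OF T] schwartz_add schwartz_cmult)
  ultimately show ?thesis by simp
qed

lemma tempered_diff: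
  fixes S T :: "'d::finite tdist"
  shows "tempered S \<Longrightarrow> tempered T \<Longrightarrow> tempered (\<lambda>\<phi>. S \<phi> - T \<phi>)"
  using tempered_add[of S "\<lambda>\<phi>. -1 * T \<phi>"] tempered_cmult[of T "-1"] by simp

lemma tempered_sum:
  fixes T :: "'i \<Rightarrow> 'd::finite tdist"
  shows "(\<And>i. i \<in> I \<Longrightarrow> tempered (T i)) \<Longrightarrow> tempered (\<lambda>\<phi>. \<Sum>i\<in>I. T i \<phi>)"
  by (induction I rule: infinite_finite_induct) (auto intro: tempered_zero tempered_add)

lemma tempered_fun_dist:
  fixes w :: "'d::finite tfun"
  assumes w: "tempered_fun w"
  shows "tempered (fun_dist w)"
proof -
  obtain C M where C: "C \<ge> 0" "\<And>f. f \<in> schwartz \<Longrightarrow> integrable lborel (\<lambda>x. w x * f x)"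
    "\<And>f. f \<in> schwartz \<Longrightarrow> (LINT x|lborel. norm (w x * f x)) \<le> C * schwartz_seminorm M f"
    using tempered_fun_schwartz_bound[OF w] by blast
  have "norm (fun_dist w f) \<le> C * schwartz_seminorm M f" if "f \<in> schwartz" for f
    unfolding fun_dist_def by (rule order_trans[OF integral_norm_bound C(3)[OF that]])
  moreover have "fun_dist w (\<lambda>x. f x + g x) = fun_dist w f + fun_dist w g" if "f \<in> schwartz" "g \<in> schwartz" for f g
    unfolding fun_dist_def distrib_left by (intro Bochner_Integration.integral_add C that)
  moreover have "fun_dist w (\<lambda>x. c * f x) = c * fun_dist w f" for f c
    unfolding fun_dist_def by (subst integral_mult_right_zero[symmetric]) (simp add: mult_ac)
  ultimately show ?thesis unfolding tempered_def by blast
qed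

subsection \<open>Regularization\<close>

text \<open>Partial derivatives commute because their Fourier transforms agree.\<close>

lemma pdiff_commute:
  assumes f: "(f :: 'd::finite tfun) \<in> schwartz"
  shows "pdiff k (pdiff l f) = pdiff l (pdiff k f)"
proof -
  have "fourier (pdiff k (pdiff l f)) = fourier (pdiff l (pdiff k f))"
    using f by (auto simp: fourier_pdiff schwartz_pdiff)
  then have "inv_fourier (fourier (pdiff k (pdiff l f))) = inv_fourier (fourier (pdiff l (pdiff k f)))"
    by simp
  then show ?thesis using f by (simp add: inv_fourier_fourier schwartz_pdiff)
qed

lemma pdiffs_pdiff_commute:
  "(f :: 'd::finite tfun) \<in> schwartz \<Longrightarrow> pdiffs ks (pdiff k f) = pdiff k (pdiffs ks f)"
  by (induction ks) (auto simp: pdiff_commute schwartz_pdiffs)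

lemma pdiffs_sum:
  "(\<And>i. i \<in> I \<Longrightarrow> smooth (f i)) \<Longrightarrow> pdiffs ks (\<lambda>x. \<Sum>i\<in>I. f i x) = (\<lambda>x. \<Sum>i\<in>I. pdiffs ks (f i) x)"
proof (induction I rule: infinite_finite_induct)
  case (insert i I)
  then show ?case by (simp add: pdiffs_add smooth_sum)
qed (use pdiffs_cmult[OF smooth_const, of ks 0] in auto)

lemma pdiffs_diff:
  assumes "smooth f" "smooth g"
  shows "pdiffs ks (\<lambda>x. f x - g x) = (\<lambda>x. pdiffs ks f x - pdiffs ks g x)"
  using pdiffs_add[OF assms(1) smooth_mult[OF smooth_const[of "-1"] assms(2)], of ks]
    pdiffs_cmult[OF assms(2), of ks "-1"] by simp

text \<open>The factor \<open>1\<close> in front of \<open>z\<close> gives the translate the shape of an affine substitution.\<close>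

definition taylor_rest :: "'d::finite tfun \<Rightarrow> real^'d \<Rightarrow> 'd tfun" where
  "taylor_rest f h = (\<lambda>z. f (h + 1 *\<^sub>R z) - f z - (\<Sum>k\<in>UNIV. complex_of_real (h $ k) * pdiff k f z))"

lemma schwartz_taylor_rest: "(f :: 'd::finite tfun) \<in> schwartz \<Longrightarrow> taylor_rest f h \<in> schwartz"
  unfolding taylor_rest_def
  by (intro schwartz_diff schwartz_sum schwartz_cmult schwartz_pdiff schwartz_affine(1)) auto

text \<open>Because derivatives commute, the derivatives of the remainder are the remainders of the derivatives.\<close>

lemma taylor_rest_seminorm:
  fixes f :: "'d::finite tfun"
  assumes f: "f \<in> schwartz"
  obtains C where "C \<ge> 0" "\<And>h. norm h \<le> 1 \<Longrightarrow> schwartz_seminorm N (taylor_rest f h) \<le> C * (norm h)\<^sup>2"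
proof -
  have "\<exists>C\<ge>0. \<forall>x h. norm h \<le> 1 \<longrightarrow> (1 + norm x) ^ N * norm (pdiffs ks (taylor_rest f h) x) \<le> C * (norm h)\<^sup>2" for ks
  proof -
    obtain C where C: "C \<ge> 0" "\<And>x h. norm h \<le> 1 \<Longrightarrow>
      (1 + norm x) ^ N * norm (pdiffs ks f (x + h) - pdiffs ks f x - (\<Sum>k\<in>UNIV. h $ k *\<^sub>R pdiff k (pdiffs ks f) x)) \<le> C * (norm h)\<^sup>2"
      using taylor_weighted[OF schwartz_pdiffs[OF f, of ks], of N] by blast
    have sf: "smooth f" "\<And>k. smooth (pdiff k f)" using f by (auto simp: schwartz_smooth smooth_pdiff)
    have "pdiffs ks (taylor_rest f h) x = pdiffs ks f (x + h) - pdiffs ks f x - (\<Sum>k\<in>UNIV. h $ k *\<^sub>R pdiff k (pdiffs ks f) x)" for h x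
    proof -
      have "pdiffs ks (taylor_rest f h) = (\<lambda>x. pdiffs ks (\<lambda>z. f (h + 1 *\<^sub>R z)) x - pdiffs ks f x
           - (\<Sum>k\<in>UNIV. pdiffs ks (\<lambda>z. complex_of_real (h $ k) * pdiff k f z) x))"
      proof -
        have a: "smooth (\<lambda>z. f (h + 1 *\<^sub>R z))" by (rule smooth_affine[OF sf(1)])
        have b: "smooth (\<lambda>z. complex_of_real (h $ k) * pdiff k f z)" for k
          by (rule smooth_mult[OF smooth_const sf(2)])
        have c: "smooth (\<lambda>z. f (h + 1 *\<^sub>R z) - f z)"
          using smooth_add[OF a smooth_mult[OF smooth_const[of "-1"] sf(1)]] by simp
        show ?thesis
          unfolding taylor_rest_def pdiffs_diff[OF c smooth_sum[OF b]] pdiffs_diff[OF a sf(1)] pdiffs_sum[OF b] ..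
      qed
      then show ?thesis
        using sf pdiffs_affine[OF sf(1), of ks h 1]
        by (simp add: pdiffs_cmult pdiffs_pdiff_commute[OF f] scaleR_conv_of_real add.commute)
    qed
    with C show ?thesis by (intro exI[of _ C]) auto
  qed
  then obtain C where C: "\<And>ks. C ks \<ge> 0" "\<And>ks x h. norm h \<le> 1 \<Longrightarrow> (1 + norm x) ^ N * norm (pdiffs ks (taylor_rest f h) x) \<le> C ks * (norm h)\<^sup>2"
    by metis
  define C' where "C' = (\<Sum>ks | length (ks :: 'd list) \<le> N. C ks)"
  have "schwartz_seminorm N (taylor_rest f h) \<le> C' * (norm h)\<^sup>2" if h: "norm h \<le> 1" for h
  proof (rule schwartz_seminorm_least)
    fix ks :: "'d list" and x assume ks: "length ks \<le> N"
    have "(1 + norm x) ^ N * norm (pdiffs ks (taylor_rest f h) x) \<le> C ks * (norm h)\<^sup>2" by (rule C(2)[OF h])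
    also have "\<dots> \<le> C' * (norm h)\<^sup>2"
      unfolding C'_def using ks C(1) by (intro mult_right_mono member_le_sum finite_lists_le) auto
    finally show "(1 + norm x) ^ N * norm (pdiffs ks (taylor_rest f h) x) \<le> C' * (norm h)\<^sup>2" .
  qed
  moreover have "C' \<ge> 0" unfolding C'_def using C(1) by (simp add: sum_nonneg)
  ultimately show thesis using that by blast
qed

text \<open>A tempered distribution is bounded by a seminorm, and the Taylor remainder of \<open>f\<close> is quadratically small in
  every seminorm; reflecting and translating it to \<open>x\<close> costs only the factor \<open>(1 + \<bar>x\<bar>)\<^sup>N\<close>.\<close>

lemma mollify_has_pdiff:
  fixes S :: "'d::finite tdist"
  assumes S: "tempered S" and f: "f \<in> schwartz"
  shows "pdiff k (mollify S f) = mollify S (pdiff k f)" "mollify S f differentiable (at x)"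
proof -
  obtain C N where C: "C \<ge> 0" "\<And>g. g \<in> schwartz \<Longrightarrow> norm (S g) \<le> C * schwartz_seminorm N g"
    using tempered_bound[OF S] by blast
  obtain D where D: "D \<ge> 0" "\<And>h. norm h \<le> 1 \<Longrightarrow> schwartz_seminorm N (taylor_rest f h) \<le> D * (norm h)\<^sup>2"
    using taylor_rest_seminorm[OF f] by blast
  have *: "norm (mollify S f (x + h) - mollify S f x - (\<Sum>k\<in>UNIV. h $ k *\<^sub>R mollify S (pdiff k f) x))
     \<le> (C * ((1 + norm x) ^ N * D)) * (norm h)\<^sup>2" if h: "norm h \<le> 1" for x h
  proof -
    have s: "(\<lambda>y. f (x + h - y)) \<in> schwartz" "(\<lambda>y. f (x - y)) \<in> schwartz" "\<And>k. (\<lambda>y. pdiff k f (x - y)) \<in> schwartz"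
      using f by (auto intro!: schwartz_reflect_translate schwartz_pdiff)
    have "mollify S f (x + h) - mollify S f x - (\<Sum>k\<in>UNIV. h $ k *\<^sub>R mollify S (pdiff k f) x)
      = S (\<lambda>y. f (x + h - y) - f (x - y) - (\<Sum>k\<in>UNIV. complex_of_real (h $ k) * pdiff k f (x - y)))"
      unfolding mollify_def
      by (simp add: tempered_diff_eq[OF S] tempered_sum_eq[OF S] tempered_cmult_eq[OF S] s schwartz_diff schwartz_cmult schwartz_sum scaleR_conv_of_real)
    also have "\<dots> = S (\<lambda>y. taylor_rest f h (x + (-1) *\<^sub>R y))"
      by (simp add: taylor_rest_def algebra_simps)
    also have "norm \<dots> \<le> C * schwartz_seminorm N (\<lambda>y. taylor_rest f h (x + (-1) *\<^sub>R y))"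
      by (intro C schwartz_affine schwartz_taylor_rest f) simp
    also have "\<dots> \<le> C * ((1 + norm x) ^ N * schwartz_seminorm N (taylor_rest f h))"
      by (intro mult_left_mono C schwartz_affine schwartz_taylor_rest f) simp
    also have "\<dots> \<le> C * ((1 + norm x) ^ N * (D * (norm h)\<^sup>2))"
      by (intro mult_left_mono C D h) auto
    finally show ?thesis by (simp add: mult_ac)
  qed
  show "pdiff k (mollify S f) = mollify S (pdiff k f)"
    by (rule ext, rule pdiff_quadratic_remainder(1)[where g = "\<lambda>k. mollify S (pdiff k f) _", OF *])
  show "mollify S f differentiable (at x)"
    by (rule pdiff_quadratic_remainder(2)[where g = "\<lambda>k. mollify S (pdiff k f) _", OF *])
qed

lemma smooth_mollify:
  fixes S :: "'d::finite tdist"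
  assumes "tempered S" "f \<in> schwartz"
  shows "smooth (mollify S f)"
proof -
  have "\<exists>g\<in>schwartz. mollify S f = mollify S g" using assms by blast
  then show ?thesis
    by (rule smooth_coinduct[where P = "\<lambda>f. \<exists>g\<in>schwartz. f = mollify S g"])
      (auto simp: diff_on_UNIV mollify_has_pdiff[OF assms(1)] intro: schwartz_pdiff)
qed

lemma mollify_add:
  assumes "tempered S" "f \<in> schwartz" "g \<in> schwartz"
  shows "mollify S (\<lambda>x. f x + g x) = (\<lambda>x. mollify S f x + mollify S g x)"
  unfolding mollify_def
  by (simp add: tempered_add_eq[OF assms(1)] schwartz_reflect_translate[OF assms(2)] schwartz_reflect_translate[OF assms(3)])

lemma mollify_cmult:
  assumes "tempered S" "f \<in> schwartz"
  shows "mollify S (\<lambda>x. c * f x) = (\<lambda>x. c * mollify S f x)"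
  unfolding mollify_def by (simp add: tempered_cmult_eq[OF assms(1)] schwartz_reflect_translate[OF assms(2)])

section \<open>Bump functions and delta sequences\<close>

text \<open>The functions \<open>p(1/t) exp(-1/t)\<close>, continued by \<open>0\<close> to \<open>t \<le> 0\<close>, form a class closed under
  differentiation; \<open>p = 1\<close> is the standard smooth step.\<close>

definition flat_exp :: "real poly \<Rightarrow> real \<Rightarrow> real" where
  "flat_exp p t = (if t \<le> 0 then 0 else poly p (1 / t) * exp (- (1 / t)))"

definition flat_exp_deriv :: "real poly \<Rightarrow> real poly" where
  "flat_exp_deriv p = [:0, 0, 1:] * (p - pderiv p)"

lemma poly_exp_tendsto_0: "((\<lambda>u. poly p u * exp (- u)) \<longlongrightarrow> 0) (at_top :: real filter)"
proof -
  have "((\<lambda>u. \<Sum>i\<le>degree p. coeff p i * (u ^ i / exp u)) \<longlongrightarrow> (\<Sum>i\<le>degree p. coeff p i * 0)) (at_top :: real filter)"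
    by (intro tendsto_intros tendsto_power_div_exp_0)
  then show ?thesis
    by (simp add: poly_altdef sum_distrib_right exp_minus divide_inverse mult.assoc)
qed

text \<open>At the origin the difference quotient is \<open>u p(u) exp(-u)\<close> with \<open>u = 1 / t\<close>, which tends to \<open>0\<close>.\<close>

lemma flat_exp_has_derivative: "(flat_exp p has_real_derivative flat_exp (flat_exp_deriv p) t) (at t)"
proof (cases t "0::real" rule: linorder_cases)
  case less
  have "(flat_exp p has_real_derivative 0) (at t)"
    by (rule has_field_derivative_transform_within_open[of "\<lambda>_. 0" _ _ "{..<0}"])
      (use less in \<open>auto simp: flat_exp_def\<close>)
  then show ?thesis using less by (simp add: flat_exp_def)
next
  case greater
  have "((\<lambda>t. poly p (1 / t) * exp (- (1 / t))) has_real_derivative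
     (poly (pderiv p) (1 / t) * (- 1 / t\<^sup>2)) * exp (- (1 / t)) + exp (- (1 / t)) * (1 / t\<^sup>2) * poly p (1 / t)) (at t)"
    using greater by (auto intro!: derivative_eq_intros DERIV_chain2[OF poly_DERIV] simp: power2_eq_square)
  moreover have "(poly (pderiv p) (1 / t) * (- 1 / t\<^sup>2)) * exp (- (1 / t)) + exp (- (1 / t)) * (1 / t\<^sup>2) * poly p (1 / t) = flat_exp (flat_exp_deriv p) t"
    using greater by (simp add: flat_exp_def flat_exp_deriv_def power2_eq_square algebra_simps)
  ultimately have "((\<lambda>t. poly p (1 / t) * exp (- (1 / t))) has_real_derivative flat_exp (flat_exp_deriv p) t) (at t)" by simp
  then show ?thesis
    by (rule has_field_derivative_transform_within_open[of _ _ _ "{0<..}"])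
      (use greater in \<open>auto simp: flat_exp_def\<close>)
next
  case equal
  have "((\<lambda>h. flat_exp p h / h) \<longlongrightarrow> 0) (at 0)"
  proof (rule filterlim_split_at)
    have "\<forall>\<^sub>F h in at_left (0::real). flat_exp p h / h = 0"
      by (auto simp: eventually_at_filter flat_exp_def)
    then show "((\<lambda>h. flat_exp p h / h) \<longlongrightarrow> 0) (at_left 0)" by (rule tendsto_eventually)
    have "((\<lambda>h. poly ([:0, 1:] * p) (inverse h) * exp (- (inverse h))) \<longlongrightarrow> 0) (at_right (0::real))"
      by (rule filterlim_compose[OF poly_exp_tendsto_0 filterlim_inverse_at_top_right])
    moreover have "\<forall>\<^sub>F h in at_right (0::real). flat_exp p h / h = poly ([:0, 1:] * p) (inverse h) * exp (- (inverse h))"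
      by (auto simp: eventually_at_filter flat_exp_def divide_inverse)
    ultimately show "((\<lambda>h. flat_exp p h / h) \<longlongrightarrow> 0) (at_right 0)"
      by (subst tendsto_cong)
  qed
  then show ?thesis using equal by (simp add: has_field_derivative_iff flat_exp_def)
qed

lemma smooth_flat_exp: "smooth (\<lambda>x::real^'d::finite. complex_of_real (flat_exp p (a + c * x $ j)))"
proof -
  have d: "((\<lambda>x. e * complex_of_real (flat_exp p (a + c * x $ j))) has_derivative
      (\<lambda>h. e * complex_of_real (c * h $ j * flat_exp (flat_exp_deriv p) (a + c * x $ j)))) (at x)" for e p and x :: "real^'d"
  proof -
    have "((\<lambda>x::real^'d. a + c * x $ j) has_derivative (\<lambda>h. c * h $ j)) (at x)"
      by (auto intro!: derivative_eq_intros bounded_linear_imp_has_derivative bounded_linear_vec_nth)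
    moreover have "(flat_exp p has_derivative (\<lambda>h. h * flat_exp (flat_exp_deriv p) (a + c * x $ j))) (at (a + c * x $ j))"
    proof -
      have "(*) (flat_exp (flat_exp_deriv p) (a + c * x $ j)) = (\<lambda>h. h * flat_exp (flat_exp_deriv p) (a + c * x $ j))"
        by (rule ext) (rule mult.commute)
      then show ?thesis
        using flat_exp_has_derivative[of p "a + c * x $ j"] by (simp only: has_field_derivative_def)
    qed
    ultimately have "((\<lambda>x. flat_exp p (a + c * x $ j)) has_derivative (\<lambda>h. c * h $ j * flat_exp (flat_exp_deriv p) (a + c * x $ j))) (at x)"
      by (rule has_derivative_compose)
    then show ?thesis by (intro has_derivative_mult_right has_derivative_of_real)
  qed
  have pd: "pdiff k (\<lambda>x. e * complex_of_real (flat_exp p (a + c * x $ j)))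
    = (\<lambda>x::real^'d. (e * of_real (c * axis k 1 $ j)) * complex_of_real (flat_exp (flat_exp_deriv p) (a + c * x $ j)))" for k e p
    by (rule ext, subst pdiff_eq[OF d]) simp
  have one: "(\<lambda>x::real^'d. complex_of_real (flat_exp p (a + c * x $ j))) = (\<lambda>x. 1 * complex_of_real (flat_exp p (a + c * x $ j)))"
    by simp
  have "\<exists>q e. (\<lambda>x::real^'d. complex_of_real (flat_exp p (a + c * x $ j))) = (\<lambda>x. e * complex_of_real (flat_exp q (a + c * x $ j)))"
    by (rule exI, rule exI, rule one)
  then show ?thesis
  proof (rule smooth_coinduct[where P = "\<lambda>f::'d tfun. \<exists>p e. f = (\<lambda>x. e * complex_of_real (flat_exp p (a + c * x $ j)))"])
    fix f :: "'d tfun" and k assume "\<exists>p e. f = (\<lambda>x. e * complex_of_real (flat_exp p (a + c * x $ j)))"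
    then obtain p e where f: "f = (\<lambda>x. e * complex_of_real (flat_exp p (a + c * x $ j)))" by blast
    show "\<exists>p e. pdiff k f = (\<lambda>x. e * complex_of_real (flat_exp p (a + c * x $ j)))"
      unfolding f pd by (intro exI) (rule refl)
  next
    fix f :: "'d tfun" assume "\<exists>p e. f = (\<lambda>x. e * complex_of_real (flat_exp p (a + c * x $ j)))"
    then obtain p e where f: "f = (\<lambda>x. e * complex_of_real (flat_exp p (a + c * x $ j)))" by blast
    show "f differentiable_on UNIV"
      unfolding f diff_on_UNIV differentiable_def by (intro allI exI) (rule d)
  qed
qed

abbreviation step :: "real \<Rightarrow> real" where "step \<equiv> flat_exp 1"

lemma step_nonneg: "0 \<le> step t" by (simp add: flat_exp_def)
lemma step_le_1: "step t \<le> 1" by (simp add: flat_exp_def)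
lemma step_pos_iff: "step t \<noteq> 0 \<longleftrightarrow> t > 0" by (simp add: flat_exp_def)

text \<open>A smooth function supported in the box between \<open>a\<close> and \<open>b\<close>; for large \<open>n\<close> it is close to
  the indicator function of the box.\<close>

definition box_real :: "real \<Rightarrow> real^'d::finite \<Rightarrow> real^'d \<Rightarrow> real^'d \<Rightarrow> real" where
  "box_real n a b x = (\<Prod>k\<in>UNIV. step (n * (x $ k - a $ k)) * step (n * (b $ k - x $ k)))"

definition box_bump :: "real \<Rightarrow> real^'d::finite \<Rightarrow> real^'d \<Rightarrow> 'd tfun" where
  "box_bump n a b = (\<lambda>x. complex_of_real (box_real n a b x))"

lemma box_real_nonneg: "0 \<le> box_real n a b x"
  unfolding box_real_def by (intro prod_nonneg mult_nonneg_nonneg step_nonneg) 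

lemma box_real_le_1: "box_real n a b x \<le> 1"
  unfolding box_real_def by (intro prod_le_1 conjI mult_nonneg_nonneg step_nonneg mult_le_one step_le_1) 

lemma box_real_nonzero: "n > 0 \<Longrightarrow> box_real n a b x \<noteq> 0 \<longleftrightarrow> (\<forall>k. a $ k < x $ k \<and> x $ k < b $ k)"
  by (simp add: box_real_def step_pos_iff zero_less_mult_iff)

lemma smooth_box_bump:
  fixes a b :: "real^'d::finite"
  shows "smooth (box_bump n a b)"
proof -
  have 1: "smooth (\<lambda>x::real^'d. complex_of_real (step (n * (x $ k - a $ k))))" for k
    using smooth_flat_exp[of 1 "- n * a $ k" n k] by (simp add: algebra_simps)
  have 2: "smooth (\<lambda>x::real^'d. complex_of_real (step (n * (b $ k - x $ k))))" for k
    using smooth_flat_exp[of 1 "n * b $ k" "- n" k] by (simp add: algebra_simps)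
  show ?thesis
    unfolding box_bump_def box_real_def of_real_prod of_real_mult by (intro smooth_prod smooth_mult 1 2)
qed

lemma box_bump_test: "n > 0 \<Longrightarrow> box_bump n a b \<in> test_functions"
  unfolding test_functions_def
proof (safe)
  assume n: "n > 0"
  show "smooth (box_bump n a b)" by (rule smooth_box_bump)
  have "{x. box_bump n a b x \<noteq> 0} \<subseteq> box a b"
    using n by (auto simp: box_bump_def box_real_nonzero mem_box_cart)
  then show "bounded {x. box_bump n a b x \<noteq> 0}" by (rule bounded_subset[OF bounded_box])
qed

lemma box_bump_tendsto: "(\<lambda>n. box_bump (real (Suc n)) a b x) \<longlonglongrightarrow> indicator (box a b) x"
proof (cases "x \<in> box a b")
  case False
  then have "box_bump (real (Suc n)) a b x = 0" for n
    using box_real_nonzero[of "real (Suc n)" a b x] by (simp add: box_bump_def mem_box_cart) blast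
  then show ?thesis using False by simp
next
  case True
  have st: "(\<lambda>n. step (real (Suc n) * t)) \<longlonglongrightarrow> 1" if t: "t > 0" for t
  proof -
    have "(\<lambda>n. exp (- (1 / real (Suc n) * (1 / t)))) \<longlonglongrightarrow> exp (- (0 * (1 / t)))"
      by (intro tendsto_intros LIMSEQ_Suc lim_1_over_n)
    moreover have "exp (- (1 / real (Suc n) * (1 / t))) = step (real (Suc n) * t)" for n
      using t by (simp add: flat_exp_def mult_le_0_iff)
    ultimately show ?thesis by simp
  qed
  have "(\<lambda>n. box_real (real (Suc n)) a b x) \<longlonglongrightarrow> (\<Prod>k\<in>(UNIV::'a set). 1 * 1)"
    unfolding box_real_def using True by (intro tendsto_prod tendsto_mult st) (auto simp: mem_box_cart)
  then have "(\<lambda>n. complex_of_real (box_real (real (Suc n)) a b x)) \<longlonglongrightarrow> complex_of_real (\<Prod>k\<in>(UNIV::'a set). 1 * 1)"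
    by (rule tendsto_of_real)
  then show ?thesis using True by (simp add: box_bump_def)
qed

text \<open>Bumps on shrinking boxes, divided by their integrals, which are positive since the bumps are positive on
  the open boxes.\<close>

lemma delta_seq_exists: "\<exists>\<rho>. delta_seq (\<rho> :: nat \<Rightarrow> 'd::finite tfun)"
proof -
  define e where "e n = 1 / real (Suc n)" for n
  define a where "a n = (\<chi> (k::'d). - e n)" for n
  define b where "b n = (\<chi> (k::'d). e n)" for n
  define \<beta> where "\<beta> n = box_real 1 (a n) (b n)" for n
  have e: "e n > 0" for n by (simp add: e_def)
  have test: "box_bump 1 (a n) (b n) \<in> test_functions" for n by (rule box_bump_test) simp
  have ci: "integrable lborel (box_bump 1 (a n) (b n))" for n
    by (rule schwartz_integrable[OF test_functions_schwartz[OF test]])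
  have i: "integrable lborel (\<beta> n)" for n
    using integrable_Re[OF ci[of n]] by (simp add: box_bump_def \<beta>_def)
  define I where "I n = (LINT x|lborel. \<beta> n x)" for n
  have supp: "norm x < real CARD('d) * e n" if "\<beta> n x \<noteq> 0" for n x
  proof -
    have "\<bar>x $ k\<bar> < e n" for k
      using that box_real_nonzero[of 1 "a n" "b n" x] by (simp add: \<beta>_def a_def b_def abs_less_iff minus_less_iff)
    then have "(\<Sum>k\<in>UNIV. \<bar>x $ k\<bar>) < (\<Sum>k\<in>(UNIV::'d set). e n)" by (intro sum_strict_mono) auto
    with norm_le_l1_cart[of x] show ?thesis by simp
  qed
  have I0: "I n > 0" for n
  proof -
    have "I n \<noteq> 0"
    proof
      assume "I n = 0"
      then have "AE x in lborel. \<beta> n x = 0"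
        using integral_nonneg_eq_0_iff_AE[OF i[of n]] by (simp add: I_def \<beta>_def box_real_nonneg)
      then have "AE x in lborel. x \<notin> box (a n) (b n)"
      proof eventually_elim
        case (elim x)
        then show ?case using box_real_nonzero[of 1 "a n" "b n" x] by (auto simp: \<beta>_def mem_box_cart)
      qed
      then have A: "emeasure lborel (box (a n) (b n)) = 0"
        by (subst (asm) AE_iff_measurable[of "box (a n) (b n)"]) auto
      have B: "emeasure lborel (box (a n) (b n)) = ennreal (\<Prod>b'\<in>Basis. (b n - a n) \<bullet> b')"
        using e[of n] by (intro emeasure_lborel_box) (auto simp: Basis_vec_def inner_axis a_def b_def)
      have P: "(\<Prod>b'\<in>Basis. (b n - a n) \<bullet> b') > 0"
        using e[of n] by (intro prod_pos) (auto simp: Basis_vec_def inner_axis a_def b_def)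
      from trans[OF B[symmetric] A] have "(\<Prod>b'\<in>Basis. (b n - a n) \<bullet> b') \<le> 0"
        by (simp only: ennreal_eq_0_iff)
      with P show False by linarith
    qed
    moreover have "I n \<ge> 0" unfolding I_def \<beta>_def by (intro Bochner_Integration.integral_nonneg box_real_nonneg)
    ultimately show ?thesis by simp
  qed
  define \<rho> where "\<rho> n = (\<lambda>x. complex_of_real (1 / I n) * box_bump 1 (a n) (b n) x)" for n
  have \<rho>: "\<rho> n x = complex_of_real (\<beta> n x / I n)" for n x by (simp add: \<rho>_def \<beta>_def box_bump_def)
  have "delta_seq \<rho>"
    unfolding delta_seq_def
  proof (intro conjI allI exI[of _ 1] impI)
    show "\<rho> n \<in> test_functions" for n
      unfolding \<rho>_def by (rule test_functions_mult[OF smooth_const test])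
    show "(LINT x|lborel. \<rho> n x) = 1" for n
      using I0[of n] by (simp add: \<rho> I_def)
    show "(LINT x|lborel. norm (\<rho> n x)) \<le> 1" for n
    proof -
      have "norm (\<rho> n x) = \<beta> n x / I n" for x
        using I0[of n] by (simp add: \<rho> \<beta>_def box_real_nonneg norm_divide del: of_real_divide)
      then show ?thesis using I0[of n] by (simp add: I_def)
    qed
    fix \<epsilon> :: real assume "\<epsilon> > 0"
    have "(\<lambda>n. real CARD('d) * e n) \<longlonglongrightarrow> real CARD('d) * 0"
      unfolding e_def by (intro tendsto_intros LIMSEQ_Suc lim_1_over_n)
    then have "\<forall>\<^sub>F n in sequentially. real CARD('d) * e n < \<epsilon>"
      using \<open>\<epsilon> > 0\<close> by (intro order_tendstoD) auto
    then show "\<forall>\<^sub>F n in sequentially. \<forall>x. \<rho> n x \<noteq> 0 \<longrightarrow> norm x < \<epsilon>"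
    proof eventually_elim
      case (elim n)
      then show ?case using supp[of n] by (force simp: \<rho>)
    qed
  qed
  then show ?thesis by blast
qed

subsection \<open>Density of the test functions\<close>

text \<open>With \<open>\<theta>(0) = 1\<close>, the rescaled difference quotients \<open>n (\<theta>(x/n) - 1)\<close> are uniformly slowly
  increasing, so \<open>\<theta>(x/n) f\<close> tends to \<open>f\<close> with error \<open>O(1/n)\<close> in every seminorm.\<close>

lemma cutoff_family_slow:
  fixes \<theta> :: "'d::finite tfun"
  assumes \<theta>: "\<theta> \<in> schwartz" and 1: "\<theta> 0 = 1"
  shows "slow_family (\<lambda>n x. complex_of_real (real (Suc n)) * (\<theta> (0 + (1 / real (Suc n)) *\<^sub>R x) - 1))"
  unfolding slow_family_def
proof (intro conjI allI)
  have s: "smooth \<theta>" by (rule schwartz_smooth[OF \<theta>])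
  have s': "smooth (\<lambda>x. \<theta> (0 + (1 / real (Suc n)) *\<^sub>R x) + (- 1))" for n
    by (rule smooth_add[OF smooth_affine[OF s] smooth_const])
  then show "smooth (\<lambda>x. complex_of_real (real (Suc n)) * (\<theta> (0 + (1 / real (Suc n)) *\<^sub>R x) - 1))" for n
    using smooth_mult[OF smooth_const s'[of n]] by simp
  fix ks :: "'d list"
  show "\<exists>C M. \<forall>n x. norm (pdiffs ks (\<lambda>x. complex_of_real (real (Suc n)) * (\<theta> (0 + (1 / real (Suc n)) *\<^sub>R x) - 1)) x) \<le> C * (1 + norm x) ^ M"
  proof (cases ks rule: rev_cases)
    case Nil
    define L where "L = real CARD('d) * 2 ^ 0 * schwartz_seminorm (Suc 0) \<theta>"
    define B where "B = schwartz_seminorm 0 \<theta> + 1"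
    have L0: "L \<ge> 0" and B0: "B \<ge> 0" unfolding L_def B_def using schwartz_seminorm_nonneg[OF \<theta>] by auto
    have L: "norm (\<theta> y - \<theta> 0) \<le> L * norm y" if "norm y \<le> 1" for y
      using pdiff_lipschitz_weighted[OF \<theta>, of y 0 0] that by (simp add: L_def)
    have B: "norm (\<theta> y - 1) \<le> B" for y
      using norm_triangle_ineq4[of "\<theta> y" 1] schwartz_bound0[OF \<theta>, of 0 0 y] by (simp add: B_def)
    have LB: "norm (\<theta> y - 1) \<le> (L + B) * norm y" for y
    proof (cases "norm y \<le> 1")
      case True
      have "L * norm y \<le> (L + B) * norm y" using B0 by (intro mult_right_mono) auto
      with L[OF True] 1 show ?thesis by simp
    next
      case False
      have "B * 1 \<le> (L + B) * norm y" using False L0 B0 by (intro mult_mono) auto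
      with B[of y] show ?thesis by simp
    qed
    have "norm (complex_of_real (real (Suc n)) * (\<theta> (0 + (1 / real (Suc n)) *\<^sub>R x) - 1)) \<le> (L + B) * (1 + norm x) ^ 1" for n x
    proof -
      have "norm (complex_of_real (real (Suc n)) * (\<theta> (0 + (1 / real (Suc n)) *\<^sub>R x) - 1))
        \<le> real (Suc n) * ((L + B) * norm ((1 / real (Suc n)) *\<^sub>R x))"
        unfolding norm_mult using LB[of "(1 / real (Suc n)) *\<^sub>R x"] by (intro mult_mono) (auto simp del: of_nat_Suc)
      also have "\<dots> = (L + B) * norm x" by (simp del: of_nat_Suc)
      also have "\<dots> \<le> (L + B) * (1 + norm x) ^ 1" using L0 B0 by (intro mult_left_mono) auto
      finally show ?thesis .
    qed
    then show ?thesis unfolding Nil pdiffs.simps by blast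
  next
    case (snoc ls l)
    have pd: "pdiff l (\<lambda>x. complex_of_real (real (Suc n)) * (\<theta> (0 + (1 / real (Suc n)) *\<^sub>R x) - 1))
      = (\<lambda>x. pdiff l \<theta> (0 + (1 / real (Suc n)) *\<^sub>R x))" for n
    proof -
      have "pdiff l (\<lambda>x. complex_of_real (real (Suc n)) * (\<theta> (0 + (1 / real (Suc n)) *\<^sub>R x) + (- 1)))
        = (\<lambda>x. complex_of_real (real (Suc n)) * (complex_of_real (1 / real (Suc n)) * pdiff l \<theta> (0 + (1 / real (Suc n)) *\<^sub>R x)))"
        using s s'[of n] smooth_affine[OF s, of 0 "1 / real (Suc n)"]
        by (simp only: pdiff_cmult pdiff_add pdiff_affine pdiff_const smooth_differentiable_on smooth_const add_0_right)
      moreover have "complex_of_real (real (Suc n)) * (complex_of_real (1 / real (Suc n)) * z) = z" for z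
        by (simp del: of_nat_Suc)
      ultimately show ?thesis by simp
    qed
    have "norm (pdiffs ks (\<lambda>x. complex_of_real (real (Suc n)) * (\<theta> (0 + (1 / real (Suc n)) *\<^sub>R x) - 1)) x)
       \<le> schwartz_seminorm (length ks) \<theta> * (1 + norm x) ^ 0" for n x
    proof -
      let ?y = "0 + (1 / real (Suc n)) *\<^sub>R x"
      have "pdiffs ks (\<lambda>x. complex_of_real (real (Suc n)) * (\<theta> (0 + (1 / real (Suc n)) *\<^sub>R x) - 1)) x
        = complex_of_real (1 / real (Suc n)) ^ length ls * pdiffs ks \<theta> ?y"
        unfolding snoc pdiffs_snoc pd by (subst pdiffs_affine[OF smooth_pdiff[OF s]]) simp
      also have "norm \<dots> \<le> 1 * ((1 + norm ?y) ^ 0 * norm (pdiffs ks \<theta> ?y))"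
        unfolding norm_mult norm_power by (intro mult_mono power_le_one) (auto simp del: of_real_divide)
      also have "\<dots> \<le> schwartz_seminorm (length ks) \<theta>"
        using schwartz_bound[OF \<theta>, of 0 "length ks" ks ?y] by simp
      finally show ?thesis by simp
    qed
    then show ?thesis by blast
  qed
qed

text \<open>The distribution \<open>D = S - T\<close> vanishes on the test function \<open>\<theta>(x/n) \<phi>\<close>, hence \<open>D \<phi>\<close> is up to sign \<open>1/n\<close> times the value of
  \<open>D\<close> on a family that is bounded in every seminorm.\<close>

lemma tempered_eq_on_test:
  fixes S T :: "'d::finite tdist"
  assumes S: "tempered S" and T: "tempered T" and eq: "\<And>\<phi>. \<phi> \<in> test_functions \<Longrightarrow> S \<phi> = T \<phi>"
  shows "S \<doteq> T"
proof -
  define D where "D = (\<lambda>\<phi>. S \<phi> - T \<phi>)"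
  have D: "tempered D" unfolding D_def by (rule tempered_diff[OF S T])
  let ?b = "box_bump 1 (\<chi> (k::'d). -1) (\<chi> k. 1)"
  define \<theta> where "\<theta> = (\<lambda>x. (1 / ?b 0) * ?b x)"
  have \<theta>t: "\<theta> \<in> test_functions"
    unfolding \<theta>_def by (intro test_functions_mult box_bump_test smooth_const) simp
  note \<theta> = test_functions_schwartz[OF \<theta>t]
  have "?b 0 \<noteq> 0" by (simp add: box_bump_def box_real_nonzero)
  then have \<theta>0: "\<theta> 0 = 1" by (simp add: \<theta>_def)
  \<comment> \<open>These are the functions with \<open>\<theta>(x/n) - 1 = W/n\<close>, with \<open>Suc n\<close> in place of \<open>n\<close>.\<close>
  define W where "W n = (\<lambda>x. complex_of_real (real (Suc n)) * (\<theta> (0 + (1 / real (Suc n)) *\<^sub>R x) - 1))" for n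
  have W: "slow_family W" unfolding W_def by (rule cutoff_family_slow[OF \<theta> \<theta>0])
  have D0: "D \<phi> = 0" if \<phi>: "\<phi> \<in> schwartz" for \<phi>
  proof -
    obtain C N where C: "C \<ge> 0" "\<And>f. f \<in> schwartz \<Longrightarrow> norm (D f) \<le> C * schwartz_seminorm N f"
      using tempered_bound[OF D] by blast
    obtain A M where A: "A \<ge> 0" "\<And>n f. f \<in> schwartz \<Longrightarrow> schwartz_seminorm N (\<lambda>x. W n x * f x) \<le> A * schwartz_seminorm M f"
      using slow_family_mult_seminorm[OF W] by blast
    have Wf: "(\<lambda>x. W n x * \<phi> x) \<in> schwartz" for n by (rule slow_family_mult_schwartz[OF W \<phi>])
    have "norm (D \<phi>) \<le> (1 / real (Suc n)) * (C * (A * schwartz_seminorm M \<phi>))" for n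
    proof -
      let ?c = "\<lambda>x. \<theta> (0 + (1 / real (Suc n)) *\<^sub>R x) * \<phi> x"
      have ct: "?c \<in> test_functions"
        unfolding test_functions_def
      proof safe
        show "smooth ?c" by (rule smooth_mult[OF smooth_affine[OF schwartz_smooth[OF \<theta>]] schwartz_smooth[OF \<phi>]])
        obtain R where R: "\<And>y. \<theta> y \<noteq> 0 \<Longrightarrow> norm y \<le> R"
          using \<theta>t by (auto simp: test_functions_def bounded_iff)
        have "norm x \<le> real (Suc n) * R" if "?c x \<noteq> 0" for x
          using R[of "0 + (1 / real (Suc n)) *\<^sub>R x"] that by (simp add: field_simps del: of_nat_Suc)
        then show "bounded {x. ?c x \<noteq> 0}" by (auto simp: bounded_iff)
      qed
      have "?c x - complex_of_real (1 / real (Suc n)) * (W n x * \<phi> x) = \<phi> x" for x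
        by (simp add: W_def algebra_simps del: of_nat_Suc)
      then have "D \<phi> = D (\<lambda>x. ?c x - complex_of_real (1 / real (Suc n)) * (W n x * \<phi> x))" by simp
      also have "\<dots> = D ?c - complex_of_real (1 / real (Suc n)) * D (\<lambda>x. W n x * \<phi> x)"
        using test_functions_schwartz[OF ct] Wf[of n]
        by (simp only: tempered_diff_eq[OF D] tempered_cmult_eq[OF D] schwartz_cmult)
      also have "D ?c = 0" using eq[OF ct] by (simp add: D_def)
      finally have "norm (D \<phi>) = (1 / real (Suc n)) * norm (D (\<lambda>x. W n x * \<phi> x))"
        by (simp add: norm_mult norm_divide del: of_nat_Suc)
      also have "\<dots> \<le> (1 / real (Suc n)) * (C * schwartz_seminorm N (\<lambda>x. W n x * \<phi> x))"
        by (intro mult_left_mono C Wf) simp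
      also have "\<dots> \<le> (1 / real (Suc n)) * (C * (A * schwartz_seminorm M \<phi>))"
        by (intro mult_left_mono A C \<phi>) simp
      finally show ?thesis .
    qed
    moreover have "(\<lambda>n. (1 / real (Suc n)) * (C * (A * schwartz_seminorm M \<phi>))) \<longlonglongrightarrow> 0 * (C * (A * schwartz_seminorm M \<phi>))"
      by (intro tendsto_intros LIMSEQ_Suc lim_1_over_n)
    ultimately have "norm (D \<phi>) \<le> 0 * (C * (A * schwartz_seminorm M \<phi>))"
      by (intro tendsto_lowerbound[of _ _ sequentially]) auto
    then show ?thesis by simp
  qed
  then show ?thesis by (simp add: dist_eq_def D_def)
qed

section \<open>Products of distributions\<close>

lemma delta_seq_test: "delta_seq \<rho> \<Longrightarrow> \<rho> n \<in> test_functions"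
  by (simp add: delta_seq_def)

lemma delta_seq_schwartz: "delta_seq \<rho> \<Longrightarrow> \<rho> n \<in> schwartz"
  by (simp add: delta_seq_def test_functions_schwartz)

lemma is_productD:
  assumes "is_product S T R" "delta_seq \<rho>" "\<phi> \<in> test_functions"
  shows "(\<lambda>n. T (\<lambda>x. mollify S (\<rho> n) x * \<phi> x)) \<longlonglongrightarrow> R \<phi>"
  using assms unfolding is_product_def by blast

lemma is_product_tempered: "is_product S T R \<Longrightarrow> tempered R"
  by (simp add: is_product_def)

lemma mollify_test:
  assumes "tempered S" "delta_seq \<rho>" "\<phi> \<in> test_functions"
  shows "(\<lambda>x. mollify S (\<rho> n) x * \<phi> x) \<in> test_functions"
  by (rule test_functions_mult[OF smooth_mollify[OF assms(1) delta_seq_schwartz[OF assms(2)]] assms(3)])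

text \<open>The limits defining the product determine it on test functions; these are dense.\<close>

lemma is_product_unique:
  assumes R: "is_product S T R" and R': "is_product S T R'"
  shows "R \<doteq> R'"
proof (rule tempered_eq_on_test)
  show "tempered R" "tempered R'" using R R' by (auto simp: is_product_def)
  fix \<phi> :: "'a tfun" assume \<phi>: "\<phi> \<in> test_functions"
  obtain \<rho> :: "nat \<Rightarrow> 'a tfun" where \<rho>: "delta_seq \<rho>" using delta_seq_exists by blast
  show "R \<phi> = R' \<phi>"
    by (rule LIMSEQ_unique[OF is_productD[OF R \<rho> \<phi>] is_productD[OF R' \<rho> \<phi>]])
qed

lemma dist_prod_eq:
  assumes "is_product S T R"
  shows "dist_prod S T \<doteq> R"
proof -
  have "is_product S T (dist_prod S T)"
    unfolding dist_prod_def by (rule someI[of "is_product S T", OF assms])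
  then show ?thesis using assms by (rule is_product_unique)
qed

text \<open>Only the regularizations of the first factor enter the definition, and they evaluate it at Schwartz
  functions.\<close>

lemma is_product_cong:
  assumes "S \<doteq> S'"
  shows "is_product S T R \<longleftrightarrow> is_product S' T R"
proof -
  have "mollify S (\<rho> n) = mollify S' (\<rho> n)" if "delta_seq \<rho>" for \<rho> n
    using assms delta_seq_schwartz[OF that, of n]
    by (auto simp: mollify_def dist_eq_def schwartz_reflect_translate)
  then show ?thesis by (auto simp: is_product_def)
qed

lemma dist_prod_cong: "S \<doteq> S' \<Longrightarrow> dist_prod S T = dist_prod S' T"
  by (simp add: dist_prod_def is_product_cong)

lemma is_product_cong_result:
  assumes "is_product S T R" "R \<doteq> R'" "tempered R'"
  shows "is_product S T R'"
  using assms by (auto simp: is_product_def dist_eq_def test_functions_schwartz)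

lemma is_product_add:
  fixes S1 S2 T R1 R2 :: "'d::finite tdist"
  assumes 1: "is_product S1 T R1" and 2: "is_product S2 T R2"
    and S: "tempered S1" "tempered S2" and T: "tempered T"
  shows "is_product (\<lambda>\<phi>. S1 \<phi> + S2 \<phi>) T (\<lambda>\<phi>. R1 \<phi> + R2 \<phi>)"
  unfolding is_product_def
proof (intro conjI allI impI ballI)
  show "tempered (\<lambda>\<phi>. R1 \<phi> + R2 \<phi>)" using 1 2 by (auto simp: is_product_def intro: tempered_add)
  fix \<rho> :: "nat \<Rightarrow> 'd tfun" and \<phi> :: "'d tfun" assume \<rho>: "delta_seq \<rho>" and \<phi>: "\<phi> \<in> test_functions"
  have "T (\<lambda>x. mollify (\<lambda>\<phi>. S1 \<phi> + S2 \<phi>) (\<rho> n) x * \<phi> x)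
     = T (\<lambda>x. mollify S1 (\<rho> n) x * \<phi> x) + T (\<lambda>x. mollify S2 (\<rho> n) x * \<phi> x)" for n
    using tempered_add_eq[OF T test_functions_schwartz[OF mollify_test[OF S(1) \<rho> \<phi>]]
      test_functions_schwartz[OF mollify_test[OF S(2) \<rho> \<phi>]], of n n]
    by (simp add: mollify_def distrib_right)
  then show "(\<lambda>n. T (\<lambda>x. mollify (\<lambda>\<phi>. S1 \<phi> + S2 \<phi>) (\<rho> n) x * \<phi> x)) \<longlonglongrightarrow> R1 \<phi> + R2 \<phi>"
    using tendsto_add[OF is_productD[OF 1 \<rho> \<phi>] is_productD[OF 2 \<rho> \<phi>]] by simp
qed

lemma is_product_cmult:
  fixes S T R :: "'d::finite tdist"
  assumes 1: "is_product S T R" and S: "tempered S" and T: "tempered T"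
  shows "is_product (\<lambda>\<phi>. c * S \<phi>) T (\<lambda>\<phi>. c * R \<phi>)"
  unfolding is_product_def
proof (intro conjI allI impI ballI)
  show "tempered (\<lambda>\<phi>. c * R \<phi>)" using 1 by (auto simp: is_product_def intro: tempered_cmult)
  fix \<rho> :: "nat \<Rightarrow> 'd tfun" and \<phi> :: "'d tfun" assume \<rho>: "delta_seq \<rho>" and \<phi>: "\<phi> \<in> test_functions"
  have "T (\<lambda>x. mollify (\<lambda>\<phi>. c * S \<phi>) (\<rho> n) x * \<phi> x) = c * T (\<lambda>x. mollify S (\<rho> n) x * \<phi> x)" for n
    using tempered_cmult_eq[OF T test_functions_schwartz[OF mollify_test[OF S \<rho> \<phi>]], of c n]
    by (simp add: mollify_def mult.assoc)
  then show "(\<lambda>n. T (\<lambda>x. mollify (\<lambda>\<phi>. c * S \<phi>) (\<rho> n) x * \<phi> x)) \<longlonglongrightarrow> c * R \<phi>"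
    using tendsto_mult_left[OF is_productD[OF 1 \<rho> \<phi>]] by simp
qed

lemma is_product_zero:
  assumes T: "tempered T"
  shows "is_product (\<lambda>\<phi>. 0) T (\<lambda>\<phi>. 0)"
  unfolding is_product_def by (simp add: tempered_zero mollify_def tempered_zero_eq[OF T])

lemma is_product_sum:
  assumes "\<And>i. i \<in> I \<Longrightarrow> is_product (S i) T (R i)" "\<And>i. i \<in> I \<Longrightarrow> tempered (S i)" and T: "tempered T"
  shows "is_product (\<lambda>\<phi>. \<Sum>i\<in>I. S i \<phi>) T (\<lambda>\<phi>. \<Sum>i\<in>I. R i \<phi>)"
  using assms(1,2)
proof (induction I rule: infinite_finite_induct)
  case (insert i I)
  then show ?case by (simp add: is_product_add tempered_sum T)
qed (simp_all add: is_product_zero T)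

lemma fun_times_eq_const: "tempered T \<Longrightarrow> fun_times (\<lambda>x. c) T \<doteq> (\<lambda>\<phi>. c * T \<phi>)"
  by (simp add: dist_eq_def fun_times_def tempered_cmult_eq)

lemma delta_seq_L1_bound:
  assumes "delta_seq \<rho>"
  obtains C where "C > 0" "\<And>n. (LINT x|lborel. norm (\<rho> n x)) \<le> C"
proof -
  obtain C where C: "\<And>n. (LINT x|lborel. norm (\<rho> n x)) \<le> C" using assms by (auto simp: delta_seq_def)
  have "(LINT x|lborel. norm (\<rho> n x)) \<le> \<bar>C\<bar> + 1" for n using C[of n] by simp
  then show thesis by (intro that[of "\<bar>C\<bar> + 1"]) auto
qed

text \<open>If \<open>\<rho>\<close> is a delta sequence, so is \<open>(\<rho> + x\<^sub>k \<rho>) / (1 + \<integral> x\<^sub>k \<rho>)\<close> up to finitely many terms.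
  The product being independent of the delta sequence, \<open>x\<^sub>k \<rho>\<close> contributes nothing in the limit.\<close>

lemma delta_seq_perturb:
  fixes \<rho> :: "nat \<Rightarrow> 'd::finite tfun" and k :: 'd
  assumes \<rho>: "delta_seq \<rho>"
    and c_def: "c = (\<lambda>n. LINT x|lborel. complex_of_real (x $ k) * \<rho> n x)"
  obtains \<sigma> where "delta_seq \<sigma>" "c \<longlonglongrightarrow> 0"
    "\<forall>\<^sub>F n in sequentially. 1 + c n \<noteq> 0 \<and> \<sigma> n = (\<lambda>x. (1 / (1 + c n)) * (\<rho> n x + complex_of_real (x $ k) * \<rho> n x))"
proof -
  obtain C where C: "C > 0" "\<And>n. (LINT x|lborel. norm (\<rho> n x)) \<le> C"
    by (rule delta_seq_L1_bound[OF \<rho>]) blast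
  have sch: "\<rho> n \<in> schwartz" for n by (rule delta_seq_schwartz[OF \<rho>])
  have i: "integrable lborel (\<rho> n)" "integrable lborel (\<lambda>x. complex_of_real (x $ k) * \<rho> n x)" for n
    by (intro schwartz_integrable schwartz_coord sch)+
  define small where "small e n \<longleftrightarrow> (\<forall>x. \<rho> n x \<noteq> 0 \<longrightarrow> norm x < e)" for e n
  have ev: "\<forall>\<^sub>F n in sequentially. small e n" if "e > 0" for e
    using \<rho> that by (auto simp: delta_seq_def small_def)
  have b: "(LINT x|lborel. norm (complex_of_real (x $ k) * \<rho> n x)) \<le> e * C" if "small e n" "e > 0" for e n
  proof -
    have "(LINT x|lborel. norm (complex_of_real (x $ k) * \<rho> n x)) \<le> (LINT x|lborel. e * norm (\<rho> n x))"
    proof (rule integral_mono)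
      fix x
      show "norm (complex_of_real (x $ k) * \<rho> n x) \<le> e * norm (\<rho> n x)"
        using that component_le_norm_cart[of x k]
        by (cases "\<rho> n x = 0") (fastforce simp: norm_mult small_def intro!: mult_right_mono)+
    qed (intro integrable_norm integrable_mult_right i)+
    also have "\<dots> = e * (LINT x|lborel. norm (\<rho> n x))" by simp
    also have "\<dots> \<le> e * C" using C that by (intro mult_left_mono) auto
    finally show ?thesis .
  qed
  have cb: "norm (c n) \<le> e * C" if "small e n" "e > 0" for e n
    unfolding c_def by (rule order_trans[OF integral_norm_bound b[OF that]])
  have c0: "c \<longlonglongrightarrow> 0"
  proof (rule tendstoI)
    fix e :: real assume "e > 0"
    have "e / (2 * C) > 0" using \<open>e > 0\<close> C by simp
    from ev[OF this] show "\<forall>\<^sub>F n in sequentially. dist (c n) 0 < e"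
    proof eventually_elim
      case (elim n)
      from cb[OF this \<open>e / (2 * C) > 0\<close>] show ?case using C \<open>e > 0\<close> by simp
    qed
  qed
  \<comment> \<open>With this support radius \<open>1 + c n\<close> stays away from \<open>0\<close>; the finitely many other terms keep \<open>\<rho>\<close>.\<close>
  define e where "e = 1 / (2 * C)"
  have e: "e > 0" using C by (simp add: e_def)
  have eC: "e * C = 1 / 2" using C by (simp add: e_def)
  define \<sigma> where "\<sigma> n = (if small e n then (\<lambda>x. (1 / (1 + c n)) * (\<rho> n x + complex_of_real (x $ k) * \<rho> n x)) else \<rho> n)" for n
  have c1: "norm (1 + c n) \<ge> 1 / 2" if "small e n" for n
  proof -
    have "norm (c n) \<le> 1 / 2" using cb[OF that e] eC by simp
    then show ?thesis using norm_triangle_ineq2[of 1 "- c n"] by simp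
  qed
  have "delta_seq \<sigma>"
    unfolding delta_seq_def
  proof (intro conjI allI exI[of _ "max C (2 * (C + e * C))"] impI)
    fix n
    have t: "\<rho> n \<in> test_functions" by (rule delta_seq_test[OF \<rho>])
    show "\<sigma> n \<in> test_functions"
      unfolding \<sigma>_def using t test_functions_mult[OF smooth_const test_functions_add[OF t test_functions_mult[OF smooth_coord t]]]
      by (simp only: split: if_split) blast
    show "(LINT x|lborel. \<sigma> n x) = 1"
    proof (cases "small e n")
      case True
      then have "1 + c n \<noteq> 0" using c1[OF True] by auto
      moreover have "(LINT x|lborel. \<rho> n x) = 1" using \<rho> by (simp add: delta_seq_def)
      ultimately show ?thesis using True i
        by (simp add: \<sigma>_def c_def Bochner_Integration.integral_add)
    next
      case False then show ?thesis using \<rho> by (simp add: \<sigma>_def delta_seq_def)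
    qed
    show "(LINT x|lborel. norm (\<sigma> n x)) \<le> max C (2 * (C + e * C))"
    proof (cases "small e n")
      case True
      have "(LINT x|lborel. norm (\<sigma> n x)) \<le> (LINT x|lborel. 2 * (norm (\<rho> n x) + norm (complex_of_real (x $ k) * \<rho> n x)))"
      proof (rule integral_mono)
        show "integrable lborel (\<lambda>x. norm (\<sigma> n x))"
          using \<open>\<sigma> n \<in> test_functions\<close> by (intro integrable_norm schwartz_integrable test_functions_schwartz)
        show "integrable lborel (\<lambda>x. 2 * (norm (\<rho> n x) + norm (complex_of_real (x $ k) * \<rho> n x)))"
          by (intro integrable_mult_right Bochner_Integration.integrable_add integrable_norm i)
        fix x
        have "norm (1 + c n) > 0" using c1[OF True] by linarith
        then have "1 / norm (1 + c n) \<le> 2" using c1[OF True] by (simp add: pos_divide_le_eq)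
        then have "(1 / norm (1 + c n)) * norm (\<rho> n x + complex_of_real (x $ k) * \<rho> n x)
          \<le> 2 * (norm (\<rho> n x) + norm (complex_of_real (x $ k) * \<rho> n x))"
          by (intro mult_mono norm_triangle_ineq) auto
        then show "norm (\<sigma> n x) \<le> 2 * (norm (\<rho> n x) + norm (complex_of_real (x $ k) * \<rho> n x))"
          using True by (simp add: \<sigma>_def norm_divide)
      qed
      also have "\<dots> = 2 * ((LINT x|lborel. norm (\<rho> n x)) + (LINT x|lborel. norm (complex_of_real (x $ k) * \<rho> n x)))"
        by (simp only: integral_mult_right_zero Bochner_Integration.integral_add[OF integrable_norm[OF i(1)] integrable_norm[OF i(2)]])
      also have "\<dots> \<le> 2 * (C + e * C)"
        by (intro mult_left_mono add_mono C b[OF True e]) simp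
      finally show ?thesis by simp
    next
      case False then show ?thesis using C(2)[of n] by (simp add: \<sigma>_def le_max_iff_disj)
    qed
  next
    fix \<epsilon> :: real assume "\<epsilon> > 0"
    from ev[OF this] show "\<forall>\<^sub>F n in sequentially. \<forall>x. \<sigma> n x \<noteq> 0 \<longrightarrow> norm x < \<epsilon>"
    proof eventually_elim
      case (elim n)
      have "\<rho> n x \<noteq> 0" if "\<sigma> n x \<noteq> 0" for x using that by (auto simp: \<sigma>_def split: if_splits)
      with elim show ?case by (auto simp: small_def)
    qed
  qed
  moreover have "\<forall>\<^sub>F n in sequentially. 1 + c n \<noteq> 0 \<and> \<sigma> n = (\<lambda>x. (1 / (1 + c n)) * (\<rho> n x + complex_of_real (x $ k) * \<rho> n x))"
    using ev[OF e]
  proof eventually_elim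
    case (elim n)
    with c1[OF elim] show ?case by (auto simp: \<sigma>_def)
  qed
  ultimately show thesis using c0 that by blast
qed

text \<open>Writing \<open>y\<^sub>k = x\<^sub>k - (x - y)\<^sub>k\<close> under the regularization gives \<open>(x\<^sub>k S) * \<rho> = x\<^sub>k (S * \<rho>) - S * (x\<^sub>k \<rho>)\<close>. The
  second term disappears in the limit by comparing the product along \<open>\<rho>\<close> with the product along the perturbed
  delta sequence.\<close>

lemma is_product_coord:
  fixes S T R :: "'d::finite tdist"
  assumes P: "is_product S T R" and S: "tempered S" and T: "tempered T"
  shows "is_product (fun_times (\<lambda>x. complex_of_real (x $ k)) S) T (fun_times (\<lambda>x. complex_of_real (x $ k)) R)"
    (is "is_product (fun_times ?x S) T _")
  unfolding is_product_def
proof (intro conjI allI impI ballI)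
  show "tempered (fun_times ?x R)"
    by (rule tempered_fun_times[OF slow_coord is_product_tempered[OF P]])
  fix \<rho> :: "nat \<Rightarrow> 'd tfun" and \<phi> :: "'d tfun"
  assume \<rho>: "delta_seq \<rho>" and \<phi>: "\<phi> \<in> test_functions"
  define c where "c = (\<lambda>n. LINT x|lborel. complex_of_real (x $ k) * \<rho> n x)"
  define \<rho>' where "\<rho>' n = (\<lambda>x. ?x x * \<rho> n x)" for n
  obtain \<sigma> where \<sigma>: "delta_seq \<sigma>" and c0: "c \<longlonglongrightarrow> 0" and
    ev: "\<forall>\<^sub>F n in sequentially. 1 + c n \<noteq> 0 \<and> \<sigma> n = (\<lambda>x. (1 / (1 + c n)) * (\<rho> n x + \<rho>' n x))"
    unfolding \<rho>'_def by (rule delta_seq_perturb[OF \<rho> c_def]) blast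
  have s: "\<rho> n \<in> schwartz" for n by (rule delta_seq_schwartz[OF \<rho>])
  have s': "\<rho>' n \<in> schwartz" for n unfolding \<rho>'_def by (rule schwartz_coord[OF s])
  have m: "(\<lambda>x. mollify S f x * \<phi> x) \<in> schwartz" if "f \<in> schwartz" for f
    by (rule test_functions_schwartz[OF test_functions_mult[OF smooth_mollify[OF S that] \<phi>]])
  have x\<phi>: "(\<lambda>x. ?x x * \<phi> x) \<in> test_functions" by (rule test_functions_mult[OF smooth_coord \<phi>])
  define A where "A f = T (\<lambda>x. mollify S f x * \<phi> x)" for f
  have A: "A (\<lambda>x. d * (f x + g x)) = d * (A f + A g)" if f: "f \<in> schwartz" and g: "g \<in> schwartz" for f g d
  proof -
    have "mollify S (\<lambda>x. d * (f x + g x)) = (\<lambda>x. d * (mollify S f x + mollify S g x))"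
      unfolding mollify_cmult[OF S schwartz_add[OF f g]] mollify_add[OF S f g] ..
    then have "A (\<lambda>x. d * (f x + g x)) = T (\<lambda>x. d * (mollify S f x * \<phi> x + mollify S g x * \<phi> x))"
      by (simp add: A_def algebra_simps)
    also have "\<dots> = d * (A f + A g)"
      unfolding tempered_cmult_eq[OF T schwartz_add[OF m[OF f] m[OF g]]] tempered_add_eq[OF T m[OF f] m[OF g]] A_def ..
    finally show ?thesis .
  qed
  have R\<rho>: "(\<lambda>n. A (\<rho> n)) \<longlonglongrightarrow> R \<phi>" unfolding A_def by (rule is_productD[OF P \<rho> \<phi>])
  have "(\<lambda>n. (1 + c n) * A (\<sigma> n) - A (\<rho> n)) \<longlonglongrightarrow> (1 + 0) * R \<phi> - R \<phi>"
    using is_productD[OF P \<sigma> \<phi>] unfolding A_def[symmetric] by (intro tendsto_intros c0 R\<rho>)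
  then have "(\<lambda>n. (1 + c n) * A (\<sigma> n) - A (\<rho> n)) \<longlonglongrightarrow> 0" by simp
  moreover have "\<forall>\<^sub>F n in sequentially. (1 + c n) * A (\<sigma> n) - A (\<rho> n) = A (\<rho>' n)"
    using ev
  proof eventually_elim
    case (elim n)
    then have "A (\<sigma> n) = (1 / (1 + c n)) * (A (\<rho> n) + A (\<rho>' n))"
      by (simp only: A[OF s s'])
    with elim show ?case by simp
  qed
  ultimately have A0: "(\<lambda>n. A (\<rho>' n)) \<longlonglongrightarrow> 0"
    by (subst (asm) tendsto_cong) auto
  have eq: "T (\<lambda>x. mollify (fun_times ?x S) (\<rho> n) x * \<phi> x) = T (\<lambda>x. mollify S (\<rho> n) x * (?x x * \<phi> x)) - A (\<rho>' n)" for n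
  proof -
    have "mollify (fun_times ?x S) (\<rho> n) x = ?x x * mollify S (\<rho> n) x - mollify S (\<rho>' n) x" for x
    proof -
      have "mollify (fun_times ?x S) (\<rho> n) x = S (\<lambda>y. ?x x * \<rho> n (x - y) - \<rho>' n (x - y))"
        unfolding mollify_def fun_times_def \<rho>'_def by (simp add: algebra_simps)
      also have "\<dots> = ?x x * mollify S (\<rho> n) x - mollify S (\<rho>' n) x"
        unfolding mollify_def
        by (simp add: tempered_diff_eq[OF S] tempered_cmult_eq[OF S] schwartz_cmult schwartz_reflect_translate s s')
      finally show ?thesis .
    qed
    then have "(\<lambda>x. mollify (fun_times ?x S) (\<rho> n) x * \<phi> x) = (\<lambda>x. mollify S (\<rho> n) x * (?x x * \<phi> x) - mollify S (\<rho>' n) x * \<phi> x)"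
      by (simp only: left_diff_distrib right_diff_distrib mult_ac)
    then have "T (\<lambda>x. mollify (fun_times ?x S) (\<rho> n) x * \<phi> x) = T (\<lambda>x. mollify S (\<rho> n) x * (?x x * \<phi> x) - mollify S (\<rho>' n) x * \<phi> x)"
      by (rule arg_cong)
    also have "\<dots> = T (\<lambda>x. mollify S (\<rho> n) x * (?x x * \<phi> x)) - A (\<rho>' n)"
      unfolding A_def by (rule tempered_diff_eq[OF T test_functions_schwartz[OF mollify_test[OF S \<rho> x\<phi>]] m[OF s']])
    finally show ?thesis .
  qed
  have "(\<lambda>n. T (\<lambda>x. mollify S (\<rho> n) x * (?x x * \<phi> x)) - A (\<rho>' n)) \<longlonglongrightarrow> R (\<lambda>x. ?x x * \<phi> x) - 0"
    by (intro tendsto_diff is_productD[OF P \<rho> x\<phi>] A0)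
  then show "(\<lambda>n. T (\<lambda>x. mollify (fun_times ?x S) (\<rho> n) x * \<phi> x)) \<longlonglongrightarrow> fun_times ?x R \<phi>"
    unfolding eq by (simp add: fun_times_def)
qed

inductive polyn :: "'d::finite tfun \<Rightarrow> bool" where
  const: "polyn (\<lambda>x. c)"
| coord: "polyn (\<lambda>x. complex_of_real (x $ k))"
| add: "polyn f \<Longrightarrow> polyn g \<Longrightarrow> polyn (\<lambda>x. f x + g x)"
| mult: "polyn f \<Longrightarrow> polyn g \<Longrightarrow> polyn (\<lambda>x. f x * g x)"

lemma polyn_sum: "(\<And>i. i \<in> I \<Longrightarrow> polyn (f i)) \<Longrightarrow> polyn (\<lambda>x. \<Sum>i\<in>I. f i x)"
  by (induction I rule: infinite_finite_induct) (auto intro: polyn.intros)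

lemma polyn_prod: "(\<And>i. i \<in> I \<Longrightarrow> polyn (f i)) \<Longrightarrow> polyn (\<lambda>x. \<Prod>i\<in>I. f i x)"
  by (induction I rule: infinite_finite_induct) (auto intro: polyn.intros)

lemma polyn_power: "polyn f \<Longrightarrow> polyn (\<lambda>x. f x ^ n)"
  by (induction n) (auto intro: polyn.intros)

lemma polyn_slow: "polyn f \<Longrightarrow> slow f"
  by (induction rule: polyn.induct) (auto intro: slow_const slow_coord slow_family_add slow_family_mult)

text \<open>A polynomial may be moved from the first factor to the result, although the first factor is an
  arbitrary tempered distribution. This is what turns identities between symbols into identities
  between products.\<close>

theorem is_product_polyn:
  fixes S T R :: "'d::finite tdist"
  assumes "polyn a" and "is_product S T R" "tempered S" and T: "tempered T"
  shows "is_product (fun_times a S) T (fun_times a R)"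
  using assms(1-3)
proof (induction arbitrary: S R rule: polyn.induct)
  case (const c)
  note R = is_product_tempered[OF const(1)]
  have "is_product (\<lambda>\<phi>. c * S \<phi>) T (\<lambda>\<phi>. c * R \<phi>)" by (rule is_product_cmult[OF const T])
  then have "is_product (fun_times (\<lambda>x. c) S) T (\<lambda>\<phi>. c * R \<phi>)"
    by (simp add: is_product_cong[OF fun_times_eq_const[OF const(2)]])
  then show ?case
    by (rule is_product_cong_result) (use fun_times_eq_const[OF R] in \<open>auto simp: dist_eq_def intro: tempered_fun_times slow_const R\<close>)
next
  case (coord k)
  show ?case by (rule is_product_coord[OF coord T])
next
  case (add f g)
  note R = is_product_tempered[OF add.prems(1)] and s = polyn_slow[OF add.hyps(1)] polyn_slow[OF add.hyps(2)]
  have sum: "fun_times (\<lambda>x. f x + g x) U \<doteq> (\<lambda>\<phi>. fun_times f U \<phi> + fun_times g U \<phi>)" if U: "tempered U" for U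
    unfolding dist_eq_def fun_times_def
    by (auto simp: distrib_right tempered_add_eq[OF U] slow_mult_schwartz s)
  have "is_product (\<lambda>\<phi>. fun_times f S \<phi> + fun_times g S \<phi>) T (\<lambda>\<phi>. fun_times f R \<phi> + fun_times g R \<phi>)"
    by (intro is_product_add add.IH add.prems tempered_fun_times s T)
  then have "is_product (fun_times (\<lambda>x. f x + g x) S) T (\<lambda>\<phi>. fun_times f R \<phi> + fun_times g R \<phi>)"
    by (simp add: is_product_cong[OF sum[OF add.prems(2)]])
  then show ?case
    by (rule is_product_cong_result) (use sum[OF R] in \<open>simp_all add: dist_eq_def tempered_fun_times[OF slow_family_add[OF s] R]\<close>)
next
  case (mult f g)
  have "fun_times (\<lambda>x. f x * g x) U = fun_times g (fun_times f U)" for U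
    by (simp add: fun_times_def mult.assoc)
  then show ?case
    using mult by (simp add: tempered_fun_times polyn_slow)
qed

lemma is_product_one:
  assumes T: "tempered T"
  shows "is_product (fun_dist (\<lambda>x. 1)) T T"
  unfolding is_product_def
proof (intro conjI allI impI ballI)
  fix \<rho> :: "nat \<Rightarrow> 'a tfun" and \<phi> :: "'a tfun"
  assume \<rho>: "delta_seq \<rho>" and \<phi>: "\<phi> \<in> test_functions"
  have "mollify (fun_dist (\<lambda>x. 1)) (\<rho> n) x = 1" for n x
  proof -
    have [measurable]: "\<rho> n \<in> borel_measurable borel"
      by (rule smooth_measurable[OF schwartz_smooth[OF delta_seq_schwartz[OF \<rho>]]])
    have "mollify (fun_dist (\<lambda>x. 1)) (\<rho> n) x = (LINT y|lborel. \<rho> n y)"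
      unfolding mollify_def fun_dist_def by (subst (2) lborel_integral_affine[of _ "-1" x]) auto
    then show ?thesis using \<rho> by (simp add: delta_seq_def)
  qed
  then show "(\<lambda>n. T (\<lambda>x. mollify (fun_dist (\<lambda>x. 1)) (\<rho> n) x * \<phi> x)) \<longlonglongrightarrow> T \<phi>" by simp
qed fact

lemma mollify_fun_bounded:
  fixes h :: "'d::finite tfun"
  assumes [measurable]: "h \<in> borel_measurable borel" and b: "\<And>x. norm (h x) \<le> B" and \<rho>: "integrable lborel \<rho>"
  shows "norm (mollify (fun_dist h) \<rho> x) \<le> B * (LINT y|lborel. norm (\<rho> y))"
proof -
  have [measurable]: "\<rho> \<in> borel_measurable borel" using \<rho> by auto
  have B: "B \<ge> 0" using b[of 0] by (simp add: order_trans[OF norm_ge_zero])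
  have i: "integrable lborel (\<lambda>y. \<rho> (x - y))" using lborel_integrable_affine[OF \<rho>, of "-1" x] by simp
  have "norm (mollify (fun_dist h) \<rho> x) \<le> (LINT y|lborel. norm (h y * \<rho> (x - y)))"
    unfolding mollify_def fun_dist_def by (rule integral_norm_bound)
  also have "\<dots> \<le> (LINT y|lborel. B * norm (\<rho> (x - y)))"
  proof (rule integral_mono')
    show "integrable lborel (\<lambda>y. B * norm (\<rho> (x - y)))" by (intro integrable_mult_right integrable_norm i)
    show "norm (h y * \<rho> (x - y)) \<le> B * norm (\<rho> (x - y))" for y
      using b[of y] by (simp add: norm_mult mult_right_mono)
    show "0 \<le> B * norm (\<rho> (x - y))" for y using B by simp
  qed
  also have "\<dots> = B * (LINT y|lborel. norm (\<rho> y))"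
    by (subst (2) lborel_integral_affine[of _ "-1" x]) auto
  finally show ?thesis .
qed

text \<open>The usual approximate identity argument; positivity of \<open>\<rho>\<close> is replaced by the bound on the
  \<open>L\<^sup>1\<close> norms.\<close>

lemma mollify_fun_tendsto:
  fixes h :: "'d::finite tfun"
  assumes hm [measurable]: "h \<in> borel_measurable borel" and b: "\<And>x. norm (h x) \<le> B" and \<rho>: "delta_seq \<rho>"
    and cont: "isCont h x"
  shows "(\<lambda>n. mollify (fun_dist h) (\<rho> n) x) \<longlonglongrightarrow> h x"
proof (rule tendstoI)
  fix e :: real assume e: "e > 0"
  obtain C where C: "C > 0" "\<And>n. (LINT x|lborel. norm (\<rho> n x)) \<le> C"
    by (rule delta_seq_L1_bound[OF \<rho>]) blast
  have "e / (2 * C) > 0" using e C by simp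
  then obtain d where d: "d > 0" "\<And>y. dist y x < d \<Longrightarrow> dist (h y) (h x) < e / (2 * C)"
    using cont unfolding continuous_at_eps_delta by blast
  have "\<forall>\<^sub>F n in sequentially. \<forall>x. \<rho> n x \<noteq> 0 \<longrightarrow> norm x < d" using \<rho> d by (simp add: delta_seq_def)
  then show "\<forall>\<^sub>F n in sequentially. dist (mollify (fun_dist h) (\<rho> n) x) (h x) < e"
  proof eventually_elim
    case (elim n)
    note s = delta_seq_schwartz[OF \<rho>, of n]
    have [measurable]: "\<rho> n \<in> borel_measurable borel" by (rule smooth_measurable[OF schwartz_smooth[OF s]])
    have i: "integrable lborel (\<lambda>y. \<rho> n (x - y))" by (intro schwartz_integrable schwartz_reflect_translate s)
    have "(LINT y|lborel. \<rho> n (x - y)) = (LINT y|lborel. \<rho> n y)"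
      by (subst (2) lborel_integral_affine[of _ "-1" x]) auto
    then have one: "(LINT y|lborel. \<rho> n (x - y)) = 1" using \<rho> by (simp add: delta_seq_def)
    have hi: "integrable lborel (\<lambda>y. h y * \<rho> n (x - y))"
      by (intro tempered_fun_integrable tempered_fun_bounded[OF hm b] schwartz_reflect_translate s)
    have "mollify (fun_dist h) (\<rho> n) x - h x = (LINT y|lborel. h y * \<rho> n (x - y) - h x * \<rho> n (x - y))"
      using one hi i by (simp add: mollify_def fun_dist_def Bochner_Integration.integral_diff)
    also have "norm \<dots> \<le> (LINT y|lborel. norm (h y * \<rho> n (x - y) - h x * \<rho> n (x - y)))"
      by (rule integral_norm_bound)
    also have "\<dots> \<le> (LINT y|lborel. (e / (2 * C)) * norm (\<rho> n (x - y)))"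
    proof (rule integral_mono)
      show "integrable lborel (\<lambda>y. norm (h y * \<rho> n (x - y) - h x * \<rho> n (x - y)))"
        by (intro integrable_norm Bochner_Integration.integrable_diff hi integrable_mult_right i)
      show "integrable lborel (\<lambda>y. (e / (2 * C)) * norm (\<rho> n (x - y)))"
        by (intro integrable_mult_right integrable_norm i)
      fix y
      show "norm (h y * \<rho> n (x - y) - h x * \<rho> n (x - y)) \<le> (e / (2 * C)) * norm (\<rho> n (x - y))"
      proof (cases "\<rho> n (x - y) = 0")
        case False
        then have "norm (x - y) < d" using elim by blast
        then have "norm (h y - h x) < e / (2 * C)" using d(2)[of y] by (simp add: dist_norm norm_minus_commute)
        then have "norm (h y - h x) * norm (\<rho> n (x - y)) \<le> (e / (2 * C)) * norm (\<rho> n (x - y))"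
          by (intro mult_right_mono) auto
        then show ?thesis by (simp only: left_diff_distrib[symmetric] norm_mult)
      qed simp
    qed
    also have "\<dots> = (e / (2 * C)) * (LINT y|lborel. norm (\<rho> n (x - y)))" by (rule integral_mult_right_zero)
    also have "(LINT y|lborel. norm (\<rho> n (x - y))) = (LINT y|lborel. norm (\<rho> n y))"
      by (subst (2) lborel_integral_affine[of _ "-1" x]) auto
    also have "(e / (2 * C)) * \<dots> \<le> (e / (2 * C)) * C" using e C by (intro mult_left_mono) auto
    also have "\<dots> < e" using e C by simp
    finally show ?case by (simp add: dist_norm)
  qed
qed

text \<open>When the second factor is a function, the product with a bounded function that is continuous off the
  origin is the pointwise one, by dominated convergence: the origin is a null set.\<close>

lemma is_product_fun:
  fixes h g :: "'d::finite tfun"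
  assumes hm [measurable]: "h \<in> borel_measurable borel" and b: "\<And>x. norm (h x) \<le> B"
    and cont: "\<And>x. x \<noteq> 0 \<Longrightarrow> isCont h x"
    and g: "tempered_fun g" and T: "T \<doteq> fun_dist g"
  shows "is_product (fun_dist h) T (fun_dist (\<lambda>x. h x * g x))"
  unfolding is_product_def
proof (intro conjI allI impI ballI)
  have [measurable]: "g \<in> borel_measurable borel" using g by (simp add: tempered_fun_def)
  have "tempered_fun (\<lambda>x. h x * g x)"
    by (rule tempered_fun_mono[OF g, of _ B 0]) (use b in \<open>auto simp: norm_mult intro!: mult_right_mono\<close>)
  then show "tempered (fun_dist (\<lambda>x. h x * g x))" by (rule tempered_fun_dist)
  fix \<rho> :: "nat \<Rightarrow> 'd tfun" and \<phi> :: "'d tfun"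
  assume \<rho>: "delta_seq \<rho>" and \<phi>: "\<phi> \<in> test_functions"
  obtain C where C: "C > 0" "\<And>n. (LINT x|lborel. norm (\<rho> n x)) \<le> C"
    by (rule delta_seq_L1_bound[OF \<rho>]) blast
  have B: "B \<ge> 0" using b[of 0] by (simp add: order_trans[OF norm_ge_zero])
  have th: "tempered (fun_dist h)" by (intro tempered_fun_dist tempered_fun_bounded[OF hm b])
  note ms = smooth_mollify[OF th delta_seq_schwartz[OF \<rho>]]
  have [measurable]: "mollify (fun_dist h) (\<rho> n) \<in> borel_measurable borel" for n by (rule smooth_measurable[OF ms])
  have [measurable]: "\<phi> \<in> borel_measurable borel" by (rule smooth_measurable[OF schwartz_smooth[OF test_functions_schwartz[OF \<phi>]]])
  have "(\<lambda>n. LINT x|lborel. g x * (mollify (fun_dist h) (\<rho> n) x * \<phi> x)) \<longlonglongrightarrow> (LINT x|lborel. h x * g x * \<phi> x)"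
  proof (rule integral_dominated_convergence)
    show "integrable lborel (\<lambda>x. B * C * norm (g x * \<phi> x))"
      by (intro integrable_mult_right integrable_norm tempered_fun_integrable g test_functions_schwartz \<phi>)
    have "AE x in lborel. x \<noteq> (0::real^'d)" by (rule AE_lborel_singleton)
    then show "AE x in lborel. (\<lambda>n. g x * (mollify (fun_dist h) (\<rho> n) x * \<phi> x)) \<longlonglongrightarrow> h x * g x * \<phi> x"
    proof eventually_elim
      case (elim x)
      have "(\<lambda>n. g x * (mollify (fun_dist h) (\<rho> n) x * \<phi> x)) \<longlonglongrightarrow> g x * (h x * \<phi> x)"
        by (intro tendsto_intros mollify_fun_tendsto[OF hm b \<rho> cont[OF elim]])
      then show ?case by (simp add: mult_ac)
    qed
    show "AE x in lborel. norm (g x * (mollify (fun_dist h) (\<rho> n) x * \<phi> x)) \<le> B * C * norm (g x * \<phi> x)" for n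
    proof (rule AE_I2)
      fix x
      have "norm (mollify (fun_dist h) (\<rho> n) x) \<le> B * (LINT y|lborel. norm (\<rho> n y))"
        by (rule mollify_fun_bounded[OF hm b schwartz_integrable[OF delta_seq_schwartz[OF \<rho>]]])
      also have "\<dots> \<le> B * C" using B C by (intro mult_left_mono) auto
      finally have "norm (mollify (fun_dist h) (\<rho> n) x) * norm (g x * \<phi> x) \<le> B * C * norm (g x * \<phi> x)"
        by (intro mult_right_mono) auto
      then show "norm (g x * (mollify (fun_dist h) (\<rho> n) x * \<phi> x)) \<le> B * C * norm (g x * \<phi> x)"
        by (simp add: norm_mult mult_ac)
    qed
  qed measurable
  moreover have "T (\<lambda>x. mollify (fun_dist h) (\<rho> n) x * \<phi> x) = (LINT x|lborel. g x * (mollify (fun_dist h) (\<rho> n) x * \<phi> x))" for n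
    using T test_functions_schwartz[OF mollify_test[OF th \<rho> \<phi>]] by (simp add: dist_eq_def fun_dist_def)
  ultimately show "(\<lambda>n. T (\<lambda>x. mollify (fun_dist h) (\<rho> n) x * \<phi> x)) \<longlonglongrightarrow> fun_dist (\<lambda>x. h x * g x) \<phi>"
    by (simp add: fun_dist_def)
qed

section \<open>Square integrable functions\<close>

definition L2 :: "'d::finite tfun \<Rightarrow> bool" where
  "L2 f \<longleftrightarrow> f \<in> borel_measurable borel \<and> integrable lborel (\<lambda>x. (norm (f x))\<^sup>2)"

definition sqnorm :: "'d::finite tfun \<Rightarrow> real" where
  "sqnorm f = (LINT x|lborel. (norm (f x))\<^sup>2)"

lemma sqnorm_nonneg: "0 \<le> sqnorm f"
  by (simp add: sqnorm_def)

lemma L2_measurable [measurable_dest]: "L2 f \<Longrightarrow> f \<in> borel_measurable borel"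
  by (simp add: L2_def)

lemma L2_mono:
  assumes f: "L2 f" and g: "g \<in> borel_measurable borel" and b: "\<And>x. norm (g x) \<le> C * norm (f x)"
  shows "L2 g"
  unfolding L2_def
proof
  show "integrable lborel (\<lambda>x. (norm (g x))\<^sup>2)"
  proof (rule Bochner_Integration.integrable_bound)
    show "integrable lborel (\<lambda>x. C\<^sup>2 * (norm (f x))\<^sup>2)" using f by (simp add: L2_def)
    show "AE x in lborel. norm ((norm (g x))\<^sup>2) \<le> norm (C\<^sup>2 * (norm (f x))\<^sup>2)"
      using b by (auto simp: power_mult_distrib[symmetric] intro!: power_mono)
  qed (use g in measurable)
qed fact

lemma sqnorm_mono:
  assumes "L2 f" "g \<in> borel_measurable borel" "\<And>x. norm (g x) \<le> norm (f x)"
  shows "sqnorm g \<le> sqnorm f"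
  unfolding sqnorm_def using assms L2_mono[OF assms(1,2), of 1]
  by (intro integral_mono power_mono) (auto simp: L2_def)

lemma norm_add_square: "(norm (a + b :: complex))\<^sup>2 \<le> 2 * (norm a)\<^sup>2 + 2 * (norm b)\<^sup>2"
proof -
  have "(norm (a + b))\<^sup>2 \<le> (norm a + norm b)\<^sup>2" by (intro power_mono norm_triangle_ineq) auto
  also have "\<dots> \<le> 2 * (norm a)\<^sup>2 + 2 * (norm b)\<^sup>2"
    using sum_squares_bound[of "norm a" "norm b"] by (simp add: power2_sum)
  finally show ?thesis .
qed

lemma L2_add:
  assumes f: "L2 f" and g: "L2 g"
  shows "L2 (\<lambda>x. f x + g x)" "sqnorm (\<lambda>x. f x + g x) \<le> 2 * sqnorm f + 2 * sqnorm g"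
proof -
  have [measurable]: "f \<in> borel_measurable borel" "g \<in> borel_measurable borel" using f g by (auto simp: L2_def)
  have i: "integrable lborel (\<lambda>x. 2 * (norm (f x))\<^sup>2 + 2 * (norm (g x))\<^sup>2)"
    using f g by (simp add: L2_def)
  have i': "integrable lborel (\<lambda>x. (norm (f x + g x))\<^sup>2)"
    by (rule Bochner_Integration.integrable_bound[OF i]) (use norm_add_square in \<open>auto intro: order_trans[OF _ abs_ge_self]\<close>)
  then show "L2 (\<lambda>x. f x + g x)" by (simp add: L2_def)
  have "sqnorm (\<lambda>x. f x + g x) \<le> (LINT x|lborel. 2 * (norm (f x))\<^sup>2 + 2 * (norm (g x))\<^sup>2)"
    unfolding sqnorm_def by (rule integral_mono[OF i' i norm_add_square])
  also have "\<dots> = 2 * sqnorm f + 2 * sqnorm g"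
    using f g by (simp add: sqnorm_def L2_def)
  finally show "sqnorm (\<lambda>x. f x + g x) \<le> 2 * sqnorm f + 2 * sqnorm g" .
qed

lemma L2_cmult: "L2 f \<Longrightarrow> L2 (\<lambda>x. c * f x)"
  by (rule L2_mono[of f _ "norm c"]) (auto simp: norm_mult)

lemma L2_cnj: "L2 f \<Longrightarrow> L2 (\<lambda>x. cnj (f x))"
  by (rule L2_mono[of f _ 1]) (auto intro: borel_measurable_continuous_on[OF continuous_on_cnj[OF continuous_on_id]])

lemma L2_diff: "L2 f \<Longrightarrow> L2 g \<Longrightarrow> L2 (\<lambda>x. f x - g x)"
  using L2_add(1)[of f "\<lambda>x. -1 * g x"] L2_cmult[of g "-1"] by simp

lemma L2_sum: "(\<And>i. i \<in> I \<Longrightarrow> L2 (f i)) \<Longrightarrow> L2 (\<lambda>x. \<Sum>i\<in>I. f i x)"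
proof (induction I rule: infinite_finite_induct)
  case (insert i I)
  then show ?case by (simp add: L2_add(1))
qed (auto simp: L2_def)

lemma L2_mult_integrable:
  assumes f: "L2 f" and g: "L2 g"
  shows "integrable lborel (\<lambda>x. f x * g x)"
proof (rule Bochner_Integration.integrable_bound)
  have [measurable]: "f \<in> borel_measurable borel" "g \<in> borel_measurable borel" using f g by (auto simp: L2_def)
  show "integrable lborel (\<lambda>x. (norm (f x))\<^sup>2 + (norm (g x))\<^sup>2)" using f g by (simp add: L2_def)
  show "(\<lambda>x. f x * g x) \<in> borel_measurable lborel" by measurable
  show "AE x in lborel. norm (f x * g x) \<le> norm ((norm (f x))\<^sup>2 + (norm (g x))\<^sup>2)"
  proof (rule AE_I2)
    fix x
    have "norm (f x) * norm (g x) \<le> 2 * norm (f x) * norm (g x)" by simp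
    also have "\<dots> \<le> (norm (f x))\<^sup>2 + (norm (g x))\<^sup>2" by (rule sum_squares_bound)
    finally show "norm (f x * g x) \<le> norm ((norm (f x))\<^sup>2 + (norm (g x))\<^sup>2)" by (simp add: norm_mult)
  qed
qed

lemma L2_Cauchy_Schwarz:
  assumes f: "L2 f" and g: "L2 g"
  shows "(LINT x|lborel. norm (f x * g x)) \<le> sqrt (sqnorm f * sqnorm g)"
proof -
  have [measurable]: "f \<in> borel_measurable borel" "g \<in> borel_measurable borel" using f g by (auto simp: L2_def)
  let ?I = "LINT x|lborel. norm (f x * g x)"
  have "ennreal (?I\<^sup>2) = (\<integral>\<^sup>+x. ennreal (norm (f x)) * ennreal (norm (g x)) \<partial>lborel)\<^sup>2"
    using nn_integral_eq_integral[OF integrable_norm[OF L2_mult_integrable[OF f g]]]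
    by (simp add: norm_mult ennreal_mult ennreal_power[symmetric])
  also have "\<dots> \<le> (\<integral>\<^sup>+x. ennreal (norm (f x)) ^ 2 \<partial>lborel) * (\<integral>\<^sup>+x. ennreal (norm (g x)) ^ 2 \<partial>lborel)"
    by (rule Cauchy_Schwarz_nn_integral) auto
  also have "\<dots> = ennreal (sqnorm f * sqnorm g)"
    using f g by (simp add: ennreal_power nn_integral_eq_integral L2_def sqnorm_def ennreal_mult)
  finally have "?I\<^sup>2 \<le> sqnorm f * sqnorm g"
    by (simp add: mult_nonneg_nonneg sqnorm_nonneg)
  then show ?thesis by (rule real_le_rsqrt)
qed

text \<open>Passage to the limit in a product of two sequences that converge in the mean.\<close>

lemma L2_limit_product:
  assumes f: "L2 f" "\<And>n. L2 (F n)" "(\<lambda>n. sqnorm (\<lambda>x. f x - F n x)) \<longlonglongrightarrow> 0"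
    and g: "L2 g" "\<And>n. L2 (G n)" "(\<lambda>n. sqnorm (\<lambda>x. g x - G n x)) \<longlonglongrightarrow> 0"
  shows "(\<lambda>n. LINT x|lborel. F n x * G n x) \<longlonglongrightarrow> (LINT x|lborel. f x * g x)"
proof -
  let ?a = "\<lambda>n. sqnorm (\<lambda>x. f x - F n x)" and ?b = "\<lambda>n. sqnorm (\<lambda>x. g x - G n x)"
  define u where "u n = sqrt (?a n * (2 * sqnorm g + 2 * ?b n)) + sqrt (sqnorm f * ?b n)" for n
  have df: "L2 (\<lambda>x. f x - F n x)" and dg: "L2 (\<lambda>x. g x - G n x)" for n
    by (intro L2_diff f g)+
  have *: "norm ((LINT x|lborel. f x * g x) - (LINT x|lborel. F n x * G n x)) \<le> u n" for n
  proof -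
    have "(LINT x|lborel. f x * g x) - (LINT x|lborel. F n x * G n x)
      = (LINT x|lborel. (f x - F n x) * G n x + f x * (g x - G n x))"
      by (subst Bochner_Integration.integral_diff[symmetric]) (auto intro: L2_mult_integrable f g simp: algebra_simps)
    also have "\<dots> = (LINT x|lborel. (f x - F n x) * G n x) + (LINT x|lborel. f x * (g x - G n x))"
      by (intro Bochner_Integration.integral_add L2_mult_integrable df dg f g)
    also have "norm \<dots> \<le> (LINT x|lborel. norm ((f x - F n x) * G n x)) + (LINT x|lborel. norm (f x * (g x - G n x)))"
      by (intro norm_triangle_le add_mono integral_norm_bound)
    also have "\<dots> \<le> sqrt (?a n * sqnorm (G n)) + sqrt (sqnorm f * ?b n)"
      by (intro add_mono L2_Cauchy_Schwarz df dg f g)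
    also have "\<dots> \<le> u n"
    proof -
      have "sqnorm (G n) = sqnorm (\<lambda>x. g x + (-1) * (g x - G n x))" by simp
      also have "\<dots> \<le> 2 * sqnorm g + 2 * sqnorm (\<lambda>x. (-1) * (g x - G n x))"
        by (intro L2_add g L2_cmult dg)
      also have "sqnorm (\<lambda>x. (-1) * (g x - G n x)) = ?b n" by (simp add: sqnorm_def norm_minus_commute)
      finally show ?thesis unfolding u_def
        by (intro add_right_mono real_sqrt_le_mono mult_left_mono sqnorm_nonneg)
    qed
    finally show ?thesis .
  qed
  have "u \<longlonglongrightarrow> sqrt (0 * (2 * sqnorm g + 2 * 0)) + sqrt (sqnorm f * 0)"
    unfolding u_def[abs_def] by (intro tendsto_intros f g)
  then have u: "u \<longlonglongrightarrow> 0" by simp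
  have "(\<lambda>n. (LINT x|lborel. F n x * G n x) - (LINT x|lborel. f x * g x)) \<longlonglongrightarrow> 0"
    by (rule Lim_null_comparison[OF always_eventually[OF allI] u]) (subst norm_minus_commute, rule *)
  then show ?thesis by (rule LIM_zero_cancel)
qed

lemma L2_tempered_fun:
  fixes f :: "'d::finite tfun"
  assumes f: "L2 f" shows "tempered_fun f"
proof -
  have [measurable]: "f \<in> borel_measurable borel" using f by (simp add: L2_def)
  have "L2 (\<lambda>x::real^'d. complex_of_real (1 / (1 + norm x) ^ (2 * CARD('d))))"
    unfolding L2_def
  proof
    have "(norm (complex_of_real (1 / (1 + norm x) ^ (2 * CARD('d)))))\<^sup>2 = 1 / (1 + norm x) ^ (2 * (2 * CARD('d)))" for x :: "real^'d"
      by (simp add: norm_divide norm_power power_divide mult.commute power_mult[symmetric] del: of_real_power of_real_add)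
    moreover have "integrable lborel (\<lambda>x::real^'d. 1 / (1 + norm x) ^ (2 * (2 * CARD('d))))"
      by (rule integrable_weight) simp
    ultimately show "integrable lborel (\<lambda>x::real^'d. (norm (complex_of_real (1 / (1 + norm x) ^ (2 * CARD('d)))))\<^sup>2)"
      by simp
  qed measurable
  from L2_mult_integrable[OF f this] show ?thesis
    by (auto simp: tempered_fun_def divide_inverse)
qed

lemma schwartz_L2:
  assumes f: "f \<in> schwartz" shows "L2 f"
  unfolding L2_def
proof
  show m [measurable]: "f \<in> borel_measurable borel" by (rule smooth_measurable[OF schwartz_smooth[OF f]])
  show "integrable lborel (\<lambda>x. (norm (f x))\<^sup>2)"
  proof (rule Bochner_Integration.integrable_bound)
    show "integrable lborel (\<lambda>x. schwartz_seminorm 0 f * norm (f x))"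
      by (intro integrable_mult_right integrable_norm schwartz_integrable f)
    show "AE x in lborel. norm ((norm (f x))\<^sup>2) \<le> norm (schwartz_seminorm 0 f * norm (f x))"
    proof (rule AE_I2)
      fix x
      have "norm (f x) * norm (f x) \<le> schwartz_seminorm 0 f * norm (f x)"
        using schwartz_bound0[OF f, of 0 0 x] by (intro mult_right_mono) auto
      then show "norm ((norm (f x))\<^sup>2) \<le> norm (schwartz_seminorm 0 f * norm (f x))"
        using schwartz_seminorm_nonneg[OF f, of 0] by (simp add: power2_eq_square)
    qed
  qed measurable
qed

subsection \<open>A function orthogonal to all test functions vanishes\<close>

lemma L2_indicator_box: 
  fixes a b :: "real^'d::finite"
  shows "L2 (\<lambda>x. indicator (box a b) x)"
proof -
  have "integrable lborel (indicat_real (box a b))" by (rule integrable_real_indicator) (auto simp: emeasure_lborel_box_eq)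
  moreover have "(\<lambda>x. (norm (indicator (box a b) x :: complex))\<^sup>2) = indicat_real (box a b)"
    by (auto simp: indicator_def)
  ultimately show ?thesis by (simp add: L2_def)
qed

text \<open>The bumps \<open>box_bump n a b\<close> are test functions that converge boundedly to the indicator of the box.\<close>

lemma integral_box_eq_0:
  fixes h :: "'d::finite tfun"
  assumes h: "L2 h" and 0: "\<And>\<phi>. \<phi> \<in> test_functions \<Longrightarrow> (LINT x|lborel. h x * \<phi> x) = 0"
  shows "(LINT x|lborel. h x * indicator (box a b) x) = 0"
proof -
  have [measurable]: "h \<in> borel_measurable borel" using h by (simp add: L2_def)
  have [measurable]: "box_bump (real (Suc n)) a b \<in> borel_measurable borel" for n
    by (rule smooth_measurable[OF smooth_box_bump])
  have "(\<lambda>n. LINT x|lborel. h x * box_bump (real (Suc n)) a b x) \<longlonglongrightarrow> (LINT x|lborel. h x * indicator (box a b) x)"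
  proof (rule integral_dominated_convergence)
    show "integrable lborel (\<lambda>x. norm (h x * indicator (box a b) x))"
      by (intro integrable_norm L2_mult_integrable h L2_indicator_box)
    show "AE x in lborel. (\<lambda>n. h x * box_bump (real (Suc n)) a b x) \<longlonglongrightarrow> h x * indicator (box a b) x"
      by (intro AE_I2 tendsto_intros box_bump_tendsto)
    show "AE x in lborel. norm (h x * box_bump (real (Suc n)) a b x) \<le> norm (h x * indicator (box a b) x)" for n
    proof (rule AE_I2)
      fix x
      have "norm (box_bump (real (Suc n)) a b x) \<le> norm (indicator (box a b) x :: complex)"
      proof (cases "x \<in> box a b")
        case True
        then show ?thesis by (simp add: box_bump_def abs_of_nonneg box_real_nonneg box_real_le_1)
      next
        case False
        then have "box_real (real (Suc n)) a b x = 0"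
          using box_real_nonzero[of "real (Suc n)" a b x] by (auto simp: mem_box_cart)
        then show ?thesis by (simp add: box_bump_def)
      qed
      then show "norm (h x * box_bump (real (Suc n)) a b x) \<le> norm (h x * indicator (box a b) x)"
        unfolding norm_mult by (intro mult_left_mono) auto
    qed
  qed measurable
  moreover have "(LINT x|lborel. h x * box_bump (real (Suc n)) a b x) = 0" for n
    by (rule 0[OF box_bump_test]) simp
  ultimately show ?thesis by (simp add: LIMSEQ_const_iff)
qed

text \<open>The integrals over boxes vanish, hence over all Borel sets, since boxes are closed under intersection and
  generate the Borel sets.\<close>

lemma L2_eq_0_AE:
  fixes h :: "'d::finite tfun"
  assumes h: "L2 h" and 0: "\<And>\<phi>. \<phi> \<in> test_functions \<Longrightarrow> (LINT x|lborel. h x * \<phi> x) = 0"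
  shows "AE x in lborel. h x = 0"
proof -
  have *: "AE x in lborel. h x * indicator (box a b) x = 0" for a b :: "real^'d"
  proof (rule sigma_finite_measure.density_zero[OF lborel.sigma_finite_measure_axioms])
    let ?f = "\<lambda>x. h x * indicator (box a b) x"
    show i: "integrable lborel ?f" by (intro L2_mult_integrable h L2_indicator_box)
    have si: "set_integrable lborel A ?f" if "A \<in> sets borel" for A
      using that i unfolding set_integrable_def by (intro integrable_mult_indicator) auto
    fix A :: "(real^'d) set" assume "A \<in> sets lborel"
    then have Asig: "A \<in> sigma_sets UNIV (range (\<lambda>(a, b). box a b))" by (simp add: borel_eq_box)
    have "Int_stable (range (\<lambda>(a, b). box a b :: (real^'d) set))"
      by (auto simp: Int_stable_def box_Int_box)
    moreover have "range (\<lambda>(a, b). box a b :: (real^'d) set) \<subseteq> Pow UNIV" by auto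
    ultimately show "set_lebesgue_integral lborel A ?f = 0"
      using Asig
    proof (induction rule: sigma_sets_induct_disjoint)
      case (basic A)
      then obtain c d where A: "A = box c d" by auto
      obtain a' b' where ab: "box c d \<inter> box a b = box a' b'" unfolding box_Int_box by blast
      have "(LINT x|lborel. indicator A x *\<^sub>R ?f x) = (LINT x|lborel. h x * indicator (box a' b') x)"
        unfolding A ab[symmetric] by (intro Bochner_Integration.integral_cong refl) (auto simp: indicator_def)
      then show ?case unfolding set_lebesgue_integral_def using integral_box_eq_0[OF h 0] by simp
    next
      case empty
      then show ?case by (simp add: set_lebesgue_integral_def)
    next
      case (compl A)
      then have [measurable]: "A \<in> sets borel" by (simp add: borel_eq_box)
      have "(LINT x|lborel. indicator (UNIV - A) x *\<^sub>R ?f x) = (LINT x|lborel. ?f x - indicator A x *\<^sub>R ?f x)"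
        by (intro Bochner_Integration.integral_cong refl) (auto simp: indicator_def)
      also have "\<dots> = (LINT x|lborel. ?f x) - (LINT x|lborel. indicator A x *\<^sub>R ?f x)"
        using i si[of A] by (intro Bochner_Integration.integral_diff) (auto simp: set_integrable_def)
      also have "\<dots> = 0"
        using compl.IH integral_box_eq_0[OF h 0, of a b] by (simp add: set_lebesgue_integral_def)
      finally show ?case by (simp add: set_lebesgue_integral_def)
    next
      case (union A)
      then have [measurable]: "A i \<in> sets borel" for i by (simp add: borel_eq_box subset_eq)
      have "set_lebesgue_integral lborel (\<Union>i. A i) ?f = (\<Sum>i. set_lebesgue_integral lborel (A i) ?f)"
      proof (rule lebesgue_integral_countable_add)
        show "\<And>i. A i \<in> sets lborel" by simp
        show "\<And>i j. i \<noteq> j \<Longrightarrow> A i \<inter> A j = {}" using union(1) by (auto simp: disjoint_family_on_def)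
        show "set_integrable lborel (\<Union>i. A i) ?f" by (rule si) auto
      qed
      then show ?case using union by simp
    qed
  qed
  have "AE x in lborel. \<forall>n. h x * indicator (box (\<chi> k. - real n) (\<chi> (k::'d). real n)) x = 0"
    unfolding AE_all_countable using * by blast
  then show ?thesis
  proof eventually_elim
    case (elim x)
    obtain n where n: "norm x < real n" using reals_Archimedean2 by blast
    have "x \<in> box (\<chi> k. - real n) (\<chi> (k::'d). real n)"
    proof -
      have "\<bar>x $ k\<bar> < real n" for k using component_le_norm_cart[of x k] n by simp
      then show ?thesis by (simp add: mem_box_cart abs_less_iff minus_less_iff)
    qed
    with elim[rule_format, of n] show ?case by simp
  qed
qed

section \<open>The Fourier transform of square integrable functions\<close>

lemma norm_integral_le_nn: "ennreal (norm (LINT x|M. f x)) \<le> (\<integral>\<^sup>+x. ennreal (norm (f x)) \<partial>M)"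
  for f :: "_ \<Rightarrow> complex"
proof (cases "integrable M f")
  case True then show ?thesis by (rule integral_norm_bound_ennreal)
next
  case False then show ?thesis by (simp add: not_integrable_integral_eq)
qed

lemma gauss_nn_integral:
  assumes e: "\<epsilon> > 0"
  shows "(\<integral>\<^sup>+y. ennreal (gauss \<epsilon> (y - x)) \<partial>lborel) = 1" "(\<integral>\<^sup>+y. ennreal (gauss \<epsilon> (x - y)) \<partial>lborel) = 1"
proof -
  have i: "integrable lborel (gauss \<epsilon> :: real^'a \<Rightarrow> real)"
    using integrable_Re[OF gauss_integrable[OF e]] by simp
  have *: "(\<integral>\<^sup>+y. ennreal (gauss \<epsilon> (a + c *\<^sub>R y)) \<partial>lborel) = 1" if c: "\<bar>c\<bar> = 1" for a :: "real^'a" and c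
  proof -
    have "c \<noteq> 0" using c by auto
    then have "integrable lborel (\<lambda>y. gauss \<epsilon> (a + c *\<^sub>R y))"
      by (rule lborel_integrable_affine[OF i])
    then have "(\<integral>\<^sup>+y. ennreal (gauss \<epsilon> (a + c *\<^sub>R y)) \<partial>lborel) = ennreal (LINT y|lborel. gauss \<epsilon> (a + c *\<^sub>R y))"
      by (rule nn_integral_eq_integral) (simp add: gauss_nonneg)
    also have "(LINT y|lborel. gauss \<epsilon> (a + c *\<^sub>R y)) = (LINT y|lborel. gauss \<epsilon> (y::real^'a))"
      using lborel_integral_affine[OF gauss_measurable \<open>c \<noteq> 0\<close>, of \<epsilon> a] c by simp
    finally show ?thesis using gauss_integral[OF e] by simp
  qed
  show "(\<integral>\<^sup>+y. ennreal (gauss \<epsilon> (y - x)) \<partial>lborel) = 1" using *[of 1 "- x"] by simp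
  show "(\<integral>\<^sup>+y. ennreal (gauss \<epsilon> (x - y)) \<partial>lborel) = 1" using *[of "-1" x] by simp
qed

text \<open>Young's inequality for the Gaussian kernel, from \<open>2 s t \<le> s\<^sup>2 + t\<^sup>2\<close>.\<close>

lemma gauss_quadratic_form_le:
  fixes f :: "'d::finite tfun"
  assumes f: "L2 f" and e: "\<epsilon> > 0"
  shows "(\<integral>\<^sup>+x. \<integral>\<^sup>+y. ennreal (norm (f x) * (norm (f y) * gauss \<epsilon> (y - x))) \<partial>lborel \<partial>lborel) \<le> ennreal (sqnorm f)"
proof -
  have [measurable]: "f \<in> borel_measurable borel" using f by (simp add: L2_def)
  define F where "F x = ennreal ((norm (f x))\<^sup>2)" for x
  have [measurable]: "F \<in> borel_measurable borel" unfolding F_def by measurable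
  have F: "(\<integral>\<^sup>+x. F x \<partial>lborel) = ennreal (sqnorm f)"
    using f by (simp add: F_def L2_def sqnorm_def nn_integral_eq_integral)
  have gm [measurable]: "(\<lambda>p. gauss \<epsilon> (snd p - fst p)) \<in> borel_measurable (lborel \<Otimes>\<^sub>M (lborel :: (real^'d) measure))"
    by measurable
  let ?g = "\<lambda>x y. ennreal (gauss \<epsilon> (y - x))"
  \<comment> \<open>Arithmetic and geometric mean; each of the two terms integrates to the square norm.\<close>
  have pt: "2 * ennreal (norm (f x) * (norm (f y) * gauss \<epsilon> (y - x))) \<le> F x * ?g x y + F y * ?g x y" for x y
  proof -
    have "2 * norm (f x) * norm (f y) * gauss \<epsilon> (y - x) \<le> ((norm (f x))\<^sup>2 + (norm (f y))\<^sup>2) * gauss \<epsilon> (y - x)"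
      by (intro mult_right_mono sum_squares_bound gauss_nonneg)
    then have "ennreal (2 * (norm (f x) * (norm (f y) * gauss \<epsilon> (y - x)))) \<le> ennreal ((norm (f x))\<^sup>2 * gauss \<epsilon> (y - x) + (norm (f y))\<^sup>2 * gauss \<epsilon> (y - x))"
      by (intro ennreal_leI) (simp add: algebra_simps)
    then show ?thesis
      by (simp add: F_def ennreal_mult gauss_nonneg ennreal_plus)
  qed
  have "2 * (\<integral>\<^sup>+x. \<integral>\<^sup>+y. ennreal (norm (f x) * (norm (f y) * gauss \<epsilon> (y - x))) \<partial>lborel \<partial>lborel)
     = (\<integral>\<^sup>+x. \<integral>\<^sup>+y. 2 * ennreal (norm (f x) * (norm (f y) * gauss \<epsilon> (y - x))) \<partial>lborel \<partial>lborel)"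
    by (subst nn_integral_cmult[symmetric], measurable) (subst nn_integral_cmult[symmetric], measurable)
  also have "\<dots> \<le> (\<integral>\<^sup>+x. \<integral>\<^sup>+y. F x * ?g x y + F y * ?g x y \<partial>lborel \<partial>lborel)"
    by (intro nn_integral_mono pt)
  also have "\<dots> = (\<integral>\<^sup>+x. (\<integral>\<^sup>+y. F x * ?g x y \<partial>lborel) + (\<integral>\<^sup>+y. F y * ?g x y \<partial>lborel) \<partial>lborel)"
    by (intro nn_integral_cong nn_integral_add) measurable
  also have "\<dots> = (\<integral>\<^sup>+x. \<integral>\<^sup>+y. F x * ?g x y \<partial>lborel \<partial>lborel) + (\<integral>\<^sup>+x. \<integral>\<^sup>+y. F y * ?g x y \<partial>lborel \<partial>lborel)"
    by (intro nn_integral_add) measurable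
  also have "(\<integral>\<^sup>+x. \<integral>\<^sup>+y. F x * ?g x y \<partial>lborel \<partial>lborel) = ennreal (sqnorm f)"
    by (simp add: nn_integral_cmult gauss_nn_integral[OF e] F)
  also have "(\<integral>\<^sup>+x. \<integral>\<^sup>+y. F y * ?g x y \<partial>lborel \<partial>lborel) = (\<integral>\<^sup>+y. \<integral>\<^sup>+x. F y * ?g x y \<partial>lborel \<partial>lborel)"
    by (rule lborel_pair.Fubini'[symmetric]) measurable
  also have "\<dots> = ennreal (sqnorm f)"
    by (simp add: nn_integral_cmult gauss_nn_integral[OF e] F)
  also have "ennreal (sqnorm f) + ennreal (sqnorm f) = 2 * ennreal (sqnorm f)" by (simp add: mult_2)
  finally show ?thesis
    by (subst (asm) ennreal_mult_le_mult_iff) auto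
qed

lemma fourier_cnj: "cnj (fourier f \<omega>) = fourier (\<lambda>x. cnj (f x)) (- \<omega>)"
  unfolding fourier_def by (subst Bochner_Integration.integral_cnj[symmetric]) (simp add: exp_cnj)

text \<open>The transform of the regularized conjugate is a Gaussian convolution, by two exchanges of
  integration.\<close>

lemma fourier_cnj_gcut:
  fixes f :: "'d::finite tfun"
  assumes f: "integrable lborel f" and e: "\<epsilon> > 0"
  shows "fourier (\<lambda>\<omega>. cnj (fourier f \<omega>) * complex_of_real (gcut \<epsilon> \<omega>)) x
    = complex_of_real ((2 * pi) ^ CARD('d)) * (LINT y|lborel. cnj (f y) * complex_of_real (gauss \<epsilon> (y - x)))"
proof -
  have [measurable]: "f \<in> borel_measurable borel" using f by auto
  have [measurable]: "(\<lambda>\<omega>. exp (\<i> * complex_of_real (x \<bullet> \<omega>))) \<in> borel_measurable borel"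
    by (intro borel_measurable_continuous_onI continuous_intros)
  have fc: "integrable lborel (\<lambda>x. cnj (f x))" using f by simp
  have [measurable]: "(\<lambda>x. cnj (f x)) \<in> borel_measurable borel"
    using borel_measurable_integrable[OF fc] by simp
  have gc: "gcut \<epsilon> (- \<omega>) = gcut \<epsilon> \<omega>" for \<omega> :: "real^'d" by (simp add: gcut_def)
  have "fourier (\<lambda>\<omega>. cnj (fourier f \<omega>) * complex_of_real (gcut \<epsilon> \<omega>)) x
    = (LINT \<omega>|lborel. fourier (\<lambda>x. cnj (f x)) (- \<omega>) * (exp (\<i> * complex_of_real (x \<bullet> \<omega>)) * complex_of_real (gcut \<epsilon> \<omega>)))"
    unfolding fourier_cnj by (simp add: fourier_def mult_ac)
  also have "\<dots> = (LINT \<omega>|lborel. fourier (\<lambda>x. cnj (f x)) \<omega> * (exp (- \<i> * complex_of_real (\<omega> \<bullet> x)) * complex_of_real (gcut \<epsilon> \<omega>)))"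
    by (subst lborel_integral_affine[of _ "-1" 0]) (auto simp: gc inner_commute)
  also have "\<dots> = (LINT y|lborel. cnj (f y) * complex_of_real ((2 * pi) ^ CARD('d) * gauss \<epsilon> (y - x)))"
    unfolding fourier_swap[OF fc modulated_gcut_integrable[OF e]] fourier_modulated_gcut[OF e] ..
  also have "\<dots> = complex_of_real ((2 * pi) ^ CARD('d)) * (LINT y|lborel. cnj (f y) * complex_of_real (gauss \<epsilon> (y - x)))"
    unfolding integral_mult_right_zero[symmetric]
    by (intro Bochner_Integration.integral_cong refl) (simp only: of_real_mult mult_ac)
  finally show ?thesis .
qed

text \<open>The Bessel inequality: regularized by the cutoff, the square norm of the transform is a
  Gaussian quadratic form in \<open>f\<close>; then the cutoff is removed.\<close>

lemma fourier_L2_bound: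
  fixes f :: "'d::finite tfun"
  assumes f: "integrable lborel f" and f2: "L2 f"
  shows "L2 (fourier f)" "sqnorm (fourier f) \<le> (2 * pi) ^ CARD('d) * sqnorm f"
proof -
  let ?K = "(2 * pi) ^ CARD('d)"
  have [measurable]: "f \<in> borel_measurable borel" using f by auto
  have b: "(\<integral>\<^sup>+\<omega>. ennreal ((norm (fourier f \<omega>))\<^sup>2 * gcut \<epsilon> \<omega>) \<partial>lborel) \<le> ennreal (?K * sqnorm f)" if e: "\<epsilon> > 0" for \<epsilon>
  proof -
    let ?\<psi> = "\<lambda>\<omega>. cnj (fourier f \<omega>) * complex_of_real (gcut \<epsilon> \<omega>)"
    let ?B = "LINT x|lborel. norm (f x)"
    have cm [measurable]: "(\<lambda>\<omega>. cnj (fourier f \<omega>)) \<in> borel_measurable borel"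
      by (intro borel_measurable_continuous_on[OF continuous_on_cnj[OF continuous_on_id]]) measurable
    have \<psi>i: "integrable lborel ?\<psi>"
    proof (rule Bochner_Integration.integrable_bound)
      show "integrable lborel (\<lambda>\<omega>. complex_of_real ?B * complex_of_real (gcut \<epsilon> \<omega>))"
        by (intro integrable_mult_right gcut_integrable e)
      show "AE \<omega> in lborel. norm (?\<psi> \<omega>) \<le> norm (complex_of_real ?B * complex_of_real (gcut \<epsilon> \<omega>))"
        by (intro AE_I2) (auto simp: norm_mult intro!: mult_right_mono order_trans[OF norm_fourier_le])
    qed measurable
    have eq: "(norm (fourier f \<omega>))\<^sup>2 * gcut \<epsilon> \<omega> = norm (fourier f \<omega> * ?\<psi> \<omega>)" for \<omega>
      using gcut_pos[of \<epsilon> \<omega>] by (simp add: norm_mult power2_eq_square)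
    have eqc: "fourier f \<omega> * ?\<psi> \<omega> = complex_of_real ((norm (fourier f \<omega>))\<^sup>2 * gcut \<epsilon> \<omega>)" for \<omega>
      unfolding of_real_mult complex_norm_square by (simp add: mult.assoc)
    have i: "integrable lborel (\<lambda>\<omega>. fourier f \<omega> * ?\<psi> \<omega>)"
    proof (rule Bochner_Integration.integrable_bound)
      show "integrable lborel (\<lambda>\<omega>. complex_of_real ?B * ?\<psi> \<omega>)" by (intro integrable_mult_right \<psi>i)
      show "AE \<omega> in lborel. norm (fourier f \<omega> * ?\<psi> \<omega>) \<le> norm (complex_of_real ?B * ?\<psi> \<omega>)"
        unfolding norm_mult by (intro AE_I2 mult_right_mono order_trans[OF norm_fourier_le]) auto
    qed measurable
    have "(\<integral>\<^sup>+\<omega>. ennreal ((norm (fourier f \<omega>))\<^sup>2 * gcut \<epsilon> \<omega>) \<partial>lborel) = ennreal (LINT \<omega>|lborel. (norm (fourier f \<omega>))\<^sup>2 * gcut \<epsilon> \<omega>)"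
      unfolding eq by (rule nn_integral_eq_integral[OF integrable_norm[OF i]]) simp
    also have "(LINT \<omega>|lborel. (norm (fourier f \<omega>))\<^sup>2 * gcut \<epsilon> \<omega>) = norm (LINT \<omega>|lborel. fourier f \<omega> * ?\<psi> \<omega>)"
    proof -
      have "(LINT \<omega>|lborel. (norm (fourier f \<omega>))\<^sup>2 * gcut \<epsilon> \<omega>) \<ge> 0"
        by (intro Bochner_Integration.integral_nonneg) (simp add: gcut_pos less_imp_le)
      then show ?thesis unfolding eqc integral_complex_of_real norm_of_real by simp
    qed
    also have "(LINT \<omega>|lborel. fourier f \<omega> * ?\<psi> \<omega>) = (LINT x|lborel. f x * fourier ?\<psi> x)"
      by (rule fourier_swap[OF f \<psi>i])
    also have "ennreal (norm \<dots>) \<le> (\<integral>\<^sup>+x. ennreal (norm (f x * fourier ?\<psi> x)) \<partial>lborel)"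
      by (rule norm_integral_le_nn)
    also have "\<dots> \<le> (\<integral>\<^sup>+x. ennreal ?K * (\<integral>\<^sup>+y. ennreal (norm (f x) * (norm (f y) * gauss \<epsilon> (y - x))) \<partial>lborel) \<partial>lborel)"
    proof (rule nn_integral_mono)
      fix x
      have "ennreal (norm (LINT y|lborel. cnj (f y) * complex_of_real (gauss \<epsilon> (y - x))))
        \<le> (\<integral>\<^sup>+y. ennreal (norm (f y) * gauss \<epsilon> (y - x)) \<partial>lborel)"
        by (rule order_trans[OF norm_integral_le_nn]) (simp add: norm_mult gauss_nonneg)
      then have "ennreal (norm (f x)) * ennreal (norm (LINT y|lborel. cnj (f y) * complex_of_real (gauss \<epsilon> (y - x))))
        \<le> ennreal (norm (f x)) * (\<integral>\<^sup>+y. ennreal (norm (f y) * gauss \<epsilon> (y - x)) \<partial>lborel)"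
        by (intro mult_left_mono) auto
      also have "\<dots> = (\<integral>\<^sup>+y. ennreal (norm (f x) * (norm (f y) * gauss \<epsilon> (y - x))) \<partial>lborel)"
        by (subst nn_integral_cmult[symmetric]) (auto simp: ennreal_mult gauss_nonneg)
      finally have "ennreal ?K * (ennreal (norm (f x)) * ennreal (norm (LINT y|lborel. cnj (f y) * complex_of_real (gauss \<epsilon> (y - x)))))
        \<le> ennreal ?K * (\<integral>\<^sup>+y. ennreal (norm (f x) * (norm (f y) * gauss \<epsilon> (y - x))) \<partial>lborel)"
        by (intro mult_left_mono) auto
      moreover have "ennreal (norm (f x * fourier ?\<psi> x)) = ennreal ?K * (ennreal (norm (f x)) * ennreal (norm (LINT y|lborel. cnj (f y) * complex_of_real (gauss \<epsilon> (y - x)))))"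
        unfolding fourier_cnj_gcut[OF f e] norm_mult norm_of_real by (simp add: ennreal_mult mult_ac)
      ultimately show "ennreal (norm (f x * fourier ?\<psi> x)) \<le> ennreal ?K * (\<integral>\<^sup>+y. ennreal (norm (f x) * (norm (f y) * gauss \<epsilon> (y - x))) \<partial>lborel)"
        by simp
    qed
    also have "\<dots> = ennreal ?K * (\<integral>\<^sup>+x. \<integral>\<^sup>+y. ennreal (norm (f x) * (norm (f y) * gauss \<epsilon> (y - x))) \<partial>lborel \<partial>lborel)"
      by (rule nn_integral_cmult) measurable
    also have "\<dots> \<le> ennreal ?K * ennreal (sqnorm f)"
      by (intro mult_left_mono gauss_quadratic_form_le f2 e) auto
    also have "\<dots> = ennreal (?K * sqnorm f)" by (simp add: ennreal_mult sqnorm_nonneg)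
    finally show ?thesis .
  qed
  have "(\<integral>\<^sup>+\<omega>. ennreal ((norm (fourier f \<omega>))\<^sup>2) \<partial>lborel) = (\<integral>\<^sup>+\<omega>. liminf (\<lambda>n. ennreal ((norm (fourier f \<omega>))\<^sup>2 * gcut (1 / real (Suc n)) \<omega>)) \<partial>lborel)"
  proof (rule nn_integral_cong)
    fix \<omega>
    have "(\<lambda>n. (norm (fourier f \<omega>))\<^sup>2 * gcut (1 / real (Suc n)) \<omega>) \<longlonglongrightarrow> (norm (fourier f \<omega>))\<^sup>2 * 1"
      by (intro tendsto_intros gcut_tendsto)
    then have "(\<lambda>n. ennreal ((norm (fourier f \<omega>))\<^sup>2 * gcut (1 / real (Suc n)) \<omega>)) \<longlonglongrightarrow> ennreal ((norm (fourier f \<omega>))\<^sup>2 * 1)"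
      by (rule tendsto_ennrealI)
    then show "ennreal ((norm (fourier f \<omega>))\<^sup>2) = liminf (\<lambda>n. ennreal ((norm (fourier f \<omega>))\<^sup>2 * gcut (1 / real (Suc n)) \<omega>))"
      using lim_imp_Liminf[OF sequentially_bot] by fastforce
  qed
  also have "\<dots> \<le> liminf (\<lambda>n. \<integral>\<^sup>+\<omega>. ennreal ((norm (fourier f \<omega>))\<^sup>2 * gcut (1 / real (Suc n)) \<omega>) \<partial>lborel)"
    by (rule nn_integral_liminf) measurable
  also have "\<dots> \<le> liminf (\<lambda>n. ennreal (?K * sqnorm f))"
    by (intro Liminf_mono always_eventually allI b) simp
  also have "\<dots> = ennreal (?K * sqnorm f)" by (simp add: Liminf_const)
  finally have le: "(\<integral>\<^sup>+\<omega>. ennreal ((norm (fourier f \<omega>))\<^sup>2) \<partial>lborel) \<le> ennreal (?K * sqnorm f)" .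
  have i: "integrable lborel (\<lambda>\<omega>. (norm (fourier f \<omega>))\<^sup>2)"
    by (rule integrableI_nonneg) (use le in \<open>auto intro: le_less_trans\<close>)
  then show "L2 (fourier f)" by (simp add: L2_def)
  have "ennreal (sqnorm (fourier f)) \<le> ennreal (?K * sqnorm f)"
    using le nn_integral_eq_integral[OF i] by (simp add: sqnorm_def)
  then show "sqnorm (fourier f) \<le> ?K * sqnorm f"
    by (simp add: sqnorm_nonneg)
qed

text \<open>\<open>fourier_L2 f g\<close>: the function \<open>g\<close> is the transform of \<open>f\<close> in the sense of Plancherel, that is,
  there are integrable approximations of \<open>f\<close> whose transforms approximate \<open>g\<close>, both in the mean.\<close>

definition fourier_L2 :: "'d::finite tfun \<Rightarrow> 'd tfun \<Rightarrow> bool" where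
  "fourier_L2 f g \<longleftrightarrow> L2 f \<and> L2 g \<and> (\<exists>h. (\<forall>n. integrable lborel (h n) \<and> L2 (h n)) \<and>
     (\<lambda>n. sqnorm (\<lambda>x. f x - h n x)) \<longlonglongrightarrow> 0 \<and> (\<lambda>n. sqnorm (\<lambda>x. g x - fourier (h n) x)) \<longlonglongrightarrow> 0)"

text \<open>The transform is symmetric for integrable functions by Fubini, and both sides pass to the limit.\<close>

lemma fourier_L2_sym:
  assumes f: "fourier_L2 f f'" and g: "fourier_L2 g g'"
  shows "(LINT x|lborel. f' x * g x) = (LINT x|lborel. f x * g' x)"
proof -
  obtain F where F: "\<And>n. integrable lborel (F n)" "\<And>n. L2 (F n)" "(\<lambda>n. sqnorm (\<lambda>x. f x - F n x)) \<longlonglongrightarrow> 0"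
    "(\<lambda>n. sqnorm (\<lambda>x. f' x - fourier (F n) x)) \<longlonglongrightarrow> 0" and f2: "L2 f" "L2 f'"
    using f by (auto simp: fourier_L2_def)
  obtain G where G: "\<And>n. integrable lborel (G n)" "\<And>n. L2 (G n)" "(\<lambda>n. sqnorm (\<lambda>x. g x - G n x)) \<longlonglongrightarrow> 0"
    "(\<lambda>n. sqnorm (\<lambda>x. g' x - fourier (G n) x)) \<longlonglongrightarrow> 0" and g2: "L2 g" "L2 g'"
    using g by (auto simp: fourier_L2_def)
  have "(\<lambda>n. LINT x|lborel. fourier (F n) x * G n x) \<longlonglongrightarrow> (LINT x|lborel. f' x * g x)"
    by (intro L2_limit_product f2 g2 F G fourier_L2_bound)
  moreover have "(\<lambda>n. LINT x|lborel. F n x * fourier (G n) x) \<longlonglongrightarrow> (LINT x|lborel. f x * g' x)"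
    by (intro L2_limit_product f2 g2 F G fourier_L2_bound)
  moreover have "(LINT x|lborel. fourier (F n) x * G n x) = (LINT x|lborel. F n x * fourier (G n) x)" for n
    by (intro fourier_swap F G)
  ultimately show ?thesis using LIMSEQ_unique by auto
qed

lemma fourier_L2_integrable:
  assumes "integrable lborel f" "L2 f"
  shows "fourier_L2 f (fourier f)"
  unfolding fourier_L2_def
  by (intro conjI exI[of _ "\<lambda>_. f"]) (use assms fourier_L2_bound in \<open>auto simp: sqnorm_def\<close>)

lemma fourier_L2_schwartz: "f \<in> schwartz \<Longrightarrow> fourier_L2 f (fourier f)"
  by (intro fourier_L2_integrable schwartz_integrable schwartz_L2)

lemma L2_truncation:
  fixes f :: "'d::finite tfun"
  assumes f: "L2 f"
  defines "h \<equiv> \<lambda>n x. indicator (ball 0 (real n)) x * f x"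
  shows "integrable lborel (h n)" "L2 (h n)" "(\<lambda>n. sqnorm (\<lambda>x. f x - h n x)) \<longlonglongrightarrow> 0"
proof -
  have [measurable]: "f \<in> borel_measurable borel" using f by (simp add: L2_def)
  have "L2 (\<lambda>x::real^'d. indicator (ball 0 (real n)) x)"
  proof -
    have "integrable lborel (indicat_real (ball (0::real^'d) (real n)))"
      using emeasure_lborel_ball_finite[of 0 "real n"] by (intro integrable_real_indicator) (auto simp: less_top)
    moreover have "(\<lambda>x. (norm (indicator (ball 0 (real n)) x :: complex))\<^sup>2) = indicat_real (ball (0::real^'d) (real n))"
      by (auto simp: indicator_def)
    ultimately show ?thesis by (simp add: L2_def borel_measurable_indicator)
  qed
  then show "integrable lborel (h n)" unfolding h_def by (rule L2_mult_integrable[OF _ f])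
  show h2: "L2 (h n)" for n unfolding h_def
    by (rule L2_mono[OF f, of _ 1]) (auto simp: norm_mult indicator_def)
  have [measurable]: "h n \<in> borel_measurable borel" for n by (rule L2_measurable[OF h2])
  have "(\<lambda>n. LINT x|lborel. (norm (f x - h n x))\<^sup>2) \<longlonglongrightarrow> (LINT x|(lborel :: (real^'d) measure). (0::real))"
  proof (rule integral_dominated_convergence)
    show "integrable lborel (\<lambda>x. (norm (f x))\<^sup>2)" using f by (simp add: L2_def)
    show "(\<lambda>x. (norm (f x - h n x))\<^sup>2) \<in> borel_measurable lborel" for n by measurable
    show "AE x in lborel. norm ((norm (f x - h n x))\<^sup>2) \<le> (norm (f x))\<^sup>2" for n
      by (intro AE_I2) (auto simp: h_def indicator_def)
    show "AE x in lborel. (\<lambda>n. (norm (f x - h n x))\<^sup>2) \<longlonglongrightarrow> 0"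
    proof (rule AE_I2)
      fix x :: "real^'d"
      obtain N where N: "norm x < real N" using reals_Archimedean2 by blast
      have "(norm (f x - h n x))\<^sup>2 = 0" if "n \<ge> N" for n
        using N that by (simp add: h_def indicator_def)
      then have "\<forall>\<^sub>F n in sequentially. (norm (f x - h n x))\<^sup>2 = 0" by (auto simp: eventually_sequentially)
      then show "(\<lambda>n. (norm (f x - h n x))\<^sup>2) \<longlonglongrightarrow> 0" by (rule tendsto_eventually)
    qed
  qed auto
  then show "(\<lambda>n. sqnorm (\<lambda>x. f x - h n x)) \<longlonglongrightarrow> 0" by (simp add: sqnorm_def)
qed

text \<open>Completeness: truncations are chosen so fast that the transforms converge almost everywhere
  (Riesz and Fischer); Fatou's lemma then gives convergence in the mean.\<close>

lemma fourier_L2_exists: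
  fixes f :: "'d::finite tfun"
  assumes f: "L2 f"
  obtains g where "fourier_L2 f g"
proof -
  let ?K = "(2 * pi) ^ CARD('d)"
  define t where "t n x = indicator (ball 0 (real n)) x * f x" for n x
  have ti: "integrable lborel (t n)" and t2: "L2 (t n)" for n
    unfolding t_def[abs_def] by (rule L2_truncation[OF f])+
  have tl: "(\<lambda>n. sqnorm (\<lambda>x. f x - t n x)) \<longlonglongrightarrow> 0"
    unfolding t_def[abs_def] by (rule L2_truncation[OF f])
  have "\<exists>n. sqnorm (\<lambda>x. f x - t n x) < (1/4) ^ j" for j :: nat
  proof -
    have "\<forall>\<^sub>F n in sequentially. sqnorm (\<lambda>x. f x - t n x) < (1/4) ^ j"
      by (intro order_tendstoD(2)[OF tl]) simp
    then show ?thesis by (auto simp: eventually_sequentially)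
  qed
  then obtain m where m: "\<And>j. sqnorm (\<lambda>x. f x - t (m j) x) < (1/4) ^ j" by metis
  \<comment> \<open>Partial sums make the truncation radii increase with \<open>j\<close>.\<close>
  define r where "r j = (\<Sum>i\<le>j. m i)" for j
  have rm: "r j \<ge> m j" for j unfolding r_def by (rule member_le_sum) auto
  have r_mono: "r i \<le> r j" if "i \<le> j" for i j
    unfolding r_def using that by (intro sum_mono2) auto
  define h where "h j = t (r j)" for j
  have [measurable]: "f \<in> borel_measurable borel" using f by (simp add: L2_def)
  have [measurable]: "h j \<in> borel_measurable borel" for j
    using t2[of "r j"] by (simp add: h_def L2_def)
  have hi: "integrable lborel (h j)" and h2: "L2 (h j)" for j by (auto simp: h_def ti t2)
  have d2: "L2 (\<lambda>x. f x - h j x)" for j by (intro L2_diff f h2)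
  have small: "sqnorm (\<lambda>x. f x - h j x) \<le> (1/4) ^ j" for j
  proof -
    have "sqnorm (\<lambda>x. f x - h j x) \<le> sqnorm (\<lambda>x. f x - t (m j) x)"
      using rm[of j] by (intro sqnorm_mono L2_diff f t2) (auto simp: h_def t_def indicator_def)
    with m[of j] show ?thesis by simp
  qed
  have diff: "sqnorm (\<lambda>x. fourier (h i) x - fourier (h j) x) \<le> ?K * sqnorm (\<lambda>x. f x - h j x)" if "j \<le> i" for i j
  proof -
    have "(\<lambda>x. fourier (h i) x - fourier (h j) x) = fourier (\<lambda>x. h i x - h j x)"
      by (rule ext) (simp add: fourier_diff hi)
    moreover have "sqnorm (fourier (\<lambda>x. h i x - h j x)) \<le> ?K * sqnorm (\<lambda>x. h i x - h j x)"
      by (intro fourier_L2_bound Bochner_Integration.integrable_diff L2_diff hi h2)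
    moreover have "sqnorm (\<lambda>x. h i x - h j x) \<le> sqnorm (\<lambda>x. f x - h j x)"
      using r_mono[OF that] by (intro sqnorm_mono d2) (auto simp: h_def t_def indicator_def)
    ultimately show ?thesis by (simp add: mult_left_mono order_trans)
  qed
  define F where "F j = fourier (h j)" for j
  have [measurable]: "F j \<in> borel_measurable borel" for j unfolding F_def by measurable
  have F2: "L2 (F j)" for j unfolding F_def by (intro fourier_L2_bound hi h2)
  have FD2: "L2 (\<lambda>x. F i x - F j x)" for i j by (intro L2_diff F2)
  have nn: "(\<integral>\<^sup>+x. ennreal ((norm (F i x - F j x))\<^sup>2) \<partial>lborel) = ennreal (sqnorm (\<lambda>x. F i x - F j x))" for i j
    using FD2[of i j] by (simp add: L2_def sqnorm_def nn_integral_eq_integral)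
  \<comment> \<open>The weight \<open>2\<^sup>j\<close> is harmless against \<open>(1/4)\<^sup>j\<close> and makes the increments summable almost everywhere.\<close>
  have fin: "(\<integral>\<^sup>+x. (\<Sum>j. ennreal (2 ^ j * (norm (F (Suc j) x - F j x))\<^sup>2)) \<partial>lborel) < \<infinity>"
  proof -
    have "(\<integral>\<^sup>+x. (\<Sum>j. ennreal (2 ^ j * (norm (F (Suc j) x - F j x))\<^sup>2)) \<partial>lborel)
      = (\<Sum>j. \<integral>\<^sup>+x. ennreal (2 ^ j * (norm (F (Suc j) x - F j x))\<^sup>2) \<partial>lborel)"
      by (rule nn_integral_suminf) measurable
    also have "\<dots> = (\<Sum>j. ennreal (2 ^ j * sqnorm (\<lambda>x. F (Suc j) x - F j x)))"
      by (intro suminf_cong) (simp add: ennreal_mult nn_integral_cmult nn sqnorm_nonneg)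
    also have "\<dots> \<le> (\<Sum>j. ennreal (?K * (1/2) ^ j))"
    proof (intro suminf_le summableI ennreal_leI)
      fix j :: nat
      have "sqnorm (\<lambda>x. F (Suc j) x - F j x) \<le> ?K * (1/4) ^ j"
        using diff[of j "Suc j"] small[of j] unfolding F_def
        by (auto intro: order_trans mult_left_mono)
      then have "2 ^ j * sqnorm (\<lambda>x. F (Suc j) x - F j x) \<le> 2 ^ j * (?K * (1/4) ^ j)"
        by (intro mult_left_mono) auto
      also have "\<dots> = ?K * ((2 * (1/4)) ^ j)" by (simp only: power_mult_distrib mult_ac)
      finally show "2 ^ j * sqnorm (\<lambda>x. F (Suc j) x - F j x) \<le> ?K * (1/2) ^ j" by simp
    qed
    also have "\<dots> = ennreal (\<Sum>j. ?K * (1/2) ^ j)"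
      by (intro suminf_ennreal2 summable_mult summable_geometric) auto
    also have "\<dots> < \<infinity>" by simp
    finally show ?thesis .
  qed
  have "AE x in lborel. (\<Sum>j. ennreal (2 ^ j * (norm (F (Suc j) x - F j x))\<^sup>2)) \<noteq> \<infinity>"
    by (rule nn_integral_PInf_AE) (use fin in auto)
  then have conv: "AE x in lborel. convergent (\<lambda>j. F j x)"
  proof eventually_elim
    case (elim x)
    let ?s = "\<lambda>j. 2 ^ j * (norm (F (Suc j) x - F j x))\<^sup>2"
    have "summable ?s" by (rule summable_suminf_not_top) (use elim in auto)
    then have "?s \<longlonglongrightarrow> 0" by (rule summable_LIMSEQ_zero)
    then have "Bseq ?s" by (intro convergent_imp_Bseq) (auto simp: convergent_def)
    then obtain B where B: "B > 0" "\<And>j. norm (?s j) \<le> B" by (auto simp: Bseq_def)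
    have b: "norm (F (Suc j) x - F j x) \<le> sqrt B * (sqrt (1/2)) ^ j" for j
    proof (rule power2_le_imp_le)
      have "(norm (F (Suc j) x - F j x))\<^sup>2 \<le> B / 2 ^ j" using B(2)[of j] by (simp add: field_simps)
      also have "\<dots> = (sqrt B * (sqrt (1/2)) ^ j)\<^sup>2"
      proof -
        have "(sqrt (1/2) ^ j)\<^sup>2 = (sqrt (1/2) * sqrt (1/2)) ^ j"
          unfolding power2_eq_square power_mult_distrib ..
        also have "\<dots> = (1/2) ^ j" by simp
        finally have s: "(sqrt (1/2) ^ j)\<^sup>2 = (1/2) ^ j" .
        show ?thesis
          unfolding power_mult_distrib s using B(1) by (simp add: power_one_over)
      qed
      finally show "(norm (F (Suc j) x - F j x))\<^sup>2 \<le> (sqrt B * (sqrt (1/2)) ^ j)\<^sup>2" .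
    qed (use B in simp)
    have summ: "summable (\<lambda>j. sqrt B * (sqrt (1/2)) ^ j)"
      by (intro summable_mult summable_geometric) (simp add: real_sqrt_divide)
    have "summable (\<lambda>j. F (Suc j) x - F j x)"
      by (rule summable_comparison_test'[OF summ b])
    then have "convergent (\<lambda>n. \<Sum>j<n. F (Suc j) x - F j x)" by (simp add: summable_iff_convergent)
    then have "convergent (\<lambda>n. F n x - F 0 x)" using sum_lessThan_telescope[of "\<lambda>j. F j x"] by simp
    then show ?case by (simp add: convergent_diff_const_right_iff)
  qed
  define g where "g x = lim (\<lambda>j. F j x)" for x
  have [measurable]: "g \<in> borel_measurable borel"
    unfolding g_def[abs_def] by (intro borel_measurable_lim_metric) measurable
  have gl: "AE x in lborel. (\<lambda>j. F j x) \<longlonglongrightarrow> g x"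
    using conv by eventually_elim (simp add: g_def convergent_LIMSEQ_iff)
  have gb: "(\<integral>\<^sup>+x. ennreal ((norm (g x - F j x))\<^sup>2) \<partial>lborel) \<le> ennreal (?K * (1/4) ^ j)" for j
  proof -
    have "(\<integral>\<^sup>+x. ennreal ((norm (g x - F j x))\<^sup>2) \<partial>lborel) = (\<integral>\<^sup>+x. liminf (\<lambda>i. ennreal ((norm (F i x - F j x))\<^sup>2)) \<partial>lborel)"
    proof (rule nn_integral_cong_AE, use gl in eventually_elim)
      case (elim x)
      then have "(\<lambda>i. ennreal ((norm (F i x - F j x))\<^sup>2)) \<longlonglongrightarrow> ennreal ((norm (g x - F j x))\<^sup>2)"
        by (intro tendsto_ennrealI tendsto_intros)
      then show ?case using lim_imp_Liminf[OF sequentially_bot] by fastforce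
    qed
    also have "\<dots> \<le> liminf (\<lambda>i. \<integral>\<^sup>+x. ennreal ((norm (F i x - F j x))\<^sup>2) \<partial>lborel)"
      by (rule nn_integral_liminf) measurable
    also have "\<dots> \<le> liminf (\<lambda>i. ennreal (?K * (1/4) ^ j))"
    proof (rule Liminf_mono)
      have "sqnorm (\<lambda>x. F i x - F j x) \<le> ?K * (1/4) ^ j" if "j \<le> i" for i
        unfolding F_def by (rule order_trans[OF diff[OF that] mult_left_mono[OF small]]) simp
      then have "(\<integral>\<^sup>+x. ennreal ((norm (F i x - F j x))\<^sup>2) \<partial>lborel) \<le> ennreal (?K * (1/4) ^ j)" if "j \<le> i" for i
        unfolding nn using that by (intro ennreal_leI) blast
      then show "\<forall>\<^sub>F i in sequentially. (\<integral>\<^sup>+x. ennreal ((norm (F i x - F j x))\<^sup>2) \<partial>lborel) \<le> ennreal (?K * (1/4) ^ j)"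
        by (auto simp: eventually_sequentially)
    qed
    also have "\<dots> = ennreal (?K * (1/4) ^ j)" by (simp add: Liminf_const)
    finally show ?thesis .
  qed
  have gi: "integrable lborel (\<lambda>x. (norm (g x - F j x))\<^sup>2)" for j
    by (rule integrableI_nonneg) (use gb[of j] in \<open>auto intro: le_less_trans\<close>)
  have gF2: "L2 (\<lambda>x. g x - F j x)" for j using gi[of j] by (simp add: L2_def)
  have "L2 (\<lambda>x. (g x - F 0 x) + F 0 x)" by (intro L2_add gF2 F2)
  then have g2: "L2 g" by simp
  have gs: "sqnorm (\<lambda>x. g x - F j x) \<le> ?K * (1/4) ^ j" for j
    using gb[of j] nn_integral_eq_integral[OF gi[of j]] by (simp add: sqnorm_def)
  have geo: "(\<lambda>j. c * (1/4::real) ^ j) \<longlonglongrightarrow> 0" for c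
    using tendsto_mult_right_zero[OF LIMSEQ_power_zero[of "1/4::real"]] by simp
  have "(\<lambda>j. sqnorm (\<lambda>x. g x - F j x)) \<longlonglongrightarrow> 0"
    by (rule tendsto_sandwich[OF always_eventually[OF allI[OF sqnorm_nonneg]] always_eventually[OF allI[OF gs]] tendsto_const geo])
  moreover have "(\<lambda>j. sqnorm (\<lambda>x. f x - h j x)) \<longlonglongrightarrow> 0"
    by (rule tendsto_sandwich[OF always_eventually[OF allI[OF sqnorm_nonneg]] always_eventually[OF allI[OF small]] tendsto_const geo[of 1, simplified]])
  ultimately have "fourier_L2 f g"
    unfolding fourier_L2_def F_def using f g2 hi h2 by blast
  then show thesis by (rule that)
qed

subsection \<open>Parseval's formula\<close>

lemma pdiff_cnj:
  assumes "f differentiable_on UNIV"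
  shows "pdiff k (\<lambda>x. cnj (f x)) = (\<lambda>x. cnj (pdiff k f x))" "(\<lambda>x. cnj (f x)) differentiable_on UNIV"
proof -
  have d: "((\<lambda>x. cnj (f x)) has_derivative (\<lambda>h. cnj (\<Sum>k\<in>UNIV. h $ k *\<^sub>R pdiff k f x))) (at x)" for x
    using assms by (intro bounded_linear.has_derivative[OF bounded_linear_cnj] has_derivative_pdiff) (simp add: diff_on_UNIV)
  show "pdiff k (\<lambda>x. cnj (f x)) = (\<lambda>x. cnj (pdiff k f x))"
    by (rule ext, subst pdiff_eq[OF d]) (simp only: sum_axis)
  show "(\<lambda>x. cnj (f x)) differentiable_on UNIV"
    using d by (auto simp: diff_on_UNIV differentiable_def)
qed

lemma smooth_upto_cnj: "smooth_upto n f \<Longrightarrow> smooth_upto n (\<lambda>x. cnj (f x))"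
  by (induction n arbitrary: f) (auto simp: pdiff_cnj)

lemma pdiffs_cnj: "smooth f \<Longrightarrow> pdiffs ks (\<lambda>x. cnj (f x)) = (\<lambda>x. cnj (pdiffs ks f x))"
  by (induction ks) (auto simp: pdiff_cnj smooth_differentiable_on smooth_pdiffs)

lemma schwartz_cnj: "f \<in> schwartz \<Longrightarrow> (\<lambda>x. cnj (f x)) \<in> schwartz"
  by (auto simp: schwartz_iff pdiffs_cnj smooth_iff_smooth_upto smooth_upto_cnj)

lemma fourier_cnj_fourier:
  fixes f :: "'d::finite tfun"
  assumes f: "f \<in> schwartz"
  shows "fourier (\<lambda>\<omega>. cnj (fourier f \<omega>)) x = complex_of_real ((2 * pi) ^ CARD('d)) * cnj (f x)"
proof -
  let ?K = "complex_of_real ((2 * pi) ^ CARD('d))"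
  have c: "(\<lambda>x. cnj (f x)) \<in> schwartz" by (rule schwartz_cnj[OF f])
  have "(\<lambda>\<omega>. cnj (fourier f \<omega>)) = (\<lambda>\<omega>. ?K * inv_fourier (\<lambda>x. cnj (f x)) \<omega>)"
    by (rule ext) (simp add: fourier_cnj inv_fourier_eq)
  then show ?thesis by (simp add: fourier_cmult fourier_inv_fourier[OF c])
qed

text \<open>By symmetry the left side is the integral of \<open>f\<close> against the transform \<open>m\<close> of the conjugate of \<open>g'\<close>. Tested on
  Schwartz functions, \<open>m\<close> is \<open>(2 \<pi>)\<^sup>d\<close> times the conjugate of \<open>g\<close> by the inversion formula.\<close>

lemma parseval_L2:
  fixes f g :: "'d::finite tfun"
  assumes f: "fourier_L2 f f'" and g: "fourier_L2 g g'"
  shows "(LINT x|lborel. f' x * cnj (g' x)) = complex_of_real ((2 * pi) ^ CARD('d)) * (LINT x|lborel. f x * cnj (g x))"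
proof -
  let ?K = "complex_of_real ((2 * pi) ^ CARD('d))"
  have L: "L2 f" "L2 g" "L2 g'" using f g by (auto simp: fourier_L2_def)
  obtain m where m: "fourier_L2 (\<lambda>x. cnj (g' x)) m" by (rule fourier_L2_exists[OF L2_cnj[OF L(3)]])
  then have m2: "L2 m" by (simp add: fourier_L2_def)
  have "AE x in lborel. m x - ?K * cnj (g x) = 0"
  proof (rule L2_eq_0_AE)
    show "L2 (\<lambda>x. m x - ?K * cnj (g x))" by (intro L2_diff L2_cmult L2_cnj L m2)
    fix \<phi> :: "'d tfun" assume "\<phi> \<in> test_functions"
    then have \<phi>: "\<phi> \<in> schwartz" by (rule test_functions_schwartz)
    have c: "(\<lambda>x. cnj (fourier \<phi> x)) \<in> schwartz" by (intro schwartz_cnj schwartz_fourier \<phi>)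
    have "(LINT x|lborel. m x * \<phi> x) = (LINT x|lborel. cnj (g' x) * fourier \<phi> x)"
      by (rule fourier_L2_sym[OF m fourier_L2_schwartz[OF \<phi>]])
    also have "\<dots> = cnj (LINT x|lborel. g' x * cnj (fourier \<phi> x))"
      by (simp flip: Bochner_Integration.integral_cnj)
    also have "(LINT x|lborel. g' x * cnj (fourier \<phi> x)) = (LINT x|lborel. g x * fourier (\<lambda>x. cnj (fourier \<phi> x)) x)"
      by (rule fourier_L2_sym[OF g fourier_L2_schwartz[OF c]])
    also have "cnj \<dots> = (LINT x|lborel. ?K * cnj (g x) * \<phi> x)"
      unfolding fourier_cnj_fourier[OF \<phi>] by (simp add: mult_ac flip: Bochner_Integration.integral_cnj)
    finally have "(LINT x|lborel. m x * \<phi> x) = (LINT x|lborel. ?K * cnj (g x) * \<phi> x)" .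
    moreover have "(LINT x|lborel. (m x - ?K * cnj (g x)) * \<phi> x) = (LINT x|lborel. m x * \<phi> x) - (LINT x|lborel. ?K * cnj (g x) * \<phi> x)"
      unfolding left_diff_distrib
      by (intro Bochner_Integration.integral_diff L2_mult_integrable L2_cmult L2_cnj L m2 schwartz_L2 \<phi>)
    ultimately show "(LINT x|lborel. (m x - ?K * cnj (g x)) * \<phi> x) = 0" by simp
  qed
  then have ae: "AE x in lborel. f x * m x = ?K * (f x * cnj (g x))"
    by eventually_elim simp
  have meas: "(\<lambda>x. f x * m x) \<in> borel_measurable lborel" "(\<lambda>x. ?K * (f x * cnj (g x))) \<in> borel_measurable lborel"
    using L2_mult_integrable[OF L(1) m2] L2_mult_integrable[OF L(1) L2_cnj[OF L(2)]]
    by (auto intro!: borel_measurable_integrable)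
  have "(LINT x|lborel. f' x * cnj (g' x)) = (LINT x|lborel. f x * m x)"
    by (rule fourier_L2_sym[OF f m])
  also have "\<dots> = (LINT x|lborel. ?K * (f x * cnj (g x)))"
    by (rule integral_cong_AE[OF meas ae])
  finally show ?thesis by simp
qed

lemma dist_inv_fourier_L2:
  fixes f :: "'d::finite tfun"
  assumes f: "fourier_L2 f f'"
  shows "dist_inv_fourier (fun_dist f) \<doteq> fun_dist (\<lambda>x. complex_of_real (1 / (2 * pi) ^ CARD('d)) * f' (- x))"
  unfolding dist_eq_def
proof
  fix \<phi> :: "'d tfun" assume \<phi>: "\<phi> \<in> schwartz"
  let ?c = "complex_of_real (1 / (2 * pi) ^ CARD('d))"
  have r: "(\<lambda>x. \<phi> (0 + (-1) *\<^sub>R x)) \<in> schwartz" by (rule schwartz_affine(1)[OF \<phi>]) simp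
  have [measurable]: "\<phi> \<in> borel_measurable borel" by (rule smooth_measurable[OF schwartz_smooth[OF \<phi>]])
  have [measurable]: "f' \<in> borel_measurable borel" using f by (auto simp: fourier_L2_def L2_def)
  have refl: "fourier \<phi> (- \<omega>) = fourier (\<lambda>x. \<phi> (0 + (-1) *\<^sub>R x)) \<omega>" for \<omega>
    unfolding fourier_def by (subst lborel_integral_affine[of _ "-1" 0]) auto
  have "dist_inv_fourier (fun_dist f) \<phi> = (LINT \<omega>|lborel. ?c * (f \<omega> * fourier (\<lambda>x. \<phi> (0 + (-1) *\<^sub>R x)) \<omega>))"
    by (simp add: dist_inv_fourier_def fun_dist_def inv_fourier_eq refl[simplified] mult_ac)
  also have "\<dots> = ?c * (LINT \<omega>|lborel. f \<omega> * fourier (\<lambda>x. \<phi> (0 + (-1) *\<^sub>R x)) \<omega>)"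
    by (rule integral_mult_right_zero)
  also have "(LINT \<omega>|lborel. f \<omega> * fourier (\<lambda>x. \<phi> (0 + (-1) *\<^sub>R x)) \<omega>) = (LINT x|lborel. f' x * \<phi> (0 + (-1) *\<^sub>R x))"
    by (rule fourier_L2_sym[OF f fourier_L2_schwartz[OF r], symmetric])
  also have "\<dots> = (LINT x|lborel. f' (- x) * \<phi> x)"
    by (subst lborel_integral_affine[of _ "-1" 0]) auto
  also have "?c * \<dots> = fun_dist (\<lambda>x. ?c * f' (- x)) \<phi>"
    unfolding fun_dist_def integral_mult_right_zero[symmetric] by (simp add: mult.assoc)
  finally show "dist_inv_fourier (fun_dist f) \<phi> = fun_dist (\<lambda>x. ?c * f' (- x)) \<phi>" .
qed

lemma L2_reflect:
  assumes f: "L2 f" shows "L2 (\<lambda>x. f (- x))"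
proof -
  have [measurable]: "f \<in> borel_measurable borel" using f by (simp add: L2_def)
  have "integrable lborel (\<lambda>x. (norm (f (0 + (-1) *\<^sub>R x)))\<^sup>2)"
    using f by (intro lborel_integrable_affine[of "\<lambda>x. (norm (f x))\<^sup>2"]) (auto simp: L2_def)
  then show ?thesis by (simp add: L2_def)
qed

section \<open>Lebesgue functions and their transforms\<close>

lemma Lp_2_iff: "Lp 2 f \<longleftrightarrow> L2 f"
  by (simp add: Lp_def L2_def powr_numeral)

text \<open>A function in \<open>L\<^sup>p\<close> is integrable where it is large and bounded where it is small.\<close>

lemma Lp_split:
  fixes f :: "'d::finite tfun"
  assumes f: "Lp p f" and p: "1 \<le> p" "p \<noteq> \<infinity>"
  obtains f1 f2 where "f = (\<lambda>x. f1 x + f2 x)" "integrable lborel f1" "f2 \<in> borel_measurable borel"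
    "\<And>x. norm (f2 x) \<le> 1" "p \<le> 2 \<Longrightarrow> L2 f2"
proof -
  define q where "q = real_of_ereal p"
  have q: "1 \<le> q" "p \<le> 2 \<Longrightarrow> q \<le> 2" "p = ereal q"
    using p by (cases p; simp add: q_def one_ereal_def; fail)+
  have [measurable]: "f \<in> borel_measurable borel" using f by (simp add: Lp_def)
  have i: "integrable lborel (\<lambda>x. norm (f x) powr q)" using f p by (simp add: Lp_def q_def)
  define f1 where "f1 x = (if norm (f x) > 1 then f x else 0)" for x
  define f2 where "f2 x = (if norm (f x) > 1 then 0 else f x)" for x
  have m [measurable]: "f1 \<in> borel_measurable borel" "f2 \<in> borel_measurable borel"
    unfolding f1_def f2_def by measurable
  have "integrable lborel f1"
  proof (rule Bochner_Integration.integrable_bound[OF i])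
    show "AE x in lborel. norm (f1 x) \<le> norm (norm (f x) powr q)"
    proof (rule AE_I2)
      fix x
      show "norm (f1 x) \<le> norm (norm (f x) powr q)"
      proof (cases "norm (f x) > 1")
        case True
        then have "norm (f x) powr 1 \<le> norm (f x) powr q" using q by (intro powr_mono) auto
        then show ?thesis using True by (simp add: f1_def)
      qed (simp add: f1_def)
    qed
  qed measurable
  moreover have "L2 f2" if "p \<le> 2"
    unfolding L2_def
  proof
    show "integrable lborel (\<lambda>x. (norm (f2 x))\<^sup>2)"
    proof (rule Bochner_Integration.integrable_bound[OF i])
      show "AE x in lborel. norm ((norm (f2 x))\<^sup>2) \<le> norm (norm (f x) powr q)"
      proof (rule AE_I2)
        fix x
        show "norm ((norm (f2 x))\<^sup>2) \<le> norm (norm (f x) powr q)"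
        proof (cases "norm (f x) > 1 \<or> f x = 0")
          case False
          then have "norm (f x) powr 2 \<le> norm (f x) powr q" using q(2)[OF that] by (intro powr_mono') auto
          then show ?thesis using False by (simp add: f2_def powr_numeral)
        qed (auto simp: f2_def)
      qed
    qed measurable
  qed measurable
  moreover have "f = (\<lambda>x. f1 x + f2 x)" by (auto simp: f1_def f2_def)
  moreover have "norm (f2 x) \<le> 1" for x by (simp add: f2_def)
  ultimately show thesis using m that by blast
qed

lemma Lp_tempered_fun:
  fixes f :: "'d::finite tfun"
  assumes f: "Lp p f" and p: "1 \<le> p"
  shows "tempered_fun f"
proof (cases "p = \<infinity>")
  case True
  then obtain C where C: "AE x in lborel. norm (f x) \<le> C" and [measurable]: "f \<in> borel_measurable borel"
    using f by (auto simp: Lp_def)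
  have "integrable lborel (\<lambda>x. f x / of_real ((1 + norm x) ^ (2 * CARD('d))))"
  proof (rule Bochner_Integration.integrable_bound)
    show "integrable lborel (\<lambda>x::real^'d. C * (1 / (1 + norm x) ^ (2 * CARD('d))))"
      by (intro integrable_mult_right integrable_weight order_refl)
    show "AE x in lborel. norm (f x / of_real ((1 + norm x) ^ (2 * CARD('d)))) \<le> norm (C * (1 / (1 + norm x) ^ (2 * CARD('d))))"
      using C
    proof eventually_elim
      case (elim x)
      have "0 < 1 + norm x" by (simp add: add_pos_nonneg)
      with elim show ?case
        by (auto simp: norm_divide norm_power abs_mult simp del: of_real_power of_real_add intro!: divide_right_mono)
    qed
  qed measurable
  then show ?thesis by (auto simp: tempered_fun_def)
next
  case False
  obtain f1 f2 where f12: "f = (\<lambda>x. f1 x + f2 x)" "integrable lborel f1" "f2 \<in> borel_measurable borel" "\<And>x. norm (f2 x) \<le> 1"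
    by (rule Lp_split[OF f p False]) blast
  then show ?thesis
    using tempered_fun_add[OF tempered_fun_integrableI tempered_fun_bounded[of f2 1]] by simp
qed

text \<open>For \<open>p \<le> 2\<close> an \<open>L\<^sup>p\<close> function is the sum of an integrable and a square integrable one, whose transforms
  are a bounded and a square integrable function.\<close>

lemma Lp_fourier_function:
  fixes f :: "'d::finite tfun"
  assumes f: "Lp p f" and p: "1 \<le> p" "p \<le> 2"
  obtains g where "tempered_fun g" "dist_fourier (fun_dist f) \<doteq> fun_dist g"
proof -
  have "p \<noteq> \<infinity>" using p by auto
  then obtain f1 f2 where f12: "f = (\<lambda>x. f1 x + f2 x)" "integrable lborel f1" "L2 f2"
    using Lp_split[OF f p(1)] p(2) by metis
  obtain g where g: "fourier_L2 f2 g" by (rule fourier_L2_exists[OF f12(3)])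
  then have g2: "L2 g" by (simp add: fourier_L2_def)
  have m: "f1 \<in> borel_measurable borel" using f12(2) by auto
  have tf: "tempered_fun (fourier f1)"
    by (rule tempered_fun_bounded[OF fourier_measurable[OF m] norm_fourier_le])
  have tg: "tempered_fun (\<lambda>x. fourier f1 x + g x)"
    by (rule tempered_fun_add[OF tf L2_tempered_fun[OF g2]])
  have "dist_fourier (fun_dist f) \<phi> = fun_dist (\<lambda>x. fourier f1 x + g x) \<phi>" if \<phi>: "\<phi> \<in> schwartz" for \<phi>
  proof -
    have F: "fourier \<phi> \<in> schwartz" by (rule schwartz_fourier[OF \<phi>])
    have "dist_fourier (fun_dist f) \<phi> = (LINT x|lborel. f1 x * fourier \<phi> x) + (LINT x|lborel. f2 x * fourier \<phi> x)"
      unfolding dist_fourier_def fun_dist_def f12(1) distrib_right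
      by (intro Bochner_Integration.integral_add tempered_fun_integrable[OF _ F] tempered_fun_integrableI L2_tempered_fun f12)
    also have "(LINT x|lborel. f1 x * fourier \<phi> x) = (LINT x|lborel. fourier f1 x * \<phi> x)"
      by (rule fourier_swap[OF f12(2) schwartz_integrable[OF \<phi>], symmetric])
    also have "(LINT x|lborel. f2 x * fourier \<phi> x) = (LINT x|lborel. g x * \<phi> x)"
      by (rule fourier_L2_sym[OF g fourier_L2_schwartz[OF \<phi>], symmetric])
    also have "(LINT x|lborel. fourier f1 x * \<phi> x) + (LINT x|lborel. g x * \<phi> x) = fun_dist (\<lambda>x. fourier f1 x + g x) \<phi>"
      unfolding fun_dist_def distrib_right
      by (intro Bochner_Integration.integral_add[symmetric] tempered_fun_integrable[OF _ \<phi>] tf L2_tempered_fun g2)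
    finally show ?thesis .
  qed
  then show thesis using tg that by (simp add: dist_eq_def)
qed

lemma L2_fourier_dist:
  assumes "fourier_L2 f g"
  shows "dist_fourier (fun_dist f) \<doteq> fun_dist g"
  using fourier_L2_sym[OF assms fourier_L2_schwartz] by (simp add: dist_eq_def dist_fourier_def fun_dist_def)

section \<open>Constant coefficient operators on the Fourier side\<close>

lemma dist_eq_sym: "S \<doteq> T \<Longrightarrow> T \<doteq> S" by (simp add: dist_eq_def)
lemma dist_eq_trans: "S \<doteq> T \<Longrightarrow> T \<doteq> U \<Longrightarrow> S \<doteq> U" by (simp add: dist_eq_def)
lemma dist_eqD: "S \<doteq> T \<Longrightarrow> \<phi> \<in> schwartz \<Longrightarrow> S \<phi> = T \<phi>" by (simp add: dist_eq_def)

lemma tempered_cong: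
  assumes "S \<doteq> T" "tempered S"
  shows "tempered T"
proof -
  have eq: "T f = S f" if "f \<in> schwartz" for f using dist_eqD[OF assms(1) that] by simp
  have "\<exists>C N. \<forall>f\<in>schwartz. norm (T f) \<le> C * schwartz_seminorm N f"
    using assms(2) unfolding tempered_def by (simp add: eq)
  then show ?thesis
    unfolding tempered_def
    by (simp add: eq schwartz_add schwartz_cmult tempered_add_eq[OF assms(2)] tempered_cmult_eq[OF assms(2)])
qed

lemma dist_inv_fourier_fourier: "T \<doteq> dist_inv_fourier (dist_fourier T)"
  by (simp add: dist_eq_def dist_inv_fourier_def dist_fourier_def fourier_inv_fourier)

text \<open>Every multi-index is realized by a list of directions, so the choice in \<open>Dm\<close> is one of an actual
  list.\<close>

lemma count_list_exists: "\<exists>ks. \<forall>k::'d::finite. count_list ks k = \<alpha> k"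
proof -
  have "finite {k. 0 < \<alpha> k}" by simp
  then obtain M where M: "count M = \<alpha>" using Abs_multiset_inverse[of \<alpha>] by blast
  obtain ks where "mset ks = M" using ex_mset by blast
  then show ?thesis using M by (metis count_mset)
qed

text \<open>Only the multiplicities of the directions matter on the Fourier side, whatever list represents the
  multi-index.\<close>

lemma inv_fourier_pdiffs:
  fixes f :: "'d::finite tfun"
  assumes f: "f \<in> schwartz"
  shows "inv_fourier (pdiffs ks f) \<omega> = (\<Prod>k\<in>UNIV. (\<i> * complex_of_real (\<omega> $ k)) ^ count_list ks k) * inv_fourier f \<omega>"
proof (induction ks)
  case (Cons k ks)
  let ?a = "\<lambda>k. \<i> * complex_of_real (\<omega> $ k)"
  have "(\<Prod>l\<in>UNIV. ?a l ^ count_list (k # ks) l) = (\<Prod>l\<in>UNIV. (if l = k then ?a l else 1) * ?a l ^ count_list ks l)"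
    by (rule prod.cong) auto
  also have "\<dots> = ?a k * (\<Prod>l\<in>UNIV. ?a l ^ count_list ks l)"
    by (simp add: prod.distrib)
  finally show ?case
    using Cons f by (simp add: inv_fourier_pdiff schwartz_pdiffs)
qed simp

lemma Dm_pdiffs:
  obtains ks where "\<And>k. count_list ks k = \<alpha> k" "\<And>f. Dm \<alpha> f = pdiffs ks (f :: 'd::finite tfun)"
  using someI_ex[OF count_list_exists[of \<alpha>]] that by (auto simp: Dm_def)

lemma schwartz_Dm: "f \<in> schwartz \<Longrightarrow> Dm \<alpha> f \<in> schwartz"
  by (simp add: Dm_def schwartz_pdiffs)

lemma P_minus_eq: "P_minus \<gamma> m \<omega> $ j = (\<Sum>\<alpha> | mdeg \<alpha> \<le> m. complex_of_real (\<gamma> \<alpha> $ j) * (\<Prod>k\<in>UNIV. (- \<i> * complex_of_real (\<omega> $ k)) ^ \<alpha> k))"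
  by (simp add: P_minus_def P_symbol_def)

lemma power_mdeg: "c ^ mdeg \<alpha> = (\<Prod>k\<in>UNIV. (c::complex) ^ \<alpha> k)"
  by (simp add: mdeg_def power_sum)

lemma P_star_eq: "P_star \<gamma> m \<omega> $ j = P_minus (reflect \<gamma>) m \<omega> $ j"
proof -
  have "P_minus (reflect \<gamma>) m \<omega> $ j = (\<Sum>\<alpha> | mdeg \<alpha> \<le> m. complex_of_real (\<gamma> \<alpha> $ j) * (\<Prod>k\<in>UNIV. (\<i> * complex_of_real (\<omega> $ k)) ^ \<alpha> k))"
  proof -
    have "complex_of_real (reflect \<gamma> \<alpha> $ j) * (\<Prod>k\<in>UNIV. (- \<i> * complex_of_real (\<omega> $ k)) ^ \<alpha> k)
      = complex_of_real (\<gamma> \<alpha> $ j) * (\<Prod>k\<in>UNIV. (\<i> * complex_of_real (\<omega> $ k)) ^ \<alpha> k)" for \<alpha>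
    proof -
      have "complex_of_real (reflect \<gamma> \<alpha> $ j) * (\<Prod>k\<in>UNIV. (- \<i> * complex_of_real (\<omega> $ k)) ^ \<alpha> k)
        = complex_of_real (\<gamma> \<alpha> $ j) * ((- 1) ^ mdeg \<alpha> * (\<Prod>k\<in>UNIV. (- \<i> * complex_of_real (\<omega> $ k)) ^ \<alpha> k))"
        by (simp add: reflect_def)
      also have "(- 1) ^ mdeg \<alpha> * (\<Prod>k\<in>UNIV. (- \<i> * complex_of_real (\<omega> $ k)) ^ \<alpha> k) = (\<Prod>k\<in>UNIV. (\<i> * complex_of_real (\<omega> $ k)) ^ \<alpha> k)"
        unfolding power_mdeg prod.distrib[symmetric] power_mult_distrib[symmetric] by simp
      finally show ?thesis .
    qed
    then show ?thesis unfolding P_minus_eq by simp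
  qed
  moreover have "P_star \<gamma> m \<omega> $ j = (\<Sum>\<alpha> | mdeg \<alpha> \<le> m. complex_of_real (\<gamma> \<alpha> $ j) * (\<Prod>k\<in>UNIV. (\<i> * complex_of_real (\<omega> $ k)) ^ \<alpha> k))"
    by (simp add: P_star_def P_minus_eq)
  ultimately show ?thesis by simp
qed

lemma polyn_monomial: "polyn (\<lambda>\<omega>. \<Prod>k\<in>UNIV. (c * complex_of_real (\<omega> $ k)) ^ \<alpha> k)"
  by (intro polyn_prod polyn_power polyn.mult polyn.const polyn.coord)

lemma polyn_P_minus: "polyn (\<lambda>\<omega>. P_minus \<gamma> m \<omega> $ j)"
  unfolding P_minus_eq by (intro polyn_sum polyn.mult polyn.const polyn_monomial)

lemma polyn_P_star: "polyn (\<lambda>\<omega>. P_star \<gamma> m \<omega> $ j)"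
  unfolding P_star_eq by (rule polyn_P_minus)

lemma op_cmp_cong: "S \<doteq> T \<Longrightarrow> op_cmp \<gamma> m j S \<doteq> op_cmp \<gamma> m j T"
  by (simp add: dist_eq_def op_cmp_def dist_deriv_def schwartz_Dm)

text \<open>\<open>P\<^sub>j(D)\<close> becomes multiplication by its symbol: the sign \<open>(-1)\<^sup>\<bar>\<^sup>\<alpha>\<^sup>\<bar>\<close> from the definition of the distributional
  derivative turns the factors \<open>i \<omega>\<^sub>k\<close> of the inverse transform into \<open>- i \<omega>\<^sub>k\<close>.\<close>

lemma op_cmp_inv_fourier:
  fixes W :: "'d::finite tdist"
  assumes W: "tempered W"
  shows "op_cmp \<gamma> m j (dist_inv_fourier W) \<doteq> dist_inv_fourier (fun_times (\<lambda>\<omega>. P_minus \<gamma> m \<omega> $ j) W)"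
  unfolding dist_eq_def
proof
  fix \<phi> :: "'d tfun" assume \<phi>: "\<phi> \<in> schwartz"
  let ?\<psi> = "inv_fourier \<phi>"
  let ?m = "\<lambda>\<alpha> \<omega>. \<Prod>k\<in>UNIV. (- \<i> * complex_of_real (\<omega> $ k)) ^ \<alpha> k"
  have \<psi>: "?\<psi> \<in> schwartz" by (rule schwartz_inv_fourier[OF \<phi>])
  have s: "(\<lambda>\<omega>. ?m \<alpha> \<omega> * ?\<psi> \<omega>) \<in> schwartz" for \<alpha>
    by (rule slow_mult_schwartz[OF polyn_slow[OF polyn_monomial] \<psi>])
  have D: "(- 1) ^ mdeg \<alpha> * W (inv_fourier (Dm \<alpha> \<phi>)) = W (\<lambda>\<omega>. ?m \<alpha> \<omega> * ?\<psi> \<omega>)" for \<alpha>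
  proof -
    obtain ks where ks: "\<And>k. count_list ks k = \<alpha> k" "\<And>f. Dm \<alpha> f = pdiffs ks (f :: 'd tfun)"
      by (rule Dm_pdiffs[of \<alpha>]) blast
    have "(\<lambda>\<omega>. (- 1) ^ mdeg \<alpha> * inv_fourier (Dm \<alpha> \<phi>) \<omega>) = (\<lambda>\<omega>. ?m \<alpha> \<omega> * ?\<psi> \<omega>)"
      unfolding ks(2) inv_fourier_pdiffs[OF \<phi>] ks(1) power_mdeg mult.assoc[symmetric] prod.distrib[symmetric] power_mult_distrib[symmetric]
      by simp
    then show ?thesis
      using tempered_cmult_eq[OF W schwartz_inv_fourier[OF schwartz_Dm[OF \<phi>, of \<alpha>]], of "(- 1) ^ mdeg \<alpha>"] by simp
  qed
  have "op_cmp \<gamma> m j (dist_inv_fourier W) \<phi> = (\<Sum>\<alpha> | mdeg \<alpha> \<le> m. W (\<lambda>\<omega>. complex_of_real (\<gamma> \<alpha> $ j) * (?m \<alpha> \<omega> * ?\<psi> \<omega>)))"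
    unfolding op_cmp_def dist_deriv_def dist_inv_fourier_def D tempered_cmult_eq[OF W s] ..
  also have "\<dots> = W (\<lambda>\<omega>. \<Sum>\<alpha> | mdeg \<alpha> \<le> m. complex_of_real (\<gamma> \<alpha> $ j) * (?m \<alpha> \<omega> * ?\<psi> \<omega>))"
    by (rule tempered_sum_eq[OF W schwartz_cmult[OF s], symmetric])
  also have "(\<lambda>\<omega>. \<Sum>\<alpha> | mdeg \<alpha> \<le> m. complex_of_real (\<gamma> \<alpha> $ j) * (?m \<alpha> \<omega> * ?\<psi> \<omega>)) = (\<lambda>\<omega>. P_minus \<gamma> m \<omega> $ j * ?\<psi> \<omega>)"
    unfolding P_minus_eq sum_distrib_right mult.assoc ..
  finally show "op_cmp \<gamma> m j (dist_inv_fourier W) \<phi> = dist_inv_fourier (fun_times (\<lambda>\<omega>. P_minus \<gamma> m \<omega> $ j) W) \<phi>"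
    by (simp add: dist_inv_fourier_def fun_times_def)
qed

lemma tempered_times_P:
  assumes "tempered (W :: 'd::finite tdist)"
  shows "tempered (fun_times (\<lambda>\<omega>. P_minus \<gamma> m \<omega> $ j) W)" "tempered (fun_times (\<lambda>\<omega>. P_star \<gamma> m \<omega> $ j) W)"
  by (intro tempered_fun_times polyn_slow polyn_P_minus polyn_P_star assms)+

lemma op_cmp_fourier:
  fixes T :: "'d::finite tdist"
  assumes T: "tempered T"
  shows "op_cmp \<gamma> m j T \<doteq> dist_inv_fourier (fun_times (\<lambda>\<omega>. P_minus \<gamma> m \<omega> $ j) (dist_fourier T))"
  by (rule dist_eq_trans[OF op_cmp_cong[OF dist_inv_fourier_fourier] op_cmp_inv_fourier[OF tempered_dist_fourier[OF T]]])

lemma tempered_op_cmp: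
  fixes T :: "'d::finite tdist"
  assumes T: "tempered T"
  shows "tempered (op_cmp \<gamma> m j T)"
  by (rule tempered_cong[OF dist_eq_sym[OF op_cmp_fourier[OF T]]])
    (intro tempered_dist_inv_fourier tempered_times_P tempered_dist_fourier T)

lemma dist_fourier_op_cmp:
  fixes T :: "'d::finite tdist"
  assumes T: "tempered T"
  shows "dist_fourier (op_cmp \<gamma> m j T) \<doteq> fun_times (\<lambda>\<omega>. P_minus \<gamma> m \<omega> $ j) (dist_fourier T)"
  unfolding dist_eq_def
proof
  fix \<phi> :: "'d tfun" assume \<phi>: "\<phi> \<in> schwartz"
  have "dist_fourier (op_cmp \<gamma> m j T) \<phi> = op_cmp \<gamma> m j T (fourier \<phi>)" by (simp add: dist_fourier_def)
  also have "\<dots> = dist_inv_fourier (fun_times (\<lambda>\<omega>. P_minus \<gamma> m \<omega> $ j) (dist_fourier T)) (fourier \<phi>)"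
    by (rule dist_eqD[OF op_cmp_fourier[OF T] schwartz_fourier[OF \<phi>]])
  also have "\<dots> = fun_times (\<lambda>\<omega>. P_minus \<gamma> m \<omega> $ j) (dist_fourier T) \<phi>"
    by (simp add: dist_inv_fourier_def inv_fourier_fourier[OF \<phi>])
  finally show "dist_fourier (op_cmp \<gamma> m j T) \<phi> = fun_times (\<lambda>\<omega>. P_minus \<gamma> m \<omega> $ j) (dist_fourier T) \<phi>" .
qed

lemma op_cmp_op_cmp_inv_fourier:
  fixes W :: "'d::finite tdist"
  assumes W: "tempered W"
  shows "op_cmp (reflect \<gamma>) m k (op_cmp \<gamma> m j (dist_inv_fourier W)) \<doteq>
      dist_inv_fourier (fun_times (\<lambda>\<omega>. P_star \<gamma> m \<omega> $ k) (fun_times (\<lambda>\<omega>. P_minus \<gamma> m \<omega> $ j) W))"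
  unfolding P_star_eq
  by (rule dist_eq_trans[OF op_cmp_cong[OF op_cmp_inv_fourier[OF W]] op_cmp_inv_fourier[OF tempered_times_P(1)[OF W]]])

subsection \<open>The symbol of the projection\<close>

lemma PstarP_eq: "PstarP \<gamma> m \<omega> = complex_of_real (\<Sum>j\<in>UNIV. (norm (P_minus \<gamma> m \<omega> $ j))\<^sup>2)"
  unfolding PstarP_def P_star_def of_real_sum complex_norm_square by (simp add: mult.commute)

text \<open>\<open>\<bar>P\<^sub>j\<bar> \<bar>P\<^sub>k\<bar>\<close> is at most \<open>\<bar>P\<bar>\<^sup>2\<close>; where \<open>P\<close> vanishes, so does the symbol.\<close>

lemma proj_symbol_bound: "norm (proj_symbol \<gamma> m j k \<omega>) \<le> 1"
proof -
  let ?a = "\<lambda>j. norm (P_minus \<gamma> m \<omega> $ j)"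
  define S where "S = (\<Sum>j\<in>UNIV. (?a j)\<^sup>2)"
  have S: "(?a j)\<^sup>2 \<le> S" for j unfolding S_def by (rule member_le_sum) auto
  have S0: "S \<ge> 0" unfolding S_def by (intro sum_nonneg) auto
  have "2 * (?a j * ?a k) \<le> 2 * S"
    using sum_squares_bound[of "?a j" "?a k"] S[of j] S[of k] by simp
  then have "?a j * ?a k * inverse S \<le> S * inverse S"
    using S0 by (intro mult_right_mono) auto
  also have "\<dots> \<le> 1" by (cases "S = 0") auto
  finally have le: "?a j * ?a k * inverse S \<le> 1" .
  have "norm (PstarP \<gamma> m \<omega>) = S"
    using S0 unfolding PstarP_eq S_def[symmetric] norm_of_real by simp
  with le show ?thesis
    by (simp add: proj_symbol_def P_star_def norm_mult norm_inverse mult_ac)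
qed

lemma polyn_measurable [measurable_dest]: "polyn f \<Longrightarrow> f \<in> borel_measurable borel"
  by (rule smooth_measurable) (use polyn_slow[of f] in \<open>auto simp: slow_family_def\<close>)

lemma polyn_isCont: "polyn f \<Longrightarrow> isCont f x"
  by (rule differentiable_imp_continuous_within[OF smooth_differentiable])
    (use polyn_slow[of f] in \<open>auto simp: slow_family_def\<close>)

lemma polyn_PstarP: "polyn (PstarP \<gamma> m)"
  unfolding PstarP_def[abs_def] by (intro polyn_sum polyn.mult polyn_P_star polyn_P_minus)

lemma proj_symbol_measurable [measurable]: "proj_symbol \<gamma> m j k \<in> borel_measurable borel"
  unfolding proj_symbol_def
  by (intro borel_measurable_times borel_measurable_inverse polyn_measurable polyn_P_star polyn_P_minus polyn_PstarP)

lemma proj_symbol_isCont: "PstarP \<gamma> m \<omega> \<noteq> 0 \<Longrightarrow> isCont (proj_symbol \<gamma> m j k) \<omega>"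
  unfolding proj_symbol_def
  by (intro continuous_intros polyn_isCont polyn_P_star polyn_P_minus polyn_PstarP) 

lemma proj_symbol_swap:
  "P_minus \<gamma> m \<omega> $ a * proj_symbol \<gamma> m b k \<omega> = P_minus \<gamma> m \<omega> $ b * proj_symbol \<gamma> m a k \<omega>"
  by (simp add: proj_symbol_def)

lemma proj_symbol_div:
  assumes "PstarP \<gamma> m \<omega> \<noteq> 0"
  shows "(\<Sum>j\<in>UNIV. P_star \<gamma> m \<omega> $ j * proj_symbol \<gamma> m j k \<omega>) = P_star \<gamma> m \<omega> $ k"
proof -
  have "(\<Sum>j\<in>UNIV. P_star \<gamma> m \<omega> $ j * proj_symbol \<gamma> m j k \<omega>) = PstarP \<gamma> m \<omega> * (inverse (PstarP \<gamma> m \<omega>) * P_star \<gamma> m \<omega> $ k)"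
    unfolding PstarP_def[of \<gamma> m \<omega>] proj_symbol_def sum_distrib_right
    by (simp add: mult_ac PstarP_def)
  then show ?thesis using assms by simp
qed

lemma proj_symbol_trace:
  assumes "PstarP \<gamma> m \<omega> \<noteq> 0"
  shows "(\<Sum>j\<in>UNIV. proj_symbol \<gamma> m j j \<omega>) = 1"
proof -
  have "(\<Sum>j\<in>UNIV. proj_symbol \<gamma> m j j \<omega>) = inverse (PstarP \<gamma> m \<omega>) * PstarP \<gamma> m \<omega>"
    unfolding PstarP_def[of \<gamma> m \<omega>] proj_symbol_def sum_distrib_left
    by (simp add: mult_ac PstarP_def)
  then show ?thesis using assms by simp
qed

lemma fun_times_fun_dist: "fun_times a (fun_dist h) = fun_dist (\<lambda>\<omega>. a \<omega> * h \<omega>)"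
  by (rule ext) (simp add: fun_times_def fun_dist_def mult_ac)

lemma tempered_proj: "tempered (fun_dist (proj_symbol \<gamma> m j k))"
  by (intro tempered_fun_dist tempered_fun_bounded[OF proj_symbol_measurable proj_symbol_bound])

text \<open>With \<open>s = P\<^sup>* g\<close> and \<open>N = P\<^sup>* P\<close>, the projection of \<open>g\<close> is \<open>b = P s / N\<close>, so \<open>b\<^sup>* g\<close> and \<open>b\<^sup>* b\<close> both equal \<open>\<bar>s\<bar>\<^sup>2 / N\<close>.\<close>

lemma proj_orthogonal_pointwise:
  fixes g b :: "3 \<Rightarrow> complex"
  assumes b_def: "\<And>j. b j = (\<Sum>k\<in>UNIV. proj_symbol \<gamma> m j k \<omega> * g k)"
  shows "(\<Sum>j\<in>UNIV. (g j - b j) * cnj (b j)) = 0"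
proof -
  define N where "N = PstarP \<gamma> m \<omega>"
  define P where "P j = P_minus \<gamma> m \<omega> $ j" for j
  define s where "s = (\<Sum>k\<in>UNIV. cnj (P k) * g k)"
  have N: "cnj N = N" by (simp add: N_def PstarP_eq)
  have NP: "(\<Sum>j\<in>UNIV. P j * cnj (P j)) = N" by (simp add: N_def PstarP_def P_def P_star_def mult.commute)
  have b: "b j = P j * (inverse N * s)" for j
    by (simp add: b_def proj_symbol_def N_def P_def P_star_def s_def sum_distrib_left mult_ac)
  have "(\<Sum>j\<in>UNIV. (g j - b j) * cnj (b j)) = (\<Sum>j\<in>UNIV. (cnj (P j) * g j) * (inverse N * cnj s)
      - (P j * cnj (P j)) * (inverse N * s * (inverse N * cnj s)))"
    by (intro sum.cong refl) (simp add: b N algebra_simps)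
  also have "\<dots> = s * (inverse N * cnj s) - N * (inverse N * s * (inverse N * cnj s))"
    unfolding sum_subtractf sum_distrib_right[symmetric] NP s_def[symmetric] ..
  also have "\<dots> = 0" by (cases "N = 0") (auto simp: field_simps)
  finally show ?thesis .
qed

section \<open>The decomposition\<close>

lemma product_definedD: "product_defined S T \<Longrightarrow> is_product S T (dist_prod S T)"
  unfolding product_defined_def dist_prod_def by (erule someI_ex)

text \<open>The transform of the Dirac distribution is the constant \<open>1\<close>.\<close>

lemma dist_fourier_op_scalar:
  assumes "op_scalar \<gamma> m \<Phi> \<doteq> dirac"
  shows "dist_fourier (op_scalar \<gamma> m \<Phi>) \<doteq> fun_dist (\<lambda>\<omega>. 1)"
  using assms by (simp add: dist_eq_def dist_fourier_def fun_dist_def schwartz_fourier) (simp add: dirac_def fourier_def)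

text \<open>The quotient by \<open>P\<^sub>1\<^sup>*P\<^sub>1\<close> is compensated by the two factors from the numerator, so the defining
  integral of the transform of \<open>\<Phi>\<close> converges on the test functions \<open>P\<^sub>j P\<^sub>k\<^sup>* \<phi>\<close>.\<close>

lemma fundamental_solution_times:
  fixes \<Phi> :: "'d::finite tdist"
  assumes Phi: "fundamental_solution \<gamma> m \<Phi>"
  shows "fun_times (\<lambda>\<omega>. P_minus \<gamma> m \<omega> $ j) (fun_times (\<lambda>\<omega>. P_star \<gamma> m \<omega> $ k) (dist_fourier \<Phi>)) \<doteq> fun_dist (proj_symbol \<gamma> m j k)"
  unfolding dist_eq_def
proof
  fix \<phi> :: "'d tfun" assume \<phi>: "\<phi> \<in> schwartz"
  let ?p = "\<lambda>\<omega>. P_star \<gamma> m \<omega> $ k * (P_minus \<gamma> m \<omega> $ j * \<phi> \<omega>)"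
  have p: "?p \<in> schwartz"
    by (intro slow_mult_schwartz polyn_slow polyn_P_star polyn_P_minus \<phi>)
  have eq: "inverse (PstarP \<gamma> m \<omega>) * ?p \<omega> = proj_symbol \<gamma> m j k \<omega> * \<phi> \<omega>" for \<omega>
    by (simp add: proj_symbol_def)
  have "integrable lborel (\<lambda>\<omega>. inverse (PstarP \<gamma> m \<omega>) * ?p \<omega>)"
    unfolding eq by (rule tempered_fun_integrable[OF tempered_fun_bounded[OF proj_symbol_measurable proj_symbol_bound] \<phi>])
  then have "dist_fourier \<Phi> ?p = fun_dist (\<lambda>\<omega>. inverse (PstarP \<gamma> m \<omega>)) ?p"
    using Phi p by (simp add: fundamental_solution_def given_by_def)
  then show "fun_times (\<lambda>\<omega>. P_minus \<gamma> m \<omega> $ j) (fun_times (\<lambda>\<omega>. P_star \<gamma> m \<omega> $ k) (dist_fourier \<Phi>)) \<phi>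
     = fun_dist (proj_symbol \<gamma> m j k) \<phi>"
    unfolding fun_times_def fun_dist_def eq .
qed

lemma dist_fourier_op_entry:
  fixes \<Phi> :: "'d::finite tdist"
  assumes Phi: "fundamental_solution \<gamma> m \<Phi>"
  shows "dist_fourier (op_entry \<gamma> m j k \<Phi>) \<doteq> fun_dist (proj_symbol \<gamma> m j k)"
proof -
  have T: "tempered \<Phi>" using Phi by (simp add: fundamental_solution_def)
  have "dist_fourier (op_entry \<gamma> m j k \<Phi>) \<doteq> fun_times (\<lambda>\<omega>. P_minus \<gamma> m \<omega> $ j) (dist_fourier (op_cmp (reflect \<gamma>) m k \<Phi>))"
    unfolding op_entry_def by (rule dist_fourier_op_cmp[OF tempered_op_cmp[OF T]])
  also have "fun_times (\<lambda>\<omega>. P_minus \<gamma> m \<omega> $ j) (dist_fourier (op_cmp (reflect \<gamma>) m k \<Phi>)) \<doteq>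
     fun_times (\<lambda>\<omega>. P_minus \<gamma> m \<omega> $ j) (fun_times (\<lambda>\<omega>. P_star \<gamma> m \<omega> $ k) (dist_fourier \<Phi>))"
    using dist_fourier_op_cmp[OF T, of "reflect \<gamma>" m k]
    by (simp add: dist_eq_def fun_times_def P_star_eq slow_mult_schwartz polyn_slow polyn_P_minus)
  finally (dist_eq_trans) show ?thesis
    by (rule dist_eq_trans[OF _ fundamental_solution_times[OF Phi]])
qed

text \<open>In the next lemmas \<open>T k\<close> stands for the transform of the \<open>k\<close>-th component of the field and
  \<open>R j k\<close> for its product with the \<open>(j,k)\<close> entry of the projection symbol.\<close>

lemma dist_eqI: "(\<And>\<phi>. \<phi> \<in> schwartz \<Longrightarrow> S \<phi> = T \<phi>) \<Longrightarrow> S \<doteq> T"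
  by (simp add: dist_eq_def)

text \<open>The rows of the projection symbol are proportional to \<open>P\<close>; this is the vanishing of the curl.\<close>

lemma proj_products_swap:
  fixes T :: "'d::finite tdist" and \<gamma> :: "'d mindex \<Rightarrow> real^3"
  assumes T: "tempered T" and R: "\<And>j. is_product (fun_dist (proj_symbol \<gamma> m j k)) T (R j)"
  shows "fun_times (\<lambda>\<omega>. P_minus \<gamma> m \<omega> $ a) (R b) \<doteq> fun_times (\<lambda>\<omega>. P_minus \<gamma> m \<omega> $ b) (R a)"
proof -
  have p: "is_product (fun_times (\<lambda>\<omega>. P_minus \<gamma> m \<omega> $ x) (fun_dist (proj_symbol \<gamma> m y k))) T
      (fun_times (\<lambda>\<omega>. P_minus \<gamma> m \<omega> $ x) (R y))" for x y
    by (rule is_product_polyn[OF polyn_P_minus R tempered_proj T])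
  have "fun_times (\<lambda>\<omega>. P_minus \<gamma> m \<omega> $ a) (fun_dist (proj_symbol \<gamma> m b k))
    = fun_times (\<lambda>\<omega>. P_minus \<gamma> m \<omega> $ b) (fun_dist (proj_symbol \<gamma> m a k))"
    unfolding fun_times_fun_dist by (rule arg_cong[of _ _ fun_dist], rule ext, rule proj_symbol_swap)
  then show ?thesis using is_product_unique[OF p[of a b]] p[of b a] by simp
qed

lemma fun_dist_sum:
  assumes "\<And>i. i \<in> I \<Longrightarrow> tempered_fun (h i)" "\<phi> \<in> schwartz"
  shows "(\<Sum>i\<in>I. fun_dist (h i) \<phi>) = fun_dist (\<lambda>\<omega>. \<Sum>i\<in>I. h i \<omega>) \<phi>"
  unfolding fun_dist_def sum_distrib_right
  by (rule Bochner_Integration.integral_sum[symmetric]) (rule tempered_fun_integrable[OF assms])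

lemma fun_dist_cong_off_0:
  fixes g h :: "'d::finite tfun"
  assumes "\<And>\<omega>. \<omega> \<noteq> 0 \<Longrightarrow> g \<omega> = h \<omega>" and [measurable]: "g \<in> borel_measurable borel" "h \<in> borel_measurable borel"
  shows "fun_dist g \<doteq> fun_dist h"
proof (rule dist_eqI)
  fix \<phi> :: "'d tfun" assume \<phi>: "\<phi> \<in> schwartz"
  have [measurable]: "\<phi> \<in> borel_measurable borel" by (rule smooth_measurable[OF schwartz_smooth[OF \<phi>]])
  have ae: "AE \<omega> in lborel. \<omega> \<noteq> (0::real^'d)" by (rule AE_lborel_singleton)
  show "fun_dist g \<phi> = fun_dist h \<phi>"
    unfolding fun_dist_def
  proof (rule integral_cong_AE)
    show "AE \<omega> in lborel. g \<omega> * \<phi> \<omega> = h \<omega> * \<phi> \<omega>"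
      using ae by eventually_elim (simp add: assms(1))
  qed measurable
qed

lemma polyn_tempered_fun: "polyn (p :: 'd::finite tfun) \<Longrightarrow> tempered_fun p"
proof -
  assume p: "polyn p"
  have "\<exists>C M. \<forall>(i::unit) x. norm (pdiffs [] p x) \<le> C * (1 + norm x) ^ M"
    using polyn_slow[OF p] unfolding slow_family_def by blast
  then obtain C M where C: "norm (p x) \<le> C * (1 + norm x) ^ M" for x by auto
  show ?thesis
    by (rule tempered_fun_mono[OF tempered_fun_const[of 1] polyn_measurable[OF p], of C M]) (use C in simp)
qed

text \<open>\<open>P\<^sup>*\<close> is unchanged by the projection off the origin; this is the vanishing of the divergence.\<close>

lemma proj_products_div:
  fixes T :: "'d::finite tdist" and \<gamma> :: "'d mindex \<Rightarrow> real^3"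
  assumes elliptic: "\<And>\<omega>. \<omega> \<noteq> 0 \<Longrightarrow> PstarP \<gamma> m \<omega> \<noteq> 0"
    and T: "tempered T" and R: "\<And>j. is_product (fun_dist (proj_symbol \<gamma> m j k)) T (R j)"
  shows "(\<lambda>\<phi>. \<Sum>j\<in>UNIV. fun_times (\<lambda>\<omega>. P_star \<gamma> m \<omega> $ j) (R j) \<phi>) \<doteq> fun_times (\<lambda>\<omega>. P_star \<gamma> m \<omega> $ k) T"
proof -
  let ?Q = "\<lambda>j \<omega>. P_star \<gamma> m \<omega> $ j"
  have 1: "is_product (\<lambda>\<phi>. \<Sum>j\<in>UNIV. fun_times (?Q j) (fun_dist (proj_symbol \<gamma> m j k)) \<phi>) T
     (\<lambda>\<phi>. \<Sum>j\<in>UNIV. fun_times (?Q j) (R j) \<phi>)"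
    by (intro is_product_sum is_product_polyn polyn_P_star R tempered_proj T tempered_times_P)
  have tp: "tempered_fun (\<lambda>\<omega>. ?Q j \<omega> * proj_symbol \<gamma> m j k \<omega>)" for j
  proof (rule tempered_fun_mono[OF polyn_tempered_fun[OF polyn_P_star[of \<gamma> m j]], of _ 1 0])
    show "(\<lambda>\<omega>. ?Q j \<omega> * proj_symbol \<gamma> m j k \<omega>) \<in> borel_measurable borel"
      by (rule borel_measurable_times[OF polyn_measurable[OF polyn_P_star] proj_symbol_measurable])
    show "norm (?Q j \<omega> * proj_symbol \<gamma> m j k \<omega>) \<le> 1 * (1 + norm \<omega>) ^ 0 * norm (?Q j \<omega>)" for \<omega>
      using mult_left_le[OF proj_symbol_bound norm_ge_zero] by (simp add: norm_mult)
  qed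
  have "(\<lambda>\<phi>. \<Sum>j\<in>UNIV. fun_times (?Q j) (fun_dist (proj_symbol \<gamma> m j k)) \<phi>)
     \<doteq> fun_dist (\<lambda>\<omega>. \<Sum>j\<in>UNIV. ?Q j \<omega> * proj_symbol \<gamma> m j k \<omega>)"
    unfolding fun_times_fun_dist by (rule dist_eqI) (rule fun_dist_sum[OF tp])
  also have "fun_dist (\<lambda>\<omega>. \<Sum>j\<in>UNIV. ?Q j \<omega> * proj_symbol \<gamma> m j k \<omega>) \<doteq> fun_dist (\<lambda>\<omega>. ?Q k \<omega> * 1)"
  proof (rule fun_dist_cong_off_0)
    show "(\<lambda>\<omega>. \<Sum>j\<in>UNIV. ?Q j \<omega> * proj_symbol \<gamma> m j k \<omega>) \<in> borel_measurable borel"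
      by (rule borel_measurable_sum[OF borel_measurable_times[OF polyn_measurable[OF polyn_P_star] proj_symbol_measurable]])
    show "(\<lambda>\<omega>. ?Q k \<omega> * 1) \<in> borel_measurable borel"
      using polyn_measurable[OF polyn_P_star] by simp
  qed (simp add: proj_symbol_div elliptic)
  finally (dist_eq_trans) have "(\<lambda>\<phi>. \<Sum>j\<in>UNIV. fun_times (?Q j) (fun_dist (proj_symbol \<gamma> m j k)) \<phi>)
     \<doteq> fun_times (?Q k) (fun_dist (\<lambda>\<omega>. 1))"
    by (simp only: fun_times_fun_dist)
  with 1 have "is_product (fun_times (?Q k) (fun_dist (\<lambda>\<omega>. 1))) T (\<lambda>\<phi>. \<Sum>j\<in>UNIV. fun_times (?Q j) (R j) \<phi>)"
    by (simp only: is_product_cong)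
  moreover have "is_product (fun_times (?Q k) (fun_dist (\<lambda>\<omega>. 1))) T (fun_times (?Q k) T)"
    by (rule is_product_polyn[OF polyn_P_star is_product_one[OF T] tempered_fun_dist[OF tempered_fun_const] T])
  ultimately show ?thesis by (rule is_product_unique)
qed

text \<open>If the convolution with \<open>\<Phi>\<close> exists, multiplying the symbol \<open>P\<^sub>j P\<^sub>k\<^sup>*\<close> into the product \<open>X\<close> gives the product with the
  \<open>(j,k)\<close> entry of the projection symbol.\<close>

lemma solution_product_entry:
  fixes T :: "'d::finite tdist" and \<gamma> :: "'d mindex \<Rightarrow> real^3"
  assumes Phi: "fundamental_solution \<gamma> m \<Phi>" and T: "tempered T"
    and X: "is_product (dist_fourier \<Phi>) T X" and R: "is_product (fun_dist (proj_symbol \<gamma> m j k)) T R"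
  shows "fun_times (\<lambda>\<omega>. P_minus \<gamma> m \<omega> $ j) (fun_times (\<lambda>\<omega>. P_star \<gamma> m \<omega> $ k) X) \<doteq> R"
proof -
  have t: "tempered (dist_fourier \<Phi>)" using Phi by (simp add: fundamental_solution_def tempered_dist_fourier)
  have "is_product (fun_times (\<lambda>\<omega>. P_minus \<gamma> m \<omega> $ j) (fun_times (\<lambda>\<omega>. P_star \<gamma> m \<omega> $ k) (dist_fourier \<Phi>))) T
     (fun_times (\<lambda>\<omega>. P_minus \<gamma> m \<omega> $ j) (fun_times (\<lambda>\<omega>. P_star \<gamma> m \<omega> $ k) X))"
    by (intro is_product_polyn polyn_P_minus polyn_P_star X t tempered_times_P T)
  then have "is_product (fun_dist (proj_symbol \<gamma> m j k)) T (fun_times (\<lambda>\<omega>. P_minus \<gamma> m \<omega> $ j) (fun_times (\<lambda>\<omega>. P_star \<gamma> m \<omega> $ k) X))"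
    by (simp only: is_product_cong[OF fundamental_solution_times[OF Phi]])
  then show ?thesis using R by (rule is_product_unique)
qed

lemma fun_times_commute: "fun_times a (fun_times b T) = fun_times b (fun_times a T)"
  by (simp add: fun_times_def mult.left_commute)

text \<open>The trace of a rank one projection is \<open>1\<close>, so the scalar operator undoes the convolution with \<open>\<Phi>\<close>.\<close>

lemma solution_product_trace:
  fixes T :: "'d::finite tdist" and \<gamma> :: "'d mindex \<Rightarrow> real^3"
  assumes elliptic: "\<And>\<omega>. \<omega> \<noteq> 0 \<Longrightarrow> PstarP \<gamma> m \<omega> \<noteq> 0"
    and Phi: "fundamental_solution \<gamma> m \<Phi>" and T: "tempered T"
    and X: "is_product (dist_fourier \<Phi>) T X"
  shows "(\<lambda>\<phi>. \<Sum>l\<in>UNIV. fun_times (\<lambda>\<omega>. P_star \<gamma> m \<omega> $ l) (fun_times (\<lambda>\<omega>. P_minus \<gamma> m \<omega> $ l) X) \<phi>) \<doteq> T"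
proof -
  let ?F = "\<lambda>W l. fun_times (\<lambda>\<omega>. P_star \<gamma> m \<omega> $ l) (fun_times (\<lambda>\<omega>. P_minus \<gamma> m \<omega> $ l) W)"
  have t: "tempered (dist_fourier \<Phi>)" using Phi by (simp add: fundamental_solution_def tempered_dist_fourier)
  have 1: "is_product (\<lambda>\<phi>. \<Sum>l\<in>UNIV. ?F (dist_fourier \<Phi>) l \<phi>) T (\<lambda>\<phi>. \<Sum>l\<in>UNIV. ?F X l \<phi>)"
    by (intro is_product_sum is_product_polyn polyn_P_minus polyn_P_star X t tempered_times_P T)
  have "(\<lambda>\<phi>. \<Sum>l\<in>UNIV. ?F (dist_fourier \<Phi>) l \<phi>) \<doteq> fun_dist (\<lambda>\<omega>. \<Sum>l\<in>UNIV. proj_symbol \<gamma> m l l \<omega>)"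
  proof (rule dist_eqI)
    fix \<phi> :: "'d tfun" assume \<phi>: "\<phi> \<in> schwartz"
    have "?F (dist_fourier \<Phi>) l \<phi> = fun_dist (proj_symbol \<gamma> m l l) \<phi>" for l
      using dist_eqD[OF fundamental_solution_times[OF Phi] \<phi>] by (simp only: fun_times_commute)
    then show "(\<Sum>l\<in>UNIV. ?F (dist_fourier \<Phi>) l \<phi>) = fun_dist (\<lambda>\<omega>. \<Sum>l\<in>UNIV. proj_symbol \<gamma> m l l \<omega>) \<phi>"
      using fun_dist_sum[OF tempered_fun_bounded[OF proj_symbol_measurable proj_symbol_bound] \<phi>] by simp
  qed
  also have "fun_dist (\<lambda>\<omega>. \<Sum>l\<in>UNIV. proj_symbol \<gamma> m l l \<omega>) \<doteq> fun_dist (\<lambda>\<omega>. 1)"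
    by (rule fun_dist_cong_off_0) (auto simp: proj_symbol_trace elliptic)
  finally (dist_eq_trans) have "is_product (fun_dist (\<lambda>\<omega>. 1)) T (\<lambda>\<phi>. \<Sum>l\<in>UNIV. ?F X l \<phi>)"
    using 1 by (simp only: is_product_cong)
  then show ?thesis by (rule is_product_unique[OF _ is_product_one[OF T]])
qed

lemma projections_defined_le_2:
  fixes \<gamma> :: "'d::finite mindex \<Rightarrow> real^3"
  assumes elliptic: "\<And>\<omega>. \<omega> \<noteq> 0 \<Longrightarrow> PstarP \<gamma> m \<omega> \<noteq> 0"
    and u: "\<And>j. Lp p (\<lambda>x. u x $ j)" and p: "1 \<le> p" "p \<le> 2"
  shows "projections_defined \<gamma> m (fun_dist3 u)"
  unfolding projections_defined_def product_defined_def
proof (intro allI)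
  fix j k
  have c: "cmp (fun_dist3 u) k = fun_dist (\<lambda>x. u x $ k)" by (simp add: cmp_def fun_dist3_def)
  obtain g where g: "tempered_fun g" "dist_fourier (fun_dist (\<lambda>x. u x $ k)) \<doteq> fun_dist g"
    by (rule Lp_fourier_function[OF u p])
  show "\<exists>R. is_product (fun_dist (proj_symbol \<gamma> m j k)) (dist_fourier (cmp (fun_dist3 u) k)) R"
    unfolding c
    by (rule exI, rule is_product_fun[OF proj_symbol_measurable proj_symbol_bound proj_symbol_isCont[OF elliptic] g])
qed

text \<open>For square integrable fields all products are functions, orthogonal at almost every frequency; Parseval's
  formula carries this over to the fields.\<close>

lemma projections_orthogonal:
  fixes \<gamma> :: "'d::finite mindex \<Rightarrow> real^3"
  assumes elliptic: "\<And>\<omega>. \<omega> \<noteq> 0 \<Longrightarrow> PstarP \<gamma> m \<omega> \<noteq> 0"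
    and u: "\<And>j. L2 (\<lambda>x. u x $ j)"
    and R: "\<And>j k. is_product (fun_dist (proj_symbol \<gamma> m j k)) (dist_fourier (fun_dist (\<lambda>x. u x $ k))) (R j k)"
    and V: "V = (\<lambda>\<phi>. \<chi> j. dist_fourier (fun_dist (\<lambda>x. u x $ j)) (inv_fourier \<phi>) - (\<Sum>k\<in>UNIV. R j k (inv_fourier \<phi>)))"
    and W: "W = (\<lambda>\<phi>. \<chi> j. \<Sum>k\<in>UNIV. R j k (inv_fourier \<phi>))"
  shows "orthogonal_L2 V W"
proof -
  have "\<exists>g. fourier_L2 (\<lambda>x. u x $ j) g" for j by (rule fourier_L2_exists[OF u[of j]]) blast
  then obtain g where g: "\<And>j. fourier_L2 (\<lambda>x. u x $ j) (g j)" by metis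
  have g2: "L2 (g j)" for j using g[of j] by (simp add: fourier_L2_def)
  have pg: "L2 (\<lambda>\<omega>. proj_symbol \<gamma> m j k \<omega> * g k \<omega>)" for j k
  proof (rule L2_mono[OF g2[of k], of _ 1])
    show "(\<lambda>\<omega>. proj_symbol \<gamma> m j k \<omega> * g k \<omega>) \<in> borel_measurable borel"
      using L2_measurable[OF g2[of k]] by measurable
    show "norm (proj_symbol \<gamma> m j k \<omega> * g k \<omega>) \<le> 1 * norm (g k \<omega>)" for \<omega>
      unfolding norm_mult by (intro mult_right_mono proj_symbol_bound) auto
  qed
  define b where "b j \<omega> = (\<Sum>k\<in>UNIV. proj_symbol \<gamma> m j k \<omega> * g k \<omega>)" for j \<omega>
  define a where "a j \<omega> = g j \<omega> - b j \<omega>" for j \<omega>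
  have b2: "L2 (b j)" for j unfolding b_def[abs_def] by (intro L2_sum pg)
  have a2: "L2 (a j)" for j unfolding a_def[abs_def] by (intro L2_diff g2 b2)
  have Rb: "(\<Sum>k\<in>UNIV. R j k \<psi>) = fun_dist (b j) \<psi>" if \<psi>: "\<psi> \<in> schwartz" for j \<psi>
  proof -
    have "R j k \<doteq> fun_dist (\<lambda>\<omega>. proj_symbol \<gamma> m j k \<omega> * g k \<omega>)" for k
      by (rule is_product_unique[OF R is_product_fun[OF proj_symbol_measurable proj_symbol_bound proj_symbol_isCont[OF elliptic]
          L2_tempered_fun[OF g2] L2_fourier_dist[OF g]]])
    then have "(\<Sum>k\<in>UNIV. R j k \<psi>) = (\<Sum>k\<in>UNIV. fun_dist (\<lambda>\<omega>. proj_symbol \<gamma> m j k \<omega> * g k \<omega>) \<psi>)"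
      using \<psi> by (simp add: dist_eq_def)
    also have "\<dots> = fun_dist (b j) \<psi>"
      unfolding b_def[abs_def] by (rule fun_dist_sum[OF L2_tempered_fun[OF pg] \<psi>])
    finally show ?thesis .
  qed
  have Ta: "dist_fourier (fun_dist (\<lambda>x. u x $ j)) \<psi> - (\<Sum>k\<in>UNIV. R j k \<psi>) = fun_dist (a j) \<psi>" if \<psi>: "\<psi> \<in> schwartz" for j \<psi>
  proof -
    have "fun_dist (a j) \<psi> = fun_dist (g j) \<psi> - fun_dist (b j) \<psi>"
      unfolding fun_dist_def a_def left_diff_distrib
      by (intro Bochner_Integration.integral_diff tempered_fun_integrable[OF _ \<psi>] L2_tempered_fun g2 b2)
    then show ?thesis using Rb[OF \<psi>] dist_eqD[OF L2_fourier_dist[OF g] \<psi>] by simp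
  qed
  have "\<exists>k. fourier_L2 (a j) k" for j by (rule fourier_L2_exists[OF a2[of j]]) blast
  then obtain ka where ka: "\<And>j. fourier_L2 (a j) (ka j)" by metis
  have "\<exists>k. fourier_L2 (b j) k" for j by (rule fourier_L2_exists[OF b2[of j]]) blast
  then obtain kb where kb: "\<And>j. fourier_L2 (b j) (kb j)" by metis
  have k2: "L2 (ka j)" "L2 (kb j)" for j using ka[of j] kb[of j] by (auto simp: fourier_L2_def)
  define c where "c = complex_of_real (1 / (2 * pi) ^ CARD('d))"
  define av where "av x = (\<chi> j. c * ka j (- x))" for x
  define bv where "bv x = (\<chi> j. c * kb j (- x))" for x
  have l2: "L2 (\<lambda>x. c * ka j (- x))" "L2 (\<lambda>x. c * kb j (- x))" for j
    by (intro L2_cmult L2_reflect k2)+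
  have i0: "(LINT x|lborel. (c * ka j (- x)) * cnj (c * kb j (- x))) = c * cnj c * (complex_of_real ((2 * pi) ^ CARD('d)) * (LINT \<omega>|lborel. a j \<omega> * cnj (b j \<omega>)))" for j
  proof -
    have [measurable]: "ka j \<in> borel_measurable borel" "(\<lambda>x. cnj (kb j x)) \<in> borel_measurable borel"
      using k2[of j] L2_cnj[OF k2(2)[of j]] by (auto simp: L2_def)
    have "(LINT x|lborel. (c * ka j (- x)) * cnj (c * kb j (- x))) = (LINT x|lborel. c * cnj c * (ka j (- x) * cnj (kb j (- x))))"
      by (simp add: mult_ac)
    also have "\<dots> = c * cnj c * (LINT x|lborel. ka j (- x) * cnj (kb j (- x)))"
      by (rule integral_mult_right_zero)
    also have "(LINT x|lborel. ka j (- x) * cnj (kb j (- x))) = (LINT x|lborel. ka j x * cnj (kb j x))"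
      using lborel_integral_affine[of "\<lambda>x. ka j x * cnj (kb j x)" "-1" 0] by simp
    finally show ?thesis unfolding parseval_L2[OF ka kb] .
  qed
  show ?thesis
    unfolding orthogonal_L2_def
  proof (intro exI conjI allI)
    show "Lp 2 (\<lambda>x. av x $ j)" for j unfolding Lp_2_iff av_def using l2 by simp
    show "Lp 2 (\<lambda>x. bv x $ j)" for j unfolding Lp_2_iff bv_def using l2 by simp
    show "V \<doteq> fun_dist3 av"
    proof (rule dist_eqI)
      fix \<phi> :: "'d tfun" assume \<phi>: "\<phi> \<in> schwartz"
      have "V \<phi> $ j = fun_dist3 av \<phi> $ j" for j
        using Ta[OF schwartz_inv_fourier[OF \<phi>], of j] dist_eqD[OF dist_inv_fourier_L2[OF ka[of j]] \<phi>]
        by (simp add: V fun_dist3_def av_def c_def dist_inv_fourier_def)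
      then show "V \<phi> = fun_dist3 av \<phi>" by (simp add: vec_eq_iff)
    qed
    show "W \<doteq> fun_dist3 bv"
    proof (rule dist_eqI)
      fix \<phi> :: "'d tfun" assume \<phi>: "\<phi> \<in> schwartz"
      have "W \<phi> $ j = fun_dist3 bv \<phi> $ j" for j
        using Rb[OF schwartz_inv_fourier[OF \<phi>], of j] dist_eqD[OF dist_inv_fourier_L2[OF kb[of j]] \<phi>]
        by (simp add: W fun_dist3_def bv_def c_def dist_inv_fourier_def)
      then show "W \<phi> = fun_dist3 bv \<phi>" by (simp add: vec_eq_iff)
    qed
    have "(LINT x|lborel. (\<Sum>j\<in>UNIV. av x $ j * cnj (bv x $ j))) = (\<Sum>j\<in>UNIV. LINT x|lborel. (c * ka j (- x)) * cnj (c * kb j (- x)))"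
      unfolding av_def bv_def vec_lambda_beta
      by (intro Bochner_Integration.integral_sum L2_mult_integrable L2_cnj l2)
    also have "\<dots> = c * cnj c * complex_of_real ((2 * pi) ^ CARD('d)) * (\<Sum>j\<in>UNIV. LINT \<omega>|lborel. a j \<omega> * cnj (b j \<omega>))"
      by (simp only: i0) (simp only: sum_distrib_left mult.assoc)
    also have "(\<Sum>j\<in>UNIV. LINT \<omega>|lborel. a j \<omega> * cnj (b j \<omega>)) = (LINT \<omega>|lborel. (\<Sum>j\<in>UNIV. a j \<omega> * cnj (b j \<omega>)))"
      by (intro Bochner_Integration.integral_sum[symmetric] L2_mult_integrable L2_cnj a2 b2)
    also have "(\<lambda>\<omega>. \<Sum>j\<in>UNIV. a j \<omega> * cnj (b j \<omega>)) = (\<lambda>\<omega>. 0)"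
      unfolding a_def by (rule ext, rule proj_orthogonal_pointwise) (simp add: b_def)
    finally show "(LINT x|lborel. (\<Sum>j\<in>UNIV. av x $ j * cnj (bv x $ j))) = 0" by simp
  qed
qed

lemma cmp_op_grad: "cmp (op_grad \<gamma> m T) j = op_cmp \<gamma> m j T"
  by (simp add: cmp_def op_grad_def)

theorem lemma3p3:
  fixes \<gamma> :: "'d::finite mindex \<Rightarrow> real^3" and r1 :: nat and \<Phi> :: "'d tdist"
    and p :: ereal and r :: real
    and u :: "real^'d \<Rightarrow> complex^3" and U :: "'d tdist3"
  assumes elliptic: "\<And>\<omega>. \<omega> \<noteq> 0 \<Longrightarrow> PstarP \<gamma> r1 \<omega> \<noteq> 0"
    and Phi: "fundamental_solution \<gamma> r1 \<Phi>"
    and p: "1 \<le> p" and r: "ereal (real CARD('d)) / p < ereal r"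
    and u: "\<And>j. sobolev p r (\<lambda>x. u x $ j)"
    and U: "U = fun_dist3 u"
    and well_defined: "2 < p \<Longrightarrow> projections_defined \<gamma> r1 U"
  shows "projections_defined \<gamma> r1 U
    \<and> U \<doteq> (\<lambda>\<phi>. proj_div \<gamma> r1 U \<phi> + proj_curl \<gamma> r1 U \<phi>)
    \<and> ((\<forall>k. conv_defined \<Phi> (cmp U k)) \<longrightarrow>
        proj_div \<gamma> r1 U \<doteq>
          (\<lambda>\<phi>. (\<chi> j. op_scalar \<gamma> r1 (cmp (conv3 \<Phi> U) j) \<phi>) - op_matrix \<gamma> r1 (conv3 \<Phi> U) \<phi>)
        \<and> proj_curl \<gamma> r1 U \<doteq> op_matrix \<gamma> r1 (conv3 \<Phi> U))
    \<and> (\<forall>j k. conv_defined (op_entry \<gamma> r1 j k \<Phi>) (cmp U k))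
    \<and> (\<forall>j. conv_defined (op_scalar \<gamma> r1 \<Phi>) (cmp U j))
    \<and> proj_div \<gamma> r1 U \<doteq>
        (\<lambda>\<phi>. \<chi> j. conv (op_scalar \<gamma> r1 \<Phi>) (cmp U j) \<phi>
                - (\<Sum>k\<in>UNIV. conv (op_entry \<gamma> r1 j k \<Phi>) (cmp U k) \<phi>))
    \<and> proj_curl \<gamma> r1 U \<doteq> (\<lambda>\<phi>. \<chi> j. \<Sum>k\<in>UNIV. conv (op_entry \<gamma> r1 j k \<Phi>) (cmp U k) \<phi>)
    \<and> op_div (reflect \<gamma>) r1 (proj_div \<gamma> r1 U) \<doteq> (\<lambda>\<phi>. 0)
    \<and> op_curl \<gamma> r1 (proj_curl \<gamma> r1 U) \<doteq> (\<lambda>\<phi>. 0)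
    \<and> (p = 2 \<longrightarrow> orthogonal_L2 (proj_div \<gamma> r1 U) (proj_curl \<gamma> r1 U))"
proof -
  define T where "T k = dist_fourier (cmp U k)" for k
  define R where "R j k = dist_prod (fun_dist (proj_symbol \<gamma> r1 j k)) (T k)" for j k
  let ?P = "\<lambda>j \<omega>. P_minus \<gamma> r1 \<omega> $ j" and ?Q = "\<lambda>j \<omega>. P_star \<gamma> r1 \<omega> $ j"
  have Lp: "Lp p (\<lambda>x. u x $ j)" for j using u[of j] by (simp add: sobolev_def)
  have cU: "cmp U k = fun_dist (\<lambda>x. u x $ k)" for k by (simp add: U cmp_def fun_dist3_def)
  have tU: "tempered (cmp U k)" for k
    unfolding cU by (rule tempered_fun_dist[OF Lp_tempered_fun[OF Lp p]])
  then have T: "tempered (T k)" for k unfolding T_def by (rule tempered_dist_fourier)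
  have defined: "projections_defined \<gamma> r1 U"
  proof (cases "2 < p")
    case False
    then show ?thesis unfolding U by (intro projections_defined_le_2[OF elliptic Lp p]) auto
  qed (rule well_defined)
  then have R: "is_product (fun_dist (proj_symbol \<gamma> r1 j k)) (T k) (R j k)" for j k
    unfolding R_def T_def projections_defined_def by (intro product_definedD) blast
  have tR: "tempered (R j k)" for j k by (rule is_product_tempered[OF R])
  define S where "S j = (\<lambda>\<phi>. \<Sum>k\<in>UNIV. R j k \<phi>)" for j
  have tS: "tempered (S j)" for j unfolding S_def by (intro tempered_sum tR)
  have inv: "inv_fourier \<phi> \<in> schwartz" if "\<phi> \<in> schwartz" for \<phi> :: "'d tfun"
    by (rule schwartz_inv_fourier[OF that])

  \<comment> \<open>Both projections in terms of \<open>T\<close> and \<open>R\<close>.\<close>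
  have Tk: "dist_fourier U \<psi> $ k = T k \<psi>" for k \<psi> by (simp add: T_def dist_fourier_def cmp_def)
  have cT: "cmp (dist_fourier U) k = T k" for k by (rule ext) (simp add: cmp_def Tk)
  have st: "symbol_times \<gamma> r1 (dist_fourier U) \<psi> $ j = S j \<psi>" for j \<psi>
    by (simp add: symbol_times_def cT S_def R_def)
  have curl: "proj_curl \<gamma> r1 U \<phi> $ j = S j (inv_fourier \<phi>)" for j \<phi>
    by (simp add: proj_curl_def dist_inv_fourier_def st)
  have div: "proj_div \<gamma> r1 U \<phi> $ j = T j (inv_fourier \<phi>) - S j (inv_fourier \<phi>)" for j \<phi>
    by (simp add: proj_div_def dist_inv_fourier_def st Tk)
  have ccurl: "cmp (proj_curl \<gamma> r1 U) j = dist_inv_fourier (S j)" for j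
    by (rule ext) (simp add: cmp_def curl dist_inv_fourier_def)
  have cdiv: "cmp (proj_div \<gamma> r1 U) j = dist_inv_fourier (\<lambda>\<phi>. T j \<phi> - S j \<phi>)" for j
    by (rule ext) (simp add: cmp_def div dist_inv_fourier_def)

  have sum: "U \<doteq> (\<lambda>\<phi>. proj_div \<gamma> r1 U \<phi> + proj_curl \<gamma> r1 U \<phi>)"
  proof (rule dist_eqI)
    fix \<phi> :: "'d tfun" assume \<phi>: "\<phi> \<in> schwartz"
    have "T j (inv_fourier \<phi>) = U \<phi> $ j" for j
      by (simp add: T_def dist_fourier_def cmp_def fourier_inv_fourier[OF \<phi>])
    then show "U \<phi> = proj_div \<gamma> r1 U \<phi> + proj_curl \<gamma> r1 U \<phi>"
      by (simp add: vec_eq_iff div curl)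
  qed

  \<comment> \<open>Convolutions with the derivatives of the fundamental solution.\<close>
  have entry: "dist_fourier (op_entry \<gamma> r1 j k \<Phi>) \<doteq> fun_dist (proj_symbol \<gamma> r1 j k)" for j k
    by (rule dist_fourier_op_entry[OF Phi])
  have scalar: "dist_fourier (op_scalar \<gamma> r1 \<Phi>) \<doteq> fun_dist (\<lambda>\<omega>. 1)"
    using Phi by (intro dist_fourier_op_scalar) (simp add: fundamental_solution_def)
  have conv_entry: "conv (op_entry \<gamma> r1 j k \<Phi>) (cmp U k) = dist_inv_fourier (R j k)" for j k
    unfolding conv_def T_def[symmetric] R_def by (simp only: dist_prod_cong[OF entry])
  have conv_scalar: "conv (op_scalar \<gamma> r1 \<Phi>) (cmp U j) \<phi> = T j (inv_fourier \<phi>)" if "\<phi> \<in> schwartz" for j \<phi>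
    unfolding conv_def T_def[symmetric] dist_prod_cong[OF scalar] dist_inv_fourier_def
    by (rule dist_eqD[OF dist_prod_eq[OF is_product_one[OF T]] inv[OF that]])
  have def_entry: "conv_defined (op_entry \<gamma> r1 j k \<Phi>) (cmp U k)" for j k
    unfolding conv_defined_def product_defined_def T_def[symmetric] is_product_cong[OF entry] using R by blast
  have def_scalar: "conv_defined (op_scalar \<gamma> r1 \<Phi>) (cmp U j)" for j
    unfolding conv_defined_def product_defined_def T_def[symmetric] is_product_cong[OF scalar] using is_product_one[OF T] by blast
  have curl_conv: "proj_curl \<gamma> r1 U \<doteq> (\<lambda>\<phi>. \<chi> j. \<Sum>k\<in>UNIV. conv (op_entry \<gamma> r1 j k \<Phi>) (cmp U k) \<phi>)"
    by (rule dist_eqI) (simp add: vec_eq_iff curl conv_entry dist_inv_fourier_def S_def)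
  have div_conv: "proj_div \<gamma> r1 U \<doteq> (\<lambda>\<phi>. \<chi> j. conv (op_scalar \<gamma> r1 \<Phi>) (cmp U j) \<phi>
                - (\<Sum>k\<in>UNIV. conv (op_entry \<gamma> r1 j k \<Phi>) (cmp U k) \<phi>))"
    by (rule dist_eqI) (simp add: vec_eq_iff div conv_entry conv_scalar dist_inv_fourier_def S_def)

  \<comment> \<open>The operators applied to the convolution with \<open>\<Phi>\<close> itself.\<close>
  have conv3: "proj_div \<gamma> r1 U \<doteq>
          (\<lambda>\<phi>. (\<chi> j. op_scalar \<gamma> r1 (cmp (conv3 \<Phi> U) j) \<phi>) - op_matrix \<gamma> r1 (conv3 \<Phi> U) \<phi>)
        \<and> proj_curl \<gamma> r1 U \<doteq> op_matrix \<gamma> r1 (conv3 \<Phi> U)"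
    if def_conv: "\<forall>k. conv_defined \<Phi> (cmp U k)"
  proof -
    define X where "X k = dist_prod (dist_fourier \<Phi>) (T k)" for k
    have X: "is_product (dist_fourier \<Phi>) (T k) (X k)" for k
      using def_conv unfolding X_def conv_defined_def T_def by (intro product_definedD) blast
    have tX: "tempered (X k)" for k by (rule is_product_tempered[OF X])
    have cX: "cmp (conv3 \<Phi> U) k = dist_inv_fourier (X k)" for k
      by (rule ext) (simp add: cmp_def conv3_def conv_def X_def T_def)
    have dX: "op_div (reflect \<gamma>) r1 (conv3 \<Phi> U) \<doteq> dist_inv_fourier (\<lambda>\<phi>. \<Sum>k\<in>UNIV. fun_times (?Q k) (X k) \<phi>)"
    proof (rule dist_eqI)
      fix \<phi> :: "'d tfun" assume \<phi>: "\<phi> \<in> schwartz"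
      show "op_div (reflect \<gamma>) r1 (conv3 \<Phi> U) \<phi> = dist_inv_fourier (\<lambda>\<phi>. \<Sum>k\<in>UNIV. fun_times (?Q k) (X k) \<phi>) \<phi>"
        using dist_eqD[OF op_cmp_inv_fourier[OF tX] \<phi>]
        by (simp add: op_div_def cX P_star_eq dist_inv_fourier_def)
    qed
    have matrix: "op_matrix \<gamma> r1 (conv3 \<Phi> U) \<phi> $ j = S j (inv_fourier \<phi>)" if \<phi>: "\<phi> \<in> schwartz" for j \<phi>
    proof -
      have tq: "tempered (\<lambda>\<phi>. \<Sum>k\<in>UNIV. fun_times (?Q k) (X k) \<phi>)"
        by (intro tempered_sum tempered_times_P tX)
      have "op_matrix \<gamma> r1 (conv3 \<Phi> U) \<phi> $ j = op_cmp \<gamma> r1 j (op_div (reflect \<gamma>) r1 (conv3 \<Phi> U)) \<phi>"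
        by (simp add: op_matrix_def op_grad_def)
      also have "\<dots> = dist_inv_fourier (fun_times (?P j) (\<lambda>\<phi>. \<Sum>k\<in>UNIV. fun_times (?Q k) (X k) \<phi>)) \<phi>"
        by (rule dist_eqD[OF dist_eq_trans[OF op_cmp_cong[OF dX] op_cmp_inv_fourier[OF tq]] \<phi>])
      also have "\<dots> = (\<Sum>k\<in>UNIV. fun_times (?P j) (fun_times (?Q k) (X k)) (inv_fourier \<phi>))"
        by (simp add: dist_inv_fourier_def fun_times_def)
      also have "\<dots> = S j (inv_fourier \<phi>)"
        unfolding S_def by (intro sum.cong refl dist_eqD[OF solution_product_entry[OF Phi T X R] inv[OF \<phi>]])
      finally show ?thesis .
    qed
    have scal: "op_scalar \<gamma> r1 (cmp (conv3 \<Phi> U) j) \<phi> = T j (inv_fourier \<phi>)" if \<phi>: "\<phi> \<in> schwartz" for j \<phi>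
    proof -
      have "op_scalar \<gamma> r1 (cmp (conv3 \<Phi> U) j) \<phi> = (\<Sum>l\<in>UNIV. op_cmp (reflect \<gamma>) r1 l (op_cmp \<gamma> r1 l (dist_inv_fourier (X j))) \<phi>)"
        by (simp add: op_scalar_def op_div_def cmp_op_grad cX)
      also have "\<dots> = (\<Sum>l\<in>UNIV. dist_inv_fourier (fun_times (?Q l) (fun_times (?P l) (X j))) \<phi>)"
        by (intro sum.cong refl dist_eqD[OF op_cmp_op_cmp_inv_fourier[OF tX] \<phi>])
      also have "\<dots> = T j (inv_fourier \<phi>)"
        unfolding dist_inv_fourier_def
        by (rule dist_eqD[OF solution_product_trace[OF elliptic Phi T X] inv[OF \<phi>]])
      finally show ?thesis .
    qed
    show ?thesis
      by (intro conjI dist_eqI) (simp_all add: vec_eq_iff div curl matrix scal)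
  qed

  \<comment> \<open>The differential identities.\<close>
  have div0: "op_div (reflect \<gamma>) r1 (proj_div \<gamma> r1 U) \<doteq> (\<lambda>\<phi>. 0)"
  proof (rule dist_eqI)
    fix \<phi> :: "'d tfun" assume \<phi>: "\<phi> \<in> schwartz"
    let ?\<psi> = "inv_fourier \<phi>"
    have "op_div (reflect \<gamma>) r1 (proj_div \<gamma> r1 U) \<phi> = (\<Sum>j\<in>UNIV. fun_times (?Q j) (\<lambda>\<phi>. T j \<phi> - S j \<phi>) ?\<psi>)"
      using dist_eqD[OF op_cmp_inv_fourier[OF tempered_diff[OF T tS]] \<phi>]
      by (simp add: op_div_def cdiv P_star_eq dist_inv_fourier_def)
    also have "\<dots> = (\<Sum>j\<in>UNIV. fun_times (?Q j) (T j) ?\<psi>) - (\<Sum>j\<in>UNIV. \<Sum>k\<in>UNIV. fun_times (?Q j) (R j k) ?\<psi>)"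
      by (simp add: fun_times_def S_def sum_subtractf)
    also have "(\<Sum>j\<in>UNIV. \<Sum>k\<in>UNIV. fun_times (?Q j) (R j k) ?\<psi>) = (\<Sum>k\<in>UNIV. \<Sum>j\<in>UNIV. fun_times (?Q j) (R j k) ?\<psi>)"
      by (rule sum.swap)
    also have "\<dots> = (\<Sum>k\<in>UNIV. fun_times (?Q k) (T k) ?\<psi>)"
      by (intro sum.cong refl dist_eqD[OF proj_products_div[OF elliptic T R] inv[OF \<phi>]])
    finally show "op_div (reflect \<gamma>) r1 (proj_div \<gamma> r1 U) \<phi> = 0" by simp
  qed
  have curl0: "op_curl \<gamma> r1 (proj_curl \<gamma> r1 U) \<doteq> (\<lambda>\<phi>. 0)"
  proof (rule dist_eqI)
    fix \<phi> :: "'d tfun" assume \<phi>: "\<phi> \<in> schwartz"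
    let ?\<psi> = "inv_fourier \<phi>"
    have c: "op_cmp \<gamma> r1 a (cmp (proj_curl \<gamma> r1 U) b) \<phi> = (\<Sum>k\<in>UNIV. fun_times (?P a) (R b k) ?\<psi>)" for a b
      using dist_eqD[OF op_cmp_inv_fourier[OF tS] \<phi>]
      by (simp add: ccurl dist_inv_fourier_def fun_times_def S_def)
    have "op_cmp \<gamma> r1 a (cmp (proj_curl \<gamma> r1 U) b) \<phi> = op_cmp \<gamma> r1 b (cmp (proj_curl \<gamma> r1 U) a) \<phi>" for a b
      unfolding c by (intro sum.cong refl dist_eqD[OF proj_products_swap[OF T R] inv[OF \<phi>]])
    then show "op_curl \<gamma> r1 (proj_curl \<gamma> r1 U) \<phi> = 0"
      by (simp add: op_curl_def vec_eq_iff forall_3)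
  qed

  have orth: "orthogonal_L2 (proj_div \<gamma> r1 U) (proj_curl \<gamma> r1 U)" if "p = 2"
  proof (rule projections_orthogonal[OF elliptic])
    show "L2 (\<lambda>x. u x $ j)" for j using Lp[of j] unfolding that Lp_2_iff .
    show "is_product (fun_dist (proj_symbol \<gamma> r1 j k)) (dist_fourier (fun_dist (\<lambda>x. u x $ k))) (R j k)" for j k
      using R[of j k] by (simp only: T_def cU)
    show "proj_div \<gamma> r1 U = (\<lambda>\<phi>. \<chi> j. dist_fourier (fun_dist (\<lambda>x. u x $ j)) (inv_fourier \<phi>) - (\<Sum>k\<in>UNIV. R j k (inv_fourier \<phi>)))"
      by (rule ext) (simp add: vec_eq_iff div S_def T_def cU)
    show "proj_curl \<gamma> r1 U = (\<lambda>\<phi>. \<chi> j. \<Sum>k\<in>UNIV. R j k (inv_fourier \<phi>))"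
      by (rule ext) (simp add: vec_eq_iff curl S_def)
  qed

  show ?thesis
    by (rule conjI, rule defined, rule conjI, rule sum, rule conjI, rule impI, erule conv3,
      rule conjI, intro allI, rule def_entry, rule conjI, intro allI, rule def_scalar,
      rule conjI, rule div_conv, rule conjI, rule curl_conv, rule conjI, rule div0,
      rule conjI, rule curl0, rule impI, erule orth)
qed

end
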